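(* For $\hbar\in[0,1]$ define on the space $\mathcal{S}_0$ of continuous semimartingales starting at $0$ the $\mathbb{R}$-bilinear operations $$X\dashv^{!}_{\hbar} Y:=Y\bullet X+(1-\hbar)[X,Y],\qquad X\vdash^{!}_{\hbar} Y:=X\bullet Y+\hbar[X,Y].$$ Then for every $\hbar\in[0,1]$ they give $\mathcal{S}_0$ the structure of a dendriform algebra, i.e. for all $X,Y,Z\in\mathcal{S}_0$: \begin{align*} (X\dashv^{!}_{\hbar} Y)\dashv^!_{\hbar} Z&= X\dashv^!_{\hbar}(Y\dashv^!_{\hbar} Z)+X\dashv^{!}_{\hbar}(Y\vdash^{!}_{\hbar} Z),\\ (X\vdash^{!}_{\hbar} Y)\dashv^{!}_{\hbar} Z&= X\vdash^{!}_{\hbar} (Y\dashv^{!}_{\hbar} Z),\\ (X\dashv^{!}_{\hbar} Y)\vdash^{!}_{\hbar} Z+(X\vdash^{!}_{\hbar} Y)\vdash^{!}_{\hbar} Z &= X\vdash^{!}_{\hbar} (Y \vdash^{!}_{\hbar} Z). \end{align*} For $\hbar=1/2$ (the Stratonovich integral) this dendriform algebra is commutative, and therefore also a Zinbiel algebra.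
   Context: Fix a filtered probability space $(\Omega,\mathcal{F},(\mathcal{F}_t)_{t\in\mathbb{R}_+},\mathbb{P})$ with complete filtration ($\mathcal{F}_0$ contains all $\mathbb{P}$-null sets of $\mathcal{F}$). Processes are real-valued; equality of processes is up to indistinguishability. $\mathcal{A}$ is the space of adapted path-wise continuous processes whose paths are of locally bounded variation; $\mathcal{M}$ is the space of adapted path-wise continuous processes $X$ such that $X-X_0$ is a local martingale; $\mathcal{S}:=\mathcal{A}+\mathcal{M}$ is the space of continuous semimartingales, and $\mathcal{S}_0:=\{X\in\mathcal{S}:X_0=0\}$. For $X,Y\in\mathcal{S}$, $X\bullet Y$ denotes the Itô integral process $(X\bullet Y)_t=\int_0^tX\,dY$ and $[X,Y]$ the quadratic covariation process, $[X,Y]_0=0$; both map $\mathcal{S}_0\times\mathcal{S}_0$ to $\mathcal{S}_0$. A dendriform algebra with operations $\dashv$ (left) and $\vdash$ (right) is commutative if $x\dashv y=y\vdash x$ for all $x,y$. A (left- or right-handed) Zinbiel algebra is a vector space with a single bilinear operation obtained from a commutative dendriform algebra by keeping one operation; in terms of $\dashv$ its defining relation is $(x\dashv y)\dashv z=x\dashv(y\dashv z)+x\dashv(z\dashv y)$. *)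

theory Defs
  imports "HOL-Probability.Probability"
begin

section \<open>Vector spaces and dendriform algebras up to an equivalence relation\<close>

text \<open>
  Processes are identified when they are indistinguishable.  Instead of passing to equivalence
  classes, the algebraic structures live on a carrier set \<open>V\<close> and equality is replaced by an
  equivalence relation \<open>\<simeq>\<close> with which all operations are required to be compatible.  This is the
  same as the corresponding structure on the quotient of \<open>V\<close> by \<open>\<simeq>\<close>.
\<close>

locale real_vector_space_upto =
  fixes V :: "'v set"
    and eq :: "'v \<Rightarrow> 'v \<Rightarrow> bool" (infix "\<simeq>" 50)
    and add :: "'v \<Rightarrow> 'v \<Rightarrow> 'v" (infixl "\<oplus>" 65)
    and zero :: 'v ("\<zero>")
    and scale :: "real \<Rightarrow> 'v \<Rightarrow> 'v" (infixr "\<odot>" 75)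
  assumes equiv: "equivp (\<simeq>)"
    and add_closed: "\<lbrakk>x \<in> V; y \<in> V\<rbrakk> \<Longrightarrow> x \<oplus> y \<in> V"
    and zero_closed: "\<zero> \<in> V"
    and scale_closed: "x \<in> V \<Longrightarrow> a \<odot> x \<in> V"
    and add_cong:
      "\<lbrakk>x \<in> V; x' \<in> V; y \<in> V; y' \<in> V; x \<simeq> x'; y \<simeq> y'\<rbrakk> \<Longrightarrow> x \<oplus> y \<simeq> x' \<oplus> y'"
    and scale_cong: "\<lbrakk>x \<in> V; x' \<in> V; x \<simeq> x'\<rbrakk> \<Longrightarrow> a \<odot> x \<simeq> a \<odot> x'"
    and add_assoc: "\<lbrakk>x \<in> V; y \<in> V; z \<in> V\<rbrakk> \<Longrightarrow> (x \<oplus> y) \<oplus> z \<simeq> x \<oplus> (y \<oplus> z)"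
    and add_commute: "\<lbrakk>x \<in> V; y \<in> V\<rbrakk> \<Longrightarrow> x \<oplus> y \<simeq> y \<oplus> x"
    and add_zero: "x \<in> V \<Longrightarrow> x \<oplus> \<zero> \<simeq> x"
    and add_inverse: "x \<in> V \<Longrightarrow> x \<oplus> (-1) \<odot> x \<simeq> \<zero>"
    and scale_add_right: "\<lbrakk>x \<in> V; y \<in> V\<rbrakk> \<Longrightarrow> a \<odot> (x \<oplus> y) \<simeq> a \<odot> x \<oplus> a \<odot> y"
    and scale_add_left: "x \<in> V \<Longrightarrow> (a + b) \<odot> x \<simeq> a \<odot> x \<oplus> b \<odot> x"
    and scale_scale: "x \<in> V \<Longrightarrow> a \<odot> b \<odot> x \<simeq> (a * b) \<odot> x"
    and scale_one: "x \<in> V \<Longrightarrow> 1 \<odot> x \<simeq> x"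

locale bilinear_operation_upto = real_vector_space_upto +
  fixes mult :: "'a \<Rightarrow> 'a \<Rightarrow> 'a" (infixl "\<star>" 70)
  assumes mult_closed: "\<lbrakk>x \<in> V; y \<in> V\<rbrakk> \<Longrightarrow> x \<star> y \<in> V"
    and mult_cong:
      "\<lbrakk>x \<in> V; x' \<in> V; y \<in> V; y' \<in> V; x \<simeq> x'; y \<simeq> y'\<rbrakk> \<Longrightarrow> x \<star> y \<simeq> x' \<star> y'"
    and mult_add_left:
      "\<lbrakk>x \<in> V; y \<in> V; z \<in> V\<rbrakk> \<Longrightarrow> (x \<oplus> y) \<star> z \<simeq> x \<star> z \<oplus> y \<star> z"
    and mult_add_right:
      "\<lbrakk>x \<in> V; y \<in> V; z \<in> V\<rbrakk> \<Longrightarrow> x \<star> (y \<oplus> z) \<simeq> x \<star> y \<oplus> x \<star> z"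
    and mult_scale_left: "\<lbrakk>x \<in> V; y \<in> V\<rbrakk> \<Longrightarrow> (a \<odot> x) \<star> y \<simeq> a \<odot> (x \<star> y)"
    and mult_scale_right: "\<lbrakk>x \<in> V; y \<in> V\<rbrakk> \<Longrightarrow> x \<star> (a \<odot> y) \<simeq> a \<odot> (x \<star> y)"

locale dendriform_algebra =
  left: bilinear_operation_upto V eq add zero scale left +
  right: bilinear_operation_upto V eq add zero scale right
  for V :: "'v set"
    and eq :: "'v \<Rightarrow> 'v \<Rightarrow> bool" (infix "\<simeq>" 50)
    and add :: "'v \<Rightarrow> 'v \<Rightarrow> 'v" (infixl "\<oplus>" 65)
    and zero :: 'v ("\<zero>")
    and scale :: "real \<Rightarrow> 'v \<Rightarrow> 'v" (infixr "\<odot>" 75)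
    and left :: "'v \<Rightarrow> 'v \<Rightarrow> 'v" (infixl "\<stileturn>" 70)
    and right :: "'v \<Rightarrow> 'v \<Rightarrow> 'v" (infixl "\<turnstile>" 70) +
  assumes left_left:
      "\<lbrakk>x \<in> V; y \<in> V; z \<in> V\<rbrakk> \<Longrightarrow> (x \<stileturn> y) \<stileturn> z \<simeq> x \<stileturn> (y \<stileturn> z) \<oplus> x \<stileturn> (y \<turnstile> z)"
    and right_left:
      "\<lbrakk>x \<in> V; y \<in> V; z \<in> V\<rbrakk> \<Longrightarrow> (x \<turnstile> y) \<stileturn> z \<simeq> x \<turnstile> (y \<stileturn> z)"
    and right_right:
      "\<lbrakk>x \<in> V; y \<in> V; z \<in> V\<rbrakk> \<Longrightarrow> (x \<stileturn> y) \<turnstile> z \<oplus> (x \<turnstile> y) \<turnstile> z \<simeq> x \<turnstile> (y \<turnstile> z)"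

locale commutative_dendriform_algebra = dendriform_algebra +
  assumes left_right_commute: "\<lbrakk>x \<in> V; y \<in> V\<rbrakk> \<Longrightarrow> x \<stileturn> y \<simeq> y \<turnstile> x"

locale left_zinbiel_algebra =
  bilinear_operation_upto V eq add zero scale left
  for V :: "'v set"
    and eq :: "'v \<Rightarrow> 'v \<Rightarrow> bool" (infix "\<simeq>" 50)
    and add :: "'v \<Rightarrow> 'v \<Rightarrow> 'v" (infixl "\<oplus>" 65)
    and zero :: 'v ("\<zero>")
    and scale :: "real \<Rightarrow> 'v \<Rightarrow> 'v" (infixr "\<odot>" 75)
    and left :: "'v \<Rightarrow> 'v \<Rightarrow> 'v" (infixl "\<stileturn>" 70) +
  assumes zinbiel:
    "\<lbrakk>x \<in> V; y \<in> V; z \<in> V\<rbrakk> \<Longrightarrow> (x \<stileturn> y) \<stileturn> z \<simeq> x \<stileturn> (y \<stileturn> z) \<oplus> x \<stileturn> (z \<stileturn> y)"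

locale right_zinbiel_algebra =
  bilinear_operation_upto V eq add zero scale right
  for V :: "'v set"
    and eq :: "'v \<Rightarrow> 'v \<Rightarrow> bool" (infix "\<simeq>" 50)
    and add :: "'v \<Rightarrow> 'v \<Rightarrow> 'v" (infixl "\<oplus>" 65)
    and zero :: 'v ("\<zero>")
    and scale :: "real \<Rightarrow> 'v \<Rightarrow> 'v" (infixr "\<odot>" 75)
    and right :: "'v \<Rightarrow> 'v \<Rightarrow> 'v" (infixl "\<turnstile>" 70) +
  assumes zinbiel:
    "\<lbrakk>x \<in> V; y \<in> V; z \<in> V\<rbrakk> \<Longrightarrow> (y \<turnstile> x) \<turnstile> z \<oplus> (x \<turnstile> y) \<turnstile> z \<simeq> x \<turnstile> (y \<turnstile> z)"


section \<open>Filtrations and processes\<close>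

text \<open>
  Time is represented by type \<^typ>\<open>real\<close>; filtrations and processes are only ever inspected at
  times \<open>t \<ge> 0\<close>, and only at points of the sample space.
\<close>

type_synonym 'a process = "real \<Rightarrow> 'a \<Rightarrow> real"

locale complete_filtered_prob_space = prob_space P
  for P :: "'a measure" +
  fixes F :: "real \<Rightarrow> 'a measure"
  assumes subalgebra_F: "0 \<le> t \<Longrightarrow> subalgebra P (F t)"
    and F_mono: "\<lbrakk>0 \<le> s; s \<le> t\<rbrakk> \<Longrightarrow> sets (F s) \<subseteq> sets (F t)"
    and null_sets_F: "null_sets P \<subseteq> sets (F 0)"

definition indistinguishable :: "'a measure \<Rightarrow> 'a process \<Rightarrow> 'a process \<Rightarrow> bool" where
  "indistinguishable P X Y \<longleftrightarrow> (AE \<omega> in P. \<forall>t\<ge>0. X t \<omega> = Y t \<omega>)"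

definition process_add :: "'a process \<Rightarrow> 'a process \<Rightarrow> 'a process" where
  "process_add X Y = (\<lambda>t \<omega>. X t \<omega> + Y t \<omega>)"

definition process_zero :: "'a process" where
  "process_zero = (\<lambda>t \<omega>. 0)"

definition process_scale :: "real \<Rightarrow> 'a process \<Rightarrow> 'a process" where
  "process_scale a X = (\<lambda>t \<omega>. a * X t \<omega>)"

definition adapted :: "(real \<Rightarrow> 'a measure) \<Rightarrow> 'a process \<Rightarrow> bool" where
  "adapted F X \<longleftrightarrow> (\<forall>t\<ge>0. X t \<in> borel_measurable (F t))"

definition continuous_paths :: "'a measure \<Rightarrow> 'a process \<Rightarrow> bool" where
  "continuous_paths P X \<longleftrightarrow> (\<forall>\<omega>\<in>space P. continuous_on {0..} (\<lambda>t. X t \<omega>))"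

definition locally_bounded_variation :: "(real \<Rightarrow> real) \<Rightarrow> bool" where
  "locally_bounded_variation f \<longleftrightarrow>
     (\<forall>T\<ge>0. \<exists>C. \<forall>(n::nat) \<tau>. mono_on {..n} \<tau> \<and> \<tau> ` {..n} \<subseteq> {0..T} \<longrightarrow>
        (\<Sum>i<n. \<bar>f (\<tau> (Suc i)) - f (\<tau> i)\<bar>) \<le> C)"

definition martingale :: "'a measure \<Rightarrow> (real \<Rightarrow> 'a measure) \<Rightarrow> 'a process \<Rightarrow> bool" where
  "martingale P F X \<longleftrightarrow>
     adapted F X \<and> (\<forall>t\<ge>0. integrable P (X t)) \<and>
     (\<forall>s t. 0 \<le> s \<and> s \<le> t \<longrightarrow> (AE \<omega> in P. real_cond_exp P (F s) (X t) \<omega> = X s \<omega>))"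

text \<open>
  Stopping times take values in \<open>[0,\<infinity>]\<close>, so the library predicate \<^const>\<open>stopping_time\<close>, in which
  times and stopping times have the same type, is not applicable to a filtration indexed by reals.
\<close>

definition extended_stopping_time :: "(real \<Rightarrow> 'a measure) \<Rightarrow> ('a \<Rightarrow> ennreal) \<Rightarrow> bool" where
  "extended_stopping_time F T \<longleftrightarrow> (\<forall>t\<ge>0. Measurable.pred (F t) (\<lambda>\<omega>. T \<omega> \<le> ennreal t))"

definition stopped :: "'a process \<Rightarrow> ('a \<Rightarrow> ennreal) \<Rightarrow> 'a process" where
  "stopped X T = (\<lambda>t \<omega>. X (enn2real (min (ennreal t) (T \<omega>))) \<omega>)"

definition local_martingale :: "'a measure \<Rightarrow> (real \<Rightarrow> 'a measure) \<Rightarrow> 'a process \<Rightarrow> bool" where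
  "local_martingale P F X \<longleftrightarrow>
     (\<exists>T :: nat \<Rightarrow> 'a \<Rightarrow> ennreal.
        (\<forall>n. extended_stopping_time F (T n)) \<and>
        (AE \<omega> in P. incseq (\<lambda>n. T n \<omega>) \<and> (\<lambda>n. T n \<omega>) \<longlonglongrightarrow> \<infinity>) \<and>
        (\<forall>n. martingale P F (stopped X (T n))))"

definition continuous_BV_processes ::
  "'a measure \<Rightarrow> (real \<Rightarrow> 'a measure) \<Rightarrow> 'a process set" where
  "continuous_BV_processes P F =
     {X. adapted F X \<and> continuous_paths P X \<and>
         (\<forall>\<omega>\<in>space P. locally_bounded_variation (\<lambda>t. X t \<omega>))}"

definition continuous_local_martingales ::
  "'a measure \<Rightarrow> (real \<Rightarrow> 'a measure) \<Rightarrow> 'a process set" where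
  "continuous_local_martingales P F =
     {X. adapted F X \<and> continuous_paths P X \<and> local_martingale P F (\<lambda>t \<omega>. X t \<omega> - X 0 \<omega>)}"

definition semimartingales :: "'a measure \<Rightarrow> (real \<Rightarrow> 'a measure) \<Rightarrow> 'a process set" where
  "semimartingales P F =
     {process_add A M | A M.
        A \<in> continuous_BV_processes P F \<and> M \<in> continuous_local_martingales P F}"

text \<open>
  As processes are considered up to indistinguishability, \<open>X\<^sub>0 = 0\<close> is required almost surely.
\<close>

definition semimartingales0 :: "'a measure \<Rightarrow> (real \<Rightarrow> 'a measure) \<Rightarrow> 'a process set" where
  "semimartingales0 P F = {X \<in> semimartingales P F. AE \<omega> in P. X 0 \<omega> = 0}"


section \<open>Ito integral and quadratic covariation\<close>

text \<open>
  Uniform convergence on compacts in probability.  The event below is measurable in all uses: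
  there \<open>X n - Y\<close> is adapted with left-continuous paths on \<open>(0,\<infinity>)\<close>, so that \<open>s\<close> may be restricted
  to a countable set.
\<close>

definition ucp_tendsto :: "'a measure \<Rightarrow> (nat \<Rightarrow> 'a process) \<Rightarrow> 'a process \<Rightarrow> bool" where
  "ucp_tendsto P X Y \<longleftrightarrow>
     (\<forall>t\<ge>0. \<forall>\<epsilon>>0.
        (\<lambda>n. measure P {\<omega> \<in> space P. \<exists>s\<in>{0..t}. \<bar>X n s \<omega> - Y s \<omega>\<bar> > \<epsilon>}) \<longlonglongrightarrow> 0)"

text \<open>
  A simple integrand represents the process
  \<open>\<eta> 1\<^bsub>{0}\<^esub> + (\<Sum>i<n. \<xi>\<^sub>i 1\<^bsub>(t\<^sub>i,t\<^sub>i\<^sub>+\<^sub>1]\<^esub>)\<close> with \<open>0 \<le> t\<^sub>0 \<le> \<dots> \<le> t\<^sub>n\<close>, \<open>\<eta>\<close> bounded and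
  \<open>F\<^sub>0\<close>-measurable, and \<open>\<xi>\<^sub>i\<close> bounded and \<open>F\<^bsub>t\<^sub>i\<^esub>\<close>-measurable.
\<close>

record 'a simple_integrand =
  steps :: nat
  grid :: "nat \<Rightarrow> real"
  init :: "'a \<Rightarrow> real"
  coef :: "nat \<Rightarrow> 'a \<Rightarrow> real"

definition simple_predictable ::
  "'a measure \<Rightarrow> (real \<Rightarrow> 'a measure) \<Rightarrow> 'a simple_integrand \<Rightarrow> bool" where
  "simple_predictable P F H \<longleftrightarrow>
     0 \<le> grid H 0 \<and> mono_on {..steps H} (grid H) \<and>
     init H \<in> borel_measurable (F 0) \<and> (\<exists>B. \<forall>\<omega>\<in>space P. \<bar>init H \<omega>\<bar> \<le> B) \<and>
     (\<forall>i<steps H. coef H i \<in> borel_measurable (F (grid H i)) \<and>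
        (\<exists>B. \<forall>\<omega>\<in>space P. \<bar>coef H i \<omega>\<bar> \<le> B))"

definition simple_process :: "'a simple_integrand \<Rightarrow> 'a process" where
  "simple_process H = (\<lambda>t \<omega>. init H \<omega> * indicator {0} t +
     (\<Sum>i<steps H. coef H i \<omega> * indicator {grid H i<..grid H (Suc i)} t))"

definition simple_integral :: "'a simple_integrand \<Rightarrow> 'a process \<Rightarrow> 'a process" where
  "simple_integral H Y = (\<lambda>t \<omega>.
     (\<Sum>i<steps H. coef H i \<omega> * (Y (min (grid H (Suc i)) t) \<omega> - Y (min (grid H i) t) \<omega>)))"

text \<open>
  The Ito integral is the extension of \<^const>\<open>simple_integral\<close> from simple predictable to
  continuous adapted integrands that is continuous for ucp convergence.  For every continuous
  adapted \<open>X\<close> there are simple predictable processes converging to \<open>X\<close> ucp, so \<open>I\<close> is determined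
  up to indistinguishability by the following property.
\<close>

definition is_ito_integral ::
  "'a measure \<Rightarrow> (real \<Rightarrow> 'a measure) \<Rightarrow> 'a process \<Rightarrow> 'a process \<Rightarrow> 'a process \<Rightarrow> bool" where
  "is_ito_integral P F X Y I \<longleftrightarrow>
     adapted F I \<and> continuous_paths P I \<and>
     (\<forall>H :: nat \<Rightarrow> 'a simple_integrand.
        (\<forall>n. simple_predictable P F (H n)) \<and> ucp_tendsto P (\<lambda>n. simple_process (H n)) X \<longrightarrow>
        ucp_tendsto P (\<lambda>n. simple_integral (H n) Y) I)"

definition ito_integral ::
  "'a measure \<Rightarrow> (real \<Rightarrow> 'a measure) \<Rightarrow> 'a process \<Rightarrow> 'a process \<Rightarrow> 'a process" where
  "ito_integral P F X Y = (SOME I. is_ito_integral P F X Y I)"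

text \<open>
  Sequences of finite grids \<open>0 = \<tau>\<^sub>n(0) \<le> \<dots> \<le> \<tau>\<^sub>n(N\<^sub>n)\<close> whose last points tend to infinity
  and whose mesh tends to \<open>0\<close>.
\<close>

definition grids_tending_to_identity :: "(nat \<Rightarrow> nat) \<Rightarrow> (nat \<Rightarrow> nat \<Rightarrow> real) \<Rightarrow> bool" where
  "grids_tending_to_identity N \<tau> \<longleftrightarrow>
     (\<forall>n. \<tau> n 0 = 0 \<and> mono_on {..N n} (\<tau> n)) \<and>
     filterlim (\<lambda>n. \<tau> n (N n)) at_top sequentially \<and>
     (\<forall>\<delta>>0. \<forall>\<^sub>F n in sequentially. \<forall>i<N n. \<tau> n (Suc i) - \<tau> n i < \<delta>)"

definition is_quadratic_covariation ::
  "'a measure \<Rightarrow> (real \<Rightarrow> 'a measure) \<Rightarrow> 'a process \<Rightarrow> 'a process \<Rightarrow> 'a process \<Rightarrow> bool" where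
  "is_quadratic_covariation P F X Y V \<longleftrightarrow>
     adapted F V \<and> continuous_paths P V \<and>
     (\<forall>N \<tau>. grids_tending_to_identity N \<tau> \<longrightarrow>
        ucp_tendsto P
          (\<lambda>n t \<omega>. \<Sum>i<N n.
             (X (min (\<tau> n (Suc i)) t) \<omega> - X (min (\<tau> n i) t) \<omega>) *
             (Y (min (\<tau> n (Suc i)) t) \<omega> - Y (min (\<tau> n i) t) \<omega>)) V)"

definition quadratic_covariation ::
  "'a measure \<Rightarrow> (real \<Rightarrow> 'a measure) \<Rightarrow> 'a process \<Rightarrow> 'a process \<Rightarrow> 'a process" where
  "quadratic_covariation P F X Y = (SOME V. is_quadratic_covariation P F X Y V)"


section \<open>The operations\<close>

definition left_op ::
  "'a measure \<Rightarrow> (real \<Rightarrow> 'a measure) \<Rightarrow> real \<Rightarrow> 'a process \<Rightarrow> 'a process \<Rightarrow> 'a process" where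
  "left_op P F h X Y =
     process_add (ito_integral P F Y X) (process_scale (1 - h) (quadratic_covariation P F X Y))"

definition right_op ::
  "'a measure \<Rightarrow> (real \<Rightarrow> 'a measure) \<Rightarrow> real \<Rightarrow> 'a process \<Rightarrow> 'a process \<Rightarrow> 'a process" where
  "right_op P F h X Y =
     process_add (ito_integral P F X Y) (process_scale h (quadratic_covariation P F X Y))"

end

theory Submission
  imports Defs
begin

text \<open>
  Everything is reduced to Riemann sums along dyadic grids.  A continuous semimartingale is a good
  integrator: for the bounded variation part this is a pathwise estimate, for the local martingale
  part it follows by localisation from the isometry bound for simple integrands.  Hence Riemann sums
  \<open>\<Sum> X\<^sub>i \<Delta>\<^sub>iY\<close> converge ucp to the Ito integral, summation by parts gives the quadratic covariation,
  and the integral of a continuous adapted process is again a continuous semimartingale.  Three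
  identities then follow from exact identities between Riemann sums: the associativity
  \<open>X \<bullet> (Y \<bullet> Z) = (XY) \<bullet> Z\<close>, integration by parts \<open>XY = X \<bullet> Y + Y \<bullet> X + [X,Y]\<close>, and
  \<open>(X \<bullet> Y) Z = (X \<bullet> Y) \<bullet> Z + X \<bullet> (YZ) - (XY) \<bullet> Z\<close>, which yields \<open>[X \<bullet> Y, Z] = X \<bullet> [Y,Z]\<close>.
  Since brackets have bounded variation, \<open>[[X,Y],Z] = 0\<close>, and the dendriform identities become linear
  algebra; \<open>X \<stileturn>\<^sub>h Y\<close> is \<open>Y \<turnstile>\<^sub>1\<^sub>-\<^sub>h X\<close> because the bracket is symmetric.
\<close>

text \<open>The integral and the bracket are picked by \<open>SOME\<close> from a property
  quantified over all approximating sequences. Nothing is known about the picked process until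
  existence is proved; uniqueness of ucp limits then ties it to the constructed one, and also
  carries identities between Riemann sums over to the integrals. The filtration is complete, but
  right-continuity is not among the assumptions. Localisation therefore uses the first times at
  which a continuous adapted process reaches a closed half-line [k, \<infinity>), which are stopping
  times of the filtration itself. One process U dominating everything to be bounded yields common
  localising times, so the unknown localising sequences of different local martingales never have to
  be combined. Completeness pays for the value 0 given to limits and modifications on null sets.
  Associativity is the step where the integrator is itself only a limit; it needs two scales, a
  coarse grid fixed first and a finer one chosen after it. The formula for [X \<bullet> Y, Z] goes
  through the product formula, so that no second argument of that kind is required.\<close>

lemma dyadic_floor_tendsto: "(\<lambda>m. of_int \<lfloor>2 ^ m * x\<rfloor> / 2 ^ m) \<longlonglongrightarrow> (x :: real)"
proof (rule tendsto_sandwich)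
  have "x - (1/2)^m \<le> of_int \<lfloor>2 ^ m * x\<rfloor> / 2 ^ m" for m
  proof -
    have "(2 ^ m * x - 1) / 2 ^ m \<le> of_int \<lfloor>2 ^ m * x\<rfloor> / 2 ^ m"
      by (intro divide_right_mono) (linarith, simp)
    moreover have "(2 ^ m * x - 1) / 2 ^ m = x - (1/2)^m"
      by (simp add: diff_divide_distrib power_divide)
    ultimately show ?thesis by simp
  qed
  then show "\<forall>\<^sub>F m in sequentially. x - (1/2)^m \<le> of_int \<lfloor>2 ^ m * x\<rfloor> / 2 ^ m"
    by (intro always_eventually allI)
  show "\<forall>\<^sub>F m in sequentially. of_int \<lfloor>2 ^ m * x\<rfloor> / 2 ^ m \<le> x"
    by (intro always_eventually allI) (simp add: divide_le_eq mult.commute[of x] of_int_floor_le)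
  show "(\<lambda>m. x - (1/2)^m) \<longlonglongrightarrow> x"
    using tendsto_diff[OF tendsto_const LIMSEQ_power_zero[of "1/2::real"], of x] by simp
qed simp

context complete_filtered_prob_space
begin

section \<open>Events of high probability\<close>

lemma space_F: "0 \<le> t \<Longrightarrow> space (F t) = space P"
  using subalgebra_F[of t] by (simp add: subalgebra_def)

lemma sets_F_P: "0 \<le> t \<Longrightarrow> A \<in> sets (F t) \<Longrightarrow> A \<in> events"
  using subalgebra_F[of t] by (auto simp: subalgebra_def)

lemma subalgebra_F_le: "0 \<le> s \<Longrightarrow> s \<le> t \<Longrightarrow> subalgebra (F t) (F s)"
  using F_mono[of s t] by (simp add: subalgebra_def space_F)

lemma measurable_F_le:
  "\<lbrakk>f \<in> measurable (F s) N; 0 \<le> s; s \<le> t\<rbrakk> \<Longrightarrow> f \<in> measurable (F t) N"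
  using measurable_from_subalg[OF subalgebra_F_le] by blast

lemma measurable_F_P: "\<lbrakk>f \<in> measurable (F s) N; 0 \<le> s\<rbrakk> \<Longrightarrow> f \<in> measurable P N"
  using measurable_from_subalg[OF subalgebra_F] by blast

lemma null_sets_F_t: "\<lbrakk>N \<in> null_sets P; 0 \<le> t\<rbrakk> \<Longrightarrow> N \<in> sets (F t)"
  using null_sets_F F_mono[of 0 t] by blast

text \<open>Quantifying over an enclosing event avoids all measurability side conditions.\<close>

definition hp :: "real \<Rightarrow> ('a \<Rightarrow> bool) \<Rightarrow> bool" where
  "hp e Q \<longleftrightarrow> (\<exists>B\<in>events. prob B < e \<and> (\<forall>\<omega>\<in>space P - B. Q \<omega>))"

lemma hpD: "hp e Q \<Longrightarrow> \<exists>B. B \<in> events \<and> prob B < e \<and> (\<forall>\<omega>. \<omega> \<in> space P \<longrightarrow> \<omega> \<notin> B \<longrightarrow> Q \<omega>)"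
  unfolding hp_def by blast

lemma hpI: "\<lbrakk>B \<in> events; prob B < e; \<And>\<omega>. \<lbrakk>\<omega> \<in> space P; \<omega> \<notin> B\<rbrakk> \<Longrightarrow> Q \<omega>\<rbrakk> \<Longrightarrow> hp e Q"
  unfolding hp_def by blast

lemma hp_mono: "\<lbrakk>hp a Q; a \<le> b; \<And>\<omega>. \<lbrakk>\<omega> \<in> space P; Q \<omega>\<rbrakk> \<Longrightarrow> Q' \<omega>\<rbrakk> \<Longrightarrow> hp b Q'"
  unfolding hp_def by (meson DiffD1 less_le_trans)

lemma hp_conj:
  assumes "hp a Q" "hp b R"
  shows "hp (a + b) (\<lambda>\<omega>. Q \<omega> \<and> R \<omega>)"
proof -
  obtain B where B: "B \<in> events" "prob B < a"
    "\<And>\<omega>. \<lbrakk>\<omega> \<in> space P; \<omega> \<notin> B\<rbrakk> \<Longrightarrow> Q \<omega>" using hpD[OF assms(1)] by blast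
  obtain C where C: "C \<in> events" "prob C < b"
    "\<And>\<omega>. \<lbrakk>\<omega> \<in> space P; \<omega> \<notin> C\<rbrakk> \<Longrightarrow> R \<omega>" using hpD[OF assms(2)] by blast
  show ?thesis
  proof (rule hpI[of "B \<union> C"])
    show "prob (B \<union> C) < a + b"
      using measure_Un_le[OF B(1) C(1)] B(2) C(2) by linarith
  qed (use B C in auto)
qed

lemma hp_AE:
  assumes "AE \<omega> in P. Q \<omega>" "0 < e"
  shows "hp e Q"
proof -
  obtain N where "{\<omega>\<in>space P. \<not> Q \<omega>} \<subseteq> N" "emeasure P N = 0" "N \<in> events"
    using assms(1) by (elim AE_E)
  then show ?thesis using assms(2)
    by (intro hpI[of N]) (auto simp: measure_def)
qed

lemma hp_TrueI: "\<lbrakk>0 < e; \<And>\<omega>. \<omega> \<in> space P \<Longrightarrow> Q \<omega>\<rbrakk> \<Longrightarrow> hp e Q"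
  by (rule hpI[of "{}"]) auto

text \<open>Continuity of the probability from above: the failure sets decrease to the empty set.
  This turns a pathwise finite quantity (supremum, variation, modulus of continuity) into a
  deterministic bound off an event of small probability.\<close>

lemma hp_exhaust:
  assumes meas: "\<And>n::nat. {\<omega>\<in>space P. \<not> Q n \<omega>} \<in> events"
    and mono: "\<And>n \<omega>. \<lbrakk>\<omega> \<in> space P; Q n \<omega>\<rbrakk> \<Longrightarrow> Q (Suc n) \<omega>"
    and ex: "\<And>\<omega>. \<omega> \<in> space P \<Longrightarrow> \<exists>n. Q n \<omega>"
    and e: "0 < e"
  shows "\<exists>n. hp e (Q n)"
proof -
  let ?C = "\<lambda>n. {\<omega>\<in>space P. \<not> Q n \<omega>}"
  have "(\<lambda>n. prob (?C n)) \<longlonglongrightarrow> prob (\<Inter>n. ?C n)"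
    by (rule finite_Lim_measure_decseq) (use meas mono in \<open>auto intro!: decseq_SucI\<close>)
  also have "(\<Inter>n. ?C n) = {}" using ex by auto
  finally have "eventually (\<lambda>n. prob (?C n) < e) sequentially"
    using e by (intro order_tendstoD(2)[where a=e]) auto
  then obtain n where "prob (?C n) < e" by (auto simp: eventually_sequentially)
  then show ?thesis
    by (intro exI hpI[of "?C n"]) (use meas in auto)
qed

text \<open>The passage from statements in probability to almost sure ones; the rate (1/2)^n matters
  only through its summability.\<close>

lemma hp_borel_cantelli:
  assumes "\<And>n. hp ((1/2)^n) (Q n)"
  shows "AE \<omega> in P. \<forall>\<^sub>F n in sequentially. Q n \<omega>"
proof -
  have "\<exists>B. \<forall>n. B n \<in> events \<and> prob (B n) < (1/2)^n \<and> (\<forall>\<omega>\<in>space P - B n. Q n \<omega>)"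
    using assms unfolding hp_def by (intro choice allI) (auto simp: Bex_def)
  then obtain B where B: "\<And>n. B n \<in> events" "\<And>n. prob (B n) < (1/2)^n"
    "\<And>n \<omega>. \<omega> \<in> space P - B n \<Longrightarrow> Q n \<omega>" by blast
  have "summable (\<lambda>n. prob (B n))"
    by (rule summable_comparison_test'[OF summable_geometric[of "1/2::real"]])
      (use B(2) in \<open>auto intro: less_imp_le\<close>)
  then have "AE \<omega> in P. \<forall>\<^sub>F n in sequentially. \<omega> \<in> space P - B n"
    by (intro borel_cantelli_AE1) (use B(1) in \<open>auto simp: emeasure_eq_measure\<close>)
  then show ?thesis
    by eventually_elim (rule eventually_mono, assumption, rule B(3))
qed

text \<open>As in the Ky Fan metric, one number bounds both the exceptional probability and the
  deviation, so that \<open>small_add\<close> is a plain triangle inequality.\<close>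

definition small :: "real \<Rightarrow> real \<Rightarrow> 'a process \<Rightarrow> bool" where
  "small t e D \<longleftrightarrow> hp e (\<lambda>\<omega>. \<forall>s\<in>{0..t}. \<bar>D s \<omega>\<bar> \<le> e)"

lemma small_mono: "\<lbrakk>small t a D; a \<le> b\<rbrakk> \<Longrightarrow> small t b D"
  unfolding small_def by (erule hp_mono) force+

lemma small_cong_hp:
  assumes "small t a D" "hp b (\<lambda>\<omega>. \<forall>s\<in>{0..t}. D s \<omega> = D' s \<omega>)" "0 \<le> b"
  shows "small t (a + b) D'"
  unfolding small_def
  by (rule hp_mono[OF hp_conj[OF assms(1)[unfolded small_def] assms(2)]])
    (use assms(3) in \<open>auto intro: order_trans\<close>)

lemma small_add:
  assumes "small t a D" "small t b E"
  shows "small t (a + b) (\<lambda>s \<omega>. D s \<omega> + E s \<omega>)"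
  unfolding small_def
  by (rule hp_mono[OF hp_conj[OF assms[unfolded small_def]]])
    (auto intro!: order_trans[OF abs_triangle_ineq] add_mono)

lemma small_uminus: "small t a (\<lambda>s \<omega>. - D s \<omega>) \<longleftrightarrow> small t a D"
  unfolding small_def by simp

lemma small_diff:
  assumes "small t a D" "small t b E"
  shows "small t (a + b) (\<lambda>s \<omega>. D s \<omega> - E s \<omega>)"
  using small_add[OF assms(1), of b "\<lambda>s \<omega>. - E s \<omega>"] assms(2) by (simp add: small_uminus)

section \<open>Uniform convergence on compacts in probability\<close>

text \<open>The notion of \<open>ucp_tendsto\<close> with enclosing events in place of the
  exceedance sets. Passing from \<open>ucp\<close> to \<open>ucp_tendsto\<close> is free; the
  converse asks for measurability and left-continuity.\<close>

definition ucp :: "(nat \<Rightarrow> 'a process) \<Rightarrow> 'a process \<Rightarrow> bool" where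
  "ucp J I \<longleftrightarrow> (\<forall>t\<ge>0. \<forall>e>0. \<forall>\<^sub>F n in sequentially. small t e (\<lambda>s \<omega>. J n s \<omega> - I s \<omega>))"

lemma ucpD: "\<lbrakk>ucp J I; 0 \<le> t; 0 < e\<rbrakk> \<Longrightarrow> \<forall>\<^sub>F n in sequentially. small t e (\<lambda>s \<omega>. J n s \<omega> - I s \<omega>)"
  by (simp add: ucp_def)

lemma ucp_add:
  assumes "ucp J I" "ucp J' I'"
  shows "ucp (\<lambda>n s \<omega>. J n s \<omega> + J' n s \<omega>) (\<lambda>s \<omega>. I s \<omega> + I' s \<omega>)"
  unfolding ucp_def
proof (intro allI impI)
  fix t e :: real assume "0 \<le> t" "0 < e"
  then have "0 < e/2" by simp
  from ucpD[OF assms(1) \<open>0 \<le> t\<close> this] ucpD[OF assms(2) \<open>0 \<le> t\<close> this]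
  show "\<forall>\<^sub>F n in sequentially. small t e (\<lambda>s \<omega>. J n s \<omega> + J' n s \<omega> - (I s \<omega> + I' s \<omega>))"
    by eventually_elim (drule (1) small_add, simp add: algebra_simps)
qed

lemma ucp_uminus: "ucp J I \<Longrightarrow> ucp (\<lambda>n s \<omega>. - J n s \<omega>) (\<lambda>s \<omega>. - I s \<omega>)"
  unfolding ucp_def by (subst small_uminus[symmetric]) simp

lemma ucp_diff:
  "\<lbrakk>ucp J I; ucp J' I'\<rbrakk> \<Longrightarrow> ucp (\<lambda>n s \<omega>. J n s \<omega> - J' n s \<omega>) (\<lambda>s \<omega>. I s \<omega> - I' s \<omega>)"
  using ucp_add[of J I "\<lambda>n s \<omega>. - J' n s \<omega>" "\<lambda>s \<omega>. - I' s \<omega>"] ucp_uminus[of J' I'] by simp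

lemma ucp_const: "ucp (\<lambda>n. I) I"
  unfolding ucp_def small_def by (auto intro!: hp_TrueI eventuallyI)

lemma ucp_scale:
  assumes "ucp J I"
  shows "ucp (\<lambda>n s \<omega>. a * J n s \<omega>) (\<lambda>s \<omega>. a * I s \<omega>)"
  unfolding ucp_def
proof (intro allI impI)
  fix t e :: real assume te: "0 \<le> t" "0 < e"
  \<comment> \<open>The 1 in the denominator covers a = 0 and gives d \<le> e, needed for the
    probability, besides \<bar>a\<bar> * d \<le> e for the size.\<close>
  define d where "d = e / (1 + \<bar>a\<bar>)"
  have d: "0 < d" "d \<le> e" "\<bar>a\<bar> * d \<le> e"
    using te mult_left_mono[of "\<bar>a\<bar>" "1 + \<bar>a\<bar>" d] by (auto simp: d_def divide_simps algebra_simps)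
  from ucpD[OF assms te(1) d(1)]
  show "\<forall>\<^sub>F n in sequentially. small t e (\<lambda>s \<omega>. a * J n s \<omega> - a * I s \<omega>)"
  proof eventually_elim
    case (elim n)
    have "\<bar>a * x - a * y\<bar> \<le> e" if "\<bar>x - y\<bar> \<le> d" for x y
    proof -
      have "\<bar>a * x - a * y\<bar> = \<bar>a\<bar> * \<bar>x - y\<bar>" by (simp add: abs_mult[symmetric] algebra_simps)
      also have "\<dots> \<le> \<bar>a\<bar> * d" using that by (intro mult_left_mono) auto
      finally show ?thesis using d by simp
    qed
    then show ?case using elim d(2) unfolding small_def by (elim hp_mono) auto
  qed
qed

lemma ucp_cong_AE:
  assumes "ucp J I" "\<And>n. AE \<omega> in P. \<forall>t\<ge>0. J n t \<omega> = J' n t \<omega>" "AE \<omega> in P. \<forall>t\<ge>0. I t \<omega> = I' t \<omega>"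
  shows "ucp J' I'"
  unfolding ucp_def
proof (intro allI impI)
  fix t e :: real assume te: "0 \<le> t" "0 < e"
  then have "0 < e/2" by simp
  from ucpD[OF assms(1) te(1) this]
  show "\<forall>\<^sub>F n in sequentially. small t e (\<lambda>s \<omega>. J' n s \<omega> - I' s \<omega>)"
  proof eventually_elim
    case (elim n)
    have "AE \<omega> in P. \<forall>s\<in>{0..t}. J n s \<omega> - I s \<omega> = J' n s \<omega> - I' s \<omega>"
      using assms(2)[of n] assms(3) by eventually_elim auto
    from small_cong_hp[OF elim hp_AE[OF this \<open>0 < e/2\<close>]] te show ?case by simp
  qed
qed

lemma ucp_cong:
  assumes "ucp J I" "\<And>n t \<omega>. \<lbrakk>0 \<le> t; \<omega> \<in> space P\<rbrakk> \<Longrightarrow> J n t \<omega> = J' n t \<omega>"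
    "\<And>t \<omega>. \<lbrakk>0 \<le> t; \<omega> \<in> space P\<rbrakk> \<Longrightarrow> I t \<omega> = I' t \<omega>"
  shows "ucp J' I'"
  using assms by (intro ucp_cong_AE[OF assms(1)]) auto

text \<open>The difference of the two limits is a ucp limit of zeros, hence small for every horizon
  and every e. Horizon n with e = (1/2)^n and Borel-Cantelli give a single null set for all
  times.\<close>

lemma ucp_unique:
  assumes "ucp J I" "ucp J I'"
  shows "AE \<omega> in P. \<forall>t\<ge>0. I t \<omega> = I' t \<omega>"
proof -
  have u: "ucp (\<lambda>n s \<omega>. 0) (\<lambda>s \<omega>. I s \<omega> - I' s \<omega>)"
    using ucp_diff[OF assms] by simp
  have sm: "small t e (\<lambda>s \<omega>. I s \<omega> - I' s \<omega>)" if "0 \<le> t" "0 < e" for t e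
    using ucpD[OF u that] small_uminus[of t e "\<lambda>s \<omega>. I s \<omega> - I' s \<omega>"]
    by (auto simp: eventually_sequentially)
  have "AE \<omega> in P. \<forall>\<^sub>F n in sequentially. \<forall>s\<in>{0..real n}. \<bar>I s \<omega> - I' s \<omega>\<bar> \<le> (1/2)^n"
    by (rule hp_borel_cantelli) (rule sm[unfolded small_def], auto)
  then show ?thesis
  proof eventually_elim
    case (elim \<omega>)
    show ?case
    proof (intro allI impI)
      fix t :: real assume t: "0 \<le> t"
      have ev: "\<forall>\<^sub>F n in sequentially. t \<le> real n"
        by (rule eventually_mono[OF eventually_ge_at_top[of "nat \<lceil>t\<rceil>"]]) linarith
      from elim ev have "\<forall>\<^sub>F n in sequentially. \<bar>I t \<omega> - I' t \<omega>\<bar> \<le> (1/2)^n"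
        by eventually_elim (use t in auto)
      then have "\<bar>I t \<omega> - I' t \<omega>\<bar> \<le> 0"
        by (intro tendsto_lowerbound[OF LIMSEQ_power_zero[of "1/2::real"]]) auto
      then show "I t \<omega> = I' t \<omega>" by simp
    qed
  qed
qed

text \<open>The exceedance set need not be an event: monotonicity of \<open>prob\<close> asks for
  measurability of the larger set only. The bound \<open>min e r\<close> serves the size e and the
  probability r at once.\<close>

lemma ucp_imp_ucp_tendsto:
  assumes "ucp J I"
  shows "ucp_tendsto P J I"
  unfolding ucp_tendsto_def
proof (intro allI impI, rule LIMSEQ_I)
  fix t e r :: real assume "0 \<le> t" "0 < e" "0 < r"
  from ucpD[OF assms this(1), of "min e r"] this
  have "\<forall>\<^sub>F n in sequentially. small t (min e r) (\<lambda>s \<omega>. J n s \<omega> - I s \<omega>)" by simp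
  then obtain no where "\<forall>n\<ge>no. small t (min e r) (\<lambda>s \<omega>. J n s \<omega> - I s \<omega>)"
    by (auto simp: eventually_sequentially)
  moreover have "norm (prob {\<omega>\<in>space P. \<exists>s\<in>{0..t}. \<bar>D s \<omega>\<bar> > e} - 0) < r"
    if sm: "small t (min e r) D" for D
  proof -
    obtain B where B: "B \<in> events" "prob B < min e r"
      "\<And>\<omega>. \<lbrakk>\<omega> \<in> space P; \<omega> \<notin> B\<rbrakk> \<Longrightarrow> \<forall>s\<in>{0..t}. \<bar>D s \<omega>\<bar> \<le> min e r"
      using hpD[OF sm[unfolded small_def]] by blast
    have "{\<omega>\<in>space P. \<exists>s\<in>{0..t}. \<bar>D s \<omega>\<bar> > e} \<subseteq> B" using B(3) by force
    then have "prob {\<omega>\<in>space P. \<exists>s\<in>{0..t}. \<bar>D s \<omega>\<bar> > e} \<le> prob B"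
      using B(1) by (rule finite_measure_mono)
    then show ?thesis using B(2) by simp
  qed
  ultimately have "\<exists>no. \<forall>n\<ge>no. norm (prob {\<omega>\<in>space P. \<exists>s\<in>{0..t}. \<bar>J n s \<omega> - I s \<omega>\<bar> > e} - 0) < r"
    by blast
  then show "\<exists>no. \<forall>n\<ge>no. norm (prob {\<omega>\<in>space P. \<exists>s\<in>{0..t}. \<bar>J n s \<omega> - I s \<omega>\<bar> > e} - 0) < r" .
qed

text \<open>Exceeding is an open condition, so left-continuity carries it from s to rational times
  just before s. Left-continuity is what simple processes have, being built from intervals (a,b].
  The \<sigma>-algebra is a parameter because both P and F t occur.\<close>

lemma sets_exceed:
  fixes D :: "'a process"
  assumes m: "\<And>s. s \<in> {0..t} \<Longrightarrow> D s \<in> borel_measurable N" and sp: "space N = space P" and t: "0 \<le> t"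
    and c: "\<And>s \<omega>. \<lbrakk>0 < s; \<omega> \<in> space P\<rbrakk> \<Longrightarrow> continuous (at_left s) (\<lambda>s. D s \<omega>)"
  shows "{\<omega>\<in>space P. \<exists>s\<in>{0..t}. \<bar>D s \<omega>\<bar> > e} \<in> sets N"
proof -
  let ?Q = "insert 0 (\<rat> \<inter> {0..t})"
  have "{\<omega>\<in>space P. \<exists>s\<in>{0..t}. \<bar>D s \<omega>\<bar> > e} = (\<Union>q\<in>?Q. {\<omega>\<in>space P. \<bar>D q \<omega>\<bar> > e})"
  proof (intro equalityI subsetI)
    fix \<omega> assume "\<omega> \<in> {\<omega>\<in>space P. \<exists>s\<in>{0..t}. \<bar>D s \<omega>\<bar> > e}"
    then obtain s where w: "\<omega> \<in> space P" and s: "0 \<le> s" "s \<le> t" "\<bar>D s \<omega>\<bar> > e" by auto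
    have "\<exists>q\<in>?Q. \<bar>D q \<omega>\<bar> > e"
    proof (cases "s = 0")
      case False
      with s have "0 < s" by simp
      have "((\<lambda>s. \<bar>D s \<omega>\<bar>) \<longlongrightarrow> \<bar>D s \<omega>\<bar>) (at_left s)"
        using c[OF \<open>0 < s\<close> w] unfolding continuous_within by (rule tendsto_rabs)
      from order_tendstoD(1)[OF this s(3)]
      obtain b where b: "b < s" "\<And>y. b < y \<Longrightarrow> y < s \<Longrightarrow> \<bar>D y \<omega>\<bar> > e"
        using \<open>0 < s\<close> by (auto simp: eventually_at_left[of 0])
      obtain q where "q \<in> \<rat>" "max b 0 < q" "q < s"
        using Rats_dense_in_real[of "max b 0" s] b \<open>0 < s\<close> by auto
      then show ?thesis using b s by (intro bexI[of _ q]) auto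
    qed (use s in auto)
    then show "\<omega> \<in> (\<Union>q\<in>?Q. {\<omega>\<in>space P. \<bar>D q \<omega>\<bar> > e})" using w by auto
  qed (use t in auto)
  moreover have "\<dots> \<in> sets N"
  proof (rule sets.countable_UN'')
    show "countable ?Q" using countable_rat by auto
    fix q assume "q \<in> ?Q"
    then have [measurable]: "D q \<in> borel_measurable N" using m t by auto
    show "{\<omega>\<in>space P. \<bar>D q \<omega>\<bar> > e} \<in> sets N" unfolding sp[symmetric] by measurable
  qed
  ultimately show ?thesis by simp
qed

lemma ucp_tendsto_imp_ucp:
  assumes "ucp_tendsto P J I"
    and m: "\<And>n s. 0 \<le> s \<Longrightarrow> (\<lambda>\<omega>. J n s \<omega> - I s \<omega>) \<in> borel_measurable P"
    and c: "\<And>n s \<omega>. \<lbrakk>0 < s; \<omega> \<in> space P\<rbrakk> \<Longrightarrow> continuous (at_left s) (\<lambda>s. J n s \<omega> - I s \<omega>)"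
  shows "ucp J I"
  unfolding ucp_def
proof (intro allI impI)
  fix t e :: real assume te: "0 \<le> t" "0 < e"
  have "(\<lambda>n. prob {\<omega>\<in>space P. \<exists>s\<in>{0..t}. \<bar>J n s \<omega> - I s \<omega>\<bar> > e}) \<longlonglongrightarrow> 0"
    using assms(1) te unfolding ucp_tendsto_def by blast
  from order_tendstoD(2)[OF this te(2)]
  show "\<forall>\<^sub>F n in sequentially. small t e (\<lambda>s \<omega>. J n s \<omega> - I s \<omega>)"
  proof eventually_elim
    case (elim n)
    show ?case unfolding small_def
      by (rule hpI[OF sets_exceed[OF m refl te(1) c] elim]) (auto simp: not_less)
  qed
qed

section \<open>Continuous adapted processes\<close>

definition AC :: "'a process set" where
  "AC = {X. adapted F X \<and> continuous_paths P X}"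

lemma AC_measurable_F: "\<lbrakk>X \<in> AC; 0 \<le> t\<rbrakk> \<Longrightarrow> X t \<in> borel_measurable (F t)"
  by (simp add: AC_def adapted_def)

lemma AC_measurable_F_le: "\<lbrakk>X \<in> AC; 0 \<le> s; s \<le> t\<rbrakk> \<Longrightarrow> X s \<in> borel_measurable (F t)"
  by (meson AC_measurable_F measurable_F_le)

lemma AC_measurable: "\<lbrakk>X \<in> AC; 0 \<le> t\<rbrakk> \<Longrightarrow> X t \<in> borel_measurable P"
  by (meson AC_measurable_F measurable_F_P)

lemma AC_continuous: "\<lbrakk>X \<in> AC; \<omega> \<in> space P\<rbrakk> \<Longrightarrow> continuous_on {0..} (\<lambda>t. X t \<omega>)"
  by (simp add: AC_def continuous_paths_def)

lemma ACI:
  "\<lbrakk>\<And>t. 0 \<le> t \<Longrightarrow> X t \<in> borel_measurable (F t);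
    \<And>\<omega>. \<omega> \<in> space P \<Longrightarrow> continuous_on {0..} (\<lambda>t. X t \<omega>)\<rbrakk> \<Longrightarrow> X \<in> AC"
  by (simp add: AC_def continuous_paths_def adapted_def)

lemma AC_continuous_left:
  assumes "X \<in> AC" "\<omega> \<in> space P" "0 < s"
  shows "continuous (at_left s) (\<lambda>t. X t \<omega>)"
proof -
  have "continuous_on {0<..} (\<lambda>t. X t \<omega>)"
    by (rule continuous_on_subset[OF AC_continuous[OF assms(1,2)]]) auto
  then have "isCont (\<lambda>t. X t \<omega>) s" using assms(3) by (simp add: continuous_on_eq_continuous_at)
  then show ?thesis by (rule continuous_at_imp_continuous_at_within)
qed

lemma AC_add: "\<lbrakk>X \<in> AC; Y \<in> AC\<rbrakk> \<Longrightarrow> (\<lambda>t \<omega>. X t \<omega> + Y t \<omega>) \<in> AC"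
  by (rule ACI) (intro continuous_intros borel_measurable_add AC_measurable_F AC_continuous; assumption?)+

lemma AC_diff: "\<lbrakk>X \<in> AC; Y \<in> AC\<rbrakk> \<Longrightarrow> (\<lambda>t \<omega>. X t \<omega> - Y t \<omega>) \<in> AC"
  by (rule ACI) (intro continuous_intros borel_measurable_diff AC_measurable_F AC_continuous; assumption?)+

lemma AC_mult: "\<lbrakk>X \<in> AC; Y \<in> AC\<rbrakk> \<Longrightarrow> (\<lambda>t \<omega>. X t \<omega> * Y t \<omega>) \<in> AC"
  by (rule ACI) (intro continuous_intros borel_measurable_times AC_measurable_F AC_continuous; assumption?)+

lemma AC_scale: "X \<in> AC \<Longrightarrow> (\<lambda>t \<omega>. a * X t \<omega>) \<in> AC"
  by (rule ACI) (intro continuous_intros borel_measurable_times borel_measurable_const AC_measurable_F AC_continuous; assumption?)+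

lemma AC_abs: "X \<in> AC \<Longrightarrow> (\<lambda>t \<omega>. \<bar>X t \<omega>\<bar>) \<in> AC"
  by (rule ACI) (intro continuous_intros borel_measurable_abs AC_measurable_F AC_continuous; assumption?)+

lemma AC_const: "(\<lambda>t \<omega>. c) \<in> AC"
  by (rule ACI) (intro continuous_intros borel_measurable_const; assumption?)+

lemma AC_init: "X \<in> AC \<Longrightarrow> (\<lambda>t \<omega>. X 0 \<omega>) \<in> AC"
  by (intro ACI continuous_intros) (rule AC_measurable_F_le, auto)

lemma AC_min_time:
  assumes "X \<in> AC" "0 \<le> a"
  shows "(\<lambda>t \<omega>. X (min a t) \<omega>) \<in> AC"
proof (rule ACI)
  fix \<omega> assume "\<omega> \<in> space P"
  show "continuous_on {0..} (\<lambda>t. X (min a t) \<omega>)"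
    by (rule continuous_on_compose2[OF AC_continuous[OF assms(1) \<open>\<omega> \<in> space P\<close>]])
      (use assms(2) in \<open>auto intro!: continuous_intros\<close>)
qed (use assms in \<open>auto intro!: AC_measurable_F_le\<close>)

lemma AC_sum:
  assumes "\<And>i. i < (n::nat) \<Longrightarrow> X i \<in> AC"
  shows "(\<lambda>t \<omega>. \<Sum>i<n. X i t \<omega>) \<in> AC"
  using assms
proof (induction n)
  case (Suc n)
  then show ?case using AC_add[of "\<lambda>t \<omega>. \<Sum>i<n. X i t \<omega>" "X n"] by simp
qed (simp add: AC_const)

lemma AC_bounded_path:
  assumes "X \<in> AC" "\<omega> \<in> space P"
  shows "\<exists>K::nat. \<forall>s\<in>{0..t}. \<bar>X s \<omega>\<bar> \<le> real K"
proof -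
  have "compact ((\<lambda>s. X s \<omega>) ` {0..t})"
    by (intro compact_continuous_image continuous_on_subset[OF AC_continuous[OF assms]]) auto
  then obtain b where "\<forall>x\<in>(\<lambda>s. X s \<omega>) ` {0..t}. norm x \<le> b"
    by (auto dest!: compact_imp_bounded simp: bounded_iff)
  moreover obtain K where "b \<le> real K" using real_arch_simple by blast
  ultimately show ?thesis by (intro exI[of _ K]) (auto intro: order_trans)
qed

lemma AC_tight:
  assumes "X \<in> AC" "0 \<le> t" "0 < e"
  shows "\<exists>K::nat. hp e (\<lambda>\<omega>. \<forall>s\<in>{0..t}. \<bar>X s \<omega>\<bar> \<le> real K)"
proof (rule hp_exhaust[OF _ _ _ assms(3)])
  fix n :: nat
  have "{\<omega>\<in>space P. \<exists>s\<in>{0..t}. \<bar>X s \<omega>\<bar> > real n} \<in> events"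
    by (rule sets_exceed[OF _ refl]) (use assms in \<open>auto intro: AC_measurable AC_continuous_left\<close>)
  then show "{\<omega>\<in>space P. \<not> (\<forall>s\<in>{0..t}. \<bar>X s \<omega>\<bar> \<le> real n)} \<in> events" by (simp add: not_le)
next
  show "\<exists>n. \<forall>s\<in>{0..t}. \<bar>X s \<omega>\<bar> \<le> real n" if "\<omega> \<in> space P" for \<omega>
    by (rule AC_bounded_path[OF assms(1) that])
qed (auto intro: order_trans)

text \<open>Paths are uniformly continuous on [0,t], so the events on which the scale 1/(n+1) works
  increase to the whole space, and \<open>hp_exhaust\<close> makes the scale deterministic.\<close>

lemma AC_equicontinuous:
  assumes X: "X \<in> AC" and t: "0 \<le> t" and e: "0 < e" and r: "0 < r"
  shows "\<exists>d>0. hp e (\<lambda>\<omega>. \<forall>u\<in>{0..t}. \<forall>v\<in>{0..t}. \<bar>u - v\<bar> \<le> d \<longrightarrow> \<bar>X u \<omega> - X v \<omega>\<bar> \<le> r)"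
proof -
  \<comment> \<open>With a strict bound on the distance of u and v, failure of \<open>?Q\<close> is
    an open condition on the pair, so a failing pair can be moved to the countable set
    \<open>?R\<close>. The non-strict bound of the conclusion is recovered at the end by taking the
    next n.\<close>
  let ?Q = "\<lambda>n \<omega>. \<forall>u\<in>{0..t}. \<forall>v\<in>{0..t}. \<bar>u - v\<bar> < 1 / real (Suc n) \<longrightarrow> \<bar>X u \<omega> - X v \<omega>\<bar> \<le> r"
  let ?R = "insert t \<rat> \<inter> {0..t}"
  have "\<exists>n. hp e (?Q n)"
  proof (rule hp_exhaust[OF _ _ _ e])
    fix n :: nat
    let ?I = "{p \<in> ?R \<times> ?R. \<bar>fst p - snd p\<bar> < 1 / real (Suc n)}"
    have "{\<omega>\<in>space P. \<not> ?Q n \<omega>} = (\<Union>p\<in>?I. {\<omega>\<in>space P. \<bar>X (fst p) \<omega> - X (snd p) \<omega>\<bar> > r})"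
    proof (intro equalityI subsetI)
      fix \<omega> assume "\<omega> \<in> {\<omega>\<in>space P. \<not> ?Q n \<omega>}"
      then obtain u v where w: "\<omega> \<in> space P" and uv: "u \<in> {0..t}" "v \<in> {0..t}" "\<bar>u - v\<bar> < 1 / real (Suc n)"
        "\<bar>X u \<omega> - X v \<omega>\<bar> > r" by (auto simp: not_le)
      let ?r = "\<lambda>m x::real. (if x = t then t else of_int \<lfloor>2^m * x\<rfloor> / 2^m)"
      have lim: "(\<lambda>m. ?r m x) \<longlonglongrightarrow> x" for x
      proof (cases "x = t")
        case False
        then show ?thesis using dyadic_floor_tendsto[of x] by simp
      qed simp
      have rr: "?r m x \<in> ?R" if "x \<in> {0..t}" for m x
      proof (cases "x = t")
        case False
        have "of_int \<lfloor>2^m * x\<rfloor> / 2^m \<le> x"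
          using of_int_floor_le[of "2^m * x"] by (simp add: divide_le_eq mult.commute)
        then have "of_int \<lfloor>2^m * x\<rfloor> / 2^m \<le> t" using that by simp
        then show ?thesis using that False by simp
      qed (use that in simp)
      have cont: "(\<lambda>m. X (?r m x) \<omega>) \<longlonglongrightarrow> X x \<omega>" if "x \<in> {0..t}" for x
        using continuous_on_tendsto_compose[OF AC_continuous[OF X w] lim] rr[OF that] that by auto
      have "(\<lambda>m. \<bar>X (?r m u) \<omega> - X (?r m v) \<omega>\<bar>) \<longlonglongrightarrow> \<bar>X u \<omega> - X v \<omega>\<bar>"
        by (intro tendsto_intros cont uv)
      from order_tendstoD(1)[OF this uv(4)]
      have 1: "\<forall>\<^sub>F m in sequentially. r < \<bar>X (?r m u) \<omega> - X (?r m v) \<omega>\<bar>" .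
      have "(\<lambda>m. \<bar>?r m u - ?r m v\<bar>) \<longlonglongrightarrow> \<bar>u - v\<bar>"
        by (intro tendsto_intros lim)
      from order_tendstoD(2)[OF this uv(3)]
      have 2: "\<forall>\<^sub>F m in sequentially. \<bar>?r m u - ?r m v\<bar> < 1 / real (Suc n)" .
      from eventually_conj[OF 1 2]
      obtain m where m: "r < \<bar>X (?r m u) \<omega> - X (?r m v) \<omega>\<bar>" "\<bar>?r m u - ?r m v\<bar> < 1 / real (Suc n)"
        by (auto simp: eventually_sequentially)
      show "\<omega> \<in> (\<Union>p\<in>?I. {\<omega>\<in>space P. \<bar>X (fst p) \<omega> - X (snd p) \<omega>\<bar> > r})"
        by (rule UN_I[of "(?r m u, ?r m v)"]) (use m rr[OF uv(1)] rr[OF uv(2)] w in simp_all)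
    next
      fix \<omega> assume "\<omega> \<in> (\<Union>p\<in>?I. {\<omega>\<in>space P. \<bar>X (fst p) \<omega> - X (snd p) \<omega>\<bar> > r})"
      then obtain u v where "\<omega> \<in> space P" "u \<in> {0..t}" "v \<in> {0..t}" "\<bar>u - v\<bar> < 1 / real (Suc n)"
        "\<bar>X u \<omega> - X v \<omega>\<bar> > r" by auto
      then have "\<not> ?Q n \<omega>" unfolding ball_simps not_le not_imp by (metis not_le)
      then show "\<omega> \<in> {\<omega>\<in>space P. \<not> ?Q n \<omega>}" using \<open>\<omega> \<in> space P\<close> by blast
    qed
    moreover have "\<dots> \<in> events"
    proof (rule sets.countable_UN'')
      show "countable ?I"
        by (rule countable_subset[of _ "?R \<times> ?R"]) (auto intro!: countable_SIGMA simp: countable_rat)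
      fix p assume "p \<in> ?I"
      then have [measurable]: "X (fst p) \<in> borel_measurable P" "X (snd p) \<in> borel_measurable P"
        using AC_measurable[OF X] by auto
      show "{\<omega>\<in>space P. \<bar>X (fst p) \<omega> - X (snd p) \<omega>\<bar> > r} \<in> events" by measurable
    qed
    ultimately show "{\<omega>\<in>space P. \<not> ?Q n \<omega>} \<in> events" by simp
  next
    fix n \<omega> assume "?Q n \<omega>"
    moreover have "1 / real (Suc (Suc n)) \<le> 1 / real (Suc n)" by (simp add: frac_le)
    ultimately show "?Q (Suc n) \<omega>" by (blast intro: less_le_trans)
  next
    fix \<omega> assume w: "\<omega> \<in> space P"
    have "uniformly_continuous_on {0..t} (\<lambda>s. X s \<omega>)"
      by (intro compact_uniformly_continuous continuous_on_subset[OF AC_continuous[OF X w]]) auto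
    then obtain d where d: "d > 0" "\<And>u v. \<lbrakk>u\<in>{0..t}; v\<in>{0..t}; dist v u < d\<rbrakk> \<Longrightarrow> dist (X v \<omega>) (X u \<omega>) < r"
      unfolding uniformly_continuous_on_def using r by metis
    obtain n where "1 / real (Suc n) < d" using d(1) nat_approx_posE by blast
    then have "?Q n \<omega>" using d(2) unfolding dist_real_def
      by (metis abs_minus_commute less_imp_le less_trans)
    then show "\<exists>n. ?Q n \<omega>" ..
  qed
  then obtain n where "hp e (?Q n)" by blast
  then have "hp e (\<lambda>\<omega>. \<forall>u\<in>{0..t}. \<forall>v\<in>{0..t}. \<bar>u - v\<bar> \<le> 1 / real (Suc (Suc n)) \<longrightarrow> \<bar>X u \<omega> - X v \<omega>\<bar> \<le> r)"
  proof (rule hp_mono)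
    have "1 / real (Suc (Suc n)) < 1 / real (Suc n)" by (simp add: frac_less2)
    then show "\<forall>u\<in>{0..t}. \<forall>v\<in>{0..t}. \<bar>u - v\<bar> \<le> 1 / real (Suc (Suc n)) \<longrightarrow> \<bar>X u \<omega> - X v \<omega>\<bar> \<le> r"
      if "?Q n \<omega>" for \<omega> using that by (blast intro: le_less_trans)
  qed simp
  then show ?thesis by (intro exI[of _ "1 / real (Suc (Suc n))"]) simp
qed

end

section \<open>Simple integrands\<close>

lemma grid_interval_exists:
  fixes g :: "nat \<Rightarrow> real"
  assumes "g 0 < t" "t \<le> g N"
  shows "\<exists>j<N. g j < t \<and> t \<le> g (Suc j)"
  using assms
proof (induction N)
  case (Suc N)
  then show ?case by (cases "t \<le> g N") (auto intro: less_SucI)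
qed simp

lemma simple_process_active:
  assumes "mono_on {..steps H} (grid H)" "i < steps H" "grid H i < t" "t \<le> grid H (Suc i)" "t > 0"
  shows "simple_process H t \<omega> = coef H i \<omega>"
proof -
  have "coef H j \<omega> * indicator {grid H j<..grid H (Suc j)} t = 0" if "j < steps H" "j \<noteq> i" for j
  proof (cases "j < i")
    case True
    then have "grid H (Suc j) \<le> grid H i"
      using that assms(2) by (intro mono_onD[OF assms(1)]) auto
    then show ?thesis using assms(3) by auto
  next
    case False
    then have "grid H (Suc i) \<le> grid H j"
      using that assms(2) by (intro mono_onD[OF assms(1)]) auto
    then show ?thesis using assms(4) by auto
  qed
  then have "(\<Sum>j<steps H. coef H j \<omega> * indicator {grid H j<..grid H (Suc j)} t)
      = (\<Sum>j\<in>{i}. coef H j \<omega> * indicator {grid H j<..grid H (Suc j)} t)"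
    using assms(2) by (intro sum.mono_neutral_right) auto
  then show ?thesis using assms by (simp add: simple_process_def)
qed

definition dyadic :: "nat \<Rightarrow> nat \<Rightarrow> real" where
  "dyadic n i = real i / 2 ^ n"

lemma dyadic_simps: "dyadic n 0 = 0" "mono_on {..N} (dyadic n)" "0 \<le> dyadic n i" "dyadic n i \<le> dyadic n (Suc i)"
    "dyadic n (Suc i) - dyadic n i = 1 / 2 ^ n" "i \<le> j \<Longrightarrow> dyadic n i \<le> dyadic n j"
  by (auto simp: dyadic_def intro!: mono_onI divide_right_mono simp: diff_divide_distrib[symmetric])

text \<open>The discrete form of d(X \<bullet> Y) = X dY: between two neighbouring grid points, both
  cut off at t, only the term of that cell changes. Associativity of sums rests on it.\<close>

lemma grid_sum_increment:
  fixes c :: "nat \<Rightarrow> real" and f \<tau> :: "_ \<Rightarrow> real"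
  assumes \<tau>: "mono_on {..N} \<tau>" and j: "j < N"
  shows "(\<Sum>l<N. c l * (f (min (\<tau> (Suc l)) (min (\<tau> (Suc j)) t)) - f (min (\<tau> l) (min (\<tau> (Suc j)) t)))) -
      (\<Sum>l<N. c l * (f (min (\<tau> (Suc l)) (min (\<tau> j) t)) - f (min (\<tau> l) (min (\<tau> j) t)))) =
    c j * (f (min (\<tau> (Suc j)) t) - f (min (\<tau> j) t))"
proof -
  let ?d = "\<lambda>l s. c l * (f (min (\<tau> (Suc l)) s) - f (min (\<tau> l) s))"
  have le: "\<tau> i \<le> \<tau> k" if "i \<le> k" "k \<le> N" for i k using mono_onD[OF \<tau>, of i k] that by auto
  have z: "?d l (min (\<tau> (Suc j)) t) - ?d l (min (\<tau> j) t) = 0" if l: "l < N" "l \<noteq> j" for l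
  proof (cases "l < j")
    case True
    then have "\<tau> l \<le> \<tau> j" "\<tau> (Suc l) \<le> \<tau> j" "\<tau> j \<le> \<tau> (Suc j)" using le j by auto
    then have "min (\<tau> (Suc l)) (min (\<tau> (Suc j)) t) = min (\<tau> (Suc l)) (min (\<tau> j) t)"
      "min (\<tau> l) (min (\<tau> (Suc j)) t) = min (\<tau> l) (min (\<tau> j) t)" by auto
    then show ?thesis by simp
  next
    case False
    then have "\<tau> (Suc j) \<le> \<tau> l" "\<tau> l \<le> \<tau> (Suc l)" "\<tau> j \<le> \<tau> (Suc j)" using le j l by auto
    then have "min (\<tau> (Suc l)) (min (\<tau> (Suc j)) t) = min (\<tau> l) (min (\<tau> (Suc j)) t)"
      "min (\<tau> (Suc l)) (min (\<tau> j) t) = min (\<tau> l) (min (\<tau> j) t)" by auto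
    then show ?thesis by simp
  qed
  have "(\<Sum>l<N. ?d l (min (\<tau> (Suc j)) t)) - (\<Sum>l<N. ?d l (min (\<tau> j) t)) =
    (\<Sum>l<N. ?d l (min (\<tau> (Suc j)) t) - ?d l (min (\<tau> j) t))"
    by (rule sum_subtractf[symmetric])
  also have "\<dots> = (\<Sum>l\<in>{j}. ?d l (min (\<tau> (Suc j)) t) - ?d l (min (\<tau> j) t))"
    by (rule sum.mono_neutral_right) (use j z in auto)
  also have "\<dots> = ?d j t"
  proof -
    have "\<tau> j \<le> \<tau> (Suc j)" using le j by auto
    then have "min (\<tau> (Suc j)) (min (\<tau> (Suc j)) t) = min (\<tau> (Suc j)) t"
      "min (\<tau> j) (min (\<tau> (Suc j)) t) = min (\<tau> j) t"
      "min (\<tau> (Suc j)) (min (\<tau> j) t) = min (\<tau> j) t" "min (\<tau> j) (min (\<tau> j) t) = min (\<tau> j) t" by auto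
    then show ?thesis by simp
  qed
  finally show ?thesis .
qed

definition clip :: "real \<Rightarrow> real \<Rightarrow> real" where
  "clip c x = max (- c) (min c x)"

lemma abs_clip_le: "0 \<le> c \<Longrightarrow> \<bar>clip c x\<bar> \<le> c"
  by (auto simp: clip_def)

lemma clip_eq: "\<bar>x\<bar> \<le> c \<Longrightarrow> clip c x = x"
  by (auto simp: clip_def)

lemma measurable_clip [measurable]: "clip c \<in> borel_measurable borel"
  unfolding clip_def by measurable

definition clip_integrand :: "real \<Rightarrow> 'a simple_integrand \<Rightarrow> 'a simple_integrand" where
  "clip_integrand c H = H\<lparr>coef := (\<lambda>i \<omega>. clip c (coef H i \<omega>))\<rparr>"

lemma clip_integrand_sel [simp]:
  "steps (clip_integrand c H) = steps H" "grid (clip_integrand c H) = grid H"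
  "init (clip_integrand c H) = init H" "coef (clip_integrand c H) = (\<lambda>i \<omega>. clip c (coef H i \<omega>))"
  by (simp_all add: clip_integrand_def)

text \<open>Estimates need deterministically bounded coefficients, whereas smallness in probability
  bounds the process only on most paths. On such a path clipping is invisible: a cell begun before s
  shows its coefficient as the value of the process at \<open>min (grid H (Suc i)) s\<close>, and
  the other cells have zero increment.\<close>

lemma clip_integrand_integral:
  assumes mono: "mono_on {..steps H} (grid H)" and pos: "0 \<le> grid H 0"
    and small: "\<And>u. u \<in> {0..t} \<Longrightarrow> \<bar>simple_process H u \<omega>\<bar> \<le> c" and s: "s \<in> {0..t}"
  shows "simple_integral (clip_integrand c H) Y s \<omega> = simple_integral H Y s \<omega>"
  unfolding simple_integral_def
proof (simp, rule sum.cong[OF refl])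
  fix i assume i: "i \<in> {..<steps H}"
  have gi: "0 \<le> grid H i" "grid H i \<le> grid H (Suc i)"
    using i pos mono_onD[OF mono, of 0 i] mono_onD[OF mono, of i "Suc i"] by auto
  show "clip c (coef H i \<omega>) * (Y (min (grid H (Suc i)) s) \<omega> - Y (min (grid H i) s) \<omega>) =
    coef H i \<omega> * (Y (min (grid H (Suc i)) s) \<omega> - Y (min (grid H i) s) \<omega>)"
  proof (cases "grid H i < min (grid H (Suc i)) s")
    case True
    have "simple_process H (min (grid H (Suc i)) s) \<omega> = coef H i \<omega>"
      by (rule simple_process_active[OF mono]) (use i True gi in auto)
    then have "\<bar>coef H i \<omega>\<bar> \<le> c"
      using small[of "min (grid H (Suc i)) s"] s True gi by auto
    then show ?thesis by (simp add: clip_eq)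
  next
    case False
    then have "min (grid H (Suc i)) s = min (grid H i) s" using gi by auto
    then show ?thesis by simp
  qed
qed

text \<open>The process is constant on each finer cell (g j, g (j+1)], so its coefficient there can
  be read off at the right end point. This lets two integrands share one grid.\<close>

lemma simple_integral_refine:
  assumes g: "strict_mono_on {..N} g" and sub: "grid H ` {..steps H} \<subseteq> g ` {..N}"
    and mono: "mono_on {..steps H} (grid H)" and pos: "0 \<le> g 0"
  shows "simple_integral H Y t \<omega> =
    (\<Sum>j<N. simple_process H (g (Suc j)) \<omega> * (Y (min (g (Suc j)) t) \<omega> - Y (min (g j) t) \<omega>))"
proof -
  let ?y = "\<lambda>j. Y (min (g j) t) \<omega>"
  have gle: "g i < g j \<longleftrightarrow> i < j" if "i \<le> N" "j \<le> N" for i j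
    using that strict_mono_on_less[OF g] by auto
  have gle': "g i \<le> g j \<longleftrightarrow> i \<le> j" if "i \<le> N" "j \<le> N" for i j
    using that strict_mono_on_less_eq[OF g] by auto
  \<comment> \<open>A cell of H is the union of the finer cells a, ..., b - 1, over which the
    increments of Y telescope.\<close>
  have tm: "coef H i \<omega> * (Y (min (grid H (Suc i)) t) \<omega> - Y (min (grid H i) t) \<omega>) =
    (\<Sum>j<N. coef H i \<omega> * indicator {grid H i<..grid H (Suc i)} (g (Suc j)) * (?y (Suc j) - ?y j))"
    if i: "i < steps H" for i
  proof -
    obtain a b where ab: "a \<le> N" "b \<le> N" "grid H i = g a" "grid H (Suc i) = g b"
    proof -
      have "grid H i \<in> g ` {..N}" "grid H (Suc i) \<in> g ` {..N}" using sub i by auto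
      then show ?thesis using that by auto
    qed
    have "g a \<le> g b" using mono_onD[OF mono, of i "Suc i"] i ab by auto
    then have le: "a \<le> b" using gle' ab by auto
    have "(\<Sum>j<N. coef H i \<omega> * indicator {grid H i<..grid H (Suc i)} (g (Suc j)) * (?y (Suc j) - ?y j))
      = (\<Sum>j\<in>{a..<b}. coef H i \<omega> * indicator {grid H i<..grid H (Suc i)} (g (Suc j)) * (?y (Suc j) - ?y j))"
      by (rule sum.mono_neutral_right) (use ab gle gle' in \<open>auto simp: not_le not_less indicator_def split: if_splits\<close>)
    also have "\<dots> = (\<Sum>j\<in>{a..<b}. coef H i \<omega> * (?y (Suc j) - ?y j))"
      by (rule sum.cong) (use ab gle gle' in \<open>auto simp: indicator_def\<close>)
    also have "\<dots> = coef H i \<omega> * (?y b - ?y a)"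
      using sum_Suc_diff'[OF le, of ?y] by (simp add: sum_distrib_left[symmetric])
    finally show ?thesis using ab by simp
  qed
  have "simple_integral H Y t \<omega> =
    (\<Sum>i<steps H. \<Sum>j<N. coef H i \<omega> * indicator {grid H i<..grid H (Suc i)} (g (Suc j)) * (?y (Suc j) - ?y j))"
    unfolding simple_integral_def by (rule sum.cong[OF refl]) (use tm in auto)
  also have "\<dots> = (\<Sum>j<N. \<Sum>i<steps H. coef H i \<omega> * indicator {grid H i<..grid H (Suc i)} (g (Suc j)) * (?y (Suc j) - ?y j))"
    by (rule sum.swap)
  also have "\<dots> = (\<Sum>j<N. simple_process H (g (Suc j)) \<omega> * (?y (Suc j) - ?y j))"
  proof (rule sum.cong[OF refl])
    fix j assume "j \<in> {..<N}"
    then have "g 0 < g (Suc j)" using gle[of 0 "Suc j"] by auto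
    \<comment> \<open>Away from time 0 the initial value does not contribute to
      \<open>simple_process\<close>.\<close>
    then have "g (Suc j) \<noteq> 0" using pos by auto
    then show "(\<Sum>i<steps H. coef H i \<omega> * indicator {grid H i<..grid H (Suc i)} (g (Suc j)) * (?y (Suc j) - ?y j))
      = simple_process H (g (Suc j)) \<omega> * (?y (Suc j) - ?y j)"
      unfolding sum_distrib_right[symmetric] simple_process_def by simp
  qed
  finally show ?thesis .
qed

lemma simple_process_refine:
  assumes g: "strict_mono_on {..N} g" and sub: "grid H ` {..steps H} \<subseteq> g ` {..N}"
    and pos: "0 \<le> g 0" and j: "j < N" and t: "g j < t" "t \<le> g (Suc j)"
  shows "simple_process H t \<omega> = simple_process H (g (Suc j)) \<omega>"
proof -
  have gle: "g i < g j \<longleftrightarrow> i < j" if "i \<le> N" "j \<le> N" for i j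
    using that strict_mono_on_less[OF g] by auto
  have gle': "g i \<le> g j \<longleftrightarrow> i \<le> j" if "i \<le> N" "j \<le> N" for i j
    using that strict_mono_on_less_eq[OF g] by auto
  have "g 0 \<le> g j" "g 0 < g (Suc j)" using gle[of 0 "Suc j"] gle'[of 0 j] j by auto
  then have nz: "t \<noteq> 0" "g (Suc j) \<noteq> 0" using pos t by auto
  have "t \<in> {grid H i<..grid H (Suc i)} \<longleftrightarrow> g (Suc j) \<in> {grid H i<..grid H (Suc i)}" if i: "i < steps H" for i
  proof -
    obtain a b where ab: "a \<le> N" "b \<le> N" "grid H i = g a" "grid H (Suc i) = g b"
    proof -
      have "grid H i \<in> g ` {..N}" "grid H (Suc i) \<in> g ` {..N}" using sub i by auto
      then show ?thesis using that by auto
    qed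
    have "g a < t \<longleftrightarrow> g a < g (Suc j)"
      using gle[of a "Suc j"] gle'[of a j] ab j t by auto
    moreover have "t \<le> g b \<longleftrightarrow> g (Suc j) \<le> g b"
      using gle[of j b] gle'[of "Suc j" b] ab j t by auto
    ultimately show ?thesis using ab by auto
  qed
  then have "(\<Sum>i<steps H. coef H i \<omega> * indicator {grid H i<..grid H (Suc i)} t)
      = (\<Sum>i<steps H. coef H i \<omega> * indicator {grid H i<..grid H (Suc i)} (g (Suc j)))"
    by (intro sum.cong[OF refl]) (auto simp: indicator_def)
  then show ?thesis using nz by (simp add: simple_process_def)
qed

lemma simple_process_outside:
  assumes mono: "mono_on {..steps H} (grid H)" and t: "0 < t" "t \<le> grid H 0 \<or> grid H (steps H) < t"
  shows "simple_process H t \<omega> = 0"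
proof -
  have "t \<notin> {grid H i<..grid H (Suc i)}" if "i < steps H" for i
    using that mono_onD[OF mono, of 0 i] mono_onD[OF mono, of "Suc i" "steps H"] t by auto
  then have "(\<Sum>i<steps H. coef H i \<omega> * indicator {grid H i<..grid H (Suc i)} t) = 0"
    by (intro sum.neutral) (simp add: indicator_def)
  then show ?thesis using t unfolding simple_process_def by simp
qed

section \<open>Combining two simple integrands on a common grid\<close>

definition merge_points :: "'a simple_integrand \<Rightarrow> 'a simple_integrand \<Rightarrow> real list" where
  "merge_points H K = sorted_list_of_set (grid H ` {..steps H} \<union> grid K ` {..steps K})"

text \<open>Coefficients are read at the right end points of the merged cells, which is the value
  just after the left end point. The instances are difference and product; sorting a set removes
  repeated points, so the merged grid is strictly increasing.\<close>

definition merge ::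
  "(real \<Rightarrow> real \<Rightarrow> real) \<Rightarrow> 'a simple_integrand \<Rightarrow> 'a simple_integrand \<Rightarrow> 'a simple_integrand" where
  "merge f H K = \<lparr>steps = length (merge_points H K) - 1, grid = (!) (merge_points H K),
     init = \<lambda>\<omega>. f (init H \<omega>) (init K \<omega>),
     coef = \<lambda>j \<omega>. f (simple_process H (merge_points H K ! Suc j) \<omega>)
                    (simple_process K (merge_points H K ! Suc j) \<omega>)\<rparr>"

lemma merge_points:
  defines "N \<equiv> \<lambda>H K. length (merge_points H K) - 1" and "g \<equiv> \<lambda>H K. (!) (merge_points H K)"
  shows "strict_mono_on {..N H K} (g H K)"
    and "g H K ` {..N H K} = grid H ` {..steps H} \<union> grid K ` {..steps K}"
    and "merge_points H K \<noteq> []"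
proof -
  let ?S = "grid H ` {..steps H} \<union> grid K ` {..steps K}"
  have ne: "?S \<noteq> {}" "finite ?S" by auto
  then show nn: "merge_points H K \<noteq> []" by (simp add: merge_points_def)
  have len: "i \<le> N H K \<longleftrightarrow> i < length (merge_points H K)" for i
    using nn unfolding N_def by (cases "merge_points H K") auto
  show "strict_mono_on {..N H K} (g H K)"
    using strict_sorted_list_of_set[of ?S] unfolding g_def
    by (intro strict_mono_onI) (auto simp: len merge_points_def intro: sorted_wrt_nth_less)
  have "set (merge_points H K) = ?S" using ne by (simp add: merge_points_def)
  moreover have "g H K ` {..N H K} = set (merge_points H K)"
    unfolding g_def set_conv_nth by (auto simp: len image_iff)
  ultimately show "g H K ` {..N H K} = ?S" by simp
qed

context complete_filtered_prob_space
begin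

lemma simple_predictableD:
  assumes "simple_predictable P F H"
  shows "mono_on {..steps H} (grid H)" "0 \<le> grid H 0"
    "i \<le> steps H \<Longrightarrow> 0 \<le> grid H i"
    "i < steps H \<Longrightarrow> grid H i \<le> grid H (Suc i)"
    "i < steps H \<Longrightarrow> coef H i \<in> borel_measurable (F (grid H i))"
    "init H \<in> borel_measurable (F 0)"
proof -
  show m: "mono_on {..steps H} (grid H)" and z: "0 \<le> grid H 0"
    "i < steps H \<Longrightarrow> coef H i \<in> borel_measurable (F (grid H i))"
    "init H \<in> borel_measurable (F 0)"
    using assms by (auto simp: simple_predictable_def)
  show "i \<le> steps H \<Longrightarrow> 0 \<le> grid H i" "i < steps H \<Longrightarrow> grid H i \<le> grid H (Suc i)"
    using mono_onD[OF m, of 0 i] mono_onD[OF m, of i "Suc i"] z by auto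
qed

lemma simple_predictable_bound:
  assumes "simple_predictable P F H"
  obtains B where "0 \<le> B" "\<And>i \<omega>. \<lbrakk>i < steps H; \<omega> \<in> space P\<rbrakk> \<Longrightarrow> \<bar>coef H i \<omega>\<bar> \<le> B"
proof -
  have "\<exists>b. \<forall>i\<in>{..<steps H}. \<forall>\<omega>\<in>space P. \<bar>coef H i \<omega>\<bar> \<le> b i"
    using assms unfolding simple_predictable_def by (intro bchoice) auto
  then obtain b where b: "\<And>i \<omega>. \<lbrakk>i < steps H; \<omega> \<in> space P\<rbrakk> \<Longrightarrow> \<bar>coef H i \<omega>\<bar> \<le> b i" by auto
  show ?thesis
  proof (rule that)
    show "0 \<le> (\<Sum>i<steps H. \<bar>b i\<bar>)" by (simp add: sum_nonneg)
    fix i \<omega> assume i: "i < steps H" "\<omega> \<in> space P"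
    have "\<bar>b i\<bar> \<le> (\<Sum>i<steps H. \<bar>b i\<bar>)" using i by (intro member_le_sum) auto
    then show "\<bar>coef H i \<omega>\<bar> \<le> (\<Sum>i<steps H. \<bar>b i\<bar>)" using b[OF i] by linarith
  qed
qed

lemma simple_process_0: "simple_predictable P F H \<Longrightarrow> simple_process H 0 \<omega> = init H \<omega>"
  using simple_predictableD(3)[of H] unfolding simple_process_def
  by (auto intro!: sum.neutral simp: indicator_def) (meson less_imp_le linorder_not_less)

lemma simple_process_bounded:
  assumes "simple_predictable P F H"
  shows "\<exists>B. \<forall>t. \<forall>\<omega>\<in>space P. \<bar>simple_process H t \<omega>\<bar> \<le> B"
proof -
  obtain b where b: "0 \<le> b" "\<And>i \<omega>. \<lbrakk>i < steps H; \<omega> \<in> space P\<rbrakk> \<Longrightarrow> \<bar>coef H i \<omega>\<bar> \<le> b"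
    using simple_predictable_bound[OF assms] by blast
  obtain c where c: "\<forall>\<omega>\<in>space P. \<bar>init H \<omega>\<bar> \<le> c"
    using assms by (auto simp: simple_predictable_def)
  have "\<bar>simple_process H t \<omega>\<bar> \<le> \<bar>c\<bar> + (\<Sum>i<steps H. b)" if w: "\<omega> \<in> space P" for t \<omega>
    unfolding simple_process_def
  proof (rule order_trans[OF abs_triangle_ineq add_mono])
    show "\<bar>init H \<omega> * indicator {0} t\<bar> \<le> \<bar>c\<bar>" using c w by (auto simp: indicator_def intro: order_trans)
    show "\<bar>\<Sum>i<steps H. coef H i \<omega> * indicator {grid H i<..grid H (Suc i)} t\<bar> \<le> (\<Sum>i<steps H. b)"
      by (rule order_trans[OF sum_abs sum_mono]) (use b w in \<open>auto simp: indicator_def\<close>)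
  qed
  then show ?thesis by blast
qed

text \<open>The value at t is already known at time a if no cell starts after a and before t. This
  makes the coefficients of a merged integrand predictable although they are read at right end
  points.\<close>

lemma simple_process_measurable_left:
  assumes H: "simple_predictable P F H" and a: "0 \<le> a"
    and gap: "\<And>i. \<lbrakk>i < steps H; grid H i < t\<rbrakk> \<Longrightarrow> grid H i \<le> a" and t: "0 < t"
  shows "simple_process H t \<in> borel_measurable (F a)"
proof -
  have "(\<lambda>\<omega>. coef H i \<omega> * indicator {grid H i<..grid H (Suc i)} t) \<in> borel_measurable (F a)"
    if i: "i < steps H" for i
  proof (cases "grid H i < t")
    case True
    have "coef H i \<in> borel_measurable (F a)"
      using measurable_F_le[OF simple_predictableD(5)[OF H i] _ gap[OF i True]]
        simple_predictableD(3)[OF H, of i] i by auto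
    then show ?thesis by auto
  qed auto
  then have "(\<lambda>\<omega>. \<Sum>i<steps H. coef H i \<omega> * indicator {grid H i<..grid H (Suc i)} t) \<in> borel_measurable (F a)"
    by (intro borel_measurable_sum) auto
  moreover have "simple_process H t = (\<lambda>\<omega>. \<Sum>i<steps H. coef H i \<omega> * indicator {grid H i<..grid H (Suc i)} t)"
    unfolding simple_process_def using t by simp
  ultimately show ?thesis by simp
qed

lemma simple_process_measurable:
  assumes H: "simple_predictable P F H" and t: "0 \<le> t"
  shows "simple_process H t \<in> borel_measurable (F t)"
proof (cases "t = 0")
  case True
  have "simple_process H 0 = init H" using simple_process_0[OF H] by auto
  then show ?thesis using simple_predictableD(6)[OF H] True by simp
next
  case False
  then show ?thesis using simple_process_measurable_left[OF H t, of t] t by auto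
qed

lemma simple_process_continuous_left: "0 < s \<Longrightarrow> continuous (at_left s) (\<lambda>t. simple_process H t \<omega>)"
proof -
  assume s: "0 < s"
  have ind: "continuous (at_left s) (\<lambda>t. indicator {a<..b} t :: real)" for a b
  proof -
    have "\<forall>\<^sub>F t in at_left s. (indicator {a<..b} t :: real) = indicator {a<..b} s"
    proof (cases "a < s")
      case True
      show ?thesis
      proof (cases "b < s")
        case True
        show ?thesis by (rule eventually_mono[OF eventually_at_left_real[OF True]]) (use True in \<open>auto simp: indicator_def\<close>)
      next
        case False
        show ?thesis by (rule eventually_mono[OF eventually_at_left_real[OF \<open>a < s\<close>]])
          (use False in \<open>auto simp: indicator_def\<close>)
      qed
    next
      case False
      have "\<forall>\<^sub>F t in at_left s. t < s" by (simp add: eventually_at_filter)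
      then show ?thesis by (rule eventually_mono) (use False in \<open>auto simp: indicator_def\<close>)
    qed
    then show ?thesis unfolding continuous_within by (rule tendsto_eventually)
  qed
  have "continuous (at_left s) (\<lambda>t. indicator {0} t :: real)"
  proof -
    have "\<forall>\<^sub>F t in at_left s. (indicator {0} t :: real) = indicator {0} s"
      by (rule eventually_mono[OF eventually_at_left_real[OF s]]) (use s in \<open>auto simp: indicator_def\<close>)
    then show ?thesis unfolding continuous_within by (rule tendsto_eventually)
  qed
  then show ?thesis unfolding simple_process_def by (intro continuous_intros ind)
qed

lemma merge_predictable:
  assumes H: "simple_predictable P F H" and K: "simple_predictable P F K"
    and f: "case_prod f \<in> borel_measurable (borel \<Otimes>\<^sub>M borel)"
    and bd: "\<And>B. \<exists>C. \<forall>x y. \<bar>x\<bar> \<le> B \<longrightarrow> \<bar>y\<bar> \<le> B \<longrightarrow> \<bar>f x y\<bar> \<le> C"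
  shows "simple_predictable P F (merge f H K)"
proof -
  let ?g = "(!) (merge_points H K)" and ?N = "length (merge_points H K) - 1"
  note g = merge_points[of H K]
  have pos: "0 \<le> ?g i" if "i \<le> ?N" for i
  proof -
    have "?g i \<in> grid H ` {..steps H} \<union> grid K ` {..steps K}" using g(2) that by blast
    then show ?thesis using simple_predictableD(3)[OF H] simple_predictableD(3)[OF K] by auto
  qed
  have meas: "(\<lambda>\<omega>. f (a \<omega>) (b \<omega>)) \<in> borel_measurable M"
    if "a \<in> borel_measurable M" and "b \<in> borel_measurable M" for a b :: "'a \<Rightarrow> real" and M :: "'a measure"
    using measurable_compose[OF measurable_Pair[OF that] f] by simp
  have bdd: "\<exists>C. \<forall>\<omega>\<in>space P. \<bar>f (a \<omega>) (b \<omega>)\<bar> \<le> C"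
    if a: "\<exists>B. \<forall>\<omega>\<in>space P. \<bar>a \<omega>\<bar> \<le> B" and b: "\<exists>B. \<forall>\<omega>\<in>space P. \<bar>b \<omega>\<bar> \<le> B" for a b :: "'a \<Rightarrow> real"
  proof -
    obtain A B where "\<forall>\<omega>\<in>space P. \<bar>a \<omega>\<bar> \<le> A" "\<forall>\<omega>\<in>space P. \<bar>b \<omega>\<bar> \<le> B"
      using a b by blast
    then have "\<forall>\<omega>\<in>space P. \<bar>a \<omega>\<bar> \<le> max A B \<and> \<bar>b \<omega>\<bar> \<le> max A B" by auto
    then show ?thesis using bd[of "max A B"] by blast
  qed
  \<comment> \<open>No grid point of L lies strictly between neighbouring merged points, so the
    value at the right end point is measurable at the left one.\<close>
  have leftm: "simple_process L (?g (Suc j)) \<in> borel_measurable (F (?g j))"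
    if L: "simple_predictable P F L" and sub: "grid L ` {..steps L} \<subseteq> ?g ` {..?N}" and j: "j < ?N" for L j
  proof (rule simple_process_measurable_left[OF L])
    show "0 \<le> ?g j" using pos j by auto
    have "?g j < ?g (Suc j)" using strict_mono_onD[OF g(1), of j "Suc j"] j by auto
    then show "0 < ?g (Suc j)" using pos[of j] j by auto
    fix i assume i: "i < steps L" "grid L i < ?g (Suc j)"
    then have "grid L i \<in> ?g ` {..?N}" using sub by auto
    then obtain a where a: "a \<le> ?N" "grid L i = ?g a" by auto
    then have "a < Suc j" using i j strict_mono_on_less[OF g(1), of a "Suc j"] by auto
    then show "grid L i \<le> ?g j" using a j strict_mono_on_less_eq[OF g(1), of a j] by auto
  qed
  show ?thesis unfolding simple_predictable_def
  proof (intro conjI allI impI)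
    show "0 \<le> grid (merge f H K) 0" using pos[of 0] by (simp add: merge_def)
    show "mono_on {..steps (merge f H K)} (grid (merge f H K))"
      using strict_mono_on_imp_mono_on[OF g(1)] by (simp add: merge_def)
    show "init (merge f H K) \<in> borel_measurable (F 0)"
      using meas[OF simple_predictableD(6)[OF H] simple_predictableD(6)[OF K]] by (simp add: merge_def)
    show "\<exists>B. \<forall>\<omega>\<in>space P. \<bar>init (merge f H K) \<omega>\<bar> \<le> B"
      unfolding merge_def simple_integrand.simps
      by (rule bdd) (use H K in \<open>auto simp: simple_predictable_def\<close>)
    fix i assume i: "i < steps (merge f H K)"
    then have i': "i < ?N" by (simp add: merge_def)
    have "(\<lambda>\<omega>. f (simple_process H (?g (Suc i)) \<omega>) (simple_process K (?g (Suc i)) \<omega>)) \<in> borel_measurable (F (?g i))"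
      by (intro meas leftm H K i') (use g(2) in auto)
    then show "coef (merge f H K) i \<in> borel_measurable (F (grid (merge f H K) i))"
      by (simp add: merge_def)
    show "\<exists>B. \<forall>\<omega>\<in>space P. \<bar>coef (merge f H K) i \<omega>\<bar> \<le> B"
      unfolding merge_def simple_integrand.simps
      by (rule bdd) (use simple_process_bounded[OF H] simple_process_bounded[OF K] in blast)+
  qed
qed

lemma merge_process:
  assumes H: "simple_predictable P F H" and K: "simple_predictable P F K" and f: "f 0 0 = 0" and t: "0 \<le> t"
    and M: "simple_predictable P F (merge f H K)"
  shows "simple_process (merge f H K) t \<omega> = f (simple_process H t \<omega>) (simple_process K t \<omega>)"
proof (cases "t = 0")
  case True
  then show ?thesis using simple_process_0[OF H] simple_process_0[OF K] simple_process_0[OF M]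
    by (simp add: merge_def)
next
  case False
  let ?g = "(!) (merge_points H K)" and ?N = "length (merge_points H K) - 1"
  note g = merge_points[of H K]
  have t: "0 < t" using t False by simp
  have mm: "steps (merge f H K) = ?N" "grid (merge f H K) = ?g" by (simp_all add: merge_def)
  have sub: "grid H ` {..steps H} \<subseteq> ?g ` {..?N}" "grid K ` {..steps K} \<subseteq> ?g ` {..?N}" using g(2) by auto
  have g0: "0 \<le> ?g 0" using simple_predictableD(2)[OF M] mm by simp
  show ?thesis
  proof (cases "?g 0 < t \<and> t \<le> ?g ?N")
    case True
    then obtain j where j: "j < ?N" "?g j < t" "t \<le> ?g (Suc j)"
      using grid_interval_exists[of ?g t ?N] by auto
    have "simple_process (merge f H K) t \<omega> = coef (merge f H K) j \<omega>"
      by (rule simple_process_active[OF simple_predictableD(1)[OF M]]) (use j t mm in auto)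
    also have "\<dots> = f (simple_process H (?g (Suc j)) \<omega>) (simple_process K (?g (Suc j)) \<omega>)"
      by (simp add: merge_def)
    also have "\<dots> = f (simple_process H t \<omega>) (simple_process K t \<omega>)"
      using simple_process_refine[OF g(1) sub(1) g0 j] simple_process_refine[OF g(1) sub(2) g0 j] by simp
    finally show ?thesis .
  next
    case False
    \<comment> \<open>Outside the merged grid both processes vanish; this is where f 0 0 = 0
      enters.\<close>
    have out: "simple_process L t \<omega> = 0" if L: "simple_predictable P F L" "grid L ` {..steps L} \<subseteq> ?g ` {..?N}" for L
    proof (rule simple_process_outside[OF simple_predictableD(1)[OF L(1)] t])
      have "grid L 0 \<in> ?g ` {..?N}" "grid L (steps L) \<in> ?g ` {..?N}" using L(2) by auto
      then have "?g 0 \<le> grid L 0" "grid L (steps L) \<le> ?g ?N"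
        using strict_mono_on_less_eq[OF g(1)] by auto
      then show "t \<le> grid L 0 \<or> grid L (steps L) < t" using False by linarith
    qed
    show ?thesis using out[OF H sub(1)] out[OF K sub(2)] out[OF M] mm f by simp
  qed
qed

lemma simple_integral_merge_points:
  assumes H: "simple_predictable P F H" and K: "simple_predictable P F K" and M: "simple_predictable P F (merge f H K)"
  defines "g \<equiv> (!) (merge_points H K)" and "N \<equiv> length (merge_points H K) - 1"
  shows "simple_integral H Y t \<omega> =
      (\<Sum>j<N. simple_process H (g (Suc j)) \<omega> * (Y (min (g (Suc j)) t) \<omega> - Y (min (g j) t) \<omega>))"
    and "simple_integral K Y t \<omega> =
      (\<Sum>j<N. simple_process K (g (Suc j)) \<omega> * (Y (min (g (Suc j)) t) \<omega> - Y (min (g j) t) \<omega>))"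
    and "simple_integral (merge f H K) Y t \<omega> =
      (\<Sum>j<N. f (simple_process H (g (Suc j)) \<omega>) (simple_process K (g (Suc j)) \<omega>) *
         (Y (min (g (Suc j)) t) \<omega> - Y (min (g j) t) \<omega>))"
proof -
  have "0 \<le> g 0" using simple_predictableD(2)[OF M] by (simp add: merge_def g_def)
  note * = simple_integral_refine[OF merge_points(1)[of H K, folded g_def N_def] _ _ this]
  show "simple_integral H Y t \<omega> =
      (\<Sum>j<N. simple_process H (g (Suc j)) \<omega> * (Y (min (g (Suc j)) t) \<omega> - Y (min (g j) t) \<omega>))"
    by (rule *) (use merge_points(2)[of H K] simple_predictableD(1)[OF H] in \<open>auto simp: g_def N_def\<close>)
  show "simple_integral K Y t \<omega> =
      (\<Sum>j<N. simple_process K (g (Suc j)) \<omega> * (Y (min (g (Suc j)) t) \<omega> - Y (min (g j) t) \<omega>))"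
    by (rule *) (use merge_points(2)[of H K] simple_predictableD(1)[OF K] in \<open>auto simp: g_def N_def\<close>)
qed (simp add: simple_integral_def merge_def g_def N_def)

definition diff_integrand :: "'a simple_integrand \<Rightarrow> 'a simple_integrand \<Rightarrow> 'a simple_integrand" where
  "diff_integrand = merge (-)"

text \<open>Two integrands close to the same process have a small difference that is again simple,
  so continuity of the integral at 0 compares their integrals.\<close>

lemma diff_integrand:
  assumes H: "simple_predictable P F H" and K: "simple_predictable P F K"
  shows "simple_predictable P F (diff_integrand H K)"
    and "0 \<le> t \<Longrightarrow> simple_process (diff_integrand H K) t \<omega> = simple_process H t \<omega> - simple_process K t \<omega>"
    and "simple_integral (diff_integrand H K) Y t \<omega> = simple_integral H Y t \<omega> - simple_integral K Y t \<omega>"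
proof -
  show M: "simple_predictable P F (diff_integrand H K)" unfolding diff_integrand_def
  proof (rule merge_predictable[OF H K])
    show "\<exists>C. \<forall>x y. \<bar>x\<bar> \<le> B \<longrightarrow> \<bar>y\<bar> \<le> B \<longrightarrow> \<bar>x - y\<bar> \<le> C" for B :: real
      by (rule exI[of _ "2 * B"]) auto
  qed measurable
  show "0 \<le> t \<Longrightarrow> simple_process (diff_integrand H K) t \<omega> = simple_process H t \<omega> - simple_process K t \<omega>"
    unfolding diff_integrand_def by (rule merge_process[OF H K _ _ M[unfolded diff_integrand_def]]) auto
  show "simple_integral (diff_integrand H K) Y t \<omega> = simple_integral H Y t \<omega> - simple_integral K Y t \<omega>"
    unfolding diff_integrand_def simple_integral_merge_points[OF H K M[unfolded diff_integrand_def]]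
    by (simp add: sum_subtractf[symmetric] left_diff_distrib)
qed

definition times_integrand :: "'a simple_integrand \<Rightarrow> 'a simple_integrand \<Rightarrow> 'a simple_integrand" where
  "times_integrand = merge (*)"

text \<open>The third claim is associativity, exact at the level of simple integrands: by
  \<open>grid_sum_increment\<close> the increments of the inner integral are the inner values times
  the increments of Y.\<close>

lemma times_integrand:
  assumes H: "simple_predictable P F H" and K: "simple_predictable P F K"
  shows "simple_predictable P F (times_integrand H K)"
    and "0 \<le> t \<Longrightarrow> simple_process (times_integrand H K) t \<omega> = simple_process H t \<omega> * simple_process K t \<omega>"
    and "simple_integral (times_integrand H K) Y t \<omega> = simple_integral H (simple_integral K Y) t \<omega>"
proof -
  show M: "simple_predictable P F (times_integrand H K)" unfolding times_integrand_def
  proof (rule merge_predictable[OF H K])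
    show "\<exists>C. \<forall>x y. \<bar>x\<bar> \<le> B \<longrightarrow> \<bar>y\<bar> \<le> B \<longrightarrow> \<bar>x * y\<bar> \<le> C" for B :: real
      by (rule exI[of _ "B * B"]) (auto simp: abs_mult intro!: mult_mono)
  qed measurable
  show "0 \<le> t \<Longrightarrow> simple_process (times_integrand H K) t \<omega> = simple_process H t \<omega> * simple_process K t \<omega>"
    unfolding times_integrand_def by (rule merge_process[OF H K _ _ M[unfolded times_integrand_def]]) auto
  let ?g = "(!) (merge_points H K)" and ?N = "length (merge_points H K) - 1"
  note eq = simple_integral_merge_points[OF H K M[unfolded times_integrand_def]]
  note sm = merge_points(1)[of H K]
  have "simple_integral K Y (min (?g (Suc j)) t) \<omega> - simple_integral K Y (min (?g j) t) \<omega> =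
    simple_process K (?g (Suc j)) \<omega> * (Y (min (?g (Suc j)) t) \<omega> - Y (min (?g j) t) \<omega>)" if j: "j < ?N" for j
    unfolding eq(2)
    by (rule grid_sum_increment[where c = "\<lambda>l. simple_process K (?g (Suc l)) \<omega>" and f = "\<lambda>u. Y u \<omega>",
          OF strict_mono_on_imp_mono_on[OF sm] j])
  then show "simple_integral (times_integrand H K) Y t \<omega> = simple_integral H (simple_integral K Y) t \<omega>"
    unfolding times_integrand_def eq(1,3) by (intro sum.cong) auto
qed

lemma clip_integrand_predictable:
  assumes "simple_predictable P F H" "0 \<le> c"
  shows "simple_predictable P F (clip_integrand c H)"
  using assms abs_clip_le[OF assms(2)] unfolding simple_predictable_def
  by (auto intro: measurable_compose[OF _ measurable_clip])

lemma simple_integral_AC: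
  assumes H: "simple_predictable P F H" and Y: "Y \<in> AC"
  shows "simple_integral H Y \<in> AC"
  unfolding simple_integral_def
proof (rule AC_sum, rule ACI)
  fix i assume i: "i < steps H"
  note g = simple_predictableD[OF H]
  have g': "0 \<le> grid H i" "0 \<le> grid H (Suc i)" "grid H i \<le> grid H (Suc i)" using g(3,4) i by auto
  fix t :: real assume t: "0 \<le> t"
  show "(\<lambda>\<omega>. coef H i \<omega> * (Y (min (grid H (Suc i)) t) \<omega> - Y (min (grid H i) t) \<omega>)) \<in> borel_measurable (F t)"
  \<comment> \<open>The coefficient is measurable only from time \<open>grid H i\<close> on, but
    before that the increment is zero.\<close>
  proof (cases "t \<le> grid H i")
    case True
    then have "min (grid H (Suc i)) t = min (grid H i) t" using g' by auto
    then show ?thesis by simp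
  next
    case False
    then have "coef H i \<in> borel_measurable (F t)"
      using measurable_F_le[OF g(5)[OF i]] g' by auto
    then show ?thesis
      by (intro borel_measurable_times borel_measurable_diff AC_measurable_F_le[OF Y]) (use g' t in auto)
  qed
next
  fix i \<omega> assume i: "i < steps H" and w: "\<omega> \<in> space P"
  have "0 \<le> grid H i" "0 \<le> grid H (Suc i)" using simple_predictableD(3)[OF H] i by auto
  then show "continuous_on {0..} (\<lambda>t. coef H i \<omega> * (Y (min (grid H (Suc i)) t) \<omega> - Y (min (grid H i) t) \<omega>))"
    by (intro continuous_intros AC_continuous[OF AC_min_time[OF Y] w])
qed

lemma simple_integral_add:
  "simple_integral H (\<lambda>t \<omega>. Y t \<omega> + Z t \<omega>) t \<omega> = simple_integral H Y t \<omega> + simple_integral H Z t \<omega>"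
  unfolding simple_integral_def sum.distrib[symmetric] by (intro sum.cong) (auto simp: algebra_simps)

lemma simple_integral_diff:
  "simple_integral H (\<lambda>t \<omega>. Y t \<omega> - Z t \<omega>) t \<omega> = simple_integral H Y t \<omega> - simple_integral H Z t \<omega>"
  unfolding simple_integral_def sum_subtractf[symmetric] by (intro sum.cong) (auto simp: algebra_simps)

end

section \<open>Good integrators and the Ito integral\<close>

lemma continuous_on_halfline:
  fixes f :: "real \<Rightarrow> real"
  assumes "\<And>t. 0 \<le> t \<Longrightarrow> continuous_on {0..t} f"
  shows "continuous_on {0..} f"
proof -
  have "continuous (at x within {0..}) f" if x: "0 \<le> x" for x
  proof -
    have "continuous (at x within {0..x+1}) f"
      using assms[of "x+1"] x by (simp add: continuous_on_eq_continuous_within)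
    moreover have "at x within {0..} = at x within {0..x+1}"
      by (rule at_within_nhd[of x "{..<x+1}"]) (use x in auto)
    ultimately show ?thesis by simp
  qed
  then show ?thesis by (simp add: continuous_on_eq_continuous_within)
qed

lemma geometric_Cauchy:
  fixes x :: "nat \<Rightarrow> real"
  assumes "\<And>j. k \<le> j \<Longrightarrow> \<bar>x j - x (Suc j)\<bar> \<le> (1/2)^j"
  shows "convergent x" and "k \<le> j \<Longrightarrow> \<bar>x j - lim x\<bar> \<le> 2 * (1/2)^j"
proof -
  \<comment> \<open>Subtracting the remaining geometric tail makes the induction go through; the
    bound 2 * (1/2)^j alone would not reproduce itself.\<close>
  have *: "\<bar>x j - x (j + i)\<bar> \<le> 2 * (1/2)^j - 2 * (1/2)^(j+i)" if "k \<le> j" for i j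
  proof (induction i)
    case (Suc i)
    have "\<bar>x j - x (j + Suc i)\<bar> \<le> \<bar>x j - x (j + i)\<bar> + \<bar>x (j + i) - x (Suc (j + i))\<bar>" by simp
    also have "\<dots> \<le> 2 * (1/2)^j - 2 * (1/2)^(j+i) + (1/2)^(j+i)"
      using Suc assms[of "j+i"] that by (intro add_mono) auto
    finally show ?case by simp
  qed simp
  have b: "\<bar>x j - x (j + i)\<bar> \<le> 2 * (1/2)^j" if "k \<le> j" for i j
    using *[OF that, of i] by (smt (verit) zero_le_power zero_le_divide_1_iff)
  show c: "convergent x"
  proof (rule Cauchy_convergent, rule metric_CauchyI)
    fix e :: real assume e: "0 < e"
    then obtain n where n: "(1/2)^n < e/4" using real_arch_pow_inv[of "e/4" "1/2"] by auto
    have pw: "(1/2::real)^(max k n) \<le> (1/2)^n" by (rule power_decreasing) auto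
    have "\<bar>x (max k n) - x m\<bar> < e/2" if "m \<ge> max k n" for m
    proof -
      have "max k n + (m - max k n) = m" using that by simp
      then show ?thesis using b[of "max k n" "m - max k n"] n pw by (simp only:) linarith
    qed
    then show "\<exists>M. \<forall>m\<ge>M. \<forall>n\<ge>M. dist (x m) (x n) < e"
      unfolding dist_real_def by (intro exI[of _ "max k n"]) (smt (verit) field_sum_of_halves)
  qed
  show "\<bar>x j - lim x\<bar> \<le> 2 * (1/2)^j" if j: "k \<le> j"
  proof (rule tendsto_upperbound)
    have "x \<longlonglongrightarrow> lim x" using c by (simp add: convergent_LIMSEQ_iff)
    then show "(\<lambda>i. \<bar>x j - x i\<bar>) \<longlonglongrightarrow> \<bar>x j - lim x\<bar>" by (intro tendsto_intros)
    show "\<forall>\<^sub>F i in sequentially. \<bar>x j - x i\<bar> \<le> 2 * (1/2)^j"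
      using eventually_ge_at_top[of j]
    proof eventually_elim
      case (elim i)
      then show ?case using b[OF j, of "i - j"] by simp
    qed
  qed simp
qed

context complete_filtered_prob_space
begin

text \<open>A subsequence with geometric rates converges locally uniformly off a null set. Local
  uniformity preserves continuity, and completeness of the filtration keeps the limit adapted when
  it is set to 0 on the null set.\<close>

lemma ucp_Cauchy_convergent:
  assumes J: "\<And>n. J n \<in> AC"
    and C: "\<And>t e. \<lbrakk>0 \<le> t; 0 < e\<rbrakk> \<Longrightarrow> \<exists>N. \<forall>n\<ge>N. \<forall>m\<ge>N. small t e (\<lambda>s \<omega>. J n s \<omega> - J m s \<omega>)"
  shows "\<exists>I\<in>AC. ucp J I"
proof -
  have "\<exists>N. \<forall>k. \<forall>n\<ge>N k. \<forall>m\<ge>N k. small (real k) ((1/2)^k) (\<lambda>s \<omega>. J n s \<omega> - J m s \<omega>)"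
    by (intro choice allI C) auto
  then obtain N where N: "\<And>k n m. N k \<le> n \<Longrightarrow> N k \<le> m \<Longrightarrow> small (real k) ((1/2)^k) (\<lambda>s \<omega>. J n s \<omega> - J m s \<omega>)"
    by blast
  \<comment> \<open>Summing the thresholds gives N k \<le> r k and N k \<le> r (k+1), so
    neighbouring members are comparable at level k; the summand k makes r unbounded.\<close>
  define r where "r k = (\<Sum>j\<le>k. N j) + k" for k
  have r: "N k \<le> r k" "N k \<le> r (Suc k)" "k \<le> r k" for k
    using member_le_sum[of k "{..k}" N] member_le_sum[of k "{..Suc k}" N] by (auto simp: r_def)
  have "\<exists>B. \<forall>k. B k \<in> events \<and> prob (B k) < (1/2)^k \<and>
      (\<forall>\<omega>\<in>space P - B k. \<forall>s\<in>{0..real k}. \<bar>J (r k) s \<omega> - J (r (Suc k)) s \<omega>\<bar> \<le> (1/2)^k)"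
    using N[OF r(1) r(2)] unfolding small_def hp_def by (intro choice allI) (auto simp: Bex_def)
  then obtain B where B: "\<And>k. B k \<in> events" "\<And>k. prob (B k) < (1/2)^k"
    "\<And>k \<omega> s. \<lbrakk>\<omega> \<in> space P; \<omega> \<notin> B k; 0 \<le> s; s \<le> real k\<rbrakk> \<Longrightarrow> \<bar>J (r k) s \<omega> - J (r (Suc k)) s \<omega>\<bar> \<le> (1/2)^k"
    by (metis (no_types, lifting) DiffI atLeastAtMost_iff)
  \<comment> \<open>Off the tail union U k all differences from index k on are controlled at once,
    and its probability is at most the geometric tail 2 * (1/2)^k.\<close>
  define U where "U k = (\<Union>j. B (j + k))" for k
  have U: "U k \<in> events" for k using B(1) by (auto simp: U_def)
  have geo: "summable (\<lambda>j. (1/2::real)^(j + k))" for k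
    using summable_ignore_initial_segment[OF summable_geometric[of "1/2::real"]] by simp
  have "prob (U k) \<le> 2 * (1/2)^k" for k
  proof -
    have sB: "summable (\<lambda>j. prob (B (j + k)))"
      by (rule summable_comparison_test'[OF geo[of k]]) (use B(2) in \<open>auto intro: less_imp_le\<close>)
    have "prob (U k) \<le> (\<Sum>j. prob (B (j + k)))"
      unfolding U_def by (rule finite_measure_subadditive_countably) (use B(1) sB in auto)
    also have "\<dots> \<le> (\<Sum>j. (1/2)^(j + k))"
      by (rule suminf_le) (use B(2) sB geo in \<open>auto intro: less_imp_le\<close>)
    also have "\<dots> = 2 * (1/2)^k"
      using suminf_mult2[OF summable_geometric[of "1/2::real"], of "(1/2)^k"]
      by (simp add: power_add suminf_geometric)
    finally show ?thesis .
  qed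
  note pU = this
  define L where "L = (\<Inter>k. U k)"
  have L: "L \<in> events" using U by (auto simp: L_def)
  have "prob L \<le> 2 * (1/2)^k" for k
    using finite_measure_mono[of L "U k", OF _ U] pU[of k] unfolding L_def
    by (meson INT_lower UNIV_I order_trans)
  then have "prob L \<le> 0"
    by (intro LIMSEQ_le_const[OF tendsto_mult_right_zero[OF LIMSEQ_power_zero[of "1/2::real"]]]) auto
  then have "L \<in> null_sets P"
    using L by (auto simp: null_sets_def emeasure_eq_measure measure_le_0_iff)
  then have LF: "L \<in> sets (F t)" if "0 \<le> t" for t using null_sets_F_t that by blast
  have step: "\<bar>J (r j) s \<omega> - J (r (Suc j)) s \<omega>\<bar> \<le> (1/2)^j"
    if "\<omega> \<in> space P" "\<omega> \<notin> U k" "k \<le> j" "0 \<le> s" "s \<le> real k" for \<omega> k j s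
  proof (rule B(3))
    have "B j \<subseteq> U k" unfolding U_def
      using UN_upper[of "j - k" UNIV "\<lambda>i. B (i + k)"] \<open>k \<le> j\<close> by simp
    then show "\<omega> \<notin> B j" using that by auto
  qed (use that in auto)
  \<comment> \<open>The value 0 on L is a continuous path, and L belongs to every F t.\<close>
  define I where "I t \<omega> = (if \<omega> \<in> L then 0 else lim (\<lambda>k. J (r k) t \<omega>))" for t \<omega>
  have conv: "convergent (\<lambda>k. J (r k) s \<omega>)" "k \<le> j \<Longrightarrow> \<bar>J (r j) s \<omega> - I s \<omega>\<bar> \<le> 2 * (1/2)^j"
    if "\<omega> \<in> space P" "\<omega> \<notin> U k" "0 \<le> s" "s \<le> real k" for \<omega> k j s
  proof -
    have "\<omega> \<notin> L" using that by (auto simp: L_def)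
    then show "convergent (\<lambda>k. J (r k) s \<omega>)" "k \<le> j \<Longrightarrow> \<bar>J (r j) s \<omega> - I s \<omega>\<bar> \<le> 2 * (1/2)^j"
      using geometric_Cauchy[of k "\<lambda>k. J (r k) s \<omega>", OF step[OF that(1,2)]] that by (auto simp: I_def)
  qed
  have Umono: "U k \<subseteq> U l" if "l \<le> k" for k l
  proof
    fix x assume "x \<in> U k"
    then obtain j where "x \<in> B (j + k)" by (auto simp: U_def)
    then have "x \<in> B ((j + (k - l)) + l)" using that by simp
    then show "x \<in> U l" unfolding U_def by blast
  qed
  have late: "\<exists>k. \<omega> \<notin> U k \<and> t \<le> real k" if nL: "\<omega> \<notin> L" for \<omega> t
  proof -
    obtain l where "\<omega> \<notin> U l" using nL by (auto simp: L_def)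
    moreover obtain m where "t \<le> real m" using real_arch_simple by blast
    ultimately show ?thesis using Umono[of l "max l m"] by (intro exI[of _ "max l m"]) auto
  qed
  have IAC: "I \<in> AC"
  proof (rule ACI)
    fix t :: real assume t: "0 \<le> t"
    show "I t \<in> borel_measurable (F t)"
    proof (rule borel_measurable_LIMSEQ_real)
      show "(\<lambda>\<omega>. if \<omega> \<in> L then 0 else J (r k) t \<omega>) \<in> borel_measurable (F t)" for k
        using AC_measurable_F[OF J t] LF[OF t] by (intro measurable_If_set) (auto simp: Int_absorb2 sets.sets_into_space)
      fix \<omega> assume "\<omega> \<in> space (F t)"
      then have w: "\<omega> \<in> space P" using space_F[OF t] by simp
      show "(\<lambda>k. if \<omega> \<in> L then 0 else J (r k) t \<omega>) \<longlonglongrightarrow> I t \<omega>"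
      proof (cases "\<omega> \<in> L")
        case False
        then obtain k where "\<omega> \<notin> U k" "t \<le> real k" using late by blast
        then have "convergent (\<lambda>k. J (r k) t \<omega>)" using conv(1) w t by blast
        then show ?thesis using False by (simp add: I_def convergent_LIMSEQ_iff)
      qed (simp add: I_def)
    qed
  next
    fix \<omega> assume w: "\<omega> \<in> space P"
    show "continuous_on {0..} (\<lambda>t. I t \<omega>)"
    proof (cases "\<omega> \<in> L")
      case True
      then show ?thesis by (simp add: I_def)
    next
      case False
      show ?thesis
      proof (rule continuous_on_halfline)
        fix t :: real assume t: "0 \<le> t"
        obtain k where k: "\<omega> \<notin> U k" "t \<le> real k" using late[OF False] by blast
        show "continuous_on {0..t} (\<lambda>t. I t \<omega>)"
        proof (rule uniform_limit_theorem[where F = sequentially])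
          show "\<forall>\<^sub>F j in sequentially. continuous_on {0..t} (\<lambda>t. J (r j) t \<omega>)"
            using continuous_on_subset[OF AC_continuous[OF J w]] by (intro always_eventually) auto
          show "uniform_limit {0..t} (\<lambda>j t. J (r j) t \<omega>) (\<lambda>t. I t \<omega>) sequentially"
          proof (rule uniform_limitI)
            fix e :: real assume e: "0 < e"
            have "(\<lambda>j. 2 * (1/2::real)^j) \<longlonglongrightarrow> 0"
              by (rule tendsto_mult_right_zero[OF LIMSEQ_power_zero]) simp
            from order_tendstoD(2)[OF this e] eventually_ge_at_top[of k]
            show "\<forall>\<^sub>F j in sequentially. \<forall>x\<in>{0..t}. dist (J (r j) x \<omega>) (I x \<omega>) < e"
              by eventually_elim (use conv(2)[OF w k(1)] k(2) in \<open>force simp: dist_real_def\<close>)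
          qed
        qed simp
      qed
    qed
  qed
  have "ucp J I" unfolding ucp_def
  proof (intro allI impI)
    fix t e :: real assume te: "0 \<le> t" "0 < e"
    then obtain N' where N': "\<And>n m. n \<ge> N' \<Longrightarrow> m \<ge> N' \<Longrightarrow> small t (e/2) (\<lambda>s \<omega>. J n s \<omega> - J m s \<omega>)"
      using C[of t "e/2"] by auto
    have "(\<lambda>j. 2 * (1/2::real)^j) \<longlonglongrightarrow> 0"
      by (rule tendsto_mult_right_zero[OF LIMSEQ_power_zero]) simp
    from order_tendstoD(2)[OF this, of "e/2"] te(2)
    have "\<forall>\<^sub>F j in sequentially. 2 * (1/2::real)^j < e/2" by simp
    then have "\<forall>\<^sub>F k in sequentially. 2 * (1/2::real)^k < e/2 \<and> k \<ge> N' \<and> k \<ge> nat \<lceil>t\<rceil>"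
      by (intro eventually_conj eventually_ge_at_top)
    then obtain k where k: "2 * (1/2::real)^k < e/2" "k \<ge> N'" "k \<ge> nat \<lceil>t\<rceil>"
      by (auto simp: eventually_sequentially)
    have "small t (e/2) (\<lambda>s \<omega>. J (r k) s \<omega> - I s \<omega>)" unfolding small_def
    proof (rule hpI[OF U[of k]])
      show "prob (U k) < e/2" using pU[of k] k(1) by linarith
      fix \<omega> assume w: "\<omega> \<in> space P" "\<omega> \<notin> U k"
      show "\<forall>s\<in>{0..t}. \<bar>J (r k) s \<omega> - I s \<omega>\<bar> \<le> e/2"
      proof
        fix s assume s: "s \<in> {0..t}"
        then have "s \<le> real k" using k(3) by auto
        then show "\<bar>J (r k) s \<omega> - I s \<omega>\<bar> \<le> e/2"
          using conv(2)[OF w, of s k] s k(1) by auto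
      qed
    qed
    then have "small t e (\<lambda>s \<omega>. J n s \<omega> - I s \<omega>)" if "n \<ge> N'" for n
      using small_add[OF N'[of n "r k"]] that r(3)[of k] k(2) by fastforce
    then show "\<forall>\<^sub>F n in sequentially. small t e (\<lambda>s \<omega>. J n s \<omega> - I s \<omega>)"
      by (auto simp: eventually_sequentially)
  qed
  then show ?thesis using IAC by blast
qed

text \<open>Good integrators in the sense of Protter.  Stating continuity by \<open>\<epsilon>\<close> and \<open>\<delta>\<close> at a fixed
  horizon avoids passing to subsequences.\<close>

definition good :: "'a process \<Rightarrow> bool" where
  "good Y \<longleftrightarrow> Y \<in> AC \<and> (\<forall>t\<ge>0. \<forall>e>0. \<exists>d>0. \<forall>H. simple_predictable P F H \<longrightarrow>
     small t d (simple_process H) \<longrightarrow> small t e (simple_integral H Y))"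

lemma goodD:
  assumes "good Y" "0 \<le> t" "0 < e"
  obtains d where "0 < d"
    "\<And>H. simple_predictable P F H \<Longrightarrow> small t d (simple_process H) \<Longrightarrow> small t e (simple_integral H Y)"
  using assms unfolding good_def by blast

lemma good_AC: "good Y \<Longrightarrow> Y \<in> AC" by (simp add: good_def)

lemma good_add:
  assumes "good Y" "good Z"
  shows "good (\<lambda>t \<omega>. Y t \<omega> + Z t \<omega>)"
  unfolding good_def
proof (intro conjI allI impI)
  fix t e :: real assume te: "0 \<le> t" "0 < e"
  then have "0 < e/2" by simp
  obtain d where d: "0 < d" "\<And>H. simple_predictable P F H \<Longrightarrow> small t d (simple_process H) \<Longrightarrow> small t (e/2) (simple_integral H Y)"
    using goodD[OF assms(1) te(1) \<open>0 < e/2\<close>] by blast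
  obtain d' where d': "0 < d'" "\<And>H. simple_predictable P F H \<Longrightarrow> small t d' (simple_process H) \<Longrightarrow> small t (e/2) (simple_integral H Z)"
    using goodD[OF assms(2) te(1) \<open>0 < e/2\<close>] by blast
  have "small t e (simple_integral H (\<lambda>t \<omega>. Y t \<omega> + Z t \<omega>))"
    if H: "simple_predictable P F H" "small t (min d d') (simple_process H)" for H
  proof -
    have "small t (e/2 + e/2) (\<lambda>s \<omega>. simple_integral H Y s \<omega> + simple_integral H Z s \<omega>)"
      by (intro small_add d(2) d'(2) H(1) small_mono[OF H(2)]) auto
    moreover have "simple_integral H (\<lambda>t \<omega>. Y t \<omega> + Z t \<omega>) = (\<lambda>s \<omega>. simple_integral H Y s \<omega> + simple_integral H Z s \<omega>)"
      by (intro ext simple_integral_add)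
    ultimately show ?thesis by simp
  qed
  then show "\<exists>d>0. \<forall>H. simple_predictable P F H \<longrightarrow> small t d (simple_process H) \<longrightarrow>
      small t e (simple_integral H (\<lambda>t \<omega>. Y t \<omega> + Z t \<omega>))"
    using d(1) d'(1) by (intro exI[of _ "min d d'"]) auto
qed (use assms in \<open>auto intro: AC_add good_AC\<close>)

text \<open>Continuity of the simple integral at the integrand X, with value I there;
  \<open>good\<close> is the case X = 0, I = 0. Stated for a single H with one \<delta>, it implies
  the sequential property of \<open>is_ito_integral\<close>.\<close>

definition ito_rel :: "'a process \<Rightarrow> 'a process \<Rightarrow> 'a process \<Rightarrow> bool" where
  "ito_rel X Y I \<longleftrightarrow> I \<in> AC \<and> (\<forall>t\<ge>0. \<forall>e>0. \<exists>d>0. \<forall>H. simple_predictable P F H \<longrightarrow>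
     small t d (\<lambda>s \<omega>. simple_process H s \<omega> - X s \<omega>) \<longrightarrow>
     small t e (\<lambda>s \<omega>. simple_integral H Y s \<omega> - I s \<omega>))"

lemma ito_rel_ucp:
  assumes "ito_rel X Y I" "\<And>n. simple_predictable P F (H n)" "ucp (\<lambda>n. simple_process (H n)) X"
  shows "ucp (\<lambda>n. simple_integral (H n) Y) I"
  unfolding ucp_def
proof (intro allI impI)
  fix t e :: real assume te: "0 \<le> t" "0 < e"
  with assms(1) obtain d where d: "0 < d" "\<And>H. simple_predictable P F H \<Longrightarrow>
     small t d (\<lambda>s \<omega>. simple_process H s \<omega> - X s \<omega>) \<Longrightarrow>
     small t e (\<lambda>s \<omega>. simple_integral H Y s \<omega> - I s \<omega>)"
    unfolding ito_rel_def by blast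
  from ucpD[OF assms(3) te(1) d(1)]
  show "\<forall>\<^sub>F n in sequentially. small t e (\<lambda>s \<omega>. simple_integral (H n) Y s \<omega> - I s \<omega>)"
    by eventually_elim (rule d(2)[OF assms(2)])
qed

section \<open>Riemann sums and existence of the Ito integral\<close>

definition grid_approx :: "nat \<Rightarrow> nat \<Rightarrow> (nat \<Rightarrow> real) \<Rightarrow> 'a process \<Rightarrow> 'a simple_integrand" where
  "grid_approx c N \<tau> X = \<lparr>steps = N, grid = \<tau>, init = \<lambda>\<omega>. clip (real c) (X 0 \<omega>),
     coef = \<lambda>i \<omega>. clip (real c) (X (\<tau> i) \<omega>)\<rparr>"

lemma grid_approx_sel [simp]:
  "steps (grid_approx c N \<tau> X) = N" "grid (grid_approx c N \<tau> X) = \<tau>"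
  "coef (grid_approx c N \<tau> X) i = (\<lambda>\<omega>. clip (real c) (X (\<tau> i) \<omega>))"
  by (simp_all add: grid_approx_def)

text \<open>The coefficients of \<open>grid_approx\<close> are clipped because simple integrands
  must be bounded. The weights here are not, so that algebraic identities between sums hold exactly;
  both agree as long as X stays within the clipping level.\<close>

definition riemann_sum :: "nat \<Rightarrow> (nat \<Rightarrow> real) \<Rightarrow> 'a process \<Rightarrow> 'a process \<Rightarrow> 'a process" where
  "riemann_sum N \<tau> X Y = (\<lambda>t \<omega>. \<Sum>i<N. X (\<tau> i) \<omega> * (Y (min (\<tau> (Suc i)) t) \<omega> - Y (min (\<tau> i) t) \<omega>))"

lemma grid_nonneg:
  fixes \<tau> :: "nat \<Rightarrow> real"
  shows "\<lbrakk>\<tau> 0 = 0; mono_on {..N} \<tau>; i \<le> N\<rbrakk> \<Longrightarrow> 0 \<le> \<tau> i"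
  using mono_onD[of "{..N}" \<tau> 0 i] by simp

lemma grid_approx_predictable:
  assumes X: "X \<in> AC" and \<tau>: "\<tau> 0 = 0" "mono_on {..N} \<tau>"
  shows "simple_predictable P F (grid_approx c N \<tau> X)"
  unfolding simple_predictable_def grid_approx_def simple_integrand.simps
  using \<tau> grid_nonneg[OF \<tau>]
  by (auto intro!: measurable_compose[OF _ measurable_clip] AC_measurable_F[OF X] exI[of _ "real c"] abs_clip_le)

lemma grid_approx_integral:
  assumes \<tau>: "\<tau> 0 = 0" "mono_on {..N} \<tau>"
    and b: "\<And>s. s \<in> {0..t} \<Longrightarrow> \<bar>X s \<omega>\<bar> \<le> real c" and s: "s \<in> {0..t}"
  shows "simple_integral (grid_approx c N \<tau> X) Y s \<omega> = riemann_sum N \<tau> X Y s \<omega>"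
  unfolding simple_integral_def riemann_sum_def grid_approx_sel
proof (rule sum.cong[OF refl])
  fix i assume i: "i \<in> {..<N}"
  have m: "0 \<le> \<tau> i" "\<tau> i \<le> \<tau> (Suc i)"
    using grid_nonneg[OF \<tau>, of i] mono_onD[OF \<tau>(2), of i "Suc i"] i by auto
  show "clip (real c) (X (\<tau> i) \<omega>) * (Y (min (\<tau> (Suc i)) s) \<omega> - Y (min (\<tau> i) s) \<omega>) =
    X (\<tau> i) \<omega> * (Y (min (\<tau> (Suc i)) s) \<omega> - Y (min (\<tau> i) s) \<omega>)"
  \<comment> \<open>A grid point after s may lie outside the range where X is bounded, but its cell
    has no increment yet.\<close>
  proof (cases "\<tau> i \<le> s")
    case True
    then show ?thesis using b[of "\<tau> i"] m s by (simp add: clip_eq)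
  next
    case False
    then have "min (\<tau> (Suc i)) s = min (\<tau> i) s" using m by auto
    then show ?thesis by simp
  qed
qed

lemma gridsD:
  assumes "grids_tending_to_identity N \<tau>"
  shows "\<tau> n 0 = 0" "mono_on {..N n} (\<tau> n)" "\<forall>\<^sub>F n in sequentially. t \<le> \<tau> n (N n)"
    "0 < d \<Longrightarrow> \<forall>\<^sub>F n in sequentially. \<forall>i<N n. \<tau> n (Suc i) - \<tau> n i < d"
  using assms by (auto simp: grids_tending_to_identity_def filterlim_at_top)

text \<open>Off a small event X is bounded by some K, so clipping at n \<ge> K is inactive, and its
  modulus of continuity beats the mesh.\<close>

lemma grid_approx_ucp:
  assumes X: "X \<in> AC" and g: "grids_tending_to_identity N \<tau>"
  shows "ucp (\<lambda>n. simple_process (grid_approx n (N n) (\<tau> n) X)) X"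
  unfolding ucp_def
proof (intro allI impI)
  fix t e :: real assume te: "0 \<le> t" "0 < e"
  then have e2: "0 < e/2" by simp
  obtain K where K: "hp (e/2) (\<lambda>\<omega>. \<forall>s\<in>{0..t}. \<bar>X s \<omega>\<bar> \<le> real K)"
    using AC_tight[OF X te(1) e2] by blast
  obtain d where d: "0 < d" "hp (e/2) (\<lambda>\<omega>. \<forall>u\<in>{0..t}. \<forall>v\<in>{0..t}. \<bar>u - v\<bar> \<le> d \<longrightarrow> \<bar>X u \<omega> - X v \<omega>\<bar> \<le> e)"
    using AC_equicontinuous[OF X te(1) e2 te(2)] by blast
  from gridsD(3)[OF g, of t] gridsD(4)[OF g d(1)] eventually_ge_at_top[of K]
  show "\<forall>\<^sub>F n in sequentially. small t e (\<lambda>s \<omega>. simple_process (grid_approx n (N n) (\<tau> n) X) s \<omega> - X s \<omega>)"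
  proof eventually_elim
    case (elim n)
    note \<tau> = gridsD(1,2)[OF g, of n]
    let ?H = "grid_approx n (N n) (\<tau> n) X"
    have H: "simple_predictable P F ?H" by (rule grid_approx_predictable[OF X \<tau>])
    show ?case unfolding small_def
    proof (rule hp_mono[OF hp_conj[OF K d(2)]], simp, rule ballI)
      fix \<omega> s
      assume w: "(\<forall>s\<in>{0..t}. \<bar>X s \<omega>\<bar> \<le> real K) \<and> (\<forall>u\<in>{0..t}. \<forall>v\<in>{0..t}. \<bar>u - v\<bar> \<le> d \<longrightarrow> \<bar>X u \<omega> - X v \<omega>\<bar> \<le> e)"
        and s: "s \<in> {0..t}"
      have clip: "clip (real n) (X u \<omega>) = X u \<omega>" if "u \<in> {0..t}" for u
      proof (rule clip_eq)
        have "\<bar>X u \<omega>\<bar> \<le> real K" using w that by blast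
        then show "\<bar>X u \<omega>\<bar> \<le> real n" using elim(3) by simp
      qed
      show "\<bar>simple_process ?H s \<omega> - X s \<omega>\<bar> \<le> e"
      proof (cases "s = 0")
        case True
        then show ?thesis using simple_process_0[OF H] clip[of 0] te by (simp add: grid_approx_def)
      next
        case False
        then obtain j where j: "j < N n" "\<tau> n j < s" "s \<le> \<tau> n (Suc j)"
          using grid_interval_exists[of "\<tau> n" s "N n"] \<tau>(1) s elim(1) by auto
        have "0 \<le> \<tau> n j" using grid_nonneg[OF \<tau>, of j] j by simp
        moreover have "\<tau> n (Suc j) - \<tau> n j < d" using elim(2) j(1) by blast
        ultimately have m: "\<tau> n j \<in> {0..t}" "\<bar>\<tau> n j - s\<bar> \<le> d" using j s by auto
        have "simple_process ?H s \<omega> = clip (real n) (X (\<tau> n j) \<omega>)"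
          using simple_process_active[of ?H j s \<omega>] \<tau> j False s by simp
        moreover have "\<bar>X (\<tau> n j) \<omega> - X s \<omega>\<bar> \<le> e" using w m s by blast
        ultimately show ?thesis using clip[OF m(1)] by simp
      qed
    qed
  qed
qed

text \<open>The 4^n cells of width (1/2)^n reach up to 2^n: the mesh vanishes while the last point
  tends to infinity.\<close>

lemma dyadic_grids: "grids_tending_to_identity (\<lambda>n. 4 ^ n) dyadic"
  unfolding grids_tending_to_identity_def
proof (intro conjI allI impI dyadic_simps(1,2))
  have "(\<lambda>n. dyadic n (4 ^ n)) = (\<lambda>n. 2 ^ n)"
    by (simp add: dyadic_def power_divide[symmetric])
  then show "filterlim (\<lambda>n. dyadic n (4 ^ n)) at_top sequentially"
    using filterlim_at_infinity_imp_filterlim_at_top[OF filterlim_realpow_sequentially_gt1[of "2::real"]] by simp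
next
  fix d :: real assume "0 < d"
  have "(\<lambda>n. (1/2::real) ^ n) \<longlonglongrightarrow> 0" by (rule LIMSEQ_power_zero) simp
  from order_tendstoD(2)[OF this \<open>0 < d\<close>]
  show "\<forall>\<^sub>F n in sequentially. \<forall>i<4 ^ n. dyadic n (Suc i) - dyadic n i < d"
    by eventually_elim (simp add: dyadic_simps power_divide)
qed

text \<open>The integrals of the dyadic approximations are ucp Cauchy because the difference
  integrands are small. Any other simple K near X is compared with a late approximation in the same
  way, which gives the \<epsilon>-\<delta> form of the limit.\<close>

lemma ito_rel_exists:
  assumes X: "X \<in> AC" and Y: "good Y"
  shows "\<exists>I. ito_rel X Y I"
proof -
  let ?H = "\<lambda>n. grid_approx n (4 ^ n) (dyadic n) X"
  let ?J = "\<lambda>n. simple_integral (?H n) Y"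
  have H: "simple_predictable P F (?H n)" for n
    by (rule grid_approx_predictable[OF X dyadic_simps(1,2)])
  have u: "ucp (\<lambda>n. simple_process (?H n)) X" by (rule grid_approx_ucp[OF X dyadic_grids])
  have "\<exists>N. \<forall>n\<ge>N. \<forall>m\<ge>N. small t e (\<lambda>s \<omega>. ?J n s \<omega> - ?J m s \<omega>)" if te: "0 \<le> t" "0 < e" for t e
  proof -
    obtain d where d: "0 < d" "\<And>H. simple_predictable P F H \<Longrightarrow> small t d (simple_process H) \<Longrightarrow> small t e (simple_integral H Y)"
      using goodD[OF Y te] by blast
    obtain N where N: "\<And>n. n \<ge> N \<Longrightarrow> small t (d/2) (\<lambda>s \<omega>. simple_process (?H n) s \<omega> - X s \<omega>)"
      using ucpD[OF u te(1), of "d/2"] d(1) by (auto simp: eventually_sequentially)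
    have "small t e (\<lambda>s \<omega>. ?J n s \<omega> - ?J m s \<omega>)" if "n \<ge> N" "m \<ge> N" for n m
    proof -
      have "small t d (simple_process (diff_integrand (?H n) (?H m)))"
        using small_diff[OF N[OF that(1)] N[OF that(2)]] diff_integrand(2)[OF H H]
        unfolding small_def by (elim hp_mono) auto
      from d(2)[OF diff_integrand(1)[OF H H] this] show ?thesis
        by (simp add: small_def diff_integrand(3)[OF H H])
    qed
    then show ?thesis by blast
  qed
  from ucp_Cauchy_convergent[OF simple_integral_AC[OF H good_AC[OF Y]] this]
  obtain I where I: "I \<in> AC" "ucp ?J I" by blast
  have "ito_rel X Y I" unfolding ito_rel_def
  proof (intro conjI allI impI I(1))
    fix t e :: real assume te: "0 \<le> t" "0 < e"
    then have e2: "0 < e/2" by simp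
    obtain d where d: "0 < d" "\<And>H. simple_predictable P F H \<Longrightarrow> small t d (simple_process H) \<Longrightarrow> small t (e/2) (simple_integral H Y)"
      using goodD[OF Y te(1) e2] by blast
    have d2: "0 < d/2" using d by simp
    have "small t e (\<lambda>s \<omega>. simple_integral K Y s \<omega> - I s \<omega>)"
      if K: "simple_predictable P F K" "small t (d/2) (\<lambda>s \<omega>. simple_process K s \<omega> - X s \<omega>)" for K
    proof -
      from eventually_conj[OF ucpD[OF u te(1) d2] ucpD[OF I(2) te(1) e2]]
      obtain n where n: "small t (d/2) (\<lambda>s \<omega>. simple_process (?H n) s \<omega> - X s \<omega>)"
        "small t (e/2) (\<lambda>s \<omega>. ?J n s \<omega> - I s \<omega>)" by (auto simp: eventually_sequentially)
      have "small t d (simple_process (diff_integrand K (?H n)))"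
        using small_diff[OF K(2) n(1)] diff_integrand(2)[OF K(1) H]
        unfolding small_def by (elim hp_mono) auto
      from small_add[OF d(2)[OF diff_integrand(1)[OF K(1) H] this] n(2)] show ?thesis
        by (simp add: small_def diff_integrand(3)[OF K(1) H])
    qed
    then show "\<exists>d>0. \<forall>H. simple_predictable P F H \<longrightarrow>
     small t d (\<lambda>s \<omega>. simple_process H s \<omega> - X s \<omega>) \<longrightarrow>
     small t e (\<lambda>s \<omega>. simple_integral H Y s \<omega> - I s \<omega>)" using d2 by blast
  qed
  then show ?thesis by blast
qed

lemma ito_rel_cong_AE:
  assumes "ito_rel X Y I" "I' \<in> AC" "AE \<omega> in P. \<forall>t\<ge>0. I t \<omega> = I' t \<omega>"
  shows "ito_rel X Y I'"
  unfolding ito_rel_def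
proof (intro conjI allI impI assms(2))
  fix t e :: real assume te: "0 \<le> t" "0 < e"
  then have "0 < e/2" by simp
  with assms(1) te(1) obtain d where d: "0 < d" "\<And>H. simple_predictable P F H \<Longrightarrow>
     small t d (\<lambda>s \<omega>. simple_process H s \<omega> - X s \<omega>) \<Longrightarrow>
     small t (e/2) (\<lambda>s \<omega>. simple_integral H Y s \<omega> - I s \<omega>)"
    unfolding ito_rel_def by blast
  have ae: "hp (e/2) (\<lambda>\<omega>. \<forall>s\<in>{0..t}. simple_integral H Y s \<omega> - I s \<omega> = simple_integral H Y s \<omega> - I' s \<omega>)" for H
    using assms(3) te by (intro hp_AE) auto
  show "\<exists>d>0. \<forall>H. simple_predictable P F H \<longrightarrow>
     small t d (\<lambda>s \<omega>. simple_process H s \<omega> - X s \<omega>) \<longrightarrow>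
     small t e (\<lambda>s \<omega>. simple_integral H Y s \<omega> - I' s \<omega>)"
    using d(1) small_cong_hp[OF d(2) ae] te by (intro exI[of _ d]) auto
qed

text \<open>The constructed process shows that the \<open>SOME\<close> has a witness. The process it
  picks may be another one, but along the dyadic approximations both are ucp limits of the same
  sequence, so \<open>ito_rel\<close> transfers.\<close>

lemma ito_rel_ito_integral:
  assumes X: "X \<in> AC" and Y: "good Y"
  shows "ito_rel X Y (ito_integral P F X Y)"
proof -
  obtain I where I: "ito_rel X Y I" using ito_rel_exists[OF assms] by blast
  then have IAC: "I \<in> AC" by (simp add: ito_rel_def)
  have "is_ito_integral P F X Y I" unfolding is_ito_integral_def
  proof (intro conjI allI impI)
    show "adapted F I" "continuous_paths P I" using IAC by (auto simp: AC_def)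
    fix H assume H: "(\<forall>n. simple_predictable P F (H n)) \<and> ucp_tendsto P (\<lambda>n. simple_process (H n)) X"
    then have Hn: "\<And>n. simple_predictable P F (H n)" by auto
    have "ucp (\<lambda>n. simple_process (H n)) X"
      by (rule ucp_tendsto_imp_ucp)
        (use H in \<open>auto intro!: borel_measurable_diff AC_measurable[OF X] continuous_intros
          simple_process_continuous_left AC_continuous_left[OF X] measurable_F_P[OF simple_process_measurable]\<close>)
    then show "ucp_tendsto P (\<lambda>n. simple_integral (H n) Y) I"
      by (intro ucp_imp_ucp_tendsto ito_rel_ucp[OF I Hn])
  qed
  then have I': "is_ito_integral P F X Y (ito_integral P F X Y)" (is "is_ito_integral P F X Y ?I")
    unfolding ito_integral_def by (rule someI[where P = "is_ito_integral P F X Y"])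
  then have IAC': "?I \<in> AC" by (simp add: is_ito_integral_def AC_def)
  let ?H = "\<lambda>n. grid_approx n (4 ^ n) (dyadic n) X"
  have H: "simple_predictable P F (?H n)" for n
    by (rule grid_approx_predictable[OF X dyadic_simps(1,2)])
  have u: "ucp (\<lambda>n. simple_process (?H n)) X" by (rule grid_approx_ucp[OF X dyadic_grids])
  have J: "simple_integral (?H n) Y \<in> AC" for n by (rule simple_integral_AC[OF H good_AC[OF Y]])
  have "ucp_tendsto P (\<lambda>n. simple_integral (?H n) Y) ?I"
    using I'[unfolded is_ito_integral_def, THEN conjunct2, THEN conjunct2, rule_format, of ?H]
      H ucp_imp_ucp_tendsto[OF u] by simp
  then have "ucp (\<lambda>n. simple_integral (?H n) Y) ?I"
    by (rule ucp_tendsto_imp_ucp)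
      (auto intro!: borel_measurable_diff AC_measurable[OF J] AC_measurable[OF IAC'] continuous_intros
          AC_continuous_left[OF J] AC_continuous_left[OF IAC'])
  from ucp_unique[OF ito_rel_ucp[OF I H u] this] show ?thesis
    by (rule ito_rel_cong_AE[OF I IAC'])
qed

text \<open>Off a small event X is bounded by K, and for n \<ge> K the unclipped sum is the simple
  integral of \<open>grid_approx\<close>.\<close>

lemma riemann_sum_ucp:
  assumes X: "X \<in> AC" and I: "ito_rel X Y I" and g: "grids_tending_to_identity N \<tau>"
  shows "ucp (\<lambda>n. riemann_sum (N n) (\<tau> n) X Y) I"
  unfolding ucp_def
proof (intro allI impI)
  fix t e :: real assume te: "0 \<le> t" "0 < e"
  then have e2: "0 < e/2" by simp
  obtain K where K: "hp (e/2) (\<lambda>\<omega>. \<forall>s\<in>{0..t}. \<bar>X s \<omega>\<bar> \<le> real K)"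
    using AC_tight[OF X te(1) e2] by blast
  let ?H = "\<lambda>n. grid_approx n (N n) (\<tau> n) X"
  have H: "simple_predictable P F (?H n)" for n
    by (rule grid_approx_predictable[OF X]) (use gridsD[OF g, of n] in auto)
  have "ucp (\<lambda>n. simple_integral (?H n) Y) I"
    by (rule ito_rel_ucp[OF I H grid_approx_ucp[OF X g]])
  from ucpD[OF this te(1) e2] eventually_ge_at_top[of K]
  show "\<forall>\<^sub>F n in sequentially. small t e (\<lambda>s \<omega>. riemann_sum (N n) (\<tau> n) X Y s \<omega> - I s \<omega>)"
  proof eventually_elim
    case (elim n)
    have "hp (e/2) (\<lambda>\<omega>. \<forall>s\<in>{0..t}. simple_integral (?H n) Y s \<omega> - I s \<omega> = riemann_sum (N n) (\<tau> n) X Y s \<omega> - I s \<omega>)"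
    proof (rule hp_mono[OF K order_refl], rule ballI)
      fix \<omega> s assume b: "\<forall>s\<in>{0..t}. \<bar>X s \<omega>\<bar> \<le> real K" and s: "s \<in> {0..t}"
      have "\<bar>X u \<omega>\<bar> \<le> real n" if "u \<in> {0..t}" for u
        using b elim(2) that by (meson of_nat_le_iff order_trans)
      with grid_approx_integral[of "\<tau> n" "N n" t X \<omega> n s Y] gridsD(1,2)[OF g, of n] s
      show "simple_integral (?H n) Y s \<omega> - I s \<omega> = riemann_sum (N n) (\<tau> n) X Y s \<omega> - I s \<omega>" by simp
    qed
    from small_cong_hp[OF elim(1) this] te show ?case by simp
  qed
qed

end

section \<open>Processes of locally bounded variation\<close>

text \<open>The witness is the total variation function. Domination of increments is the form in
  which bounded variation passes to linear combinations and pointwise limits.\<close>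

lemma locally_bounded_variation_dominated:
  assumes "locally_bounded_variation f"
  shows "\<exists>g. \<forall>u v. 0 \<le> u \<longrightarrow> u \<le> v \<longrightarrow> \<bar>f v - f u\<bar> \<le> g v - (g u :: real)"
proof -
  define S where "S t = {(\<Sum>i<n. \<bar>f (\<tau> (Suc i)) - f (\<tau> i)\<bar>) | (n::nat) \<tau>. mono_on {..n} \<tau> \<and> \<tau> ` {..n} \<subseteq> {0..t}}" for t
  have bdd: "bdd_above (S t)" if t0: "0 \<le> t" for t
  proof -
    obtain C where C: "\<And>(n::nat) \<tau>. mono_on {..n} \<tau> \<and> \<tau> ` {..n} \<subseteq> {0..t} \<Longrightarrow> (\<Sum>i<n. \<bar>f (\<tau> (Suc i)) - f (\<tau> i)\<bar>) \<le> C"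
      using assms[unfolded locally_bounded_variation_def, rule_format, OF t0] by blast
    show ?thesis by (rule bdd_aboveI[of _ C]) (use C in \<open>auto simp: S_def\<close>)
  qed
  have ne: "S t \<noteq> {}" if "0 \<le> t" for t
  proof -
    have "(\<Sum>i<(0::nat). \<bar>f ((\<lambda>_. t) (Suc i)) - f ((\<lambda>_. t) i)\<bar>) \<in> S t"
      unfolding S_def using that by (intro CollectI exI conjI refl) (auto intro: mono_onI)
    then show ?thesis by blast
  qed
  have "\<bar>f v - f u\<bar> \<le> Sup (S v) - Sup (S u)" if uv: "0 \<le> u" "u \<le> v" for u v
  proof -
    have "Sup (S u) \<le> Sup (S v) - \<bar>f v - f u\<bar>"
    proof (rule cSup_least[OF ne[OF uv(1)]])
      fix x assume "x \<in> S u"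
      then obtain n :: nat and \<tau> where x: "x = (\<Sum>i<n. \<bar>f (\<tau> (Suc i)) - f (\<tau> i)\<bar>)"
        and \<tau>: "mono_on {..n} \<tau>" "\<tau> ` {..n} \<subseteq> {0..u}" by (auto simp: S_def)
      \<comment> \<open>Appending u and v to a grid of [0,u] gives a grid of [0,v] whose sum is
        larger by at least \<bar>f v - f u\<bar>.\<close>
      define \<sigma> where "\<sigma> i = (if i \<le> n then \<tau> i else if i = Suc n then u else v)" for i
      have r: "0 \<le> \<tau> i" "\<tau> i \<le> u" if "i \<le> n" for i using \<tau>(2) that by auto
      have "mono_on {..Suc (Suc n)} \<sigma>"
      proof (rule mono_onI)
        fix i j assume "i \<in> {..Suc (Suc n)}" "j \<in> {..Suc (Suc n)}" "i \<le> j"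
        then show "\<sigma> i \<le> \<sigma> j"
          using mono_onD[OF \<tau>(1), of i j] r[of i] uv by (auto simp: \<sigma>_def le_Suc_eq)
      qed
      moreover have "\<sigma> ` {..Suc (Suc n)} \<subseteq> {0..v}"
        using uv order_trans[OF r(2) uv(2)] r(1) by (auto simp: \<sigma>_def)
      ultimately have "(\<Sum>i<Suc (Suc n). \<bar>f (\<sigma> (Suc i)) - f (\<sigma> i)\<bar>) \<in> S v" unfolding S_def by blast
      then have "(\<Sum>i<Suc (Suc n). \<bar>f (\<sigma> (Suc i)) - f (\<sigma> i)\<bar>) \<le> Sup (S v)"
        using bdd uv by (intro cSup_upper) auto
      moreover have "(\<Sum>i<n. \<bar>f (\<sigma> (Suc i)) - f (\<sigma> i)\<bar>) = x"
        unfolding x by (rule sum.cong) (auto simp: \<sigma>_def)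
      ultimately show "x \<le> Sup (S v) - \<bar>f v - f u\<bar>" by (simp add: \<sigma>_def)
    qed
    then show ?thesis by simp
  qed
  then show ?thesis by (intro exI[of _ "\<lambda>t. Sup (S t)"]) auto
qed

text \<open>The dominating function may depend on the horizon T, because for an integral it carries
  the bound of the integrand on [0,T] as a factor.\<close>

lemma locally_bounded_variationI:
  assumes "\<And>T. 0 \<le> T \<Longrightarrow> \<exists>g. \<forall>u v. 0 \<le> u \<longrightarrow> u \<le> v \<longrightarrow> v \<le> T \<longrightarrow> \<bar>f v - f u\<bar> \<le> g v - (g u :: real)"
  shows "locally_bounded_variation f"
  unfolding locally_bounded_variation_def
proof (intro allI impI)
  fix T :: real assume T: "0 \<le> T"
  then obtain g where g: "\<And>u v. 0 \<le> u \<Longrightarrow> u \<le> v \<Longrightarrow> v \<le> T \<Longrightarrow> \<bar>f v - f u\<bar> \<le> g v - g u"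
    using assms by blast
  show "\<exists>C. \<forall>(n::nat) \<tau>. mono_on {..n} \<tau> \<and> \<tau> ` {..n} \<subseteq> {0..T} \<longrightarrow>
        (\<Sum>i<n. \<bar>f (\<tau> (Suc i)) - f (\<tau> i)\<bar>) \<le> C"
  proof (intro exI[of _ "g T - g 0"] allI impI, elim conjE)
    fix n :: nat and \<tau> assume \<tau>: "mono_on {..n} \<tau>" "\<tau> ` {..n} \<subseteq> {0..T}"
    have r: "0 \<le> \<tau> i" "\<tau> i \<le> T" if "i \<le> n" for i using \<tau>(2) that by auto
    have "(\<Sum>i<n. \<bar>f (\<tau> (Suc i)) - f (\<tau> i)\<bar>) \<le> (\<Sum>i<n. g (\<tau> (Suc i)) - g (\<tau> i))"
      using mono_onD[OF \<tau>(1)] r by (intro sum_mono g) auto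
    also have "\<dots> = g (\<tau> n) - g (\<tau> 0)" by (rule sum_lessThan_telescope)
    also have "\<dots> \<le> g T - g 0"
      using g[of "\<tau> n" T] g[of 0 "\<tau> 0"] r[of n] r[of 0] by linarith
    finally show "(\<Sum>i<n. \<bar>f (\<tau> (Suc i)) - f (\<tau> i)\<bar>) \<le> g T - g 0" .
  qed
qed

lemma locally_bounded_variation_lin:
  assumes "locally_bounded_variation f" "locally_bounded_variation g"
  shows "locally_bounded_variation (\<lambda>t. a * f t + b * g t)"
proof -
  obtain f' g' where d: "\<And>u v. 0 \<le> u \<Longrightarrow> u \<le> v \<Longrightarrow> \<bar>f v - f u\<bar> \<le> f' v - f' u"
    "\<And>u v. 0 \<le> u \<Longrightarrow> u \<le> v \<Longrightarrow> \<bar>g v - g u\<bar> \<le> g' v - g' u"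
    using assms[THEN locally_bounded_variation_dominated] by blast
  have "\<bar>(a * f v + b * g v) - (a * f u + b * g u)\<bar> \<le> (\<bar>a\<bar> * f' v + \<bar>b\<bar> * g' v) - (\<bar>a\<bar> * f' u + \<bar>b\<bar> * g' u)"
    if "0 \<le> u" "u \<le> v" for u v
  proof -
    have "\<bar>(a * f v + b * g v) - (a * f u + b * g u)\<bar> = \<bar>a * (f v - f u) + b * (g v - g u)\<bar>"
      by (simp add: algebra_simps)
    also have "\<dots> \<le> \<bar>a\<bar> * \<bar>f v - f u\<bar> + \<bar>b\<bar> * \<bar>g v - g u\<bar>"
      by (simp add: abs_mult[symmetric] abs_triangle_ineq)
    also have "\<dots> \<le> \<bar>a\<bar> * (f' v - f' u) + \<bar>b\<bar> * (g' v - g' u)"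
      by (intro add_mono mult_left_mono d that) auto
    finally show ?thesis by (simp add: algebra_simps)
  qed
  then show ?thesis by (intro locally_bounded_variationI) (rule exI[of _ "\<lambda>t. \<bar>a\<bar> * f' t + \<bar>b\<bar> * g' t"], blast)
qed

lemma locally_bounded_variation_mono:
  assumes "\<And>u v. 0 \<le> u \<Longrightarrow> u \<le> v \<Longrightarrow> f u \<le> f v"
  shows "locally_bounded_variation f"
  by (rule locally_bounded_variationI, rule exI[of _ f]) (use assms in auto)

text \<open>Rounding the points of an arbitrary grid down to dyadic ones changes a continuous f by
  arbitrarily little, and monotone rounding turns the sum into one dominated by a dyadic variation.
  Countably many sums therefore control all of them.\<close>

lemma dyadic_variation_bound:
  fixes f :: "real \<Rightarrow> real"
  assumes f: "continuous_on {0..} f"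
    and V: "\<And>m. (\<Sum>i<nat \<lfloor>2 ^ m * t\<rfloor>. \<bar>f (real (Suc i) / 2 ^ m) - f (real i / 2 ^ m)\<bar>) \<le> K"
    and \<tau>: "mono_on {..n} \<tau>" "\<tau> ` {..n} \<subseteq> {0..t}"
  shows "(\<Sum>i<n. \<bar>f (\<tau> (Suc i)) - f (\<tau> i)\<bar>) \<le> K"
proof -
  define p where "p m x = nat \<lfloor>2 ^ m * x\<rfloor>" for m :: nat and x :: real
  define G where "G m k = (\<Sum>i<k. \<bar>f (real (Suc i) / 2 ^ m) - f (real i / 2 ^ m)\<bar>)" for m k
  have r: "0 \<le> \<tau> i" "\<tau> i \<le> t" if "i \<le> n" for i using \<tau>(2) that by auto
  have pm: "p m x \<le> p m y" if "x \<le> y" for m x y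
    unfolding p_def using that by (intro nat_mono floor_mono mult_left_mono) auto
  have Gm: "G m a \<le> G m b" if "a \<le> b" for m a b
    unfolding G_def using that by (intro sum_mono2) auto
  have G: "\<bar>f (real b / 2 ^ m) - f (real a / 2 ^ m)\<bar> \<le> G m b - G m a" if "a \<le> b" for a b m
    using that
  proof (induction b rule: dec_induct)
    case (step k)
    have "G m (Suc k) = G m k + \<bar>f (real (Suc k) / 2 ^ m) - f (real k / 2 ^ m)\<bar>" by (simp add: G_def)
    then show ?case using step.IH by linarith
  qed simp
  have le: "(\<Sum>i<n. \<bar>f (real (p m (\<tau> (Suc i))) / 2 ^ m) - f (real (p m (\<tau> i)) / 2 ^ m)\<bar>) \<le> K" for m
  proof -
    have "(\<Sum>i<n. \<bar>f (real (p m (\<tau> (Suc i))) / 2 ^ m) - f (real (p m (\<tau> i)) / 2 ^ m)\<bar>)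
      \<le> (\<Sum>i<n. G m (p m (\<tau> (Suc i))) - G m (p m (\<tau> i)))"
      by (intro sum_mono G pm mono_onD[OF \<tau>(1)]) auto
    also have "\<dots> = G m (p m (\<tau> n)) - G m (p m (\<tau> 0))" by (rule sum_lessThan_telescope)
    also have "\<dots> \<le> G m (p m t)"
    proof -
      have "G m (p m (\<tau> n)) \<le> G m (p m t)" by (intro Gm pm r) simp
      moreover have "0 \<le> G m (p m (\<tau> 0))" by (simp add: G_def sum_nonneg)
      ultimately show ?thesis by linarith
    qed
    also have "\<dots> \<le> K" using V[of m] by (simp add: G_def p_def)
    finally show ?thesis .
  qed
  have lim: "(\<lambda>m. f (real (p m x) / 2 ^ m)) \<longlonglongrightarrow> f x" if "0 \<le> x" for x
  proof -
    have "real (p m x) / 2 ^ m = of_int \<lfloor>2 ^ m * x\<rfloor> / 2 ^ m" for m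
      using that by (simp add: p_def)
    then show ?thesis
      using continuous_on_tendsto_compose[OF f dyadic_floor_tendsto[of x]] that by simp
  qed
  show ?thesis
  proof (rule LIMSEQ_le_const2)
    show "(\<lambda>m. \<Sum>i<n. \<bar>f (real (p m (\<tau> (Suc i))) / 2 ^ m) - f (real (p m (\<tau> i)) / 2 ^ m)\<bar>)
      \<longlonglongrightarrow> (\<Sum>i<n. \<bar>f (\<tau> (Suc i)) - f (\<tau> i)\<bar>)"
      by (intro tendsto_intros lim r) auto
  qed (use le in auto)
qed

lemma riemann_sum_variation:
  fixes x f g :: "real \<Rightarrow> real"
  assumes g: "\<And>u v. 0 \<le> u \<Longrightarrow> u \<le> v \<Longrightarrow> \<bar>f v - f u\<bar> \<le> g v - g u"
    and \<tau>: "\<tau> 0 = 0" "mono_on {..N} \<tau>"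
    and K: "\<And>s. 0 \<le> s \<Longrightarrow> s \<le> T \<Longrightarrow> \<bar>x s\<bar> \<le> K" and uv: "0 \<le> u" "u \<le> v" "v \<le> T"
  shows "\<bar>(\<Sum>i<N. x (\<tau> i) * (f (min (\<tau> (Suc i)) v) - f (min (\<tau> i) v))) -
    (\<Sum>i<N. x (\<tau> i) * (f (min (\<tau> (Suc i)) u) - f (min (\<tau> i) u)))\<bar> \<le> K * g v - K * g u"
proof -
  \<comment> \<open>Clamping to [u,v]: the increment of a cell up to v minus that up to u is the
    increment of f over the clamped cell, and the clamped increments of g telescope.\<close>
  define c where "c a = max u (min a v)" for a
  have K0: "0 \<le> K" using K[of 0] uv by force
  have cm: "c a \<le> c b" if "a \<le> b" for a b using that by (auto simp: c_def)
  have cr: "0 \<le> c a" "u \<le> c a" "c a \<le> v" for a using uv by (auto simp: c_def)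
  have "\<bar>x (\<tau> i) * (f (min (\<tau> (Suc i)) v) - f (min (\<tau> i) v)) - x (\<tau> i) * (f (min (\<tau> (Suc i)) u) - f (min (\<tau> i) u))\<bar>
    \<le> K * (g (c (\<tau> (Suc i))) - g (c (\<tau> i)))" if i: "i < N" for i
  proof -
    have m: "\<tau> i \<le> \<tau> (Suc i)" "0 \<le> \<tau> i" using mono_onD[OF \<tau>(2)] \<tau>(1) i by (auto, metis atMost_iff le0 less_imp_le)
    have "x (\<tau> i) * (f (min (\<tau> (Suc i)) v) - f (min (\<tau> i) v)) - x (\<tau> i) * (f (min (\<tau> (Suc i)) u) - f (min (\<tau> i) u))
      = x (\<tau> i) * (f (c (\<tau> (Suc i))) - f (c (\<tau> i)))"
    proof -
      have "f (min (\<tau> (Suc i)) v) - f (min (\<tau> i) v) - (f (min (\<tau> (Suc i)) u) - f (min (\<tau> i) u))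
        = f (c (\<tau> (Suc i))) - f (c (\<tau> i))"
      proof (cases "\<tau> (Suc i) \<le> u")
        case True
        then have "c (\<tau> i) = u" "c (\<tau> (Suc i)) = u" "min (\<tau> i) v = \<tau> i" "min (\<tau> i) u = \<tau> i"
          "min (\<tau> (Suc i)) v = \<tau> (Suc i)" "min (\<tau> (Suc i)) u = \<tau> (Suc i)"
          using m uv by (auto simp: c_def)
        then show ?thesis by simp
      next
        case False then show ?thesis using m uv by (simp add: c_def min_def max_def)
      qed
      then show ?thesis by (simp add: right_diff_distrib[symmetric])
    qed
    also have "\<bar>\<dots>\<bar> \<le> K * (g (c (\<tau> (Suc i))) - g (c (\<tau> i)))"
    \<comment> \<open>Only grid points up to the horizon are covered by the bound K; a later cell
      clamps to a point.\<close>
    proof (cases "\<tau> i \<le> v")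
      case True
      then have "\<bar>x (\<tau> i)\<bar> \<le> K" using K[of "\<tau> i"] m uv by simp
      then show ?thesis unfolding abs_mult by (intro mult_mono g cr cm m K0) auto
    next
      case False
      then have "c (\<tau> (Suc i)) = c (\<tau> i)" using m by (auto simp: c_def)
      then show ?thesis by simp
    qed
    finally show ?thesis .
  qed
  then have "\<bar>\<Sum>i<N. x (\<tau> i) * (f (min (\<tau> (Suc i)) v) - f (min (\<tau> i) v)) - x (\<tau> i) * (f (min (\<tau> (Suc i)) u) - f (min (\<tau> i) u))\<bar>
    \<le> (\<Sum>i<N. K * (g (c (\<tau> (Suc i))) - g (c (\<tau> i))))"
    by (intro order_trans[OF sum_abs] sum_mono) auto
  also have "\<dots> = K * (g (c (\<tau> N)) - g (c (\<tau> 0)))"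
    using sum_lessThan_telescope[of "\<lambda>i. g (c (\<tau> i))" N] by (simp add: sum_distrib_left[symmetric])
  also have "\<dots> \<le> K * (g v - g u)"
    using g[OF cr(1,3), of "\<tau> N"] g[OF uv(1) cr(2), of "\<tau> 0"] by (intro mult_left_mono K0) linarith
  finally show ?thesis by (simp add: sum_subtractf right_diff_distrib)
qed

context complete_filtered_prob_space
begin

lemma ucp_subsequence:
  assumes "ucp J I"
  obtains r :: "nat \<Rightarrow> nat" where "strict_mono r" "AE \<omega> in P. \<forall>t\<ge>0. (\<lambda>k. J (r k) t \<omega>) \<longlonglongrightarrow> I t \<omega>"
proof -
  have "\<exists>N. \<forall>k. \<forall>n\<ge>N k. small (real k) ((1/2)^k) (\<lambda>s \<omega>. J n s \<omega> - I s \<omega>)"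
    using ucpD[OF assms] by (intro choice allI) (auto simp: eventually_sequentially)
  then obtain N where N: "\<And>k n. N k \<le> n \<Longrightarrow> small (real k) ((1/2)^k) (\<lambda>s \<omega>. J n s \<omega> - I s \<omega>)"
    by blast
  define r where "r k = (\<Sum>j\<le>k. N j) + k" for k
  have r: "N k \<le> r k" for k using member_le_sum[of k "{..k}" N] by (auto simp: r_def)
  have sm: "strict_mono r" by (rule strict_mono_Suc_iff[THEN iffD2]) (simp add: r_def)
  have "AE \<omega> in P. \<forall>\<^sub>F k in sequentially. \<forall>s\<in>{0..real k}. \<bar>J (r k) s \<omega> - I s \<omega>\<bar> \<le> (1/2)^k"
    by (rule hp_borel_cantelli) (use N[OF r] in \<open>simp add: small_def\<close>)
  then have "AE \<omega> in P. \<forall>t\<ge>0. (\<lambda>k. J (r k) t \<omega>) \<longlonglongrightarrow> I t \<omega>"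
  proof eventually_elim
    case (elim \<omega>)
    show ?case
    proof (intro allI impI)
      fix t :: real assume t: "0 \<le> t"
      from elim eventually_ge_at_top[of "nat \<lceil>t\<rceil>"]
      have "\<forall>\<^sub>F k in sequentially. norm (J (r k) t \<omega> - I t \<omega>) \<le> (1/2)^k"
        by eventually_elim (use t in auto)
      then have "(\<lambda>k. J (r k) t \<omega> - I t \<omega>) \<longlonglongrightarrow> 0"
        by (rule Lim_null_comparison) (rule LIMSEQ_power_zero, simp)
      then show "(\<lambda>k. J (r k) t \<omega>) \<longlonglongrightarrow> I t \<omega>" by (rule LIM_zero_cancel)
    qed
  qed
  with sm show ?thesis by (rule that)
qed

abbreviation "BV \<equiv> continuous_BV_processes P F"

lemma BV_AC: "A \<in> BV \<Longrightarrow> A \<in> AC"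
  by (simp add: continuous_BV_processes_def AC_def)

lemma BV_path: "\<lbrakk>A \<in> BV; \<omega> \<in> space P\<rbrakk> \<Longrightarrow> locally_bounded_variation (\<lambda>t. A t \<omega>)"
  by (simp add: continuous_BV_processes_def)

lemma BVI: "\<lbrakk>A \<in> AC; \<And>\<omega>. \<omega> \<in> space P \<Longrightarrow> locally_bounded_variation (\<lambda>t. A t \<omega>)\<rbrakk> \<Longrightarrow> A \<in> BV"
  by (simp add: continuous_BV_processes_def AC_def)

text \<open>Total variation is a supremum over uncountably many grids. The event is defined through
  dyadic sums, where measurability is immediate, and \<open>dyadic_variation_bound\<close> extends
  the bound to all grids.\<close>

lemma BV_tight:
  assumes A: "A \<in> BV" and t: "0 \<le> t" and e: "0 < e"
  shows "\<exists>K::nat. hp e (\<lambda>\<omega>. \<forall>(n::nat) \<tau>. mono_on {..n} \<tau> \<and> \<tau> ` {..n} \<subseteq> {0..t} \<longrightarrow>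
      (\<Sum>i<n. \<bar>A (\<tau> (Suc i)) \<omega> - A (\<tau> i) \<omega>\<bar>) \<le> real K)"
proof -
  let ?V = "\<lambda>m \<omega>. \<Sum>i<nat \<lfloor>2 ^ m * t\<rfloor>. \<bar>A (real (Suc i) / 2 ^ m) \<omega> - A (real i / 2 ^ m) \<omega>\<bar>"
  have "\<exists>K::nat. hp e (\<lambda>\<omega>. \<forall>m. ?V m \<omega> \<le> real K)"
  proof (rule hp_exhaust[OF _ _ _ e])
    have [measurable]: "A s \<in> borel_measurable P" if "0 \<le> s" for s
      by (rule AC_measurable[OF BV_AC[OF A] that])
    have [measurable]: "?V m \<in> borel_measurable P" for m by measurable
    show "{\<omega> \<in> space P. \<not> (\<forall>m. ?V m \<omega> \<le> real n)} \<in> events" for n by measurable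
    fix \<omega> assume w: "\<omega> \<in> space P"
    from BV_path[OF A w] t obtain C where C: "\<And>(n::nat) \<tau>. mono_on {..n} \<tau> \<and> \<tau> ` {..n} \<subseteq> {0..t} \<Longrightarrow>
        (\<Sum>i<n. \<bar>A (\<tau> (Suc i)) \<omega> - A (\<tau> i) \<omega>\<bar>) \<le> C"
      unfolding locally_bounded_variation_def by meson
    have VC: "?V m \<omega> \<le> C" for m
    proof (rule C[of "nat \<lfloor>2 ^ m * t\<rfloor>" "\<lambda>i. real i / 2 ^ m"], intro conjI subsetI)
      fix y assume "y \<in> (\<lambda>i. real i / 2 ^ m) ` {..nat \<lfloor>2 ^ m * t\<rfloor>}"
      then obtain i where i: "i \<le> nat \<lfloor>2 ^ m * t\<rfloor>" "y = real i / 2 ^ m" by auto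
      have "real i \<le> real (nat \<lfloor>2 ^ m * t\<rfloor>)" using i(1) by simp
      also have "\<dots> \<le> 2 ^ m * t" using t by (intro of_nat_floor) simp
      finally have "real i \<le> 2 ^ m * t" .
      then show "y \<in> {0..t}" using i(2) by (simp add: divide_le_eq mult.commute)
    qed (auto intro!: mono_onI divide_right_mono)
    obtain K where "C \<le> real K" using real_arch_simple by blast
    then have "?V m \<omega> \<le> real K" for m using VC[of m] by linarith
    then show "\<exists>K. \<forall>m. ?V m \<omega> \<le> real K" by (intro exI allI)
  next
    fix n \<omega> assume "\<forall>m. ?V m \<omega> \<le> real n"
    moreover have "real n \<le> real (Suc n)" by simp
    ultimately show "\<forall>m. ?V m \<omega> \<le> real (Suc n)" by (blast intro: order_trans)
  qed
  then obtain K :: nat where "hp e (\<lambda>\<omega>. \<forall>m. ?V m \<omega> \<le> real K)" by blast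
  then have "hp e (\<lambda>\<omega>. \<forall>(n::nat) \<tau>. mono_on {..n} \<tau> \<and> \<tau> ` {..n} \<subseteq> {0..t} \<longrightarrow>
      (\<Sum>i<n. \<bar>A (\<tau> (Suc i)) \<omega> - A (\<tau> i) \<omega>\<bar>) \<le> real K)"
  proof (rule hp_mono[OF _ order_refl], intro allI impI, elim conjE)
    fix \<omega> \<tau> and n :: nat
    assume w: "\<omega> \<in> space P" and V: "\<forall>m. ?V m \<omega> \<le> real K" and \<tau>: "mono_on {..n} \<tau>" "\<tau> ` {..n} \<subseteq> {0..t}"
    show "(\<Sum>i<n. \<bar>A (\<tau> (Suc i)) \<omega> - A (\<tau> i) \<omega>\<bar>) \<le> real K"
      by (rule dyadic_variation_bound[where f = "\<lambda>s. A s \<omega>", OF AC_continuous[OF BV_AC[OF A] w] V[rule_format] \<tau>])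
  qed
  then show ?thesis ..
qed

text \<open>Pathwise, the integral is at most the supremum of the integrand times the variation of
  A, and the variation is tight.\<close>

lemma good_BV:
  assumes A: "A \<in> BV"
  shows "good A"
  unfolding good_def
proof (intro conjI allI impI BV_AC[OF A])
  fix t e :: real assume te: "0 \<le> t" "0 < e"
  then have e2: "0 < e/2" by simp
  obtain K :: nat where K: "hp (e/2) (\<lambda>\<omega>. \<forall>(n::nat) \<tau>. mono_on {..n} \<tau> \<and> \<tau> ` {..n} \<subseteq> {0..t} \<longrightarrow>
      (\<Sum>i<n. \<bar>A (\<tau> (Suc i)) \<omega> - A (\<tau> i) \<omega>\<bar>) \<le> real K)"
    using BV_tight[OF A te(1) e2] by blast
  \<comment> \<open>The factor 2 leaves e/2 of the probability for the event behind K, and 1 + K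
    keeps the denominator positive while d * K stays below e.\<close>
  define d where "d = e / (2 * (1 + real K))"
  have d: "0 < d" "d \<le> e/2" "d * real K \<le> e"
    using te by (auto simp: d_def field_simps)
  have "small t e (simple_integral H A)"
    if H: "simple_predictable P F H" "small t d (simple_process H)" for H
    unfolding small_def
  proof (rule hp_mono[OF hp_conj[OF H(2)[unfolded small_def] K]], use d in simp, rule ballI)
    fix \<omega> s
    assume w: "(\<forall>s\<in>{0..t}. \<bar>simple_process H s \<omega>\<bar> \<le> d) \<and> (\<forall>(n::nat) \<tau>. mono_on {..n} \<tau> \<and> \<tau> ` {..n} \<subseteq> {0..t} \<longrightarrow>
      (\<Sum>i<n. \<bar>A (\<tau> (Suc i)) \<omega> - A (\<tau> i) \<omega>\<bar>) \<le> real K)" and s: "s \<in> {0..t}"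
    note h = simple_predictableD[OF H(1)]
    let ?d = "\<lambda>i. A (min (grid H (Suc i)) s) \<omega> - A (min (grid H i) s) \<omega>"
    have "\<bar>simple_integral H A s \<omega>\<bar> = \<bar>simple_integral (clip_integrand d H) A s \<omega>\<bar>"
      using clip_integrand_integral[OF h(1,2), of t \<omega> d s A] w s by auto
    also have "\<dots> \<le> (\<Sum>i<steps H. d * \<bar>?d i\<bar>)"
      unfolding simple_integral_def clip_integrand_sel
    proof (rule order_trans[OF sum_abs sum_mono])
      fix i
      show "\<bar>clip d (coef H i \<omega>) * ?d i\<bar> \<le> d * \<bar>?d i\<bar>"
        unfolding abs_mult by (intro mult_right_mono abs_clip_le) (use d in auto)
    qed
    also have "\<dots> = d * (\<Sum>i<steps H. \<bar>?d i\<bar>)" by (simp add: sum_distrib_left)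
    also have "\<dots> \<le> d * real K"
    proof (rule mult_left_mono)
      have "mono_on {..steps H} (\<lambda>i. min (grid H i) s)"
        using mono_onD[OF h(1)] by (intro mono_onI min.mono) auto
      moreover have "(\<lambda>i. min (grid H i) s) ` {..steps H} \<subseteq> {0..t}" using h(3) s by auto
      ultimately show "(\<Sum>i<steps H. \<bar>?d i\<bar>) \<le> real K" using w by blast
    qed (use d in simp)
    finally show "\<bar>simple_integral H A s \<omega>\<bar> \<le> e" using d(3) by linarith
  qed
  then show "\<exists>d>0. \<forall>H. simple_predictable P F H \<longrightarrow> small t d (simple_process H) \<longrightarrow> small t e (simple_integral H A)"
    using d(1) by blast
qed

text \<open>Riemann sums have increments dominated by K times those of the variation of A, uniformly
  in the grid; the bound survives the almost sure limit along a subsequence.\<close>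

lemma ito_rel_BV_path:
  assumes X: "X \<in> AC" and A: "A \<in> BV" and I: "ito_rel X A I"
  shows "AE \<omega> in P. locally_bounded_variation (\<lambda>t. I t \<omega>)"
proof -
  obtain r :: "nat \<Rightarrow> nat" where "AE \<omega> in P. \<forall>t\<ge>0. (\<lambda>k. riemann_sum (4 ^ r k) (dyadic (r k)) X A t \<omega>) \<longlonglongrightarrow> I t \<omega>"
    using ucp_subsequence[OF riemann_sum_ucp[OF X I dyadic_grids]] by blast
  then show ?thesis
  proof (rule AE_mp, intro AE_I2 impI)
    fix \<omega> assume w: "\<omega> \<in> space P"
      and lim: "\<forall>t\<ge>0. (\<lambda>k. riemann_sum (4 ^ r k) (dyadic (r k)) X A t \<omega>) \<longlonglongrightarrow> I t \<omega>"
    obtain g where g: "\<And>u v. 0 \<le> u \<Longrightarrow> u \<le> v \<Longrightarrow> \<bar>A v \<omega> - A u \<omega>\<bar> \<le> g v - g u"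
      using locally_bounded_variation_dominated[OF BV_path[OF A w]] by blast
    show "locally_bounded_variation (\<lambda>t. I t \<omega>)"
    proof (rule locally_bounded_variationI)
      fix T :: real assume T: "0 \<le> T"
      obtain K :: nat where K: "\<forall>s\<in>{0..T}. \<bar>X s \<omega>\<bar> \<le> real K" using AC_bounded_path[OF X w] by blast
      have "\<bar>I v \<omega> - I u \<omega>\<bar> \<le> real K * g v - real K * g u" if uv: "0 \<le> u" "u \<le> v" "v \<le> T" for u v
      proof (rule tendsto_upperbound)
        show "(\<lambda>k. \<bar>riemann_sum (4 ^ r k) (dyadic (r k)) X A v \<omega> -
            riemann_sum (4 ^ r k) (dyadic (r k)) X A u \<omega>\<bar>) \<longlonglongrightarrow> \<bar>I v \<omega> - I u \<omega>\<bar>"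
          using lim uv by (intro tendsto_intros) auto
        show "\<forall>\<^sub>F k in sequentially. \<bar>riemann_sum (4 ^ r k) (dyadic (r k)) X A v \<omega> -
            riemann_sum (4 ^ r k) (dyadic (r k)) X A u \<omega>\<bar> \<le> real K * g v - real K * g u"
          unfolding riemann_sum_def
          by (intro always_eventually allI riemann_sum_variation[where T = T])
            (use g K uv in \<open>auto simp: dyadic_simps\<close>)
      qed simp
      then show "\<exists>g. \<forall>u v. 0 \<le> u \<longrightarrow> u \<le> v \<longrightarrow> v \<le> T \<longrightarrow> \<bar>I v \<omega> - I u \<omega>\<bar> \<le> g v - g u"
        by (intro exI[of _ "\<lambda>v. real K * g v"]) blast
    qed
  qed
qed

end

section \<open>Martingales, stopping and hitting times\<close>

text \<open>The flags b mean "not yet stopped" and never switch back on. The increments collected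
  while active telescope to x at the first inactive index, or at N.\<close>

lemma stopped_sum_telescope:
  fixes x :: "nat \<Rightarrow> real"
  assumes "\<And>i j. i \<le> j \<Longrightarrow> b j \<Longrightarrow> b i"
  shows "\<exists>j\<le>N. (\<Sum>i<N. if b i then x (Suc i) - x i else 0) = x j - x 0 \<and> (\<forall>i<j. b i) \<and> (j < N \<longrightarrow> \<not> b j)"
proof (induction N)
  case (Suc N)
  then obtain j where j: "j \<le> N" "(\<Sum>i<N. if b i then x (Suc i) - x i else 0) = x j - x 0"
    "\<forall>i<j. b i" "j < N \<longrightarrow> \<not> b j" by blast
  show ?case
  proof (cases "b N")
    case True
    then have "j = N" using j assms[of j N] by (cases "j < N") auto
    then show ?thesis using True j by (intro exI[of _ "Suc N"]) (auto simp: less_Suc_eq)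
  next
    case False
    then show ?thesis using j by (intro exI[of _ j]) (auto simp: less_Suc_eq)
  qed
qed auto

lemma eventually_le_power2: "\<forall>\<^sub>F n in sequentially. (t::real) \<le> 2 ^ n"
  using filterlim_at_infinity_imp_filterlim_at_top[OF filterlim_realpow_sequentially_gt1[of "2::real"]]
  by (simp add: filterlim_at_top)

definition excess :: "real \<Rightarrow> real \<Rightarrow> real" where
  "excess c x = max (\<bar>x\<bar> - c) 0"

lemma excess_nonneg: "0 \<le> excess c x" by (simp add: excess_def)

lemma excess_le: "0 \<le> c \<Longrightarrow> excess c x \<le> \<bar>x\<bar>" by (auto simp: excess_def)

lemma measurable_excess [measurable]: "excess c \<in> borel_measurable borel"
  unfolding excess_def by measurable

lemma clip_excess: "0 \<le> c \<Longrightarrow> \<bar>x - clip c x\<bar> = excess c x"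
  by (auto simp: excess_def clip_def)

text \<open>A subgradient of \<open>excess c\<close>. It is bounded by 1, hence admissible as a
  multiplier of martingale increments.\<close>

definition excess_slope :: "real \<Rightarrow> real \<Rightarrow> real" where
  "excess_slope c x = (if x > c then 1 else if x < - c then - 1 else 0)"

lemma measurable_excess_slope [measurable]: "excess_slope c \<in> borel_measurable borel"
  unfolding excess_slope_def by measurable

lemma excess_subgradient: "0 \<le> c \<Longrightarrow> excess c z + excess_slope c z * (y - z) \<le> excess c y"
  by (auto simp: excess_def excess_slope_def)

text \<open>The case \<top> is separate because \<open>enn2real\<close> sends it to 0.\<close>

lemma enn2real_min_ennreal:
  "0 \<le> t \<Longrightarrow> enn2real (min (ennreal t) T) = (if T = \<top> then t else min t (enn2real T))"
proof (cases T)
  case (real r)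
  moreover assume "0 \<le> t"
  ultimately show ?thesis by (simp add: min_def)
qed simp

context complete_filtered_prob_space
begin

lemma integrable_bounded_mult:
  assumes "integrable P g" "\<xi> \<in> borel_measurable P" "\<And>\<omega>. \<omega> \<in> space P \<Longrightarrow> \<bar>\<xi> \<omega>\<bar> \<le> C"
  shows "integrable P (\<lambda>\<omega>. \<xi> \<omega> * g \<omega> :: real)"
proof (rule Bochner_Integration.integrable_bound)
  show "integrable P (\<lambda>\<omega>. C * g \<omega>)" using assms(1) by simp
  show "(\<lambda>\<omega>. \<xi> \<omega> * g \<omega>) \<in> borel_measurable P" using assms by measurable
  show "AE \<omega> in P. norm (\<xi> \<omega> * g \<omega>) \<le> norm (C * g \<omega>)"
  proof (rule AE_I2)
    fix \<omega> assume "\<omega> \<in> space P"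
    then have "\<bar>\<xi> \<omega>\<bar> \<le> \<bar>C\<bar>" using assms(3) by fastforce
    then show "norm (\<xi> \<omega> * g \<omega>) \<le> norm (C * g \<omega>)" by (simp add: abs_mult mult_right_mono)
  qed
qed

lemma finite_measure_subalgebra_F: "0 \<le> s \<Longrightarrow> finite_measure_subalgebra P (F s)"
  by (intro finite_measure_subalgebra.intro finite_measure_subalgebra_axioms.intro subalgebra_F finite_measure_axioms)

text \<open>Integrals over events of F s replace the conditional expectation, since they are linear
  and behave well under limits.\<close>

lemma martingale_iff:
  "martingale P F X \<longleftrightarrow> adapted F X \<and> (\<forall>t\<ge>0. integrable P (X t)) \<and>
    (\<forall>s t. 0 \<le> s \<longrightarrow> s \<le> t \<longrightarrow> (\<forall>B\<in>sets (F s).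
      (\<integral>\<omega>. indicator B \<omega> * X t \<omega> \<partial>P) = (\<integral>\<omega>. indicator B \<omega> * X s \<omega> \<partial>P)))"
proof -
  have key: "(AE \<omega> in P. real_cond_exp P (F s) (X t) \<omega> = X s \<omega>) \<longleftrightarrow> (\<forall>B\<in>sets (F s).
      (\<integral>\<omega>. indicator B \<omega> * X t \<omega> \<partial>P) = (\<integral>\<omega>. indicator B \<omega> * X s \<omega> \<partial>P))"
    if ad: "adapted F X" and int: "\<And>t. 0 \<le> t \<Longrightarrow> integrable P (X t)" and st: "0 \<le> s" "s \<le> t" for s t
  proof -
    interpret finite_measure_subalgebra P "F s" by (rule finite_measure_subalgebra_F[OF st(1)])
    have t0: "0 \<le> t" using st by simp
    have Xs: "X s \<in> borel_measurable (F s)" using ad st by (simp add: adapted_def)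
    show ?thesis
    proof (intro iffI ballI)
      fix B assume ae: "AE \<omega> in P. real_cond_exp P (F s) (X t) \<omega> = X s \<omega>" and B: "B \<in> sets (F s)"
      have BP: "B \<in> events" by (rule sets_F_P[OF st(1) B])
      have i: "integrable P (\<lambda>\<omega>. indicator B \<omega> * X t \<omega>)"
        by (rule integrable_bounded_mult[where C = 1, OF int[OF t0]]) (use BP in auto)
      have "(\<integral>\<omega>. indicator B \<omega> * X t \<omega> \<partial>P) = (\<integral>\<omega>. indicator B \<omega> * real_cond_exp P (F s) (X t) \<omega> \<partial>P)"
        by (rule real_cond_exp_intg(2)[OF i, symmetric]) (use B int[OF t0] in auto)
      also have "\<dots> = (\<integral>\<omega>. indicator B \<omega> * X s \<omega> \<partial>P)"
        by (rule integral_cong_AE) (use ae BP int[OF st(1)] in auto)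
      finally show "(\<integral>\<omega>. indicator B \<omega> * X t \<omega> \<partial>P) = (\<integral>\<omega>. indicator B \<omega> * X s \<omega> \<partial>P)" .
    next
      assume "\<forall>B\<in>sets (F s). (\<integral>\<omega>. indicator B \<omega> * X t \<omega> \<partial>P) = (\<integral>\<omega>. indicator B \<omega> * X s \<omega> \<partial>P)"
      then show "AE \<omega> in P. real_cond_exp P (F s) (X t) \<omega> = X s \<omega>"
        by (intro real_cond_exp_charact[OF _ int[OF t0] int[OF st(1)] Xs]) (simp add: set_lebesgue_integral_def)
    qed
  qed
  show ?thesis
  proof (cases "adapted F X \<and> (\<forall>t\<ge>0. integrable P (X t))")
    case True
    then show ?thesis using key by (simp add: martingale_def imp_conjL cong: imp_cong)
  qed (auto simp: martingale_def)
qed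

lemma martingaleD:
  assumes "martingale P F X"
  shows "0 \<le> t \<Longrightarrow> X t \<in> borel_measurable (F t)" "0 \<le> t \<Longrightarrow> integrable P (X t)"
    "\<lbrakk>0 \<le> s; s \<le> t; B \<in> sets (F s)\<rbrakk> \<Longrightarrow>
      (\<integral>\<omega>. indicator B \<omega> * X t \<omega> \<partial>P) = (\<integral>\<omega>. indicator B \<omega> * X s \<omega> \<partial>P)"
  using assms unfolding martingale_iff adapted_def by blast+

text \<open>The common source of optional stopping and of the isometry bound: an increment is
  orthogonal to every bounded variable known at its start.\<close>

lemma martingale_mult_increment:
  assumes X: "martingale P F X" and st: "0 \<le> s" "s \<le> t"
    and \<xi>: "\<xi> \<in> borel_measurable (F s)" "\<And>\<omega>. \<omega> \<in> space P \<Longrightarrow> \<bar>\<xi> \<omega>\<bar> \<le> C"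
  shows "integrable P (\<lambda>\<omega>. \<xi> \<omega> * (X t \<omega> - X s \<omega>))" and "(\<integral>\<omega>. \<xi> \<omega> * (X t \<omega> - X s \<omega>) \<partial>P) = 0"
proof -
  interpret finite_measure_subalgebra P "F s" by (rule finite_measure_subalgebra_F[OF st(1)])
  have t0: "0 \<le> t" using st by simp
  note iX = martingaleD(2)[OF X]
  have \<xi>P: "\<xi> \<in> borel_measurable P" by (rule measurable_F_P[OF \<xi>(1) st(1)])
  have i: "integrable P (\<lambda>\<omega>. \<xi> \<omega> * X t \<omega>)" "integrable P (\<lambda>\<omega>. \<xi> \<omega> * X s \<omega>)"
    using integrable_bounded_mult[OF iX \<xi>P \<xi>(2)] st t0 by auto
  show "integrable P (\<lambda>\<omega>. \<xi> \<omega> * (X t \<omega> - X s \<omega>))"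
    using Bochner_Integration.integrable_diff[OF i] by (simp add: right_diff_distrib)
  have ae: "AE \<omega> in P. real_cond_exp P (F s) (X t) \<omega> = X s \<omega>"
    using X st by (auto simp: martingale_def)
  have "(\<integral>\<omega>. \<xi> \<omega> * X t \<omega> \<partial>P) = (\<integral>\<omega>. \<xi> \<omega> * real_cond_exp P (F s) (X t) \<omega> \<partial>P)"
    by (rule real_cond_exp_intg(2)[OF i(1) \<xi>(1), symmetric]) (use iX[OF t0] in auto)
  also have "\<dots> = (\<integral>\<omega>. \<xi> \<omega> * X s \<omega> \<partial>P)"
    by (rule integral_cong_AE) (use ae \<xi>P iX[OF st(1)] in auto)
  finally show "(\<integral>\<omega>. \<xi> \<omega> * (X t \<omega> - X s \<omega>) \<partial>P) = 0"
    using i by (simp add: right_diff_distrib)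
qed

text \<open>Uniform integrability is expressed through the convex functions \<^const>\<open>excess\<close>, so that a
  stopped martingale inherits it from the terminal value by optional stopping for a convex function.\<close>

lemma uniformly_integrable_limit:
  fixes Z :: "nat \<Rightarrow> 'a \<Rightarrow> real"
  assumes Z: "\<And>m. integrable P (Z m)" and Y: "Y \<in> borel_measurable P" and W: "integrable P W"
    and lim: "\<And>\<omega>. \<omega> \<in> space P \<Longrightarrow> (\<lambda>m. Z m \<omega>) \<longlonglongrightarrow> Y \<omega>"
    and ui: "\<And>c m. \<lbrakk>0 \<le> c; m0 \<le> m\<rbrakk> \<Longrightarrow> (\<integral>\<omega>. excess c (Z m \<omega>) \<partial>P) \<le> (\<integral>\<omega>. excess c (W \<omega>) \<partial>P)"
  shows "integrable P Y"
    and "B \<in> events \<Longrightarrow> (\<lambda>m. \<integral>\<omega>. indicator B \<omega> * Z m \<omega> \<partial>P) \<longlonglongrightarrow> (\<integral>\<omega>. indicator B \<omega> * Y \<omega> \<partial>P)"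
proof -
  note [measurable] = Z[THEN borel_measurable_integrable] Y W[THEN borel_measurable_integrable]
  have iex: "integrable P (\<lambda>\<omega>. excess c (f \<omega>))" if "integrable P f" "0 \<le> c" for c f
    by (rule Bochner_Integration.integrable_bound[OF that(1)])
      (use that excess_le[OF that(2)] excess_nonneg in \<open>auto intro: measurable_compose[OF borel_measurable_integrable[OF that(1)] measurable_excess]\<close>)
  \<comment> \<open>Fatou transfers the excess bounds to the limit; c = 0 gives its
    integrability.\<close>
  have fatou: "(\<integral>\<^sup>+\<omega>. ennreal (excess c (Y \<omega>)) \<partial>P) \<le> ennreal (\<integral>\<omega>. excess c (W \<omega>) \<partial>P)" if c: "0 \<le> c" for c
  proof -
    have "(\<integral>\<^sup>+\<omega>. ennreal (excess c (Y \<omega>)) \<partial>P) = (\<integral>\<^sup>+\<omega>. liminf (\<lambda>m. ennreal (excess c (Z m \<omega>))) \<partial>P)"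
    proof (rule nn_integral_cong)
      fix \<omega> assume "\<omega> \<in> space P"
      then have "(\<lambda>m. ennreal (excess c (Z m \<omega>))) \<longlonglongrightarrow> ennreal (excess c (Y \<omega>))"
        unfolding excess_def by (intro tendsto_intros lim)
      then show "ennreal (excess c (Y \<omega>)) = liminf (\<lambda>m. ennreal (excess c (Z m \<omega>)))"
        by (rule lim_imp_Liminf[OF trivial_limit_sequentially, symmetric])
    qed
    also have "\<dots> \<le> liminf (\<lambda>m. \<integral>\<^sup>+\<omega>. ennreal (excess c (Z m \<omega>)) \<partial>P)"
      by (rule nn_integral_liminf) measurable
    also have "\<dots> \<le> liminf (\<lambda>m::nat. ennreal (\<integral>\<omega>. excess c (W \<omega>) \<partial>P))"
    proof (rule Liminf_mono)
      show "\<forall>\<^sub>F m in sequentially. (\<integral>\<^sup>+\<omega>. ennreal (excess c (Z m \<omega>)) \<partial>P) \<le> ennreal (\<integral>\<omega>. excess c (W \<omega>) \<partial>P)"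
        using eventually_ge_at_top[of m0]
      proof eventually_elim
        case (elim m)
        show ?case
          by (subst nn_integral_eq_integral[OF iex[OF Z c]]) (auto simp: excess_nonneg intro!: ennreal_leI ui c elim)
      qed
    qed
    finally show ?thesis by (simp add: Liminf_const)
  qed
  show iY: "integrable P Y"
  proof (rule integrableI_bounded[OF Y])
    have "(\<integral>\<^sup>+\<omega>. ennreal (norm (Y \<omega>)) \<partial>P) = (\<integral>\<^sup>+\<omega>. ennreal (excess 0 (Y \<omega>)) \<partial>P)"
      by (intro nn_integral_cong) (simp add: excess_def)
    also have "\<dots> < \<infinity>" using fatou[of 0] by (simp add: le_less_trans)
    finally show "(\<integral>\<^sup>+\<omega>. ennreal (norm (Y \<omega>)) \<partial>P) < \<infinity>" .
  qed
  have exY: "(\<integral>\<omega>. excess c (Y \<omega>) \<partial>P) \<le> (\<integral>\<omega>. excess c (W \<omega>) \<partial>P)" if c: "0 \<le> c" for c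
    using fatou[OF c] nn_integral_eq_integral[OF iex[OF iY c]]
    by (simp add: excess_nonneg integral_nonneg_AE)
  \<comment> \<open>Uniform integrability: the tails of all Z m and of Y are bounded by that of the
    single integrable W, which vanishes as c grows.\<close>
  have e0: "(\<lambda>c::nat. \<integral>\<omega>. excess (real c) (W \<omega>) \<partial>P) \<longlonglongrightarrow> (\<integral>\<omega>. 0 \<partial>P)"
  proof (rule integral_dominated_convergence[where w = "\<lambda>\<omega>. \<bar>W \<omega>\<bar>"])
    show "AE \<omega> in P. (\<lambda>c::nat. excess (real c) (W \<omega>)) \<longlonglongrightarrow> 0"
    proof (rule AE_I2)
      fix \<omega>
      have "\<forall>\<^sub>F c in sequentially. excess (real c) (W \<omega>) = 0"
        using eventually_ge_at_top[of "nat \<lceil>\<bar>W \<omega>\<bar>\<rceil>"] by eventually_elim (auto simp: excess_def)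
      then show "(\<lambda>c::nat. excess (real c) (W \<omega>)) \<longlonglongrightarrow> 0" by (rule tendsto_eventually)
    qed
    show "AE \<omega> in P. norm (excess (real c) (W \<omega>)) \<le> \<bar>W \<omega>\<bar>" for c
      using excess_le excess_nonneg by auto
  qed (use W in auto)
  assume B: "B \<in> events"
  show "(\<lambda>m. \<integral>\<omega>. indicator B \<omega> * Z m \<omega> \<partial>P) \<longlonglongrightarrow> (\<integral>\<omega>. indicator B \<omega> * Y \<omega> \<partial>P)"
  proof (rule LIMSEQ_I)
    fix r :: real assume r: "0 < r"
    from order_tendstoD(2)[OF e0, of "r/3"] r
    obtain c :: nat where c: "(\<integral>\<omega>. excess (real c) (W \<omega>) \<partial>P) < r/3"
      by (auto simp: eventually_sequentially)
    have ic: "integrable P (\<lambda>\<omega>. clip (real c) (f \<omega>))" if [measurable]: "f \<in> borel_measurable P" for f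
      by (rule integrable_const_bound[where B = "real c"]) (auto intro!: AE_I2 abs_clip_le)
    have "(\<lambda>m. \<integral>\<omega>. \<bar>clip (real c) (Z m \<omega>) - clip (real c) (Y \<omega>)\<bar> \<partial>P) \<longlonglongrightarrow> (\<integral>\<omega>. 0 \<partial>P)"
    proof (rule integral_dominated_convergence[where w = "\<lambda>\<omega>. 2 * real c"])
      show "AE \<omega> in P. (\<lambda>m. \<bar>clip (real c) (Z m \<omega>) - clip (real c) (Y \<omega>)\<bar>) \<longlonglongrightarrow> 0"
      proof (rule AE_I2)
        fix \<omega> assume "\<omega> \<in> space P"
        then have "(\<lambda>m. \<bar>clip (real c) (Z m \<omega>) - clip (real c) (Y \<omega>)\<bar>) \<longlonglongrightarrow> \<bar>clip (real c) (Y \<omega>) - clip (real c) (Y \<omega>)\<bar>"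
          unfolding clip_def by (intro tendsto_intros lim)
        then show "(\<lambda>m. \<bar>clip (real c) (Z m \<omega>) - clip (real c) (Y \<omega>)\<bar>) \<longlonglongrightarrow> 0" by simp
      qed
      show "AE \<omega> in P. norm \<bar>clip (real c) (Z m \<omega>) - clip (real c) (Y \<omega>)\<bar> \<le> 2 * real c" for m
        by (rule AE_I2) (use abs_clip_le[of "real c" "Z m _"] abs_clip_le[of "real c" "Y _"] in \<open>auto simp: clip_def\<close>)
    qed auto
    from order_tendstoD(2)[OF this, of "r/3"] r eventually_ge_at_top[of m0]
    have "\<forall>\<^sub>F m in sequentially. (\<integral>\<omega>. \<bar>clip (real c) (Z m \<omega>) - clip (real c) (Y \<omega>)\<bar> \<partial>P) < r/3 \<and> m0 \<le> m"
      by (intro eventually_conj) auto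
    then obtain m1 where m1: "\<And>m. m1 \<le> m \<Longrightarrow> (\<integral>\<omega>. \<bar>clip (real c) (Z m \<omega>) - clip (real c) (Y \<omega>)\<bar> \<partial>P) < r/3 \<and> m0 \<le> m"
      by (auto simp: eventually_sequentially)
    have "norm ((\<integral>\<omega>. indicator B \<omega> * Z m \<omega> \<partial>P) - (\<integral>\<omega>. indicator B \<omega> * Y \<omega> \<partial>P)) < r" if m: "m1 \<le> m" for m
    proof -
      have iB: "integrable P (\<lambda>\<omega>. indicator B \<omega> * f \<omega>)" if "integrable P f" for f :: "'a \<Rightarrow> real"
        by (rule integrable_bounded_mult[where C = 1, OF that]) (use B in auto)
      have "norm ((\<integral>\<omega>. indicator B \<omega> * Z m \<omega> \<partial>P) - (\<integral>\<omega>. indicator B \<omega> * Y \<omega> \<partial>P))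
        = \<bar>\<integral>\<omega>. indicator B \<omega> * (Z m \<omega> - Y \<omega>) \<partial>P\<bar>"
        using iB[OF Z[of m]] iB[OF iY] by (simp add: right_diff_distrib)
      also have "\<dots> \<le> (\<integral>\<omega>. \<bar>indicator B \<omega> * (Z m \<omega> - Y \<omega>)\<bar> \<partial>P)" by (rule integral_abs_bound)
      \<comment> \<open>Three errors of less than r/3: the parts of Z m and of Y beyond level c, and
        the clipped parts, to which dominated convergence applies.\<close>
      also have "\<dots> \<le> (\<integral>\<omega>. excess (real c) (Z m \<omega>) + excess (real c) (Y \<omega>) +
          \<bar>clip (real c) (Z m \<omega>) - clip (real c) (Y \<omega>)\<bar> \<partial>P)"
      proof (rule integral_mono)
        show "integrable P (\<lambda>\<omega>. \<bar>indicator B \<omega> * (Z m \<omega> - Y \<omega>)\<bar>)"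
          by (intro integrable_abs iB Bochner_Integration.integrable_diff Z iY)
        show "integrable P (\<lambda>\<omega>. excess (real c) (Z m \<omega>) + excess (real c) (Y \<omega>) +
          \<bar>clip (real c) (Z m \<omega>) - clip (real c) (Y \<omega>)\<bar>)"
          by (intro integrable_abs Bochner_Integration.integrable_add Bochner_Integration.integrable_diff iex ic Z iY) auto
        fix \<omega>
        have "\<bar>indicator B \<omega> * (Z m \<omega> - Y \<omega>)\<bar> \<le> \<bar>Z m \<omega> - Y \<omega>\<bar>" by (auto simp: indicator_def)
        also have "\<dots> \<le> \<bar>Z m \<omega> - clip (real c) (Z m \<omega>)\<bar> + \<bar>Y \<omega> - clip (real c) (Y \<omega>)\<bar> + \<bar>clip (real c) (Z m \<omega>) - clip (real c) (Y \<omega>)\<bar>"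
          by linarith
        finally show "\<bar>indicator B \<omega> * (Z m \<omega> - Y \<omega>)\<bar> \<le> excess (real c) (Z m \<omega>) + excess (real c) (Y \<omega>) +
          \<bar>clip (real c) (Z m \<omega>) - clip (real c) (Y \<omega>)\<bar>" by (simp add: clip_excess)
      qed
      also have "\<dots> = (\<integral>\<omega>. excess (real c) (Z m \<omega>) \<partial>P) + (\<integral>\<omega>. excess (real c) (Y \<omega>) \<partial>P) +
          (\<integral>\<omega>. \<bar>clip (real c) (Z m \<omega>) - clip (real c) (Y \<omega>)\<bar> \<partial>P)"
        by (simp add: iex ic Z iY)
      also have "\<dots> < r" using ui[of "real c" m] exY[of "real c"] c m1[OF m] by linarith
      finally show ?thesis .
    qed
    then show "\<exists>no. \<forall>m\<ge>no. norm ((\<integral>\<omega>. indicator B \<omega> * Z m \<omega> \<partial>P) - (\<integral>\<omega>. indicator B \<omega> * Y \<omega> \<partial>P)) < r" by blast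
  qed
qed

text \<open>\<open>stopped_sum M T s t m (4 ^ m)\<close> is \<open>M\<close> at the first grid point of \<open>[s,t]\<close> not before \<open>T\<close>,
  or at \<open>t\<close> if there is none.\<close>

definition clamp_grid :: "real \<Rightarrow> real \<Rightarrow> nat \<Rightarrow> nat \<Rightarrow> real" where
  "clamp_grid s t m i = max s (min t (real i / 2 ^ m))"

definition stopped_sum :: "'a process \<Rightarrow> ('a \<Rightarrow> ennreal) \<Rightarrow> real \<Rightarrow> real \<Rightarrow> nat \<Rightarrow> nat \<Rightarrow> 'a \<Rightarrow> real" where
  "stopped_sum M T s t m n \<omega> = M s \<omega> + (\<Sum>i<n. if T \<omega> > ennreal (clamp_grid s t m i)
     then M (clamp_grid s t m (Suc i)) \<omega> - M (clamp_grid s t m i) \<omega> else 0)"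

lemma clamp_grid:
  assumes "0 \<le> s" "s \<le> t"
  shows "clamp_grid s t m 0 = s" "s \<le> clamp_grid s t m i" "clamp_grid s t m i \<le> t"
    "i \<le> j \<Longrightarrow> clamp_grid s t m i \<le> clamp_grid s t m j"
    "clamp_grid s t m (Suc i) - clamp_grid s t m i \<le> 1 / 2 ^ m"
    "t \<le> 2 ^ m \<Longrightarrow> clamp_grid s t m (4 ^ m) = t"
proof -
  show "i \<le> j \<Longrightarrow> clamp_grid s t m i \<le> clamp_grid s t m j"
    unfolding clamp_grid_def by (intro max.mono min.mono divide_right_mono) auto
  show "clamp_grid s t m (Suc i) - clamp_grid s t m i \<le> 1 / 2 ^ m"
  proof -
    have "max s (min t (x + y)) - max s (min t x) \<le> y" if "0 \<le> y" for x y :: real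
      using that by (auto simp: max_def min_def)
    from this[of "1 / 2 ^ m" "real i / 2 ^ m"] show ?thesis
      by (simp add: clamp_grid_def add_divide_distrib add.commute)
  qed
  have "(4::real) ^ m / 2 ^ m = 2 ^ m" by (simp add: power_divide[symmetric])
  then show "t \<le> 2 ^ m \<Longrightarrow> clamp_grid s t m (4 ^ m) = t" using assms by (simp add: clamp_grid_def)
qed (use assms in \<open>auto simp: clamp_grid_def\<close>)

lemma clamp_grid_nonneg: "\<lbrakk>0 \<le> s; s \<le> t\<rbrakk> \<Longrightarrow> 0 \<le> clamp_grid s t m i"
  using clamp_grid(2)[of s t m i] by linarith

text \<open>The discretised stop comes after T cut off to [s,t], by at most one mesh width. The
  condition t \<le> 2^m makes t the last grid point.\<close>

lemma stopped_sum_eq: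
  assumes st: "0 \<le> s" "s \<le> t" "t \<le> 2 ^ m"
  shows "\<exists>u. s \<le> u \<and> u \<le> t \<and> \<bar>u - max s (enn2real (min (ennreal t) (T \<omega>)))\<bar> \<le> 1 / 2 ^ m \<and>
    stopped_sum M T s t m (4 ^ m) \<omega> = M u \<omega>"
proof -
  let ?g = "clamp_grid s t m" and ?w = "enn2real (min (ennreal t) (T \<omega>))"
  note g = clamp_grid[OF st(1,2), of m]
  have g0: "0 \<le> ?g i" for i by (rule clamp_grid_nonneg[OF st(1,2)])
  have w: "?w \<le> t" "0 \<le> ?w" using st by (auto simp: enn2real_min_ennreal)
  \<comment> \<open>Active grid points lie before the true stopping time, inactive ones after it;
    the first inactive point is thus enclosed.\<close>
  have b: "?g i \<le> ?w" if "T \<omega> > ennreal (?g i)" for i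
    using that g(3)[of i] g0[of i] st by (cases "T \<omega>") (auto simp: enn2real_min_ennreal ennreal_less_iff)
  have nb: "?w \<le> ?g i" if "\<not> T \<omega> > ennreal (?g i)" for i
    using that g(3)[of i] g0[of i] st by (cases "T \<omega>") (auto simp: enn2real_min_ennreal not_less)
  have "\<exists>j\<le>4^m. (\<Sum>i<4^m. if T \<omega> > ennreal (?g i) then M (?g (Suc i)) \<omega> - M (?g i) \<omega> else 0) = M (?g j) \<omega> - M (?g 0) \<omega> \<and>
      (\<forall>i<j. T \<omega> > ennreal (?g i)) \<and> (j < 4^m \<longrightarrow> \<not> T \<omega> > ennreal (?g j))"
  proof (rule stopped_sum_telescope[where x = "\<lambda>i. M (?g i) \<omega>"])
    fix i j :: nat assume "i \<le> j" "T \<omega> > ennreal (?g j)"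
    then show "T \<omega> > ennreal (?g i)" using ennreal_leI[OF clamp_grid(4)[OF st(1,2), of i j m]] by (auto intro: le_less_trans)
  qed
  then obtain j where j: "j \<le> 4^m" "(\<Sum>i<4^m. if T \<omega> > ennreal (?g i) then M (?g (Suc i)) \<omega> - M (?g i) \<omega> else 0) = M (?g j) \<omega> - M (?g 0) \<omega>"
      "\<forall>i<j. T \<omega> > ennreal (?g i)" "j < 4^m \<longrightarrow> \<not> T \<omega> > ennreal (?g j)" by blast
  have up: "?w \<le> ?g j" using nb[of j] j(1,4) g(6)[OF st(3)] w by (cases "j = 4^m") auto
  have "\<bar>?g j - max s ?w\<bar> \<le> 1 / 2 ^ m"
  proof (cases j)
    case 0
    then show ?thesis using up g(1) by (simp add: max_def)
  next
    case (Suc i)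
    then have "?g i \<le> ?w" using b j(3) by blast
    then show ?thesis using g(5)[of i] g(2)[of i] g(2)[of j] up Suc by (auto simp: max_def)
  qed
  then show ?thesis using j(2) g(1) g(2,3)[of j] by (intro exI[of _ "?g j"]) (simp add: stopped_sum_def)
qed

lemma stopped_sum_tendsto:
  assumes M: "M \<in> AC" and w: "\<omega> \<in> space P" and st: "0 \<le> s" "s \<le> t"
  shows "(\<lambda>m. stopped_sum M T s t m (4 ^ m) \<omega>) \<longlonglongrightarrow> M (max s (enn2real (min (ennreal t) (T \<omega>)))) \<omega>"
proof -
  let ?w = "max s (enn2real (min (ennreal t) (T \<omega>)))"
  have "\<exists>u. \<forall>m. t \<le> 2 ^ m \<longrightarrow> s \<le> u m \<and> u m \<le> t \<and> \<bar>u m - ?w\<bar> \<le> 1 / 2 ^ m \<and> stopped_sum M T s t m (4 ^ m) \<omega> = M (u m) \<omega>"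
    using stopped_sum_eq[OF st] by (intro choice allI) blast
  then obtain u where u: "\<And>m. t \<le> 2 ^ m \<Longrightarrow> s \<le> u m \<and> u m \<le> t \<and> \<bar>u m - ?w\<bar> \<le> 1 / 2 ^ m \<and> stopped_sum M T s t m (4 ^ m) \<omega> = M (u m) \<omega>"
    by blast
  note ev = eventually_le_power2[of t]
  have "(\<lambda>m. u m - ?w) \<longlonglongrightarrow> 0"
  proof (rule Lim_null_comparison)
    show "\<forall>\<^sub>F m in sequentially. norm (u m - ?w) \<le> (1/2) ^ m"
      using ev by eventually_elim (use u in \<open>simp add: power_divide\<close>)
  qed (rule LIMSEQ_power_zero, simp)
  then have "u \<longlonglongrightarrow> ?w" by (rule LIM_zero_cancel)
  moreover have "0 \<le> ?w" using st by simp
  moreover have "\<forall>\<^sub>F m in sequentially. u m \<in> {0..}" using ev by eventually_elim (use u st in force)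
  ultimately have "(\<lambda>m. M (u m) \<omega>) \<longlonglongrightarrow> M ?w \<omega>"
    by (intro continuous_on_tendsto_compose[OF AC_continuous[OF M w]]) auto
  moreover have "\<forall>\<^sub>F m in sequentially. M (u m) \<omega> = stopped_sum M T s t m (4 ^ m) \<omega>"
    using ev by eventually_elim (use u in auto)
  ultimately show ?thesis by (rule Lim_transform_eventually)
qed

section \<open>Optional stopping for continuous martingales\<close>

lemma extended_stopping_time_greater:
  assumes "extended_stopping_time F T" "0 \<le> s"
  shows "(\<lambda>\<omega>. indicator {\<omega>. T \<omega> > ennreal s} \<omega> :: real) \<in> borel_measurable (F s)"
proof -
  have [measurable]: "Measurable.pred (F s) (\<lambda>\<omega>. T \<omega> \<le> ennreal s)" using assms by (simp add: extended_stopping_time_def)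
  have "(\<lambda>\<omega>. indicator {\<omega>. T \<omega> > ennreal s} \<omega> :: real) = (\<lambda>\<omega>. if T \<omega> \<le> ennreal s then 0 else 1)"
  proof (rule ext)
    fix \<omega>
    show "(indicator {\<omega>. T \<omega> > ennreal s} \<omega> :: real) = (if T \<omega> \<le> ennreal s then 0 else 1)"
      by (cases "T \<omega> \<le> ennreal s") auto
  qed
  then show ?thesis by simp
qed

lemma stopped_sum_measurable:
  assumes M: "\<And>u. 0 \<le> u \<Longrightarrow> M u \<in> borel_measurable (F u)" and T: "extended_stopping_time F T"
    and st: "0 \<le> s" "s \<le> t" and n: "n \<le> n'"
  shows "stopped_sum M T s t m n \<in> borel_measurable (F (clamp_grid s t m n'))"
proof -
  note g = clamp_grid[OF st, of m] and g0 = clamp_grid_nonneg[OF st, of m]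
  have Mm: "M u \<in> borel_measurable (F (clamp_grid s t m n'))" if "0 \<le> u" "u \<le> clamp_grid s t m n'" for u
    using measurable_F_le[OF M] that by blast
  have eq: "stopped_sum M T s t m n = (\<lambda>\<omega>. M s \<omega> + (\<Sum>i<n. indicator {\<omega>. T \<omega> > ennreal (clamp_grid s t m i)} \<omega> *
     (M (clamp_grid s t m (Suc i)) \<omega> - M (clamp_grid s t m i) \<omega>)))"
    unfolding stopped_sum_def by (intro ext arg_cong2[where f = "(+)"] sum.cong) (auto simp: indicator_def)
  show ?thesis unfolding eq
    by (intro borel_measurable_add borel_measurable_sum borel_measurable_times borel_measurable_diff Mm g0
      measurable_F_le[OF extended_stopping_time_greater[OF T g0] g0] g(2) st) (use n in \<open>auto intro!: clamp_grid(4)[OF st]\<close>)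
qed

lemma stopped_measurable:
  assumes M: "M \<in> AC" and T: "extended_stopping_time F T" and t: "0 \<le> t"
  shows "stopped M T t \<in> borel_measurable (F t)"
proof -
  have "stopped_sum M T 0 t m (4 ^ m) \<in> borel_measurable (F t)" for m
    by (rule measurable_F_le[OF stopped_sum_measurable[OF AC_measurable_F[OF M] T order_refl t order_refl]])
      (use clamp_grid(2,3)[OF order_refl t] in auto)
  then show ?thesis
  proof (rule borel_measurable_LIMSEQ_real[rotated])
    fix \<omega> assume "\<omega> \<in> space (F t)"
    then have w: "\<omega> \<in> space P" using space_F[OF t] by simp
    show "(\<lambda>m. stopped_sum M T 0 t m (4 ^ m) \<omega>) \<longlonglongrightarrow> stopped M T t \<omega>"
      using stopped_sum_tendsto[OF M w order_refl t, of T] by (simp add: stopped_def)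
  qed
qed

lemma stopped_eq: "0 \<le> t \<Longrightarrow> stopped X T t \<omega> = X (if T \<omega> = \<top> then t else min t (enn2real (T \<omega>))) \<omega>"
  by (simp add: stopped_def enn2real_min_ennreal)

lemma stopped_AC:
  assumes M: "M \<in> AC" and T: "extended_stopping_time F T"
  shows "stopped M T \<in> AC"
proof (rule ACI[OF stopped_measurable[OF assms]])
  fix \<omega> assume w: "\<omega> \<in> space P"
  have "continuous_on {0..} (\<lambda>t. M (if T \<omega> = \<top> then t else min t (enn2real (T \<omega>))) \<omega>)"
    by (cases "T \<omega> = \<top>"; rule continuous_on_compose2[OF AC_continuous[OF M w]])
      (auto intro!: continuous_intros)
  then show "continuous_on {0..} (\<lambda>t. stopped M T t \<omega>)"
    by (rule continuous_on_eq) (simp add: stopped_eq)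
qed

text \<open>The discretised values have the right integrals over events of F s, being sums of
  orthogonal increments. Their excess is at most that of M t by convexity, so they are uniformly
  integrable and the limit inherits the identity. The lower cut-off at s keeps every increment after
  s.\<close>

lemma optional_stopping_interval:
  assumes M: "martingale P F M" "M \<in> AC" and T: "extended_stopping_time F T" and st: "0 \<le> s" "s \<le> t"
  defines "Y \<equiv> \<lambda>\<omega>. M (max s (enn2real (min (ennreal t) (T \<omega>)))) \<omega>"
  shows "integrable P Y"
    and "B \<in> sets (F s) \<Longrightarrow> (\<integral>\<omega>. indicator B \<omega> * Y \<omega> \<partial>P) = (\<integral>\<omega>. indicator B \<omega> * M s \<omega> \<partial>P)"
proof -
  let ?g = "clamp_grid s t" and ?Z = "stopped_sum M T s t"
  let ?b = "\<lambda>m i \<omega>. indicator {\<omega>. T \<omega> > ennreal (?g m i)} \<omega> :: real"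
  let ?D = "\<lambda>m i \<omega>. M (?g m (Suc i)) \<omega> - M (?g m i) \<omega>"
  note g = clamp_grid[OF st] and g0 = clamp_grid_nonneg[OF st]
  note iM = martingaleD(2)[OF M(1)] and mM = martingaleD(1)[OF M(1)]
  have gS: "?g m i \<le> ?g m (Suc i)" for m i by (rule g(4)) simp
  have Zeq: "?Z m n = (\<lambda>\<omega>. M s \<omega> + (\<Sum>i<n. ?b m i \<omega> * ?D m i \<omega>))" for m n
    unfolding stopped_sum_def by (intro ext arg_cong2[where f = "(+)"] sum.cong) (auto simp: indicator_def)
  have bm: "?b m i \<in> borel_measurable (F (?g m i))" for m i by (rule extended_stopping_time_greater[OF T g0])
  have Zm: "?Z m n \<in> borel_measurable (F (?g m n'))" if "n \<le> n'" for m n n'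
    by (rule stopped_sum_measurable[OF mM T st that])
  have iterm: "integrable P (\<lambda>\<omega>. \<xi> \<omega> * ?D m i \<omega>)" "(\<integral>\<omega>. \<xi> \<omega> * ?D m i \<omega> \<partial>P) = 0"
    if "\<xi> \<in> borel_measurable (F (?g m i))" "\<And>\<omega>. \<omega> \<in> space P \<Longrightarrow> \<bar>\<xi> \<omega>\<bar> \<le> 1" for \<xi> m i
    using martingale_mult_increment[OF M(1) g0 gS that] by blast+
  have iZ: "integrable P (?Z m n)" for m n
    unfolding Zeq using bm by (intro Bochner_Integration.integrable_add Bochner_Integration.integrable_sum iterm iM st)
      (auto simp: indicator_def)
  have EZ: "(\<integral>\<omega>. indicator B \<omega> * ?Z m n \<omega> \<partial>P) = (\<integral>\<omega>. indicator B \<omega> * M s \<omega> \<partial>P)" if B: "B \<in> sets (F s)" for B m n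
  proof -
    have BP: "B \<in> events" by (rule sets_F_P[OF st(1) B])
    have \<xi>: "(\<lambda>\<omega>. indicator B \<omega> * ?b m i \<omega>) \<in> borel_measurable (F (?g m i))" for i
    proof -
      have "(indicator B :: 'a \<Rightarrow> real) \<in> borel_measurable (F (?g m i))"
        by (rule measurable_F_le[OF _ st(1) g(2)]) (use B in simp)
      then show ?thesis by (intro borel_measurable_times bm)
    qed
    have i1: "integrable P (\<lambda>\<omega>. (indicator B \<omega> * ?b m i \<omega>) * ?D m i \<omega>)"
      "(\<integral>\<omega>. (indicator B \<omega> * ?b m i \<omega>) * ?D m i \<omega> \<partial>P) = 0" for i
      by (rule iterm[OF \<xi>]; simp add: indicator_def)+
    have iB: "integrable P (\<lambda>\<omega>. indicator B \<omega> * M s \<omega>)"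
      by (rule integrable_bounded_mult[where C = 1, OF iM[OF st(1)]]) (use BP in auto)
    have "(\<lambda>\<omega>. indicator B \<omega> * ?Z m n \<omega>) = (\<lambda>\<omega>. indicator B \<omega> * M s \<omega> + (\<Sum>i<n. (indicator B \<omega> * ?b m i \<omega>) * ?D m i \<omega>))"
      unfolding Zeq distrib_left sum_distrib_left mult.assoc ..
    then show ?thesis using i1 iB by (simp add: Bochner_Integration.integral_add Bochner_Integration.integral_sum)
  qed
  obtain m0 :: nat where m0: "\<And>m. m0 \<le> m \<Longrightarrow> t \<le> 2 ^ m"
  proof -
    show ?thesis using that eventually_le_power2[of t] by (auto simp: eventually_sequentially)
  qed
  have ui: "(\<integral>\<omega>. excess c (?Z m (4^m) \<omega>) \<partial>P) \<le> (\<integral>\<omega>. excess c (M t \<omega>) \<partial>P)" if c: "0 \<le> c" and m: "m0 \<le> m" for c m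
  proof -
    let ?N = "4 ^ m :: nat"
    have t0: "0 \<le> t" using st by simp
    have ex: "integrable P (\<lambda>\<omega>. excess c (f \<omega>))" if "integrable P f" for f
      by (rule Bochner_Integration.integrable_bound[OF that])
        (use excess_le[OF c] excess_nonneg in \<open>auto intro: measurable_compose[OF borel_measurable_integrable[OF that] measurable_excess]\<close>)
    have diff: "M t \<omega> - ?Z m ?N \<omega> = (\<Sum>i<?N. (1 - ?b m i \<omega>) * ?D m i \<omega>)" for \<omega>
    proof -
      have "(\<Sum>i<?N. ?D m i \<omega>) = M (?g m ?N) \<omega> - M (?g m 0) \<omega>"
        by (rule sum_lessThan_telescope)
      then have "M t \<omega> = M s \<omega> + (\<Sum>i<?N. ?D m i \<omega>)" using g(6)[OF m0[OF m]] g(1) by simp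
      then show ?thesis unfolding Zeq by (simp add: left_diff_distrib sum_subtractf)
    qed
    \<comment> \<open>After the flag of cell i is off the sum is frozen, so the slope at the final
      value equals the slope at the partial sum up to i. That one is known at the start of the
      cell.\<close>
    have slope: "excess_slope c (?Z m ?N \<omega>) * (1 - ?b m i \<omega>) = excess_slope c (?Z m i \<omega>) * (1 - ?b m i \<omega>)"
      if i: "i < ?N" for i \<omega>
    proof (cases "T \<omega> > ennreal (?g m i)")
      case False
      have "?b m l \<omega> = 0" if "i \<le> l" for l
        using False ennreal_leI[OF g(4)[OF that, of m]] by (auto simp: indicator_def not_less intro: order_trans)
      then have "(\<Sum>l<?N. ?b m l \<omega> * ?D m l \<omega>) = (\<Sum>l<i. ?b m l \<omega> * ?D m l \<omega>)"
        using i by (intro sum.mono_neutral_right) auto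
      then show ?thesis unfolding Zeq by simp
    qed simp
    have \<xi>: "(\<lambda>\<omega>. excess_slope c (?Z m i \<omega>) * (1 - ?b m i \<omega>)) \<in> borel_measurable (F (?g m i))" for i
      by (intro borel_measurable_times borel_measurable_diff borel_measurable_const bm measurable_compose[OF Zm measurable_excess_slope]) simp
    have i1: "integrable P (\<lambda>\<omega>. (excess_slope c (?Z m i \<omega>) * (1 - ?b m i \<omega>)) * ?D m i \<omega>)"
      "(\<integral>\<omega>. (excess_slope c (?Z m i \<omega>) * (1 - ?b m i \<omega>)) * ?D m i \<omega> \<partial>P) = 0" for i
      by (rule iterm[OF \<xi>]; simp add: indicator_def excess_slope_def)+
    have sl: "excess_slope c (?Z m ?N \<omega>) * (M t \<omega> - ?Z m ?N \<omega>) =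
        (\<Sum>i<?N. (excess_slope c (?Z m i \<omega>) * (1 - ?b m i \<omega>)) * ?D m i \<omega>)" for \<omega>
      unfolding diff sum_distrib_left using slope by (intro sum.cong) (auto simp: mult.assoc[symmetric])
    have isl: "integrable P (\<lambda>\<omega>. excess_slope c (?Z m ?N \<omega>) * (M t \<omega> - ?Z m ?N \<omega>))"
      "(\<integral>\<omega>. excess_slope c (?Z m ?N \<omega>) * (M t \<omega> - ?Z m ?N \<omega>) \<partial>P) = 0"
      unfolding sl using i1 by (auto simp: Bochner_Integration.integral_sum)
    \<comment> \<open>The subgradient term has integral zero, so adding it is free, and the sum lies
      below the excess of M t.\<close>
    have "(\<integral>\<omega>. excess c (?Z m ?N \<omega>) \<partial>P) =
      (\<integral>\<omega>. excess c (?Z m ?N \<omega>) + excess_slope c (?Z m ?N \<omega>) * (M t \<omega> - ?Z m ?N \<omega>) \<partial>P)"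
      using isl ex[OF iZ] by simp
    also have "\<dots> \<le> (\<integral>\<omega>. excess c (M t \<omega>) \<partial>P)"
      by (rule integral_mono) (use isl ex[OF iZ] ex[OF iM[OF t0]] excess_subgradient[OF c] in auto)
    finally show ?thesis .
  qed
  have lim: "\<And>\<omega>. \<omega> \<in> space P \<Longrightarrow> (\<lambda>m. ?Z m (4^m) \<omega>) \<longlonglongrightarrow> Y \<omega>"
    unfolding Y_def by (rule stopped_sum_tendsto[OF M(2) _ st])
  have Ym: "Y \<in> borel_measurable P"
    by (rule borel_measurable_LIMSEQ_real[OF lim borel_measurable_integrable[OF iZ]])
  have iMt: "integrable P (M t)" using iM st by simp
  show "integrable P Y"
    by (rule uniformly_integrable_limit(1)[OF iZ Ym iMt lim ui])
  show "(\<integral>\<omega>. indicator B \<omega> * Y \<omega> \<partial>P) = (\<integral>\<omega>. indicator B \<omega> * M s \<omega> \<partial>P)" if B: "B \<in> sets (F s)"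
    using uniformly_integrable_limit(2)[OF iZ Ym iMt lim ui sets_F_P[OF st(1) B]] EZ[OF B]
    by (simp add: LIMSEQ_const_iff)
qed

lemma optional_stopping:
  assumes M: "martingale P F M" "M \<in> AC" and T: "extended_stopping_time F T"
  shows "martingale P F (stopped M T)"
  unfolding martingale_iff
proof (intro conjI allI impI ballI)
  show "adapted F (stopped M T)" using stopped_measurable[OF M(2) T] by (simp add: adapted_def)
  show i: "integrable P (stopped M T t)" if "0 \<le> t" for t
    using optional_stopping_interval(1)[OF M T order_refl that] by (simp add: stopped_def[abs_def])
  fix s t B assume st: "0 \<le> (s::real)" "s \<le> t" and B: "B \<in> sets (F s)"
  let ?Y = "\<lambda>\<omega>. M (max s (enn2real (min (ennreal t) (T \<omega>)))) \<omega>"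
  have t: "0 \<le> t" using st by simp
  \<comment> \<open>If T \<le> s the last two terms cancel, otherwise the stopped value at s is M s.
    The process is thus split at s into a part known at s and one covered by the interval
    version.\<close>
  have eq: "stopped M T t \<omega> = stopped M T s \<omega> + ?Y \<omega> - M s \<omega>" for \<omega>
    using st t by (simp add: stopped_eq enn2real_min_ennreal) (auto simp: max_def min_def)
  have BP: "B \<in> events" by (rule sets_F_P[OF st(1) B])
  have iB: "integrable P (\<lambda>\<omega>. indicator B \<omega> * f \<omega>)" if "integrable P f" for f :: "'a \<Rightarrow> real"
    by (rule integrable_bounded_mult[where C = 1, OF that]) (use BP in auto)
  note o = optional_stopping_interval[OF M T st]
  show "(\<integral>\<omega>. indicator B \<omega> * stopped M T t \<omega> \<partial>P) = (\<integral>\<omega>. indicator B \<omega> * stopped M T s \<omega> \<partial>P)"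
    unfolding eq using o(2)[OF B] iB[OF o(1)] iB[OF i[OF st(1)]] iB[OF martingaleD(2)[OF M(1) st(1)]]
    by (simp add: distrib_left right_diff_distrib)
qed

section \<open>First entrance times into closed half-lines\<close>

definition hit :: "'a process \<Rightarrow> real \<Rightarrow> 'a \<Rightarrow> ennreal" where
  "hit U k \<omega> = Inf {ennreal t | t. 0 \<le> t \<and> k \<le> U t \<omega>}"

text \<open>The set of times with k \<le> U is closed by continuity, so its infimum is attained. The
  event that the time is at most t is therefore decided by the path on [0,t], with no glimpse beyond
  t.\<close>

lemma hit_le_iff:
  assumes U: "U \<in> AC" and w: "\<omega> \<in> space P" and t: "0 \<le> t"
  shows "hit U k \<omega> \<le> ennreal t \<longleftrightarrow> (\<exists>s\<in>{0..t}. k \<le> U s \<omega>)"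
proof
  assume "\<exists>s\<in>{0..t}. k \<le> U s \<omega>"
  then obtain s where s: "0 \<le> s" "s \<le> t" "k \<le> U s \<omega>" by auto
  then have "hit U k \<omega> \<le> ennreal s" unfolding hit_def by (intro Inf_lower) auto
  then show "hit U k \<omega> \<le> ennreal t" using ennreal_leI[OF s(2)] by (rule order_trans)
next
  assume h: "hit U k \<omega> \<le> ennreal t"
  show "\<exists>s\<in>{0..t}. k \<le> U s \<omega>"
  proof (rule ccontr)
    assume "\<not> (\<exists>s\<in>{0..t}. k \<le> U s \<omega>)"
    then have less: "\<And>s. s \<in> {0..t} \<Longrightarrow> U s \<omega> < k" by (auto simp: not_le)
    have "\<forall>\<^sub>F s in at t within {0..}. U s \<omega> < k"
      using AC_continuous[OF U w] t less[of t] unfolding continuous_on_def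
      by (intro order_tendstoD(2)[of "\<lambda>s. U s \<omega>" "U t \<omega>"]) auto
    then obtain d where d: "0 < d" "\<And>s. \<lbrakk>0 \<le> s; s \<noteq> t; dist s t < d\<rbrakk> \<Longrightarrow> U s \<omega> < k"
      unfolding eventually_at by auto
    \<comment> \<open>If U stays below k on [0,t], it does so a little beyond t, which pushes the
      infimum strictly past t.\<close>
    have "ennreal (t + d) \<le> hit U k \<omega>" unfolding hit_def
    proof (rule Inf_greatest)
      fix x assume "x \<in> {ennreal t | t. 0 \<le> t \<and> k \<le> U t \<omega>}"
      then obtain s where s: "x = ennreal s" "0 \<le> s" "k \<le> U s \<omega>" by auto
      have "t + d \<le> s"
      proof (rule ccontr)
        assume "\<not> t + d \<le> s"
        then have "U s \<omega> < k" using less[of s] d(2)[of s] s(2) by (cases "s \<le> t") (auto simp: dist_real_def)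
        then show False using s(3) by simp
      qed
      then show "ennreal (t + d) \<le> x" unfolding s(1) by (rule ennreal_leI)
    qed
    with h have "ennreal (t + d) \<le> ennreal t" by (rule order_trans[rotated])
    then show False using d(1) t by (simp add: ennreal_le_iff)
  qed
qed

lemma hit_stopping_time:
  assumes U: "U \<in> AC" and pos: "\<And>t \<omega>. 0 \<le> U t \<omega>"
  shows "extended_stopping_time F (hit U k)"
  unfolding extended_stopping_time_def
proof (intro allI impI)
  fix t :: real assume t: "0 \<le> t"
  \<comment> \<open>A maximum over [0,t] reaches k exactly when it exceeds every k - 1/(n+1); strict
    exceedance is what \<open>sets_exceed\<close> measures.\<close>
  have "{\<omega>\<in>space (F t). hit U k \<omega> \<le> ennreal t} = (\<Inter>n::nat. {\<omega>\<in>space P. \<exists>s\<in>{0..t}. \<bar>U s \<omega>\<bar> > k - 1 / real (Suc n)})"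
  proof (intro equalityI subsetI)
    fix \<omega> assume "\<omega> \<in> {\<omega>\<in>space (F t). hit U k \<omega> \<le> ennreal t}"
    then have w: "\<omega> \<in> space P" and "hit U k \<omega> \<le> ennreal t" using space_F[OF t] by auto
    then obtain s where s: "s \<in> {0..t}" "k \<le> U s \<omega>" using hit_le_iff[OF U w t] by auto
    have "k - 1 / real (Suc n) < \<bar>U s \<omega>\<bar>" for n
      using s(2) by (smt (verit) divide_pos_pos of_nat_0_less_iff zero_less_Suc)
    then show "\<omega> \<in> (\<Inter>n::nat. {\<omega>\<in>space P. \<exists>s\<in>{0..t}. \<bar>U s \<omega>\<bar> > k - 1 / real (Suc n)})"
      using s(1) w by blast
  next
    fix \<omega> assume "\<omega> \<in> (\<Inter>n::nat. {\<omega>\<in>space P. \<exists>s\<in>{0..t}. \<bar>U s \<omega>\<bar> > k - 1 / real (Suc n)})"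
    then have w: "\<omega> \<in> space P" and ex: "\<And>n::nat. \<exists>s\<in>{0..t}. \<bar>U s \<omega>\<bar> > k - 1 / real (Suc n)" by auto
    have "\<exists>x\<in>{0..t}. \<forall>y\<in>{0..t}. U y \<omega> \<le> U x \<omega>"
      by (rule continuous_attains_sup) (use t in \<open>auto intro: continuous_on_subset[OF AC_continuous[OF U w]]\<close>)
    then obtain x where x: "x \<in> {0..t}" "\<And>y. y \<in> {0..t} \<Longrightarrow> U y \<omega> \<le> U x \<omega>" by auto
    have "k \<le> U x \<omega>"
    proof (rule ccontr)
      assume "\<not> k \<le> U x \<omega>"
      then obtain n where n: "1 / real (Suc n) < k - U x \<omega>" using nat_approx_posE[of "k - U x \<omega>"] by auto
      obtain s where "s \<in> {0..t}" "\<bar>U s \<omega>\<bar> > k - 1 / real (Suc n)" using ex by blast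
      then show False using x(2)[of s] n pos[of s \<omega>] by auto
    qed
    then show "\<omega> \<in> {\<omega>\<in>space (F t). hit U k \<omega> \<le> ennreal t}"
      using hit_le_iff[OF U w t] x(1) w space_F[OF t] by auto
  qed
  moreover have "{\<omega>\<in>space P. \<exists>s\<in>{0..t}. \<bar>U s \<omega>\<bar> > k - 1 / real (Suc n)} \<in> sets (F t)" for n
    by (rule sets_exceed[OF _ space_F[OF t] t]) (auto intro: AC_measurable_F_le[OF U] AC_continuous_left[OF U])
  ultimately show "Measurable.pred (F t) (\<lambda>\<omega>. hit U k \<omega> \<le> ennreal t)"
    by (simp add: pred_def)
qed

text \<open>Time 0 is excluded: if U starts above k, the entrance time is 0 and the bound fails
  there. At s > 0 it holds as a limit from the left.\<close>

lemma hit_bound: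
  assumes U: "U \<in> AC" and w: "\<omega> \<in> space P" and s: "0 < s" "ennreal s \<le> hit U k \<omega>"
  shows "U s \<omega> \<le> k"
proof (rule tendsto_upperbound)
  show "((\<lambda>s. U s \<omega>) \<longlongrightarrow> U s \<omega>) (at_left s)"
    using AC_continuous_left[OF U w s(1)] by (simp add: continuous_within)
  show "\<forall>\<^sub>F r in at_left s. U r \<omega> \<le> k"
  proof (rule eventually_mono[OF eventually_at_left_real[OF s(1)]])
    fix r assume r: "r \<in> {0<..<s}"
    then have "ennreal r < ennreal s" by (simp add: ennreal_less_iff)
    then have "\<not> hit U k \<omega> \<le> ennreal r" using s(2) by (simp add: not_le less_le_trans)
    then have "\<not> (\<exists>q\<in>{0..r}. k \<le> U q \<omega>)" using hit_le_iff[OF U w, of r k] r by simp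
    then show "U r \<omega> \<le> k" using r by (meson atLeastAtMost_iff greaterThanLessThan_iff less_imp_le linear order_refl)
  qed
qed simp

lemma hit_attained:
  assumes U: "U \<in> AC" and w: "\<omega> \<in> space P" and fin: "hit U k \<omega> \<noteq> \<top>"
  shows "k \<le> U (enn2real (hit U k \<omega>)) \<omega>"
proof -
  let ?h = "enn2real (hit U k \<omega>)"
  have h: "hit U k \<omega> = ennreal ?h" using fin by (simp add: less_top)
  then obtain s where s: "s \<in> {0..?h}" "k \<le> U s \<omega>" using hit_le_iff[OF U w, of ?h k] by auto
  then have "hit U k \<omega> \<le> ennreal s" using hit_le_iff[OF U w, of s k] by auto
  then have "?h \<le> s" using h s(1) by (metis atLeastAtMost_iff ennreal_le_iff)
  then show ?thesis using s by auto
qed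

lemma hit_mono: "k \<le> l \<Longrightarrow> hit U k \<omega> \<le> hit U l \<omega>"
  unfolding hit_def by (rule Inf_superset_mono) auto

lemma hit_tendsto_top:
  assumes U: "U \<in> AC" and w: "\<omega> \<in> space P"
  shows "(\<lambda>n. hit U (real (Suc n)) \<omega>) \<longlonglongrightarrow> \<infinity>"
proof (rule order_tendstoI)
  fix a :: ennreal assume "a < \<infinity>"
  then obtain t where t: "0 \<le> t" "a = ennreal t" by (cases a) auto
  obtain K :: nat where K: "\<forall>s\<in>{0..t}. \<bar>U s \<omega>\<bar> \<le> real K" using AC_bounded_path[OF U w] by blast
  show "\<forall>\<^sub>F n in sequentially. a < hit U (real (Suc n)) \<omega>"
    using eventually_ge_at_top[of K]
  proof eventually_elim
    case (elim n)
    have "\<not> (\<exists>s\<in>{0..t}. real (Suc n) \<le> U s \<omega>)"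
    proof
      assume "\<exists>s\<in>{0..t}. real (Suc n) \<le> U s \<omega>"
      then obtain s where "s \<in> {0..t}" "real (Suc n) \<le> U s \<omega>" by blast
      moreover have "real K < real (Suc n)" using elim by simp
      ultimately show False using K by force
    qed
    then show ?case unfolding t(2) by (subst not_le[symmetric], subst hit_le_iff[OF U w t(1)])
  qed
qed simp

end

section \<open>Local martingales as integrators\<close>

lemma enn2real_min_min:
  assumes "0 \<le> g" "0 \<le> t"
  shows "enn2real (min (ennreal (min g t)) T) = min g (enn2real (min (ennreal t) T))"
  using assms by (simp add: enn2real_min_ennreal min.assoc)

lemma four_point_clamp:
  fixes f :: "real \<Rightarrow> real"
  assumes "a \<le> b" "s \<le> t"
  shows "(f (min b t) - f (min a t)) - (f (min b s) - f (min a s)) = f (max s (min b t)) - f (max s (min a t))"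
proof (cases "b \<le> s")
  case True
  then have "min b t = b" "min a t = a" "min b s = b" "min a s = a" "max s (min b t) = s" "max s (min a t) = s"
    using assms by auto
  then show ?thesis by simp
next
  case False
  then show ?thesis using assms by (cases "a \<le> s") (auto simp: min_def max_def)
qed

lemma ennreal_enn2real_min: "ennreal (enn2real (min (ennreal t) T)) = min (ennreal t) T"
  by (rule ennreal_enn2real) (simp add: min_less_iff_disj)

context complete_filtered_prob_space
begin

abbreviation "LM \<equiv> continuous_local_martingales P F"

lemma LM_AC: "M \<in> LM \<Longrightarrow> M \<in> AC"
  by (simp add: continuous_local_martingales_def AC_def)

lemma AC_null_modify:
  assumes X: "X \<in> AC" and Y: "Y \<in> AC" and N: "N \<in> null_sets P"
  shows "(\<lambda>t \<omega>. if \<omega> \<in> N then X t \<omega> else Y t \<omega>) \<in> AC"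
proof (rule ACI)
  fix t :: real assume t: "0 \<le> t"
  have "{\<omega> \<in> space (F t). \<omega> \<in> N} = N"
    using null_sets_F_t[OF N t] sets.sets_into_space by fastforce
  then show "(\<lambda>\<omega>. if \<omega> \<in> N then X t \<omega> else Y t \<omega>) \<in> borel_measurable (F t)"
    using null_sets_F_t[OF N t] AC_measurable_F[OF X t] AC_measurable_F[OF Y t]
    by (intro measurable_If) (auto simp: pred_def)
next
  fix \<omega> assume "\<omega> \<in> space P"
  then show "continuous_on {0..} (\<lambda>t. if \<omega> \<in> N then X t \<omega> else Y t \<omega>)"
    by (cases "\<omega> \<in> N") (simp_all add: AC_continuous[OF X] AC_continuous[OF Y])
qed

lemma indicator_mult_integrable:
  "\<lbrakk>integrable P f; B \<in> events\<rbrakk> \<Longrightarrow> integrable P (\<lambda>\<omega>. indicator B \<omega> * f \<omega> :: real)"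
  by (rule integrable_bounded_mult[where C = 1]) auto

section \<open>Linear combinations and localisation of local martingales\<close>

lemma martingale_lin:
  assumes X: "martingale P F X" and Y: "martingale P F Y"
  shows "martingale P F (\<lambda>t \<omega>. a * X t \<omega> + b * Y t \<omega>)"
  unfolding martingale_iff adapted_def
proof (intro conjI allI impI ballI)
  show "(\<lambda>\<omega>. a * X t \<omega> + b * Y t \<omega>) \<in> borel_measurable (F t)" if "0 \<le> t" for t
    using martingaleD(1)[OF X that] martingaleD(1)[OF Y that] by measurable
  show i: "integrable P (\<lambda>\<omega>. a * X t \<omega> + b * Y t \<omega>)" if "0 \<le> t" for t
    using martingaleD(2)[OF X that] martingaleD(2)[OF Y that] by simp
  fix s t B assume st: "0 \<le> (s::real)" "s \<le> t" and B: "B \<in> sets (F s)"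
  have BP: "B \<in> events" by (rule sets_F_P[OF st(1) B])
  have eq: "(\<integral>\<omega>. indicator B \<omega> * (a * X u \<omega> + b * Y u \<omega>) \<partial>P) =
    a * (\<integral>\<omega>. indicator B \<omega> * X u \<omega> \<partial>P) + b * (\<integral>\<omega>. indicator B \<omega> * Y u \<omega> \<partial>P)" if u: "0 \<le> u" for u
  proof -
    have "(\<lambda>\<omega>. indicator B \<omega> * (a * X u \<omega> + b * Y u \<omega>)) =
      (\<lambda>\<omega>. a * (indicator B \<omega> * X u \<omega>) + b * (indicator B \<omega> * Y u \<omega>))" by (simp add: algebra_simps)
    then show ?thesis
      using indicator_mult_integrable[OF martingaleD(2)[OF X u] BP] indicator_mult_integrable[OF martingaleD(2)[OF Y u] BP]
      by simp
  qed
  show "(\<integral>\<omega>. indicator B \<omega> * (a * X t \<omega> + b * Y t \<omega>) \<partial>P) = (\<integral>\<omega>. indicator B \<omega> * (a * X s \<omega> + b * Y s \<omega>) \<partial>P)"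
    using eq[of s] eq[of t] st martingaleD(3)[OF X st B] martingaleD(3)[OF Y st B] by simp
qed

lemma martingale_cong_AE:
  assumes X: "martingale P F X" and Y: "adapted F Y" and eq: "\<And>t. 0 \<le> t \<Longrightarrow> AE \<omega> in P. X t \<omega> = Y t \<omega>"
  shows "martingale P F Y"
  unfolding martingale_iff
proof (intro conjI allI impI ballI Y)
  have Ym: "Y t \<in> borel_measurable P" if "0 \<le> t" for t
    using Y that by (auto simp: adapted_def intro: measurable_F_P)
  show "integrable P (Y t)" if "0 \<le> t" for t
    using integrable_cong_AE[of "X t" P "Y t"] martingaleD(2)[OF X that] Ym[OF that] eq[OF that] by auto
  fix s t B assume st: "0 \<le> (s::real)" "s \<le> t" and B: "B \<in> sets (F s)"
  have BP: "B \<in> events" by (rule sets_F_P[OF st(1) B])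
  have "(\<integral>\<omega>. indicator B \<omega> * Y u \<omega> \<partial>P) = (\<integral>\<omega>. indicator B \<omega> * X u \<omega> \<partial>P)" if u: "0 \<le> u" for u
    by (rule integral_cong_AE) (use eq[OF u] Ym[OF u] martingaleD(2)[OF X u] BP in auto)
  then show "(\<integral>\<omega>. indicator B \<omega> * Y t \<omega> \<partial>P) = (\<integral>\<omega>. indicator B \<omega> * Y s \<omega> \<partial>P)"
    using martingaleD(3)[OF X st B] st by simp
qed

lemma LM_cong_AE:
  assumes M: "M \<in> LM" and M': "M' \<in> AC" and eq: "AE \<omega> in P. \<forall>t\<ge>0. M t \<omega> = M' t \<omega>"
  shows "M' \<in> LM"
proof -
  have N: "(\<lambda>t \<omega>. M' t \<omega> - M' 0 \<omega>) \<in> AC" by (rule AC_diff[OF M' AC_init[OF M']])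
  from M obtain T where T: "\<And>n. extended_stopping_time F (T n)"
    "AE \<omega> in P. incseq (\<lambda>n. T n \<omega>) \<and> (\<lambda>n. T n \<omega>) \<longlonglongrightarrow> \<infinity>"
    "\<And>n. martingale P F (stopped (\<lambda>t \<omega>. M t \<omega> - M 0 \<omega>) (T n))"
    unfolding continuous_local_martingales_def local_martingale_def by auto
  have "martingale P F (stopped (\<lambda>t \<omega>. M' t \<omega> - M' 0 \<omega>) (T n))" for n
  proof (rule martingale_cong_AE[OF T(3)])
    show "adapted F (stopped (\<lambda>t \<omega>. M' t \<omega> - M' 0 \<omega>) (T n))"
      using stopped_measurable[OF N T(1)] by (simp add: adapted_def)
    show "AE \<omega> in P. stopped (\<lambda>t \<omega>. M t \<omega> - M 0 \<omega>) (T n) t \<omega> = stopped (\<lambda>t \<omega>. M' t \<omega> - M' 0 \<omega>) (T n) t \<omega>" for t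
      using eq by eventually_elim (simp add: stopped_def)
  qed
  then show ?thesis using T(1,2) M' unfolding continuous_local_martingales_def local_martingale_def AC_def by auto
qed

text \<open>Stopping at the n-th localising time and at T gives martingales bounded by k, which at
  each time eventually agree with the target. Dominated convergence removes the localising
  sequence.\<close>

lemma LM_stopped_bounded:
  assumes M: "M \<in> LM" and T: "extended_stopping_time F T"
    and b: "\<And>t \<omega>. \<lbrakk>0 \<le> t; \<omega> \<in> space P\<rbrakk> \<Longrightarrow> \<bar>stopped M T t \<omega> - M 0 \<omega>\<bar> \<le> k"
  shows "martingale P F (\<lambda>t \<omega>. stopped M T t \<omega> - M 0 \<omega>)"
proof -
  let ?N = "\<lambda>t \<omega>. M t \<omega> - M 0 \<omega>" and ?Q = "\<lambda>t \<omega>. stopped M T t \<omega> - M 0 \<omega>"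
  have N: "?N \<in> AC" by (rule AC_diff[OF LM_AC[OF M] AC_init[OF LM_AC[OF M]]])
  have QN: "?Q = stopped ?N T" by (simp add: stopped_def)
  from M obtain S where S: "\<And>n. extended_stopping_time F (S n)"
    "AE \<omega> in P. incseq (\<lambda>n. S n \<omega>) \<and> (\<lambda>n. S n \<omega>) \<longlonglongrightarrow> \<infinity>"
    "\<And>n. martingale P F (stopped ?N (S n))"
    unfolding continuous_local_martingales_def local_martingale_def by auto
  define R where "R n = stopped (stopped ?N (S n)) T" for n
  have R: "martingale P F (R n)" for n
    unfolding R_def by (rule optional_stopping[OF S(3) stopped_AC[OF N S(1)] T])
  \<comment> \<open>The two stops commute, so R n is the target process read at a possibly earlier
    time and inherits its bound.\<close>
  have Req: "R n t \<omega> = ?Q (enn2real (min (ennreal t) (S n \<omega>))) \<omega>" if "0 \<le> t" for n t \<omega>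
    unfolding R_def stopped_def ennreal_enn2real_min by (simp add: ac_simps)
  have Rb: "\<bar>R n t \<omega>\<bar> \<le> k" if "0 \<le> t" "\<omega> \<in> space P" for n t \<omega>
    using b[of "enn2real (min (ennreal t) (S n \<omega>))" \<omega>] that by (simp add: Req)
  have Rlim: "AE \<omega> in P. (\<lambda>n. R n t \<omega>) \<longlonglongrightarrow> ?Q t \<omega>" if t: "0 \<le> t" for t
    using S(2)
  proof eventually_elim
    case (elim \<omega>)
    then have "\<forall>\<^sub>F n in sequentially. ennreal t < S n \<omega>" by (intro order_tendstoD(1)[of _ \<infinity>]) auto
    then have "\<forall>\<^sub>F n in sequentially. R n t \<omega> = ?Q t \<omega>"
      by eventually_elim (use t in \<open>simp add: Req min_def less_imp_le\<close>)
    then show ?case by (rule tendsto_eventually)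
  qed
  have Qm: "?Q t \<in> borel_measurable (F t)" if "0 \<le> t" for t
    using stopped_measurable[OF N T that] by (simp add: stopped_def[abs_def])
  show ?thesis unfolding martingale_iff adapted_def
  proof (intro conjI allI impI ballI Qm)
    show "integrable P (?Q t)" if t: "0 \<le> t" for t
      by (rule integrable_const_bound[where B = k]) (use b t measurable_F_P[OF Qm[OF t] t] in auto)
    fix s t B assume st: "0 \<le> (s::real)" "s \<le> t" and B: "B \<in> sets (F s)"
    have BP: "B \<in> events" by (rule sets_F_P[OF st(1) B])
    have lim: "(\<lambda>n. \<integral>\<omega>. indicator B \<omega> * R n u \<omega> \<partial>P) \<longlonglongrightarrow> (\<integral>\<omega>. indicator B \<omega> * ?Q u \<omega> \<partial>P)" if u: "0 \<le> u" for u
    proof (rule integral_dominated_convergence[where w = "\<lambda>_. k"])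
      show "(\<lambda>\<omega>. indicator B \<omega> * ?Q u \<omega>) \<in> borel_measurable P"
        using measurable_F_P[OF Qm[OF u] u] BP by measurable
      show "(\<lambda>\<omega>. indicator B \<omega> * R n u \<omega>) \<in> borel_measurable P" for n
        using martingaleD(2)[OF R u] BP by measurable
      show "AE \<omega> in P. (\<lambda>n. indicator B \<omega> * R n u \<omega>) \<longlonglongrightarrow> indicator B \<omega> * ?Q u \<omega>"
        using Rlim[OF u] by eventually_elim (intro tendsto_mult tendsto_const)
      show "AE \<omega> in P. norm (indicator B \<omega> * R n u \<omega>) \<le> k" for n
        using Rb[OF u, of _ n] by (intro AE_I2) (auto simp: indicator_def intro: order_trans[OF abs_ge_zero])
    qed simp
    show "(\<integral>\<omega>. indicator B \<omega> * ?Q t \<omega> \<partial>P) = (\<integral>\<omega>. indicator B \<omega> * ?Q s \<omega> \<partial>P)"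
      using LIMSEQ_unique[OF lim[of t]] lim[of s] st martingaleD(3)[OF R st B] by simp
  qed
qed

text \<open>The entrance time bounds U only at positive times; the value at time 0 is supplied by D
  0 = 0.\<close>

lemma stopped_hit_bound:
  assumes U: "U \<in> AC" and w: "\<omega> \<in> space P" and t: "0 \<le> t" and k: "0 \<le> k"
    and T: "T \<le> hit U k \<omega>" and D: "D 0 = 0" "\<And>r. 0 \<le> r \<Longrightarrow> \<bar>D r\<bar> \<le> U r \<omega>"
  shows "\<bar>D (enn2real (min (ennreal t) T))\<bar> \<le> k"
proof (cases "enn2real (min (ennreal t) T) = 0")
  case False
  let ?r = "enn2real (min (ennreal t) T)"
  have r: "0 < ?r" using False by (simp add: order_less_le)
  have "ennreal ?r = min (ennreal t) T" by (rule ennreal_enn2real_min)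
  then have "ennreal ?r \<le> hit U k \<omega>" using T by (simp add: min.coboundedI2)
  from hit_bound[OF U w r this] show ?thesis using D(2)[of ?r] r by simp
qed (use D k in simp)

lemma LM_stopped_hit:
  assumes M: "M \<in> LM" and T: "extended_stopping_time F T" and U: "U \<in> AC" and k: "0 \<le> k"
    and le: "\<And>\<omega>. \<omega> \<in> space P \<Longrightarrow> T \<omega> \<le> hit U k \<omega>" and MU: "\<And>t \<omega>. 0 \<le> t \<Longrightarrow> \<bar>M t \<omega> - M 0 \<omega>\<bar> \<le> U t \<omega>"
  shows "martingale P F (\<lambda>t \<omega>. stopped M T t \<omega> - M 0 \<omega>)"
    and "\<lbrakk>0 \<le> t; \<omega> \<in> space P\<rbrakk> \<Longrightarrow> \<bar>stopped M T t \<omega> - M 0 \<omega>\<bar> \<le> k"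
proof -
  show b: "\<bar>stopped M T t \<omega> - M 0 \<omega>\<bar> \<le> k" if "0 \<le> t" "\<omega> \<in> space P" for t \<omega>
    unfolding stopped_def
    by (rule stopped_hit_bound[OF U that(2,1) k le[OF that(2)], where D = "\<lambda>t. M t \<omega> - M 0 \<omega>"]) (use MU in auto)
  show "martingale P F (\<lambda>t \<omega>. stopped M T t \<omega> - M 0 \<omega>)"
    by (rule LM_stopped_bounded[OF M T b])
qed

text \<open>The levels 1, 2, 3, ... of any continuous nonnegative U give a localising sequence, so
  the martingale property need only be checked where U bounds whatever the argument
  requires.\<close>

lemma LM_hitI:
  assumes M: "M \<in> AC" and U: "U \<in> AC" "\<And>t \<omega>. 0 \<le> U t \<omega>"
    and m: "\<And>n. martingale P F (\<lambda>t \<omega>. stopped M (hit U (real (Suc n))) t \<omega> - M 0 \<omega>)"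
  shows "M \<in> LM"
proof -
  have "local_martingale P F (\<lambda>t \<omega>. M t \<omega> - M 0 \<omega>)" unfolding local_martingale_def
  proof (intro exI[of _ "\<lambda>n. hit U (real (Suc n))"] conjI allI)
    show "extended_stopping_time F (hit U (real (Suc n)))" for n by (rule hit_stopping_time[OF U])
    show "AE \<omega> in P. incseq (\<lambda>n. hit U (real (Suc n)) \<omega>) \<and> (\<lambda>n. hit U (real (Suc n)) \<omega>) \<longlonglongrightarrow> \<infinity>"
      by (intro AE_I2 conjI incseq_SucI hit_mono hit_tendsto_top[OF U(1)]) auto
    show "martingale P F (stopped (\<lambda>t \<omega>. M t \<omega> - M 0 \<omega>) (hit U (real (Suc n))))" for n
      using m[of n] by (simp add: stopped_def)
  qed
  then show ?thesis using M by (simp add: continuous_local_martingales_def AC_def)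
qed

text \<open>The entrance times of the sum of both absolute deviations localise the two summands
  simultaneously.\<close>

lemma LM_lin:
  assumes M: "M \<in> LM" and N: "N \<in> LM"
  shows "(\<lambda>t \<omega>. a * M t \<omega> + b * N t \<omega>) \<in> LM"
proof -
  let ?U = "\<lambda>t \<omega>. \<bar>M t \<omega> - M 0 \<omega>\<bar> + \<bar>N t \<omega> - N 0 \<omega>\<bar>"
  note MA = LM_AC[OF M] and NA = LM_AC[OF N]
  have U: "?U \<in> AC" by (intro AC_add AC_abs AC_diff AC_init MA NA)
  have U0: "\<And>t \<omega>. 0 \<le> ?U t \<omega>" by simp
  show ?thesis
  proof (rule LM_hitI[OF _ U U0])
    show "(\<lambda>t \<omega>. a * M t \<omega> + b * N t \<omega>) \<in> AC" by (intro AC_add AC_scale MA NA)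
    fix n
    let ?T = "hit ?U (real (Suc n))"
    have T: "extended_stopping_time F ?T" by (rule hit_stopping_time[OF U U0])
    have "martingale P F (\<lambda>t \<omega>. a * (stopped M ?T t \<omega> - M 0 \<omega>) + b * (stopped N ?T t \<omega> - N 0 \<omega>))"
      by (intro martingale_lin LM_stopped_hit(1)[OF M T U, of "real (Suc n)"]
          LM_stopped_hit(1)[OF N T U, of "real (Suc n)"]) auto
    then show "martingale P F (\<lambda>t \<omega>. stopped (\<lambda>t \<omega>. a * M t \<omega> + b * N t \<omega>) ?T t \<omega> - (a * M 0 \<omega> + b * N 0 \<omega>))"
      by (simp add: stopped_def algebra_simps)
  qed
qed

lemma LM_zero: "(\<lambda>t \<omega>. 0) \<in> LM"
proof (rule LM_hitI[OF AC_const AC_const[of 0]])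
  show "martingale P F (\<lambda>t \<omega>. stopped (\<lambda>t \<omega>. 0) (hit (\<lambda>t \<omega>. 0) (real (Suc n))) t \<omega> - 0)" for n
    unfolding martingale_iff by (simp add: stopped_def adapted_def)
qed simp

text \<open>The cross terms vanish by orthogonality. Each square is at most d^2 times a squared
  increment of N, whose expectations telescope to at most the second moment at the last point, hence
  to k^2.\<close>

lemma simple_integral_L2:
  assumes N: "N \<in> AC" "martingale P F N" and b: "\<And>t \<omega>. \<lbrakk>0 \<le> t; \<omega> \<in> space P\<rbrakk> \<Longrightarrow> \<bar>N t \<omega>\<bar> \<le> k"
    and H: "simple_predictable P F H" and c: "\<And>i \<omega>. \<lbrakk>i < steps H; \<omega> \<in> space P\<rbrakk> \<Longrightarrow> \<bar>coef H i \<omega>\<bar> \<le> d"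
    and t: "0 \<le> t" and d: "0 \<le> d"
  shows "integrable P (\<lambda>\<omega>. simple_integral H N t \<omega>)" "integrable P (\<lambda>\<omega>. (simple_integral H N t \<omega>)\<^sup>2)"
    "(\<integral>\<omega>. (simple_integral H N t \<omega>)\<^sup>2 \<partial>P) \<le> d\<^sup>2 * k\<^sup>2"
proof -
  let ?a = "\<lambda>i. min (grid H i) t" and ?\<xi> = "coef H"
  let ?D = "\<lambda>i \<omega>. N (?a (Suc i)) \<omega> - N (?a i) \<omega>"
  define S where "S j \<omega> = (\<Sum>i<j. ?\<xi> i \<omega> * ?D i \<omega>)" for j \<omega>
  note h = simple_predictableD[OF H]
  obtain \<omega>0 where w0: "\<omega>0 \<in> space P" using not_empty by auto
  have k: "0 \<le> k" using b[OF t w0] by linarith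
  have a0: "0 \<le> ?a i" if "i \<le> steps H" for i using h(3)[OF that] t by simp
  have aS: "?a i \<le> ?a (Suc i)" if "i < steps H" for i using h(4)[OF that] by auto
  have Nm: "N u \<in> borel_measurable P" if "0 \<le> u" for u by (rule AC_measurable[OF N(1) that])
  have \<xi>P: "?\<xi> i \<in> borel_measurable P" if "i < steps H" for i
    using measurable_F_P[OF h(5)[OF that]] h(3)[of i] that by simp
  have Sm: "S j \<in> borel_measurable P" if "j \<le> steps H" for j
    unfolding S_def using that a0 by (intro borel_measurable_sum borel_measurable_times borel_measurable_diff Nm \<xi>P) auto
  have Db: "\<bar>?D i \<omega>\<bar> \<le> 2 * k" if "i < steps H" "\<omega> \<in> space P" for i \<omega>
    using b[OF a0 that(2), of i] b[OF a0 that(2), of "Suc i"] that by linarith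
  have Sb: "\<bar>S j \<omega>\<bar> \<le> real j * (d * (2 * k))" if "j \<le> steps H" "\<omega> \<in> space P" for j \<omega>
  proof -
    have "\<bar>S j \<omega>\<bar> \<le> (\<Sum>i<j. \<bar>?\<xi> i \<omega> * ?D i \<omega>\<bar>)" unfolding S_def by (rule sum_abs)
    also have "\<dots> \<le> (\<Sum>i<j. d * (2 * k))"
      unfolding abs_mult using that c Db d by (intro sum_mono mult_mono) auto
    finally show ?thesis by simp
  qed
  have ib: "integrable P f" if "f \<in> borel_measurable P" "\<And>\<omega>. \<omega> \<in> space P \<Longrightarrow> \<bar>f \<omega>\<bar> \<le> C" for f :: "'a \<Rightarrow> real" and C
    by (rule integrable_const_bound[where B = C]) (use that in auto)
  have iN2: "integrable P (\<lambda>\<omega>. (N u \<omega>)\<^sup>2)" if u: "0 \<le> u" for u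
  proof (rule ib[of _ "k\<^sup>2"])
    show "\<bar>(N u \<omega>)\<^sup>2\<bar> \<le> k\<^sup>2" if "\<omega> \<in> space P" for \<omega> using abs_le_square_iff[of "N u \<omega>" k] b[OF u that] by simp
  qed (use Nm[OF u] in measurable)
  have iS2: "integrable P (\<lambda>\<omega>. (S j \<omega>)\<^sup>2)" if j: "j \<le> steps H" for j
  proof (rule ib[of _ "(real j * (d * (2 * k)))\<^sup>2"])
    show "\<bar>(S j \<omega>)\<^sup>2\<bar> \<le> (real j * (d * (2 * k)))\<^sup>2" if "\<omega> \<in> space P" for \<omega>
      using abs_le_square_iff[of "S j \<omega>" "real j * (d * (2 * k))"] Sb[OF j that] d k by simp
  qed (use Sm[OF j] in measurable)
  have main: "(\<integral>\<omega>. (S j \<omega>)\<^sup>2 \<partial>P) \<le> d\<^sup>2 * ((\<integral>\<omega>. (N (?a j) \<omega>)\<^sup>2 \<partial>P) - (\<integral>\<omega>. (N (?a 0) \<omega>)\<^sup>2 \<partial>P))"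
    if "j \<le> steps H" for j
    using that
  proof (induction j)
    case (Suc j)
    then have j: "j < steps H" "j \<le> steps H" by auto
    have SS: "S (Suc j) \<omega> = S j \<omega> + ?\<xi> j \<omega> * ?D j \<omega>" for \<omega> by (simp add: S_def)
    show ?case
    \<comment> \<open>For a cell starting at or after t the coefficient is not measurable at the
      truncated point, but its increment is zero.\<close>
    proof (cases "grid H j < t")
      case False
      then have "?a j = t" "?a (Suc j) = t" using h(4)[OF j(1)] by auto
      then have "S (Suc j) \<omega> = S j \<omega>" for \<omega> by (simp add: SS)
      then show ?thesis using Suc.IH[OF j(2)] \<open>?a j = t\<close> \<open>?a (Suc j) = t\<close> by simp
    next
      case True
      then have aj: "?a j = grid H j" by simp
      have g0: "0 \<le> ?a j" and gS: "?a j \<le> ?a (Suc j)" and g1: "0 \<le> ?a (Suc j)"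
        using a0[OF j(2)] aS[OF j(1)] a0[of "Suc j"] j by auto
      have \<xi>F: "?\<xi> j \<in> borel_measurable (F (?a j))" using h(5)[OF j(1)] aj by simp
      have SF: "S j \<in> borel_measurable (F (?a j))" unfolding S_def
      proof (intro borel_measurable_sum borel_measurable_times borel_measurable_diff)
        fix i assume i: "i \<in> {..<j}"
        then have le: "grid H i \<le> grid H j" "grid H (Suc i) \<le> grid H j" "0 \<le> grid H i" "0 \<le> grid H (Suc i)"
          using mono_onD[OF h(1), of i j] mono_onD[OF h(1), of "Suc i" j] h(3)[of i] h(3)[of "Suc i"] j by auto
        show "?\<xi> i \<in> borel_measurable (F (?a j))"
          using measurable_F_le[OF h(5), of i "?a j"] i j le aj by auto
        show "N (?a (Suc i)) \<in> borel_measurable (F (?a j))" "N (?a i) \<in> borel_measurable (F (?a j))"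
          using le t True by (auto intro!: AC_measurable_F_le[OF N(1)])
      qed
      have cross: "integrable P (\<lambda>\<omega>. (S j \<omega> * ?\<xi> j \<omega>) * ?D j \<omega>)" "(\<integral>\<omega>. (S j \<omega> * ?\<xi> j \<omega>) * ?D j \<omega> \<partial>P) = 0"
      proof -
        have 1: "(\<lambda>\<omega>. S j \<omega> * ?\<xi> j \<omega>) \<in> borel_measurable (F (?a j))" using SF \<xi>F by (rule borel_measurable_times)
        have 2: "\<bar>S j \<omega> * ?\<xi> j \<omega>\<bar> \<le> (real j * (d * (2 * k))) * d" if "\<omega> \<in> space P" for \<omega>
          unfolding abs_mult using Sb[OF j(2) that] c[OF j(1) that] d k by (intro mult_mono) auto
        show "integrable P (\<lambda>\<omega>. (S j \<omega> * ?\<xi> j \<omega>) * ?D j \<omega>)" "(\<integral>\<omega>. (S j \<omega> * ?\<xi> j \<omega>) * ?D j \<omega> \<partial>P) = 0"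
          using martingale_mult_increment[OF N(2) g0 gS 1 2] by blast+
      qed
      have crossN: "integrable P (\<lambda>\<omega>. N (?a j) \<omega> * ?D j \<omega>)" "(\<integral>\<omega>. N (?a j) \<omega> * ?D j \<omega> \<partial>P) = 0"
        using martingale_mult_increment[OF N(2) g0 gS AC_measurable_F[OF N(1) g0] b[OF g0]] by blast+
      \<comment> \<open>The mixed term has mean zero, which makes the expected squared increment a
        difference of second moments.\<close>
      have D2: "(?D j \<omega>)\<^sup>2 = (N (?a (Suc j)) \<omega>)\<^sup>2 - (N (?a j) \<omega>)\<^sup>2 - 2 * (N (?a j) \<omega> * ?D j \<omega>)" for \<omega>
        by (simp add: power2_eq_square algebra_simps)
      have iD2: "integrable P (\<lambda>\<omega>. (?D j \<omega>)\<^sup>2)"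
        unfolding D2 by (intro Bochner_Integration.integrable_diff integrable_mult_right iN2 g0 g1 crossN(1))
      have ED2: "(\<integral>\<omega>. (?D j \<omega>)\<^sup>2 \<partial>P) = (\<integral>\<omega>. (N (?a (Suc j)) \<omega>)\<^sup>2 \<partial>P) - (\<integral>\<omega>. (N (?a j) \<omega>)\<^sup>2 \<partial>P)"
        unfolding D2 using crossN iN2[OF g0] iN2[OF g1] by simp
      have \<xi>2: "(?\<xi> j \<omega> * ?D j \<omega>)\<^sup>2 \<le> d\<^sup>2 * (?D j \<omega>)\<^sup>2" if "\<omega> \<in> space P" for \<omega>
        unfolding power_mult_distrib using abs_le_square_iff[of "?\<xi> j \<omega>" d] c[OF j(1) that] d
        by (intro mult_right_mono) auto
      have i\<xi>2: "integrable P (\<lambda>\<omega>. (?\<xi> j \<omega> * ?D j \<omega>)\<^sup>2)"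
        by (rule Bochner_Integration.integrable_bound[OF integrable_mult_right[OF iD2, of "d\<^sup>2"]])
          (use \<xi>2 \<xi>P[OF j(1)] Nm[OF g0] Nm[OF g1] in auto)
      have "(\<integral>\<omega>. (S (Suc j) \<omega>)\<^sup>2 \<partial>P) = (\<integral>\<omega>. (S j \<omega>)\<^sup>2 + 2 * ((S j \<omega> * ?\<xi> j \<omega>) * ?D j \<omega>) + (?\<xi> j \<omega> * ?D j \<omega>)\<^sup>2 \<partial>P)"
        unfolding SS by (simp add: power2_sum mult.assoc add.commute add.left_commute)
      also have "\<dots> = (\<integral>\<omega>. (S j \<omega>)\<^sup>2 \<partial>P) + (\<integral>\<omega>. (?\<xi> j \<omega> * ?D j \<omega>)\<^sup>2 \<partial>P)"
        using iS2[OF j(2)] cross i\<xi>2 by simp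
      also have "(\<integral>\<omega>. (?\<xi> j \<omega> * ?D j \<omega>)\<^sup>2 \<partial>P) \<le> (\<integral>\<omega>. d\<^sup>2 * (?D j \<omega>)\<^sup>2 \<partial>P)"
        by (rule integral_mono[OF i\<xi>2 integrable_mult_right[OF iD2] \<xi>2])
      also have "\<dots> = d\<^sup>2 * ((\<integral>\<omega>. (N (?a (Suc j)) \<omega>)\<^sup>2 \<partial>P) - (\<integral>\<omega>. (N (?a j) \<omega>)\<^sup>2 \<partial>P))"
        using iD2 by (simp add: ED2)
      finally show ?thesis using Suc.IH[OF j(2)] by (simp add: right_diff_distrib)
    qed
  qed (simp add: S_def)
  have eq: "simple_integral H N t = S (steps H)" by (simp add: S_def simple_integral_def fun_eq_iff)
  show "integrable P (\<lambda>\<omega>. simple_integral H N t \<omega>)"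
    unfolding eq by (rule ib[OF Sm Sb]) auto
  show "integrable P (\<lambda>\<omega>. (simple_integral H N t \<omega>)\<^sup>2)" unfolding eq by (rule iS2) simp
  have "(\<integral>\<omega>. (N (?a (steps H)) \<omega>)\<^sup>2 \<partial>P) \<le> (\<integral>\<omega>. k\<^sup>2 \<partial>P)"
    by (rule integral_mono[OF iN2[OF a0[OF order_refl]]])
      (use b[OF a0[OF order_refl]] abs_le_square_iff[of "N (?a (steps H)) _" k] k in auto)
  moreover have "(\<integral>\<omega>. k\<^sup>2 \<partial>P) = k\<^sup>2" by (simp add: prob_space)
  moreover have "0 \<le> (\<integral>\<omega>. (N (?a 0) \<omega>)\<^sup>2 \<partial>P)" by simp
  ultimately have "(\<integral>\<omega>. (N (?a (steps H)) \<omega>)\<^sup>2 \<partial>P) - (\<integral>\<omega>. (N (?a 0) \<omega>)\<^sup>2 \<partial>P) \<le> k\<^sup>2"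
    by linarith
  then show "(\<integral>\<omega>. (simple_integral H N t \<omega>)\<^sup>2 \<partial>P) \<le> d\<^sup>2 * k\<^sup>2"
    unfolding eq using main[OF order_refl] mult_left_mono[of _ "k\<^sup>2" "d\<^sup>2"] by (meson order_trans zero_le_power2)
qed

lemma simple_integral_martingale:
  assumes N: "martingale P F N"
    and H: "simple_predictable P F H" and st: "0 \<le> s" "s \<le> t" and B: "B \<in> sets (F s)"
  shows "(\<integral>\<omega>. indicator B \<omega> * (simple_integral H N t \<omega> - simple_integral H N s \<omega>) \<partial>P) = 0"
proof -
  \<comment> \<open>Grid points clamped to [s,t]: every surviving increment starts after s, so the
    indicator of B joins the coefficient as a known multiplier.\<close>
  let ?c = "\<lambda>i. max s (min (grid H i) t)"
  note h = simple_predictableD[OF H]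
  obtain C where C: "0 \<le> C" "\<And>i \<omega>. \<lbrakk>i < steps H; \<omega> \<in> space P\<rbrakk> \<Longrightarrow> \<bar>coef H i \<omega>\<bar> \<le> C"
    using simple_predictable_bound[OF H] by blast
  have eq: "indicator B \<omega> * (simple_integral H N t \<omega> - simple_integral H N s \<omega>) =
    (\<Sum>i<steps H. (indicator B \<omega> * coef H i \<omega>) * (N (?c (Suc i)) \<omega> - N (?c i) \<omega>))" for \<omega>
  proof -
    have "simple_integral H N t \<omega> - simple_integral H N s \<omega> =
      (\<Sum>i<steps H. coef H i \<omega> * ((N (min (grid H (Suc i)) t) \<omega> - N (min (grid H i) t) \<omega>) -
        (N (min (grid H (Suc i)) s) \<omega> - N (min (grid H i) s) \<omega>)))"
      by (simp add: simple_integral_def sum_subtractf right_diff_distrib)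
    also have "\<dots> = (\<Sum>i<steps H. coef H i \<omega> * (N (?c (Suc i)) \<omega> - N (?c i) \<omega>))"
      by (rule sum.cong[OF refl])
        (use h(4) st(2) in \<open>simp add: four_point_clamp[of "grid H _" "grid H (Suc _)" s t "\<lambda>u. N u \<omega>"]\<close>)
    finally show ?thesis by (simp add: sum_distrib_left mult.assoc)
  qed
  have "integrable P (\<lambda>\<omega>. (indicator B \<omega> * coef H i \<omega>) * (N (?c (Suc i)) \<omega> - N (?c i) \<omega>)) \<and>
    (\<integral>\<omega>. (indicator B \<omega> * coef H i \<omega>) * (N (?c (Suc i)) \<omega> - N (?c i) \<omega>) \<partial>P) = 0" if i: "i < steps H" for i
  proof (cases "grid H i < t")
    case False
    then have "?c (Suc i) = ?c i" using h(4)[OF i] by auto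
    then show ?thesis by simp
  next
    case True
    have c: "0 \<le> ?c i" "?c i \<le> ?c (Suc i)" "grid H i \<le> ?c i" "s \<le> ?c i"
      using st h(4)[OF i] True by auto
    have 1: "(\<lambda>\<omega>. indicator B \<omega> * coef H i \<omega>) \<in> borel_measurable (F (?c i))"
    proof (rule borel_measurable_times)
      show "(indicator B :: 'a \<Rightarrow> real) \<in> borel_measurable (F (?c i))"
        by (rule measurable_F_le[OF _ st(1) c(4)]) (use B in simp)
      show "coef H i \<in> borel_measurable (F (?c i))"
        by (rule measurable_F_le[OF h(5)[OF i] _ c(3)]) (use h(3)[of i] i in simp)
    qed
    have 2: "\<bar>indicator B \<omega> * coef H i \<omega>\<bar> \<le> C" if "\<omega> \<in> space P" for \<omega>
      using C(2)[OF i that] C(1) by (auto simp: indicator_def)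
    show ?thesis using martingale_mult_increment[OF N c(1,2) 1 2] by blast
  qed
  then show ?thesis unfolding eq by (simp add: Bochner_Integration.integral_sum)
qed

lemma extended_stopping_time_min:
  assumes "extended_stopping_time F S" "extended_stopping_time F T"
  shows "extended_stopping_time F (\<lambda>\<omega>. min (S \<omega>) (T \<omega>))"
  unfolding extended_stopping_time_def
proof (intro allI impI)
  fix t :: real assume "0 \<le> t"
  then have [measurable]: "Measurable.pred (F t) (\<lambda>\<omega>. S \<omega> \<le> ennreal t)" "Measurable.pred (F t) (\<lambda>\<omega>. T \<omega> \<le> ennreal t)"
    using assms by (auto simp: extended_stopping_time_def)
  show "Measurable.pred (F t) (\<lambda>\<omega>. min (S \<omega>) (T \<omega>) \<le> ennreal t)"
    unfolding min_le_iff_disj by measurable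
qed

lemma simple_integral_stopped:
  assumes H: "simple_predictable P F H" and t: "0 \<le> t"
  shows "simple_integral H (\<lambda>t \<omega>. stopped M T t \<omega> - M 0 \<omega>) t \<omega> = simple_integral H M (enn2real (min (ennreal t) (T \<omega>))) \<omega>"
  unfolding simple_integral_def stopped_def
  by (rule sum.cong) (use simple_predictableD(3)[OF H] t in \<open>auto simp: enn2real_min_min\<close>)

text \<open>Stopping also at the first time the integral exceeds \<open>e\<close> turns the \<open>L\<^sup>2\<close> bound at time \<open>t\<close>
  into a bound for the supremum, so that no maximal inequality is needed.\<close>

lemma good_LM:
  assumes M: "M \<in> LM"
  shows "good M"
  unfolding good_def
proof (intro conjI allI impI LM_AC[OF M])
  note MA = LM_AC[OF M]
  fix t e :: real assume te: "0 \<le> t" "0 < e"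
  let ?U = "\<lambda>t \<omega>. \<bar>M t \<omega> - M 0 \<omega>\<bar>"
  have U: "?U \<in> AC" by (intro AC_abs AC_diff AC_init MA)
  have U0: "\<And>t \<omega>. 0 \<le> ?U t \<omega>" by simp
  obtain K :: nat where K: "hp (e/4) (\<lambda>\<omega>. \<forall>s\<in>{0..t}. \<bar>?U s \<omega>\<bar> \<le> real K)"
    using AC_tight[OF U te(1), of "e/4"] te by auto
  \<comment> \<open>One more than K, so that a path bounded by K on [0,t] has not reached level k by
    time t.\<close>
  define k where "k = real (Suc K)"
  have k: "0 < k" by (simp add: k_def)
  \<comment> \<open>The value e^3 / (8 * k^2) makes the Chebyshev bound d^2 * k^2 / e^2 smaller than
    e/4, d \<le> 1 gives d^2 \<le> d, and e/4 is the share of the probability for the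
    integrand.\<close>
  define d where "d = min (e/4) (min 1 (e^3 / (8 * k\<^sup>2)))"
  have d: "0 < d" "d \<le> e/4" "d \<le> 1" "d \<le> e^3 / (8 * k\<^sup>2)" using te k by (auto simp: d_def)
  have "d\<^sup>2 \<le> d" using d by (simp add: power2_eq_square mult_left_le)
  then have d2: "d\<^sup>2 * k\<^sup>2 < e\<^sup>2 * (e/4)"
  proof -
    have "d\<^sup>2 * k\<^sup>2 \<le> e^3 / (8 * k\<^sup>2) * k\<^sup>2"
      using \<open>d\<^sup>2 \<le> d\<close> d(4) by (intro mult_right_mono) auto
    also have "\<dots> = e^3 / 8" using k by simp
    also have "\<dots> < e\<^sup>2 * (e/4)" using te by (simp add: power3_eq_cube power2_eq_square)
    finally show ?thesis .
  qed
  have "small t e (simple_integral H M)"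
    if H: "simple_predictable P F H" "small t d (simple_process H)" for H
  proof -
    let ?H = "clip_integrand d H"
    note h = simple_predictableD[OF H(1)]
    have H': "simple_predictable P F ?H" by (rule clip_integrand_predictable[OF H(1)]) (use d in simp)
    let ?V = "\<lambda>t \<omega>. \<bar>simple_integral ?H M t \<omega>\<bar>"
    have V: "?V \<in> AC" by (intro AC_abs simple_integral_AC[OF H' MA])
    have V0: "\<And>t \<omega>. 0 \<le> ?V t \<omega>" by simp
    define R where "R \<omega> = min (hit ?U k \<omega>) (hit ?V e \<omega>)" for \<omega>
    have R: "extended_stopping_time F R" unfolding R_def
      by (intro extended_stopping_time_min hit_stopping_time U V) auto
    let ?N = "\<lambda>t \<omega>. stopped M R t \<omega> - M 0 \<omega>"
    have N: "martingale P F ?N" "\<And>t \<omega>. \<lbrakk>0 \<le> t; \<omega> \<in> space P\<rbrakk> \<Longrightarrow> \<bar>?N t \<omega>\<bar> \<le> k"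
      using LM_stopped_hit[OF M R U, of k] k by (auto simp: R_def)
    have NA: "?N \<in> AC" by (intro AC_diff stopped_AC[OF MA R] AC_init MA)
    have cd: "\<bar>coef ?H i \<omega>\<bar> \<le> d" for i \<omega> using abs_clip_le[of d] d by simp
    have "0 \<le> d" using d by simp
    note L2 = simple_integral_L2[OF NA N H' cd te(1) \<open>0 \<le> d\<close>]
    let ?f = "simple_integral ?H ?N t"
    let ?C = "{\<omega>\<in>space P. e \<le> \<bar>?f \<omega>\<bar>}"
    have [measurable]: "?f \<in> borel_measurable P" using L2(1) by auto
    have C: "?C \<in> events" by measurable
    \<comment> \<open>Chebyshev's inequality at the single time t.\<close>
    have "e\<^sup>2 * prob ?C = (\<integral>\<omega>. e\<^sup>2 * indicator ?C \<omega> \<partial>P)" using C by simp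
    also have "\<dots> \<le> (\<integral>\<omega>. (?f \<omega>)\<^sup>2 \<partial>P)"
    proof (rule integral_mono[OF _ L2(2)])
      fix \<omega>
      show "e\<^sup>2 * indicator ?C \<omega> \<le> (?f \<omega>)\<^sup>2"
        using abs_le_square_iff[of e "?f \<omega>"] te by (auto simp: indicator_def)
    qed (use C in \<open>auto intro!: integrable_mult_right integrable_real_indicator simp: less_top[symmetric]\<close>)
    also have "\<dots> < e\<^sup>2 * (e/4)" using L2(3) d2 by linarith
    finally have pC: "prob ?C < e/4" using te by simp
    have hpC: "hp (e/4) (\<lambda>\<omega>. \<bar>?f \<omega>\<bar> < e)"
      by (rule hpI[OF C pC]) auto
    have "hp (e/4 + e/4 + e/4) (\<lambda>\<omega>. ((\<forall>s\<in>{0..t}. \<bar>simple_process H s \<omega>\<bar> \<le> d) \<and> (\<forall>s\<in>{0..t}. \<bar>?U s \<omega>\<bar> \<le> real K)) \<and> \<bar>?f \<omega>\<bar> < e)"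
      by (intro hp_conj K hpC) (rule hp_mono[OF H(2)[unfolded small_def] d(2)])
    then show ?thesis unfolding small_def
    proof (rule hp_mono)
      show "e/4 + e/4 + e/4 \<le> e" using te by simp
      fix \<omega> assume w: "\<omega> \<in> space P" and good: "((\<forall>s\<in>{0..t}. \<bar>simple_process H s \<omega>\<bar> \<le> d) \<and> (\<forall>s\<in>{0..t}. \<bar>?U s \<omega>\<bar> \<le> real K)) \<and> \<bar>?f \<omega>\<bar> < e"
      show "\<forall>s\<in>{0..t}. \<bar>simple_integral H M s \<omega>\<bar> \<le> e"
      proof (rule ccontr)
        assume "\<not> (\<forall>s\<in>{0..t}. \<bar>simple_integral H M s \<omega>\<bar> \<le> e)"
        then obtain s where s: "s \<in> {0..t}" "e < \<bar>simple_integral H M s \<omega>\<bar>" by (auto simp: not_le)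
        have "simple_integral ?H M s \<omega> = simple_integral H M s \<omega>"
          using good by (intro clip_integrand_integral[OF h(1,2) _ s(1)]) auto
        then have "\<exists>r\<in>{0..s}. e \<le> ?V r \<omega>" using s by (intro bexI[of _ s]) auto
        then have "hit ?V e \<omega> \<le> ennreal s" using s hit_le_iff[OF V w, of s e] by simp
        moreover have st: "ennreal s \<le> ennreal t" using s(1) by (intro ennreal_leI) auto
        ultimately have ht: "hit ?V e \<omega> \<le> ennreal t" by (rule order_trans)
        have "\<not> hit ?U k \<omega> \<le> ennreal t"
        proof
          assume "hit ?U k \<omega> \<le> ennreal t"
          then obtain r where "r \<in> {0..t}" "k \<le> ?U r \<omega>" using hit_le_iff[OF U w te(1)] by auto
          then show False using good by (force simp: k_def)
        qed
        \<comment> \<open>On a good path that exceeds e the process is stopped by the integral, not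
          by M. Its stopped value at t is then at least e in modulus, which the good event
          excludes.\<close>
        then have R: "R \<omega> = hit ?V e \<omega>" using ht by (auto simp: R_def min_def)
        then have "min (ennreal t) (R \<omega>) = hit ?V e \<omega>" using ht by (simp add: min_absorb2)
        then have "?f \<omega> = simple_integral ?H M (enn2real (hit ?V e \<omega>)) \<omega>"
          using simple_integral_stopped[OF H' te(1), of M R \<omega>] by simp
        moreover have "e \<le> ?V (enn2real (hit ?V e \<omega>)) \<omega>"
          by (rule hit_attained[OF V w]) (use ht in \<open>auto simp: top_unique\<close>)
        ultimately show False using good by simp
      qed
    qed
  qed
  then show "\<exists>d>0. \<forall>H. simple_predictable P F H \<longrightarrow> small t d (simple_process H) \<longrightarrow> small t e (simple_integral H M)"
    using d(1) by blast
qed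

text \<open>Convergence in probability alone does not pass to integrals; a common L2 bound controls
  what happens on the exceptional events. Only means over B are claimed, and these are all that the
  martingale property uses.\<close>

lemma L2_bounded_limit:
  fixes f :: "nat \<Rightarrow> 'a \<Rightarrow> real"
  assumes f: "\<And>n. integrable P (f n)" "\<And>n. integrable P (\<lambda>\<omega>. (f n \<omega>)\<^sup>2)" "\<And>n. (\<integral>\<omega>. (f n \<omega>)\<^sup>2 \<partial>P) \<le> C"
    and g: "g \<in> borel_measurable P" "\<And>\<omega>. \<omega> \<in> space P \<Longrightarrow> \<bar>g \<omega>\<bar> \<le> k"
    and lim: "\<And>e. 0 < e \<Longrightarrow> \<forall>\<^sub>F n in sequentially. hp e (\<lambda>\<omega>. \<bar>f n \<omega> - g \<omega>\<bar> \<le> e)" and B: "B \<in> events"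
  shows "(\<lambda>n. \<integral>\<omega>. indicator B \<omega> * f n \<omega> \<partial>P) \<longlonglongrightarrow> (\<integral>\<omega>. indicator B \<omega> * g \<omega> \<partial>P)"
proof (rule LIMSEQ_I)
  fix r :: real assume r: "0 < r"
  have ig: "integrable P g" by (rule integrable_const_bound[where B = k]) (use g in auto)
  have g2: "(g \<omega>)\<^sup>2 \<le> k\<^sup>2" if "\<omega> \<in> space P" for \<omega>
    using g(2)[OF that] abs_le_square_iff[of "g \<omega>" k] by simp
  have C0: "0 \<le> C" using f(3)[of 0] by (rule order_trans[rotated]) simp
  \<comment> \<open>C' bounds the second moment of f n - g, and K makes C' / K at most r/4, the
    summand 1 keeping K positive. With e and K * e at most r/8 the total stays below r.\<close>
  define C' where "C' = 2 * C + 2 * k\<^sup>2"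
  define K where "K = 4 * C' / r + 1"
  have C'0: "0 \<le> C'" using C0 by (simp add: C'_def)
  have K: "0 < K" "C' / K \<le> r / 4"
    using C'0 r by (auto simp: K_def divide_simps algebra_simps add_pos_nonneg intro!: add_nonneg_pos)
  define e where "e = min (r / 8) (r / (8 * K))"
  have e: "0 < e" "e \<le> r / 8" "K * e \<le> r / 8"
  proof -
    show "0 < e" "e \<le> r / 8" using r K by (auto simp: e_def)
    have "K * e \<le> K * (r / (8 * K))" using K by (intro mult_left_mono) (auto simp: e_def)
    then show "K * e \<le> r / 8" using K by simp
  qed
  from lim[OF e(1)] obtain no where no: "\<And>n. no \<le> n \<Longrightarrow> hp e (\<lambda>\<omega>. \<bar>f n \<omega> - g \<omega>\<bar> \<le> e)"
    by (auto simp: eventually_sequentially)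
  have "norm ((\<integral>\<omega>. indicator B \<omega> * f n \<omega> \<partial>P) - (\<integral>\<omega>. indicator B \<omega> * g \<omega> \<partial>P)) < r" if n: "no \<le> n" for n
  proof -
    obtain A where A: "A \<in> events" "prob A < e" "\<And>\<omega>. \<lbrakk>\<omega> \<in> space P; \<omega> \<notin> A\<rbrakk> \<Longrightarrow> \<bar>f n \<omega> - g \<omega>\<bar> \<le> e"
      using hpD[OF no[OF n]] by blast
    have sq: "(x - y)\<^sup>2 \<le> 2 * x\<^sup>2 + 2 * y\<^sup>2" for x y :: real
      using zero_le_power2[of "x + y"] by (simp add: power2_sum power2_diff)
    let ?b = "\<lambda>\<omega>. e + (2 * (f n \<omega>)\<^sup>2 + 2 * k\<^sup>2) / K + K * indicator A \<omega>"
    have iA: "integrable P (indicator A :: 'a \<Rightarrow> real)"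
      using A(1) by (intro integrable_real_indicator) (auto simp: less_top[symmetric])
    have ib: "integrable P ?b" using f(2) iA by (intro Bochner_Integration.integrable_add) auto
    have "norm ((\<integral>\<omega>. indicator B \<omega> * f n \<omega> \<partial>P) - (\<integral>\<omega>. indicator B \<omega> * g \<omega> \<partial>P))
      = \<bar>\<integral>\<omega>. indicator B \<omega> * (f n \<omega> - g \<omega>) \<partial>P\<bar>"
      using indicator_mult_integrable[OF f(1) B, of n] indicator_mult_integrable[OF ig B]
      by (simp add: right_diff_distrib)
    also have "\<dots> \<le> (\<integral>\<omega>. \<bar>indicator B \<omega> * (f n \<omega> - g \<omega>)\<bar> \<partial>P)" by (rule integral_abs_bound)
    also have "\<dots> \<le> (\<integral>\<omega>. ?b \<omega> \<partial>P)"
    proof (rule integral_mono[OF _ ib])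
      show "integrable P (\<lambda>\<omega>. \<bar>indicator B \<omega> * (f n \<omega> - g \<omega>)\<bar>)"
        by (intro integrable_abs indicator_mult_integrable Bochner_Integration.integrable_diff f ig B)
      fix \<omega> assume w: "\<omega> \<in> space P"
      let ?x = "f n \<omega> - g \<omega>"
      have "\<bar>indicator B \<omega> * ?x\<bar> \<le> \<bar>?x\<bar>" by (auto simp: indicator_def)
      \<comment> \<open>On the exceptional event \<bar>x\<bar> is at most K or at most x^2 / K;
        elsewhere it is at most e.\<close>
      also have "\<bar>?x\<bar> \<le> e + ?x\<^sup>2 / K + K * indicator A \<omega>"
      proof (cases "\<omega> \<in> A")
        case True
        have "\<bar>?x\<bar> \<le> ?x\<^sup>2 / K + K"
        proof (cases "\<bar>?x\<bar> \<le> K")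
          case False
          then have "\<bar>?x\<bar> * K \<le> \<bar>?x\<bar> * \<bar>?x\<bar>" by (intro mult_left_mono) auto
          then have "\<bar>?x\<bar> \<le> ?x\<^sup>2 / K" using K by (simp add: pos_le_divide_eq power2_eq_square)
          then show ?thesis using K by simp
        qed (use K in \<open>simp add: add_increasing\<close>)
        then show ?thesis using True e by simp
      next
        case False
        have "0 \<le> ?x\<^sup>2 / K" using K by simp
        then show ?thesis using A(3)[OF w False] False by simp
      qed
      also have "?x\<^sup>2 / K \<le> (2 * (f n \<omega>)\<^sup>2 + 2 * k\<^sup>2) / K"
        using sq[of "f n \<omega>" "g \<omega>"] g2[OF w] K by (intro divide_right_mono) auto
      finally show "\<bar>indicator B \<omega> * ?x\<bar> \<le> ?b \<omega>" by simp
    qed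
    also have "(\<integral>\<omega>. ?b \<omega> \<partial>P) = e + (2 * (\<integral>\<omega>. (f n \<omega>)\<^sup>2 \<partial>P) + 2 * k\<^sup>2) / K + K * prob A"
    proof -
      have "?b = (\<lambda>\<omega>. (e + 2 * k\<^sup>2 / K) + (2 / K) * (f n \<omega>)\<^sup>2 + K * indicator A \<omega>)"
        by (simp add: fun_eq_iff add_divide_distrib)
      then have "(\<integral>\<omega>. ?b \<omega> \<partial>P) = (\<integral>\<omega>. (e + 2 * k\<^sup>2 / K) + (2 / K) * (f n \<omega>)\<^sup>2 + K * indicator A \<omega> \<partial>P)"
        by simp
      also have "\<dots> = (e + 2 * k\<^sup>2 / K) + (2 / K) * (\<integral>\<omega>. (f n \<omega>)\<^sup>2 \<partial>P) + K * prob A"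
        using f(2)[of n] iA A(1) by (simp add: prob_space)
      finally show ?thesis by (simp add: add_divide_distrib)
    qed
    also have "\<dots> \<le> e + C' / K + K * e"
      using f(3)[of n] A(2) K by (intro add_mono divide_right_mono mult_left_mono) (auto simp: C'_def)
    also have "\<dots> < r" using e K r by linarith
    finally show ?thesis .
  qed
  then show "\<exists>no. \<forall>n\<ge>no. norm ((\<integral>\<omega>. indicator B \<omega> * f n \<omega> \<partial>P) - (\<integral>\<omega>. indicator B \<omega> * g \<omega> \<partial>P)) < r" by blast
qed

end

section \<open>Stability of continuous semimartingales\<close>

lemma abs_clip_le_abs: "0 \<le> c \<Longrightarrow> \<bar>clip c x\<bar> \<le> \<bar>x\<bar>"
  by (auto simp: clip_def)

text \<open>A variant for paths watched up to r: a cell starting at r or later has no increment, so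
  its coefficient may be arbitrarily large.\<close>

lemma clip_integrand_integral_coef:
  assumes mono: "mono_on {..steps H} (grid H)"
    and c: "\<And>i. \<lbrakk>i < steps H; grid H i < r\<rbrakk> \<Longrightarrow> \<bar>coef H i \<omega>\<bar> \<le> c"
  shows "simple_integral (clip_integrand c H) Y r \<omega> = simple_integral H Y r \<omega>"
  unfolding simple_integral_def
proof (simp, rule sum.cong[OF refl])
  fix i assume "i \<in> {..<steps H}"
  then have i: "i < steps H" "grid H i \<le> grid H (Suc i)" using mono_onD[OF mono, of i "Suc i"] by auto
  show "clip c (coef H i \<omega>) * (Y (min (grid H (Suc i)) r) \<omega> - Y (min (grid H i) r) \<omega>) =
    coef H i \<omega> * (Y (min (grid H (Suc i)) r) \<omega> - Y (min (grid H i) r) \<omega>)"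
  proof (cases "grid H i < r")
    case True
    then show ?thesis using c[OF i(1)] by (simp add: clip_eq)
  next
    case False
    then have "min (grid H (Suc i)) r = min (grid H i) r" using i by auto
    then show ?thesis by simp
  qed
qed

section \<open>Summation by parts\<close>

definition quadratic_sum :: "nat \<Rightarrow> (nat \<Rightarrow> real) \<Rightarrow> 'a process \<Rightarrow> 'a process \<Rightarrow> 'a process" where
  "quadratic_sum N \<tau> X Y = (\<lambda>t \<omega>. \<Sum>i<N. (X (min (\<tau> (Suc i)) t) \<omega> - X (min (\<tau> i) t) \<omega>) *
     (Y (min (\<tau> (Suc i)) t) \<omega> - Y (min (\<tau> i) t) \<omega>))"

text \<open>For a cell not yet begun the increment is zero, so its weight may be read at time t
  instead. This makes each term a function of the path up to t and prepares telescoping.\<close>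

lemma riemann_term_min:
  assumes "\<tau> i \<le> (\<tau> (Suc i) :: real)"
  shows "(X (\<tau> i) :: real) * (Y (min (\<tau> (Suc i)) t) - Y (min (\<tau> i) t)) =
    X (min (\<tau> i) t) * (Y (min (\<tau> (Suc i)) t) - Y (min (\<tau> i) t))"
  using assms by (cases "\<tau> i \<le> t") (auto simp: min_def)

context complete_filtered_prob_space
begin

lemma summation_by_parts:
  assumes \<tau>: "\<tau> 0 = 0" "mono_on {..N} \<tau>" and t: "0 \<le> t"
  shows "X (min (\<tau> N) t) \<omega> * Y (min (\<tau> N) t) \<omega> - X 0 \<omega> * Y 0 \<omega> =
    riemann_sum N \<tau> X Y t \<omega> + riemann_sum N \<tau> Y X t \<omega> + quadratic_sum N \<tau> X Y t \<omega>"
proof -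
  let ?x = "\<lambda>i. X (min (\<tau> i) t) \<omega>" and ?y = "\<lambda>i. Y (min (\<tau> i) t) \<omega>"
  have le: "\<tau> i \<le> \<tau> (Suc i)" if "i < N" for i using mono_onD[OF \<tau>(2), of i "Suc i"] that by auto
  have "riemann_sum N \<tau> X Y t \<omega> + riemann_sum N \<tau> Y X t \<omega> + quadratic_sum N \<tau> X Y t \<omega>
    = (\<Sum>i<N. ?x (Suc i) * ?y (Suc i) - ?x i * ?y i)"
    unfolding riemann_sum_def quadratic_sum_def sum.distrib[symmetric]
  proof (rule sum.cong[OF refl])
    fix i assume "i \<in> {..<N}"
    then have l: "\<tau> i \<le> \<tau> (Suc i)" using le by auto
    note * = riemann_term_min[of \<tau> i "\<lambda>u. X u \<omega>" "\<lambda>u. Y u \<omega>" t, OF l] riemann_term_min[of \<tau> i "\<lambda>u. Y u \<omega>" "\<lambda>u. X u \<omega>" t, OF l]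
    show "X (\<tau> i) \<omega> * (?y (Suc i) - ?y i) + Y (\<tau> i) \<omega> * (?x (Suc i) - ?x i) + (?x (Suc i) - ?x i) * (?y (Suc i) - ?y i)
      = ?x (Suc i) * ?y (Suc i) - ?x i * ?y i"
      unfolding * by (simp add: algebra_simps)
  qed
  also have "\<dots> = ?x N * ?y N - ?x 0 * ?y 0"
    by (rule sum_lessThan_telescope[where f = "\<lambda>i. ?x i * ?y i"])
  finally show ?thesis using \<tau>(1) t by simp
qed

lemma ito_rel_0:
  assumes X: "X \<in> AC" and I: "ito_rel X Y I"
  shows "AE \<omega> in P. I 0 \<omega> = 0"
proof -
  obtain r :: "nat \<Rightarrow> nat" where "AE \<omega> in P. \<forall>t\<ge>0. (\<lambda>k. riemann_sum (4 ^ r k) (dyadic (r k)) X Y t \<omega>) \<longlonglongrightarrow> I t \<omega>"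
    using ucp_subsequence[OF riemann_sum_ucp[OF X I dyadic_grids]] by blast
  then show ?thesis
  proof eventually_elim
    case (elim \<omega>)
    have "riemann_sum (4 ^ k) (dyadic k) X Y 0 \<omega> = 0" for k
      unfolding riemann_sum_def by (rule sum.neutral) (simp add: min_absorb2 dyadic_simps)
    then have "(\<lambda>k. 0 :: real) \<longlonglongrightarrow> I 0 \<omega>" using elim by (auto dest: spec[of _ 0])
    then show ?case by (simp add: LIMSEQ_const_iff)
  qed
qed

text \<open>Stopped when X, M or I gets large, the simple integrals are martingales with a common L2
  bound and converge in probability to the stopped I; \<open>L2_bounded_limit\<close> passes their
  martingale property on.\<close>

lemma ito_rel_LM:
  assumes X: "X \<in> AC" and M: "M \<in> LM" and I: "ito_rel X M I"
  shows "I \<in> LM"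
proof -
  have IA: "I \<in> AC" using I by (simp add: ito_rel_def)
  note MA = LM_AC[OF M]
  let ?U = "\<lambda>t \<omega>. \<bar>X t \<omega>\<bar> + \<bar>M t \<omega> - M 0 \<omega>\<bar> + \<bar>I t \<omega> - I 0 \<omega>\<bar>"
  have U: "?U \<in> AC" by (intro AC_add AC_abs AC_diff AC_init X MA IA)
  have U0: "\<And>t \<omega>. 0 \<le> ?U t \<omega>" by simp
  show ?thesis
  proof (rule LM_hitI[OF IA U U0])
    fix n0 :: nat
    define k where "k = real (Suc n0)"
    have k: "0 \<le> k" by (simp add: k_def)
    define T where "T = hit ?U k"
    have T: "extended_stopping_time F T" unfolding T_def by (rule hit_stopping_time[OF U U0])
    let ?Q = "\<lambda>t \<omega>. stopped I T t \<omega> - I 0 \<omega>" and ?N = "\<lambda>t \<omega>. stopped M T t \<omega> - M 0 \<omega>"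
    have N: "martingale P F ?N" "\<And>t \<omega>. \<lbrakk>0 \<le> t; \<omega> \<in> space P\<rbrakk> \<Longrightarrow> \<bar>?N t \<omega>\<bar> \<le> k"
      using LM_stopped_hit[OF M T U k] by (auto simp: T_def)
    have NA: "?N \<in> AC" by (intro AC_diff stopped_AC[OF MA T] AC_init MA)
    have QA: "?Q \<in> AC" by (intro AC_diff stopped_AC[OF IA T] AC_init IA)
    have Qb: "\<bar>?Q t \<omega>\<bar> \<le> k" if "0 \<le> t" "\<omega> \<in> space P" for t \<omega>
      unfolding stopped_def
      by (rule stopped_hit_bound[OF U that(2,1) k, where D = "\<lambda>t. I t \<omega> - I 0 \<omega>"]) (auto simp: T_def)
    let ?G = "\<lambda>n. grid_approx n (4 ^ n) (dyadic n) X"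
    \<comment> \<open>The level n inside \<open>?G n\<close> grows and gives no uniform bound. The
      second level k does, and it is invisible up to the stopping time.\<close>
    let ?H = "\<lambda>n. clip_integrand k (?G n)"
    have G: "simple_predictable P F (?G n)" for n by (rule grid_approx_predictable[OF X dyadic_simps(1,2)])
    have H: "simple_predictable P F (?H n)" for n by (rule clip_integrand_predictable[OF G k])
    have cb: "\<bar>coef (?H n) i \<omega>\<bar> \<le> k" for n i \<omega> using abs_clip_le[OF k] by simp
    let ?f = "\<lambda>u n \<omega>. simple_integral (?H n) ?N u \<omega>"
    have uI: "ucp (\<lambda>n. simple_integral (?G n) M) I"
      by (rule ito_rel_ucp[OF I G grid_approx_ucp[OF X dyadic_grids]])
    have lim: "\<forall>\<^sub>F n in sequentially. hp e (\<lambda>\<omega>. \<bar>?f u n \<omega> - ?Q u \<omega>\<bar> \<le> e)" if u: "0 \<le> u" and e: "0 < e" for u e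
    proof -
      have e2: "0 < e/2" using e by simp
      from ucpD[OF uI u e2] show ?thesis
      proof eventually_elim
        case (elim n)
        from hp_conj[OF elim[unfolded small_def] hp_AE[OF ito_rel_0[OF X I] e2]]
        show ?case
        proof (rule hp_mono)
          fix \<omega> assume w: "\<omega> \<in> space P"
            and g: "(\<forall>s\<in>{0..u}. \<bar>simple_integral (?G n) M s \<omega> - I s \<omega>\<bar> \<le> e / 2) \<and> I 0 \<omega> = 0"
          let ?r = "enn2real (min (ennreal u) (T \<omega>))"
          have r: "0 \<le> ?r" "?r \<le> u" using u by (auto simp: enn2real_min_ennreal)
          have "?f u n \<omega> = simple_integral (?H n) M ?r \<omega>" by (rule simple_integral_stopped[OF H u])
          also have "\<dots> = simple_integral (?G n) M ?r \<omega>"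
          proof (rule clip_integrand_integral_coef)
            \<comment> \<open>Only cells begun strictly before the stopping time count, and there X
              is below k. A large initial value makes the stopping time 0 and leaves no such
              cell.\<close>
            fix i assume i: "i < steps (?G n)" "grid (?G n) i < ?r"
            have "ennreal (dyadic n i) < ennreal ?r" using i(2) dyadic_simps(3)[of n i] by (simp add: ennreal_less_iff)
            also have "\<dots> \<le> T \<omega>" unfolding ennreal_enn2real_min by simp
            finally have "\<not> hit ?U k \<omega> \<le> ennreal (dyadic n i)" by (simp add: T_def not_le)
            then have "\<not> (\<exists>q\<in>{0..dyadic n i}. k \<le> ?U q \<omega>)" using hit_le_iff[OF U w dyadic_simps(3)] by simp
            then have "\<not> k \<le> ?U (dyadic n i) \<omega>" using dyadic_simps(3)[of n i] by (meson atLeastAtMost_iff order_refl)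
            then have "\<bar>X (dyadic n i) \<omega>\<bar> \<le> k" by linarith
            then show "\<bar>coef (?G n) i \<omega>\<bar> \<le> k" using abs_clip_le_abs[of "real n" "X (dyadic n i) \<omega>"] by simp
          qed (simp add: dyadic_simps)
          finally have "?f u n \<omega> = simple_integral (?G n) M ?r \<omega>" .
          moreover have "?Q u \<omega> = I ?r \<omega>" using g by (simp add: stopped_def)
          moreover have "\<bar>simple_integral (?G n) M ?r \<omega> - I ?r \<omega>\<bar> \<le> e / 2" using g r by auto
          ultimately show "\<bar>?f u n \<omega> - ?Q u \<omega>\<bar> \<le> e" using e by linarith
        qed simp
      qed
    qed
    have "martingale P F ?Q" unfolding martingale_iff adapted_def
    proof (intro conjI allI impI ballI AC_measurable_F[OF QA])
      show "integrable P (?Q t)" if "0 \<le> t" for t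
        by (rule integrable_const_bound[where B = k]) (use Qb[OF that] AC_measurable[OF QA that] in auto)
      fix s t B assume st: "0 \<le> (s::real)" "s \<le> t" and B: "B \<in> sets (F s)"
      have BP: "B \<in> events" by (rule sets_F_P[OF st(1) B])
      have conv: "(\<lambda>n. \<integral>\<omega>. indicator B \<omega> * ?f u n \<omega> \<partial>P) \<longlonglongrightarrow> (\<integral>\<omega>. indicator B \<omega> * ?Q u \<omega> \<partial>P)" if u: "0 \<le> u" for u
        by (rule L2_bounded_limit[where C = "k\<^sup>2 * k\<^sup>2" and k = k])
          (use simple_integral_L2[OF NA N H cb u k] AC_measurable[OF QA u] Qb[OF u] lim[OF u] BP in auto)
      have t: "0 \<le> t" using st by simp
      have "(\<integral>\<omega>. indicator B \<omega> * ?f t n \<omega> \<partial>P) = (\<integral>\<omega>. indicator B \<omega> * ?f s n \<omega> \<partial>P)" for n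
        using simple_integral_martingale[OF N(1) H st B, of n]
          indicator_mult_integrable[OF simple_integral_L2(1)[OF NA N H cb t k] BP, of n]
          indicator_mult_integrable[OF simple_integral_L2(1)[OF NA N H cb st(1) k] BP, of n]
        by (simp add: right_diff_distrib)
      then show "(\<integral>\<omega>. indicator B \<omega> * ?Q t \<omega> \<partial>P) = (\<integral>\<omega>. indicator B \<omega> * ?Q s \<omega> \<partial>P)"
        using LIMSEQ_unique[OF conv[OF t]] conv[OF st(1)] by simp
    qed
    then show "martingale P F (\<lambda>t \<omega>. stopped I (hit ?U (real (Suc n0))) t \<omega> - I 0 \<omega>)"
      by (simp add: T_def k_def)
  qed
qed

section \<open>The vector space of continuous semimartingales\<close>

abbreviation "SM \<equiv> semimartingales P F"

lemma SM_cases: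
  assumes "X \<in> SM"
  obtains A M where "A \<in> BV" "M \<in> LM" "X = (\<lambda>t \<omega>. A t \<omega> + M t \<omega>)"
  using assms unfolding semimartingales_def process_add_def by blast

lemma SM_I: "\<lbrakk>A \<in> BV; M \<in> LM\<rbrakk> \<Longrightarrow> (\<lambda>t \<omega>. A t \<omega> + M t \<omega>) \<in> SM"
  unfolding semimartingales_def process_add_def by blast

lemma SM_AC: "X \<in> SM \<Longrightarrow> X \<in> AC"
  by (elim SM_cases) (simp add: AC_add BV_AC LM_AC)

lemma SM_good: "X \<in> SM \<Longrightarrow> good X"
  by (elim SM_cases) (simp add: good_add good_BV good_LM)

lemma BV_lin: "\<lbrakk>A \<in> BV; B \<in> BV\<rbrakk> \<Longrightarrow> (\<lambda>t \<omega>. a * A t \<omega> + b * B t \<omega>) \<in> BV"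
  by (rule BVI) (intro AC_add AC_scale BV_AC locally_bounded_variation_lin BV_path; assumption)+

lemma BV_const: "(\<lambda>t \<omega>. c) \<in> BV"
  by (rule BVI[OF AC_const], rule locally_bounded_variation_mono) simp

lemma BV_SM: "A \<in> BV \<Longrightarrow> A \<in> SM"
  using SM_I[OF _ LM_zero, of A] by simp

lemma SM_lin:
  assumes "X \<in> SM" "Y \<in> SM"
  shows "(\<lambda>t \<omega>. a * X t \<omega> + b * Y t \<omega>) \<in> SM"
proof -
  obtain A M where 1: "A \<in> BV" "M \<in> LM" "X = (\<lambda>t \<omega>. A t \<omega> + M t \<omega>)" using assms(1) by (rule SM_cases)
  obtain B N where 2: "B \<in> BV" "N \<in> LM" "Y = (\<lambda>t \<omega>. B t \<omega> + N t \<omega>)" using assms(2) by (rule SM_cases)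
  have "(\<lambda>t \<omega>. a * X t \<omega> + b * Y t \<omega>) = (\<lambda>t \<omega>. (a * A t \<omega> + b * B t \<omega>) + (a * M t \<omega> + b * N t \<omega>))"
    by (simp add: 1 2 algebra_simps)
  then show ?thesis using SM_I[OF BV_lin[OF 1(1) 2(1)] LM_lin[OF 1(2) 2(2)]] by simp
qed

lemma AE_null_set:
  assumes "AE \<omega> in P. Q \<omega>"
  obtains N where "N \<in> null_sets P" "\<And>\<omega>. \<lbrakk>\<omega> \<in> space P; \<omega> \<notin> N\<rbrakk> \<Longrightarrow> Q \<omega>"
proof -
  obtain N where "{\<omega>\<in>space P. \<not> Q \<omega>} \<subseteq> N" "emeasure P N = 0" "N \<in> events"
    using assms by (elim AE_E)
  then show ?thesis by (intro that[of N]) (auto simp: null_sets_def)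
qed

lemma SM_cong_AE:
  assumes X: "X \<in> SM" and X': "X' \<in> AC" and eq: "AE \<omega> in P. \<forall>t\<ge>0. X t \<omega> = X' t \<omega>"
  shows "X' \<in> SM"
proof -
  obtain A M where 1: "A \<in> BV" "M \<in> LM" "X = (\<lambda>t \<omega>. A t \<omega> + M t \<omega>)" using X by (rule SM_cases)
  \<comment> \<open>The discrepancy is put into the martingale part, since bounded variation is
    required on every path but the local martingale property only almost surely.\<close>
  have AM: "(\<lambda>t \<omega>. X' t \<omega> - A t \<omega>) \<in> AC" by (intro AC_diff X' BV_AC 1)
  have "(\<lambda>t \<omega>. X' t \<omega> - A t \<omega>) \<in> LM"
    by (rule LM_cong_AE[OF 1(2) AM]) (use eq in eventually_elim, auto simp: 1(3))
  from SM_I[OF 1(1) this] show ?thesis by simp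
qed

text \<open>Membership in BV concerns all paths, while limits give bounded variation only almost
  surely; completeness allows the remaining paths to be set to 0.\<close>

lemma BV_modification:
  assumes A: "A \<in> AC" and lbv: "AE \<omega> in P. locally_bounded_variation (\<lambda>t. A t \<omega>)"
  obtains A' where "A' \<in> BV" "AE \<omega> in P. \<forall>t\<ge>0. A t \<omega> = A' t \<omega>"
proof -
  obtain N where N: "N \<in> null_sets P" "\<And>\<omega>. \<lbrakk>\<omega> \<in> space P; \<omega> \<notin> N\<rbrakk> \<Longrightarrow> locally_bounded_variation (\<lambda>t. A t \<omega>)"
    using AE_null_set[OF lbv] by blast
  let ?A = "\<lambda>t \<omega>. if \<omega> \<in> N then 0 else A t \<omega>"
  have "?A \<in> BV"
  proof (rule BVI[OF AC_null_modify[OF AC_const A N(1)]])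
    show "locally_bounded_variation (\<lambda>t. if \<omega> \<in> N then 0 else A t \<omega>)" if "\<omega> \<in> space P" for \<omega>
      using N(2)[OF that] locally_bounded_variation_mono[of "\<lambda>t. 0"] by (cases "\<omega> \<in> N") simp_all
  qed
  moreover have "AE \<omega> in P. \<forall>t\<ge>0. A t \<omega> = ?A t \<omega>"
    using AE_not_in[OF N(1)] by eventually_elim auto
  ultimately show ?thesis by (rule that)
qed

section \<open>Bilinearity and range of the Ito integral\<close>

abbreviation "ito \<equiv> ito_integral P F"
abbreviation "qc \<equiv> quadratic_covariation P F"

lemma ito_AC: "\<lbrakk>X \<in> AC; Y \<in> SM\<rbrakk> \<Longrightarrow> ito X Y \<in> AC"
  using ito_rel_ito_integral[OF _ SM_good] by (auto simp: ito_rel_def)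

lemma ito_0: "\<lbrakk>X \<in> AC; Y \<in> SM\<rbrakk> \<Longrightarrow> AE \<omega> in P. ito X Y 0 \<omega> = 0"
  by (rule ito_rel_0[OF _ ito_rel_ito_integral[OF _ SM_good]])

lemma riemann_sum_ucp_ito:
  "\<lbrakk>X \<in> AC; Y \<in> SM; grids_tending_to_identity N \<tau>\<rbrakk> \<Longrightarrow> ucp (\<lambda>n. riemann_sum (N n) (\<tau> n) X Y) (ito X Y)"
  by (rule riemann_sum_ucp[OF _ ito_rel_ito_integral[OF _ SM_good]])

lemma riemann_sum_lin_right:
  "riemann_sum N \<tau> X (\<lambda>t \<omega>. a * Y t \<omega> + b * Z t \<omega>) t \<omega> = a * riemann_sum N \<tau> X Y t \<omega> + b * riemann_sum N \<tau> X Z t \<omega>"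
  unfolding riemann_sum_def sum_distrib_left sum.distrib[symmetric] by (intro sum.cong) (auto simp: algebra_simps)

lemma riemann_sum_lin_left:
  "riemann_sum N \<tau> (\<lambda>t \<omega>. a * X t \<omega> + b * Y t \<omega>) Z t \<omega> = a * riemann_sum N \<tau> X Z t \<omega> + b * riemann_sum N \<tau> Y Z t \<omega>"
  unfolding riemann_sum_def sum_distrib_left sum.distrib[symmetric] by (intro sum.cong) (auto simp: algebra_simps)

lemma ucp_lin:
  "\<lbrakk>ucp J I; ucp J' I'\<rbrakk> \<Longrightarrow> ucp (\<lambda>n s \<omega>. a * J n s \<omega> + b * J' n s \<omega>) (\<lambda>s \<omega>. a * I s \<omega> + b * I' s \<omega>)"
  by (intro ucp_add ucp_scale)

lemma ito_lin_right:
  assumes X: "X \<in> AC" and Y: "Y \<in> SM" and Z: "Z \<in> SM"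
  shows "AE \<omega> in P. \<forall>t\<ge>0. ito X (\<lambda>t \<omega>. a * Y t \<omega> + b * Z t \<omega>) t \<omega> = a * ito X Y t \<omega> + b * ito X Z t \<omega>"
  by (rule ucp_unique[OF riemann_sum_ucp_ito[OF X SM_lin[OF Y Z] dyadic_grids]])
    (unfold riemann_sum_lin_right[abs_def], intro ucp_lin riemann_sum_ucp_ito X Y Z dyadic_grids)

lemma ito_lin_left:
  assumes X: "X \<in> AC" and Y: "Y \<in> AC" and Z: "Z \<in> SM"
  shows "AE \<omega> in P. \<forall>t\<ge>0. ito (\<lambda>t \<omega>. a * X t \<omega> + b * Y t \<omega>) Z t \<omega> = a * ito X Z t \<omega> + b * ito Y Z t \<omega>"
  by (rule ucp_unique[OF riemann_sum_ucp_ito[OF AC_add[OF AC_scale[OF X] AC_scale[OF Y]] Z dyadic_grids]])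
    (unfold riemann_sum_lin_left[abs_def], intro ucp_lin riemann_sum_ucp_ito X Y Z dyadic_grids)

lemma ito_SM:
  assumes X: "X \<in> AC" and Y: "Y \<in> SM"
  shows "ito X Y \<in> SM"
proof -
  obtain A M where 1: "A \<in> BV" "M \<in> LM" "Y = (\<lambda>t \<omega>. A t \<omega> + M t \<omega>)" using Y by (rule SM_cases)
  have M: "M \<in> SM" using SM_I[OF BV_const[of 0] 1(2)] by simp
  note A = BV_SM[OF 1(1)]
  have "AE \<omega> in P. locally_bounded_variation (\<lambda>t. ito X A t \<omega>)"
    by (rule ito_rel_BV_path[OF X 1(1) ito_rel_ito_integral[OF X SM_good[OF A]]])
  then obtain A' where A': "A' \<in> BV" "AE \<omega> in P. \<forall>t\<ge>0. ito X A t \<omega> = A' t \<omega>"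
    using BV_modification[OF ito_AC[OF X A]] by blast
  have "ito X M \<in> LM" by (rule ito_rel_LM[OF X 1(2) ito_rel_ito_integral[OF X SM_good[OF M]]])
  from SM_I[OF A'(1) this] show ?thesis
  proof (rule SM_cong_AE[OF _ ito_AC[OF X Y]])
    have "AE \<omega> in P. \<forall>t\<ge>0. ito X Y t \<omega> = ito X A t \<omega> + ito X M t \<omega>"
      using ito_lin_right[OF X A M, of 1 1] by (simp add: 1(3))
    then show "AE \<omega> in P. \<forall>t\<ge>0. A' t \<omega> + ito X M t \<omega> = ito X Y t \<omega>"
      using A'(2) by eventually_elim auto
  qed
qed

section \<open>Quadratic covariation\<close>

text \<open>Summation by parts leaves a boundary term at the last grid point cut off at t;
  eventually that point lies beyond the horizon.\<close>

lemma ucp_min_time: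
  assumes J: "ucp J I" and g: "grids_tending_to_identity N \<tau>"
  shows "ucp (\<lambda>n t. J n (min (\<tau> n (N n)) t)) I"
  unfolding ucp_def
proof (intro allI impI)
  fix t e :: real assume te: "0 \<le> t" "0 < e"
  from ucpD[OF J te] gridsD(3)[OF g, of t]
  show "\<forall>\<^sub>F n in sequentially. small t e (\<lambda>s \<omega>. J n (min (\<tau> n (N n)) s) \<omega> - I s \<omega>)"
    by eventually_elim (auto simp: small_def min_absorb2 elim!: hp_mono)
qed

lemma quadratic_sum_AC:
  assumes "X \<in> AC" "Y \<in> AC" "\<And>i. i \<le> N \<Longrightarrow> 0 \<le> \<tau> i"
  shows "quadratic_sum N \<tau> X Y \<in> AC"
  unfolding quadratic_sum_def by (intro AC_sum AC_mult AC_diff AC_min_time assms) auto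

lemma quadratic_sum_ucp:
  assumes X: "X \<in> SM" and Y: "Y \<in> SM" and g: "grids_tending_to_identity N \<tau>"
  shows "ucp (\<lambda>n. quadratic_sum (N n) (\<tau> n) X Y)
    (\<lambda>t \<omega>. X t \<omega> * Y t \<omega> - X 0 \<omega> * Y 0 \<omega> - ito X Y t \<omega> - ito Y X t \<omega>)"
proof -
  let ?Z = "\<lambda>t \<omega>. X t \<omega> * Y t \<omega>"
  have "ucp (\<lambda>n t \<omega>. ?Z (min (\<tau> n (N n)) t) \<omega> - X 0 \<omega> * Y 0 \<omega> - riemann_sum (N n) (\<tau> n) X Y t \<omega> - riemann_sum (N n) (\<tau> n) Y X t \<omega>)
    (\<lambda>t \<omega>. X t \<omega> * Y t \<omega> - X 0 \<omega> * Y 0 \<omega> - ito X Y t \<omega> - ito Y X t \<omega>)"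
    using ucp_min_time[OF ucp_const[of ?Z] g]
    by (intro ucp_diff ucp_const[of "\<lambda>t \<omega>. X 0 \<omega> * Y 0 \<omega>"] riemann_sum_ucp_ito SM_AC X Y g) auto
  then show ?thesis
    by (rule ucp_cong) (use summation_by_parts[OF gridsD(1,2)[OF g], of _ X _ _ Y] in \<open>auto simp: algebra_simps\<close>)
qed

text \<open>As for the integral, integration by parts provides a witness for the
  \<open>SOME\<close>, and the dyadic sums identify the picked process with it.\<close>

lemma qc_spec:
  assumes X: "X \<in> SM" and Y: "Y \<in> SM"
  shows "qc X Y \<in> AC"
    and "grids_tending_to_identity N \<tau> \<Longrightarrow> ucp (\<lambda>n. quadratic_sum (N n) (\<tau> n) X Y) (qc X Y)"
    and "AE \<omega> in P. \<forall>t\<ge>0. qc X Y t \<omega> = X t \<omega> * Y t \<omega> - X 0 \<omega> * Y 0 \<omega> - ito X Y t \<omega> - ito Y X t \<omega>"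
proof -
  let ?V = "\<lambda>t \<omega>. X t \<omega> * Y t \<omega> - X 0 \<omega> * Y 0 \<omega> - ito X Y t \<omega> - ito Y X t \<omega>"
  note XA = SM_AC[OF X] and YA = SM_AC[OF Y]
  have VA: "?V \<in> AC" by (intro AC_diff AC_mult AC_init[OF XA] AC_init[OF YA] XA YA ito_AC X Y)
  have "is_quadratic_covariation P F X Y ?V" unfolding is_quadratic_covariation_def
  proof (intro conjI allI impI)
    show "adapted F ?V" "continuous_paths P ?V" using VA by (auto simp: AC_def)
    show "ucp_tendsto P (\<lambda>n t \<omega>. \<Sum>i<N n. (X (min (\<tau> n (Suc i)) t) \<omega> - X (min (\<tau> n i) t) \<omega>) *
             (Y (min (\<tau> n (Suc i)) t) \<omega> - Y (min (\<tau> n i) t) \<omega>)) ?V" if "grids_tending_to_identity N \<tau>" for N \<tau>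
      using ucp_imp_ucp_tendsto[OF quadratic_sum_ucp[OF X Y that]] by (simp add: quadratic_sum_def)
  qed
  then have q: "is_quadratic_covariation P F X Y (qc X Y)"
    unfolding quadratic_covariation_def by (rule someI[where P = "is_quadratic_covariation P F X Y"])
  then show QA: "qc X Y \<in> AC" by (simp add: is_quadratic_covariation_def AC_def)
  show u: "ucp (\<lambda>n. quadratic_sum (N n) (\<tau> n) X Y) (qc X Y)" if g: "grids_tending_to_identity N \<tau>" for N \<tau>
  proof (rule ucp_tendsto_imp_ucp)
    show "ucp_tendsto P (\<lambda>n. quadratic_sum (N n) (\<tau> n) X Y) (qc X Y)"
      using q g unfolding is_quadratic_covariation_def quadratic_sum_def by blast
    have SA: "(\<lambda>t \<omega>. quadratic_sum (N n) (\<tau> n) X Y t \<omega> - qc X Y t \<omega>) \<in> AC" for n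
      by (intro AC_diff quadratic_sum_AC XA YA QA grid_nonneg[OF gridsD(1,2)[OF g]])
    show "(\<lambda>\<omega>. quadratic_sum (N n) (\<tau> n) X Y s \<omega> - qc X Y s \<omega>) \<in> borel_measurable P" if "0 \<le> s" for n s
      by (rule AC_measurable[OF SA that])
    show "continuous (at_left s) (\<lambda>s. quadratic_sum (N n) (\<tau> n) X Y s \<omega> - qc X Y s \<omega>)"
      if "0 < s" "\<omega> \<in> space P" for n s \<omega>
      by (rule AC_continuous_left[OF SA that(2,1)])
  qed
  show "AE \<omega> in P. \<forall>t\<ge>0. qc X Y t \<omega> = ?V t \<omega>"
    by (rule ucp_unique[OF u[OF dyadic_grids] quadratic_sum_ucp[OF X Y dyadic_grids]])
qed

text \<open>A sum of squares is not monotone in time, because the square of the running cell may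
  shrink. The loss is at most the squared increment since the last dyadic point, which vanishes by
  continuity.\<close>

lemma qc_self_mono:
  assumes X: "X \<in> SM"
  shows "AE \<omega> in P. \<forall>u v. 0 \<le> u \<longrightarrow> u \<le> v \<longrightarrow> qc X X u \<omega> \<le> qc X X v \<omega>"
proof -
  let ?q = "\<lambda>n. quadratic_sum (4 ^ n) (dyadic n) X X"
  obtain r :: "nat \<Rightarrow> nat" where r: "strict_mono r" "AE \<omega> in P. \<forall>t\<ge>0. (\<lambda>k. ?q (r k) t \<omega>) \<longlonglongrightarrow> qc X X t \<omega>"
    using ucp_subsequence[OF qc_spec(2)[OF X X dyadic_grids]] by blast
  from r(2) show ?thesis
  proof (rule AE_mp, intro AE_I2 impI allI)
    fix \<omega> u v assume w: "\<omega> \<in> space P" and lim: "\<forall>t\<ge>0. (\<lambda>k. ?q (r k) t \<omega>) \<longlonglongrightarrow> qc X X t \<omega>"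
      and uv: "0 \<le> (u::real)" "u \<le> v"
    define d where "d n = of_int \<lfloor>2 ^ n * u\<rfloor> / (2 ^ n :: real)" for n
    have le: "?q n u \<omega> \<le> ?q n v \<omega> + (X u \<omega> - X (d n) \<omega>)\<^sup>2" for n
    proof -
      define p where "p = nat \<lfloor>2 ^ n * u\<rfloor>"
      have dp: "d n = dyadic n p" using uv by (simp add: d_def p_def dyadic_def)
      have fl: "of_int \<lfloor>2 ^ n * u\<rfloor> \<le> 2 ^ n * u" "2 ^ n * u < of_int \<lfloor>2 ^ n * u\<rfloor> + 1" by linarith+
      have pr: "real p = of_int \<lfloor>2 ^ n * u\<rfloor>" using uv by (simp add: p_def)
      have p1: "dyadic n p \<le> u" "u < dyadic n (Suc p)"
        using fl pr by (auto simp: dyadic_def divide_le_eq less_divide_eq mult.commute add.commute)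
      let ?t = "\<lambda>t i. (X (min (dyadic n (Suc i)) t) \<omega> - X (min (dyadic n i) t) \<omega>)\<^sup>2"
      have "?t u i \<le> ?t v i + (if i = p then (X u \<omega> - X (d n) \<omega>)\<^sup>2 else 0)" for i
      proof (cases i p rule: linorder_cases)
        case less
        then have "dyadic n (Suc i) \<le> u" using dyadic_simps(6)[of "Suc i" p n] p1 by simp
        moreover have "dyadic n i \<le> u" using calculation dyadic_simps(4)[of n i] by simp
        ultimately have "min (dyadic n (Suc i)) u = min (dyadic n (Suc i)) v" "min (dyadic n i) u = min (dyadic n i) v"
          using uv by auto
        then show ?thesis using less by simp
      next
        case equal
        then have "min (dyadic n (Suc i)) u = u" "min (dyadic n i) u = d n" using p1 dp by auto
        then show ?thesis using equal by simp
      next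
        case greater
        then have "u \<le> dyadic n i" using dyadic_simps(6)[of "Suc p" i n] p1 by simp
        then have "min (dyadic n (Suc i)) u = min (dyadic n i) u" using dyadic_simps(4)[of n i] by simp
        then show ?thesis using greater by simp
      qed
      then have "(\<Sum>i<4^n. ?t u i) \<le> (\<Sum>i<4^n. ?t v i + (if i = p then (X u \<omega> - X (d n) \<omega>)\<^sup>2 else 0))"
        by (intro sum_mono)
      \<comment> \<open>Only an inequality: p may lie beyond the last cell, and then the correction
        does not occur in the sum.\<close>
      also have "\<dots> \<le> (\<Sum>i<4^n. ?t v i) + (X u \<omega> - X (d n) \<omega>)\<^sup>2"
        by (simp add: sum.distrib sum.delta)
      finally show ?thesis by (simp add: quadratic_sum_def power2_eq_square)
    qed
    have "(\<lambda>n. X (d n) \<omega>) \<longlonglongrightarrow> X u \<omega>" unfolding d_def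
      by (rule continuous_on_tendsto_compose[OF AC_continuous[OF SM_AC[OF X] w] dyadic_floor_tendsto])
        (use uv in \<open>auto intro!: always_eventually divide_nonneg_nonneg\<close>)
    from LIMSEQ_subseq_LIMSEQ[OF this r(1)] have Xd: "(\<lambda>k. X (d (r k)) \<omega>) \<longlonglongrightarrow> X u \<omega>" by (simp add: comp_def)
    have "(\<lambda>k. ?q (r k) v \<omega> + (X u \<omega> - X (d (r k)) \<omega>)\<^sup>2) \<longlonglongrightarrow> qc X X v \<omega> + (X u \<omega> - X u \<omega>)\<^sup>2"
      by (intro tendsto_intros Xd) (use lim uv in auto)
    then show "qc X X u \<omega> \<le> qc X X v \<omega>"
      using LIMSEQ_le[of "\<lambda>k. ?q (r k) u \<omega>" "qc X X u \<omega>"] lim uv le by auto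
  qed
qed

lemma quadratic_sum_polarization:
  "quadratic_sum N \<tau> X Y t \<omega> = 1/4 * quadratic_sum N \<tau> (\<lambda>t \<omega>. 1 * X t \<omega> + 1 * Y t \<omega>) (\<lambda>t \<omega>. 1 * X t \<omega> + 1 * Y t \<omega>) t \<omega>
    + (- 1/4) * quadratic_sum N \<tau> (\<lambda>t \<omega>. 1 * X t \<omega> + (- 1) * Y t \<omega>) (\<lambda>t \<omega>. 1 * X t \<omega> + (- 1) * Y t \<omega>) t \<omega>"
  unfolding quadratic_sum_def sum_distrib_left sum.distrib[symmetric] by (intro sum.cong) (auto simp: algebra_simps)

text \<open>Polarisation writes the bracket as a difference of two almost surely increasing
  processes.\<close>

lemma qc_BV:
  assumes X: "X \<in> SM" and Y: "Y \<in> SM"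
  obtains V where "V \<in> BV" "AE \<omega> in P. \<forall>t\<ge>0. qc X Y t \<omega> = V t \<omega>"
proof -
  let ?S = "\<lambda>t \<omega>. 1 * X t \<omega> + 1 * Y t \<omega>" and ?D = "\<lambda>t \<omega>. 1 * X t \<omega> + (- 1) * Y t \<omega>"
  have S: "?S \<in> SM" and D: "?D \<in> SM" by (rule SM_lin[OF X Y])+
  have "ucp (\<lambda>n. quadratic_sum (4 ^ n) (dyadic n) X Y) (\<lambda>t \<omega>. 1/4 * qc ?S ?S t \<omega> + (- 1/4) * qc ?D ?D t \<omega>)"
    by (rule ucp_cong[OF ucp_lin[OF qc_spec(2)[OF S S dyadic_grids] qc_spec(2)[OF D D dyadic_grids], of "1/4" "- 1/4"]])
      (rule quadratic_sum_polarization[symmetric], rule refl)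
  from ucp_unique[OF qc_spec(2)[OF X Y dyadic_grids] this]
  have eq: "AE \<omega> in P. \<forall>t\<ge>0. qc X Y t \<omega> = 1/4 * qc ?S ?S t \<omega> + (- 1/4) * qc ?D ?D t \<omega>" .
  have "AE \<omega> in P. locally_bounded_variation (\<lambda>t. 1/4 * qc ?S ?S t \<omega> + (- 1/4) * qc ?D ?D t \<omega>)"
    using qc_self_mono[OF S] qc_self_mono[OF D]
    by eventually_elim (intro locally_bounded_variation_lin locally_bounded_variation_mono; blast)
  moreover have "(\<lambda>t \<omega>. 1/4 * qc ?S ?S t \<omega> + (- 1/4) * qc ?D ?D t \<omega>) \<in> AC"
    by (intro AC_add AC_scale qc_spec(1) S D)
  ultimately obtain V where V: "V \<in> BV" "AE \<omega> in P. \<forall>t\<ge>0. 1/4 * qc ?S ?S t \<omega> + (- 1/4) * qc ?D ?D t \<omega> = V t \<omega>"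
    using BV_modification by blast
  show ?thesis
    by (rule that[OF V(1)]) (use eq V(2) in eventually_elim, auto)
qed

lemma qc_SM: "\<lbrakk>X \<in> SM; Y \<in> SM\<rbrakk> \<Longrightarrow> qc X Y \<in> SM"
proof -
  assume X: "X \<in> SM" and Y: "Y \<in> SM"
  obtain V where V: "V \<in> BV" "AE \<omega> in P. \<forall>t\<ge>0. qc X Y t \<omega> = V t \<omega>" using qc_BV[OF X Y] by blast
  show ?thesis
    by (rule SM_cong_AE[OF BV_SM[OF V(1)] qc_spec(1)[OF X Y]]) (use V(2) in eventually_elim, auto)
qed

text \<open>The sum is at most the largest increment of Z over a cell times the variation of A. The
  former vanishes with the mesh and the latter is tight.\<close>

lemma quadratic_sum_BV_ucp:
  assumes A: "A \<in> BV" and Z: "Z \<in> AC"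
  shows "ucp (\<lambda>n. quadratic_sum (4 ^ n) (dyadic n) A Z) (\<lambda>t \<omega>. 0)"
  unfolding ucp_def
proof (intro allI impI)
  fix t e :: real assume te: "0 \<le> t" "0 < e"
  then have e2: "0 < e/2" by simp
  obtain K :: nat where K: "hp (e/2) (\<lambda>\<omega>. \<forall>(n::nat) \<tau>. mono_on {..n} \<tau> \<and> \<tau> ` {..n} \<subseteq> {0..t} \<longrightarrow>
      (\<Sum>i<n. \<bar>A (\<tau> (Suc i)) \<omega> - A (\<tau> i) \<omega>\<bar>) \<le> real K)"
    using BV_tight[OF A te(1) e2] by blast
  define c where "c = e / (1 + real K)"
  have c: "0 < c" "c * real K \<le> e" using te by (auto simp: c_def field_simps)
  obtain d where d: "0 < d" "hp (e/2) (\<lambda>\<omega>. \<forall>u\<in>{0..t}. \<forall>v\<in>{0..t}. \<bar>u - v\<bar> \<le> d \<longrightarrow> \<bar>Z u \<omega> - Z v \<omega>\<bar> \<le> c)"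
    using AC_equicontinuous[OF Z te(1) e2 c(1)] by blast
  show "\<forall>\<^sub>F n in sequentially. small t e (\<lambda>s \<omega>. quadratic_sum (4 ^ n) (dyadic n) A Z s \<omega> - 0)"
    using eventually_le_power2[of "1/d"]
  proof eventually_elim
    case (elim n)
    then have nd: "1 / 2 ^ n \<le> d" using d(1) by (simp add: field_simps)
    show ?case unfolding small_def
    proof (rule hp_mono[OF hp_conj[OF K d(2)]], simp, rule ballI)
      fix \<omega> s assume w: "(\<forall>(n::nat) \<tau>. mono_on {..n} \<tau> \<and> \<tau> ` {..n} \<subseteq> {0..t} \<longrightarrow>
          (\<Sum>i<n. \<bar>A (\<tau> (Suc i)) \<omega> - A (\<tau> i) \<omega>\<bar>) \<le> real K) \<and>
          (\<forall>u\<in>{0..t}. \<forall>v\<in>{0..t}. \<bar>u - v\<bar> \<le> d \<longrightarrow> \<bar>Z u \<omega> - Z v \<omega>\<bar> \<le> c)" and s: "s \<in> {0..t}"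
      let ?a = "\<lambda>i. min (dyadic n i) s"
      have a: "?a i \<in> {0..t}" "\<bar>?a (Suc i) - ?a i\<bar> \<le> d" for i
        using s dyadic_simps(3)[of n i] dyadic_simps(4,5)[of n i] nd by (auto simp: min_def)
      have "\<bar>quadratic_sum (4 ^ n) (dyadic n) A Z s \<omega>\<bar> \<le> (\<Sum>i<4^n. c * \<bar>A (?a (Suc i)) \<omega> - A (?a i) \<omega>\<bar>)"
        unfolding quadratic_sum_def
      proof (rule order_trans[OF sum_abs sum_mono])
        fix i
        have "\<bar>Z (?a (Suc i)) \<omega> - Z (?a i) \<omega>\<bar> \<le> c" using w a by blast
        then show "\<bar>(A (?a (Suc i)) \<omega> - A (?a i) \<omega>) * (Z (?a (Suc i)) \<omega> - Z (?a i) \<omega>)\<bar> \<le> c * \<bar>A (?a (Suc i)) \<omega> - A (?a i) \<omega>\<bar>"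
          by (subst mult.commute) (simp add: abs_mult mult_right_mono)
      qed
      also have "\<dots> = c * (\<Sum>i<4^n. \<bar>A (?a (Suc i)) \<omega> - A (?a i) \<omega>\<bar>)" by (simp add: sum_distrib_left)
      also have "\<dots> \<le> c * real K"
      proof (rule mult_left_mono)
        have "mono_on {..4^n} ?a" using dyadic_simps(6)[of _ _ n] by (intro mono_onI min.mono) auto
        moreover have "?a ` {..4^n} \<subseteq> {0..t}" using a(1) by blast
        ultimately show "(\<Sum>i<4^n. \<bar>A (?a (Suc i)) \<omega> - A (?a i) \<omega>\<bar>) \<le> real K" using w by blast
      qed (use c in simp)
      finally show "\<bar>quadratic_sum (4 ^ n) (dyadic n) A Z s \<omega> - 0\<bar> \<le> e" using c(2) by simp
    qed
  qed
qed

lemma qc_qc_zero: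
  assumes X: "X \<in> SM" and Y: "Y \<in> SM" and Z: "Z \<in> SM"
  shows "AE \<omega> in P. \<forall>t\<ge>0. qc (qc X Y) Z t \<omega> = 0"
proof -
  obtain V where V: "V \<in> BV" "AE \<omega> in P. \<forall>t\<ge>0. qc X Y t \<omega> = V t \<omega>" using qc_BV[OF X Y] by blast
  have "ucp (\<lambda>n. quadratic_sum (4 ^ n) (dyadic n) (qc X Y) Z) (\<lambda>t \<omega>. 0)"
  proof (rule ucp_cong_AE[OF quadratic_sum_BV_ucp[OF V(1) SM_AC[OF Z]]])
    show "AE \<omega> in P. \<forall>t\<ge>0. quadratic_sum (4 ^ n) (dyadic n) V Z t \<omega> = quadratic_sum (4 ^ n) (dyadic n) (qc X Y) Z t \<omega>" for n
      using V(2) by eventually_elim (simp add: quadratic_sum_def dyadic_simps)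
  qed simp
  from ucp_unique[OF qc_spec(2)[OF qc_SM[OF X Y] Z dyadic_grids] this] show ?thesis .
qed

end

section \<open>Associativity and the product formula\<close>

context complete_filtered_prob_space
begin

lemma riemann_sum_increment:
  assumes \<tau>: "mono_on {..N} \<tau>" and j: "j < N"
  shows "riemann_sum N \<tau> X Y (min (\<tau> (Suc j)) t) \<omega> - riemann_sum N \<tau> X Y (min (\<tau> j) t) \<omega> =
    X (\<tau> j) \<omega> * (Y (min (\<tau> (Suc j)) t) \<omega> - Y (min (\<tau> j) t) \<omega>)"
  unfolding riemann_sum_def
  by (rule grid_sum_increment[where c = "\<lambda>l. X (\<tau> l) \<omega>" and f = "\<lambda>u. Y u \<omega>", OF assms])

lemma riemann_sum_assoc:
  assumes \<tau>: "mono_on {..N} \<tau>"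
  shows "riemann_sum N \<tau> X (riemann_sum N \<tau> Y Z) t \<omega> = riemann_sum N \<tau> (\<lambda>t \<omega>. X t \<omega> * Y t \<omega>) Z t \<omega>"
  unfolding riemann_sum_def[of N \<tau> X] riemann_sum_def[of N \<tau> "\<lambda>t \<omega>. X t \<omega> * Y t \<omega>"]
  by (rule sum.cong) (auto simp: riemann_sum_increment[OF \<tau>])

lemma riemann_sum_cong:
  assumes "\<And>u. u \<in> {0..t} \<Longrightarrow> V u \<omega> = V' u \<omega>" "\<And>i. 0 \<le> \<tau> i" "s \<in> {0..t}"
  shows "riemann_sum N \<tau> X V s \<omega> = riemann_sum N \<tau> X V' s \<omega>"
  unfolding riemann_sum_def using assms by (intro sum.cong) (auto simp: min_le_iff_disj)

lemma riemann_sum_AC: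
  assumes X: "X \<in> AC" and Y: "Y \<in> AC" and \<tau>: "\<tau> 0 = 0" "mono_on {..N} \<tau>"
  shows "riemann_sum N \<tau> X Y \<in> AC"
proof -
  have le: "\<tau> i \<le> \<tau> (Suc i)" if "i < N" for i using mono_onD[OF \<tau>(2), of i "Suc i"] that by auto
  have "riemann_sum N \<tau> X Y = (\<lambda>t \<omega>. \<Sum>i<N. X (min (\<tau> i) t) \<omega> * (Y (min (\<tau> (Suc i)) t) \<omega> - Y (min (\<tau> i) t) \<omega>))"
    unfolding riemann_sum_def
  proof (intro ext sum.cong refl)
    fix t \<omega> i assume "i \<in> {..<N}"
    then show "X (\<tau> i) \<omega> * (Y (min (\<tau> (Suc i)) t) \<omega> - Y (min (\<tau> i) t) \<omega>) =
      X (min (\<tau> i) t) \<omega> * (Y (min (\<tau> (Suc i)) t) \<omega> - Y (min (\<tau> i) t) \<omega>)"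
      using riemann_term_min[of \<tau> i "\<lambda>u. X u \<omega>" "\<lambda>u. Y u \<omega>" t] le by simp
  qed
  also have "\<dots> \<in> AC"
    by (intro AC_sum AC_mult AC_diff AC_min_time X Y grid_nonneg[OF \<tau>]) auto
  finally show ?thesis .
qed

text \<open>Let R denote the sum for X \<bullet> Y. Expanding the increments of YZ gives X \<bullet>
  (YZ) = (XY) \<bullet> Z + Z \<bullet> R + [R,Z] at the level of sums, and summation by parts for R
  and Z eliminates the last two terms.\<close>

lemma riemann_sum_product:
  assumes \<tau>: "\<tau> 0 = 0" "mono_on {..N} \<tau>" and t: "0 \<le> t"
  shows "riemann_sum N \<tau> X Y (min (\<tau> N) t) \<omega> * Z (min (\<tau> N) t) \<omega> =
    riemann_sum N \<tau> (riemann_sum N \<tau> X Y) Z t \<omega> + riemann_sum N \<tau> X (\<lambda>t \<omega>. Y t \<omega> * Z t \<omega>) t \<omega>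
    - riemann_sum N \<tau> (\<lambda>t \<omega>. X t \<omega> * Y t \<omega>) Z t \<omega>"
proof -
  let ?R = "riemann_sum N \<tau> X Y"
  have le: "\<tau> i \<le> \<tau> (Suc i)" if "i < N" for i using mono_onD[OF \<tau>(2), of i "Suc i"] that by auto
  have pos: "0 \<le> \<tau> i" if "i \<le> N" for i by (rule grid_nonneg[OF \<tau> that])
  have R0: "?R 0 \<omega> = 0"
    unfolding riemann_sum_def by (rule sum.neutral) (use pos in \<open>auto simp: min_absorb2\<close>)
  have "riemann_sum N \<tau> X (\<lambda>t \<omega>. Y t \<omega> * Z t \<omega>) t \<omega> =
    quadratic_sum N \<tau> ?R Z t \<omega> + riemann_sum N \<tau> (\<lambda>t \<omega>. X t \<omega> * Y t \<omega>) Z t \<omega> + riemann_sum N \<tau> Z ?R t \<omega>"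
    unfolding riemann_sum_assoc[OF \<tau>(2)]
    unfolding quadratic_sum_def riemann_sum_def[of _ _ X "\<lambda>t \<omega>. Y t \<omega> * Z t \<omega>"]
      riemann_sum_def[of _ _ "\<lambda>t \<omega>. X t \<omega> * Y t \<omega>"] riemann_sum_def[of _ _ "\<lambda>t \<omega>. Z t \<omega> * X t \<omega>"] sum.distrib[symmetric]
  proof (rule sum.cong[OF refl])
    fix i assume "i \<in> {..<N}"
    then have i: "i < N" by simp
    let ?y = "Y (min (\<tau> i) t) \<omega>" and ?y' = "Y (min (\<tau> (Suc i)) t) \<omega>"
    let ?z = "Z (min (\<tau> i) t) \<omega>" and ?z' = "Z (min (\<tau> (Suc i)) t) \<omega>"
    have 1: "X (\<tau> i) \<omega> * Y (\<tau> i) \<omega> * (?z' - ?z) = X (\<tau> i) \<omega> * (?y * (?z' - ?z))"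
      using riemann_term_min[of \<tau> i "\<lambda>u. Y u \<omega>" "\<lambda>u. Z u \<omega>" t] le[OF i] by simp
    have 2: "Z (\<tau> i) \<omega> * X (\<tau> i) \<omega> * (?y' - ?y) = X (\<tau> i) \<omega> * (?z * (?y' - ?y))"
      using riemann_term_min[of \<tau> i "\<lambda>u. Z u \<omega>" "\<lambda>u. Y u \<omega>" t] le[OF i] by simp
    show "X (\<tau> i) \<omega> * (?y' * ?z' - ?y * ?z) =
      (?R (min (\<tau> (Suc i)) t) \<omega> - ?R (min (\<tau> i) t) \<omega>) * (?z' - ?z) +
      X (\<tau> i) \<omega> * Y (\<tau> i) \<omega> * (?z' - ?z) + Z (\<tau> i) \<omega> * X (\<tau> i) \<omega> * (?y' - ?y)"
      unfolding riemann_sum_increment[OF \<tau>(2) i] 1 2 by (simp add: algebra_simps)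
  qed
  then show ?thesis using summation_by_parts[OF \<tau> t, of ?R \<omega> Z] R0 by simp
qed

lemma grid_approx_bound:
  assumes X: "X \<in> AC" and \<tau>: "\<tau> 0 = 0" "mono_on {..N} \<tau>"
    and K: "\<And>u. u \<in> {0..t} \<Longrightarrow> \<bar>X u \<omega>\<bar> \<le> K" and s: "s \<in> {0..t}"
  shows "\<bar>simple_process (grid_approx c N \<tau> X) s \<omega>\<bar> \<le> K"
proof -
  have c: "\<bar>clip (real c) (X u \<omega>)\<bar> \<le> K" if "u \<in> {0..t}" for u
    using abs_clip_le_abs[of "real c" "X u \<omega>"] K[OF that] by simp
  have K0: "0 \<le> K" using K[OF s] by linarith
  note H = grid_approx_predictable[OF X \<tau>, of c]
  show ?thesis
  proof (cases "s = 0")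
    case True
    then show ?thesis using simple_process_0[OF H] c[of 0] s by (simp add: grid_approx_def)
  next
    case False
    then have s0: "0 < s" using s by simp
    show ?thesis
    proof (cases "s \<le> \<tau> N")
      case True
      then obtain j where j: "j < N" "\<tau> j < s" "s \<le> \<tau> (Suc j)"
        using grid_interval_exists[of \<tau> s N] \<tau>(1) s0 by auto
      then have "\<tau> j \<in> {0..t}" using grid_nonneg[OF \<tau>, of j] s by auto
      moreover have "simple_process (grid_approx c N \<tau> X) s \<omega> = clip (real c) (X (\<tau> j) \<omega>)"
        using simple_process_active[of "grid_approx c N \<tau> X" j s \<omega>] \<tau> j s0 by simp
      ultimately show ?thesis using c by simp
    next
      case False
      then show ?thesis using simple_process_outside[of "grid_approx c N \<tau> X" s \<omega>] \<tau> s0 K0 by simp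
    qed
  qed
qed

text \<open>Here the integrand changes together with the grid, so \<open>riemann_sum_ucp\<close> for
  a fixed X does not apply; the uniform continuity built into \<open>good\<close> does.\<close>

lemma riemann_sum_vanishing:
  assumes W: "\<And>n. W n \<in> AC" "ucp W (\<lambda>t \<omega>. 0)" and Z: "good Z"
  shows "ucp (\<lambda>n. riemann_sum (4 ^ n) (dyadic n) (W n) Z) (\<lambda>t \<omega>. 0)"
  unfolding ucp_def
proof (intro allI impI)
  fix t e :: real assume te: "0 \<le> t" "0 < e"
  then have e2: "0 < e/2" by simp
  obtain d where d: "0 < d" "\<And>H. simple_predictable P F H \<Longrightarrow> small t d (simple_process H) \<Longrightarrow> small t (e/2) (simple_integral H Z)"
    using goodD[OF Z te(1) e2] by blast
  \<comment> \<open>The 1 keeps W n below the fixed clipping level of \<open>?H\<close>, d feeds the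
    continuity of the integral, and e/2 bounds the probability.\<close>
  have "0 < min d (min 1 (e/2))" using d(1) te by simp
  from ucpD[OF W(2) te(1) this]
  show "\<forall>\<^sub>F n in sequentially. small t e (\<lambda>s \<omega>. riemann_sum (4 ^ n) (dyadic n) (W n) Z s \<omega> - 0)"
  proof eventually_elim
    case (elim n)
    let ?m = "min d (min 1 (e/2))"
    let ?H = "grid_approx 1 (4 ^ n) (dyadic n) (W n)"
    have sW: "hp ?m (\<lambda>\<omega>. \<forall>s\<in>{0..t}. \<bar>W n s \<omega>\<bar> \<le> ?m)" using elim by (simp add: small_def)
    have H: "simple_predictable P F ?H" by (rule grid_approx_predictable[OF W(1) dyadic_simps(1,2)])
    have "small t d (simple_process ?H)" unfolding small_def
      by (rule hp_mono[OF sW]) (auto intro!: grid_approx_bound[OF W(1) dyadic_simps(1,2)])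
    from d(2)[OF H this] have sI: "small t (e/2) (simple_integral ?H Z)" .
    have "hp (e/2) (\<lambda>\<omega>. \<forall>s\<in>{0..t}. simple_integral ?H Z s \<omega> = riemann_sum (4 ^ n) (dyadic n) (W n) Z s \<omega>)"
    proof (rule hp_mono[OF sW], simp, rule ballI)
      fix \<omega> s assume b: "\<forall>s\<in>{0..t}. \<bar>W n s \<omega>\<bar> \<le> ?m" and s: "s \<in> {0..t}"
      show "simple_integral ?H Z s \<omega> = riemann_sum (4 ^ n) (dyadic n) (W n) Z s \<omega>"
        by (rule grid_approx_integral[OF dyadic_simps(1,2) _ s]) (use b in auto)
    qed
    from small_cong_hp[OF sI this] te show ?case by simp
  qed
qed

lemma ucp_mult_right:
  assumes J: "ucp J I" and Z: "Z \<in> AC"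
  shows "ucp (\<lambda>n t \<omega>. J n t \<omega> * Z t \<omega>) (\<lambda>t \<omega>. I t \<omega> * Z t \<omega>)"
  unfolding ucp_def
proof (intro allI impI)
  fix t e :: real assume te: "0 \<le> t" "0 < e"
  then have e2: "0 < e/2" by simp
  obtain K :: nat where K: "hp (e/2) (\<lambda>\<omega>. \<forall>s\<in>{0..t}. \<bar>Z s \<omega>\<bar> \<le> real K)"
    using AC_tight[OF Z te(1) e2] by blast
  define d where "d = e / (2 * (1 + real K))"
  have d: "0 < d" "d \<le> e/2" "d * real K \<le> e" using te by (auto simp: d_def field_simps)
  from ucpD[OF J te(1) d(1)]
  show "\<forall>\<^sub>F n in sequentially. small t e (\<lambda>s \<omega>. J n s \<omega> * Z s \<omega> - I s \<omega> * Z s \<omega>)"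
  proof eventually_elim
    case (elim n)
    show ?case unfolding small_def
    proof (rule hp_mono[OF hp_conj[OF elim[unfolded small_def] K]], use d in simp, rule ballI)
      fix \<omega> s assume w: "(\<forall>s\<in>{0..t}. \<bar>J n s \<omega> - I s \<omega>\<bar> \<le> d) \<and> (\<forall>s\<in>{0..t}. \<bar>Z s \<omega>\<bar> \<le> real K)" and s: "s \<in> {0..t}"
      have "\<bar>J n s \<omega> * Z s \<omega> - I s \<omega> * Z s \<omega>\<bar> = \<bar>J n s \<omega> - I s \<omega>\<bar> * \<bar>Z s \<omega>\<bar>"
        by (simp add: abs_mult[symmetric] left_diff_distrib)
      also have "\<dots> \<le> d * real K" using w s d by (intro mult_mono) auto
      finally show "\<bar>J n s \<omega> * Z s \<omega> - I s \<omega> * Z s \<omega>\<bar> \<le> e" using d(3) by linarith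
    qed
  qed
qed

text \<open>On the grid n the integrator J = Y \<bullet> Z is replaced by the simple integral of a
  finer approximation m of Y. The difference from the sum for XY is then a simple integral against Z
  with integrand X times (approximation m minus approximation n), which is small.\<close>

lemma ito_assoc:
  assumes X: "X \<in> AC" and Y: "Y \<in> AC" and Z: "Z \<in> SM"
  shows "AE \<omega> in P. \<forall>t\<ge>0. ito X (ito Y Z) t \<omega> = ito (\<lambda>t \<omega>. X t \<omega> * Y t \<omega>) Z t \<omega>"
proof -
  let ?J = "ito Y Z" and ?XY = "\<lambda>t \<omega>. X t \<omega> * Y t \<omega>"
  let ?rs = "\<lambda>n. riemann_sum (4 ^ n) (dyadic n)"
  have JS: "?J \<in> SM" by (rule ito_SM[OF Y Z])
  let ?GX = "\<lambda>n. grid_approx n (4 ^ n) (dyadic n) X" and ?GY = "\<lambda>n. grid_approx n (4 ^ n) (dyadic n) Y"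
  have GX: "simple_predictable P F (?GX n)" for n by (rule grid_approx_predictable[OF X dyadic_simps(1,2)])
  have GY: "simple_predictable P F (?GY n)" for n by (rule grid_approx_predictable[OF Y dyadic_simps(1,2)])
  have uY: "ucp (\<lambda>n. simple_process (?GY n)) Y" by (rule grid_approx_ucp[OF Y dyadic_grids])
  have uJ: "ucp (\<lambda>n. simple_integral (?GY n) Z) ?J"
    by (rule ito_rel_ucp[OF ito_rel_ito_integral[OF Y SM_good[OF Z]] GY uY])
  have "ucp (\<lambda>n t \<omega>. ?rs n X ?J t \<omega> - ?rs n ?XY Z t \<omega>) (\<lambda>t \<omega>. 0)"
    unfolding ucp_def
  proof (intro allI impI)
    fix t e :: real assume te: "0 \<le> t" "0 < e"
    then have e4: "0 < e/4" and e8: "0 < e/8" by auto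
    obtain d where d: "0 < d" "\<And>H. simple_predictable P F H \<Longrightarrow> small t d (simple_process H) \<Longrightarrow> small t (e/4) (simple_integral H Z)"
      using goodD[OF SM_good[OF Z] te(1) e4] by blast
    have d4: "0 < d/4" using d by simp
    obtain K1 :: nat where K1: "hp (d/4) (\<lambda>\<omega>. \<forall>s\<in>{0..t}. \<bar>X s \<omega>\<bar> \<le> real K1)" using AC_tight[OF X te(1) d4] by blast
    obtain K2 :: nat where K2: "hp (e/8) (\<lambda>\<omega>. \<forall>s\<in>{0..t}. \<bar>X s \<omega>\<bar> \<le> real K2)" using AC_tight[OF X te(1) e8] by blast
    obtain K3 :: nat where K3: "hp (e/8) (\<lambda>\<omega>. \<forall>s\<in>{0..t}. \<bar>Y s \<omega>\<bar> \<le> real K3)" using AC_tight[OF Y te(1) e8] by blast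
    \<comment> \<open>Closeness of both approximations of Y. Twice d/8 and the d/4 behind K1 stay
      within the probability d, and K1 * 2 * h is at most d.\<close>
    define h where "h = min (d/8) (d / (2 * (1 + real K1)))"
    have h: "0 < h" using d(1) by (simp add: h_def)
    have h8: "h \<le> d/8" unfolding h_def by (rule min.cobounded1)
    have hK: "real K1 * (2 * h) \<le> d"
    proof -
      have "real K1 * (2 * h) \<le> (1 + real K1) * (2 * (d / (2 * (1 + real K1))))"
        using h by (intro mult_mono) (auto simp: h_def)
      also have "\<dots> = d" by (simp add: divide_simps)
      finally show ?thesis .
    qed
    from ucpD[OF uY te(1) h] eventually_ge_at_top[of K2] eventually_ge_at_top[of K3]
    show "\<forall>\<^sub>F n in sequentially. small t e (\<lambda>s \<omega>. ?rs n X ?J s \<omega> - ?rs n ?XY Z s \<omega> - 0)"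
    proof eventually_elim
      case (elim n)
      \<comment> \<open>The replacement of J costs at most 2 * r per cell, with weights at most n
        and 4^n cells: r is chosen after n so that the total is at most e/4.\<close>
      define q where "q = 1 + 4 ^ n * real n"
      define r where "r = e / (8 * q)"
      have den: "1 \<le> q" by (simp add: q_def)
      have r: "0 < r" "r \<le> e/8" "4 ^ n * (real n * (2 * r)) \<le> e/4"
      proof -
        show "0 < r" using te den by (simp add: r_def)
        show "r \<le> e/8" unfolding r_def using te den by (intro divide_left_mono) auto
        have "4 ^ n * real n * r \<le> q * r" using \<open>0 < r\<close> by (intro mult_right_mono) (auto simp: q_def)
        also have "\<dots> = e/8" using den by (simp add: r_def)
        finally show "4 ^ n * (real n * (2 * r)) \<le> e/4" by simp
      qed
      \<comment> \<open>The second scale: m depends on n through r.\<close>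
      from eventually_conj[OF ucpD[OF uY te(1) h] ucpD[OF uJ te(1) r(1)]]
      obtain m where m: "small t h (\<lambda>s \<omega>. simple_process (?GY m) s \<omega> - Y s \<omega>)"
        "small t r (\<lambda>s \<omega>. simple_integral (?GY m) Z s \<omega> - ?J s \<omega>)" by (auto simp: eventually_sequentially)
      let ?D = "diff_integrand (?GY m) (?GY n)"
      let ?H = "times_integrand (?GX n) ?D"
      note D = diff_integrand[OF GY[of m] GY[of n]]
      note H = times_integrand[OF GX[of n] D(1)]
      have "small t d (simple_process ?H)" unfolding small_def
      proof (rule hp_mono[OF hp_conj[OF hp_conj[OF m(1)[unfolded small_def] elim(1)[unfolded small_def]] K1]], use h8 d in simp, rule ballI)
        fix \<omega> s assume w: "((\<forall>s\<in>{0..t}. \<bar>simple_process (?GY m) s \<omega> - Y s \<omega>\<bar> \<le> h) \<and>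
            (\<forall>s\<in>{0..t}. \<bar>simple_process (?GY n) s \<omega> - Y s \<omega>\<bar> \<le> h)) \<and> (\<forall>s\<in>{0..t}. \<bar>X s \<omega>\<bar> \<le> real K1)"
          and s: "s \<in> {0..t}"
        have "\<bar>simple_process (?GX n) s \<omega>\<bar> \<le> real K1"
          by (rule grid_approx_bound[OF X dyadic_simps(1,2) _ s]) (use w in auto)
        moreover have "\<bar>simple_process ?D s \<omega>\<bar> \<le> 2 * h"
        proof -
          have "\<bar>simple_process (?GY m) s \<omega> - Y s \<omega>\<bar> \<le> h" "\<bar>simple_process (?GY n) s \<omega> - Y s \<omega>\<bar> \<le> h" using w s by auto
          then show ?thesis using D(2)[of s \<omega>] s by auto
        qed
        ultimately have "\<bar>simple_process (?GX n) s \<omega>\<bar> * \<bar>simple_process ?D s \<omega>\<bar> \<le> real K1 * (2 * h)"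
          by (intro mult_mono) auto
        then show "\<bar>simple_process ?H s \<omega>\<bar> \<le> d" using H(2)[of s \<omega>] s hK by (simp add: abs_mult)
      qed
      from d(2)[OF H(1) this] have A1: "hp (e/4) (\<lambda>\<omega>. \<forall>s\<in>{0..t}. \<bar>simple_integral ?H Z s \<omega>\<bar> \<le> e/4)"
        by (simp add: small_def)
      show ?case unfolding small_def
      proof (rule hp_mono[OF hp_conj[OF hp_conj[OF A1 m(2)[unfolded small_def]] hp_conj[OF K2 K3]]], use r te in simp, rule ballI)
        fix \<omega> s assume w: "((\<forall>s\<in>{0..t}. \<bar>simple_integral ?H Z s \<omega>\<bar> \<le> e/4) \<and>
          (\<forall>s\<in>{0..t}. \<bar>simple_integral (?GY m) Z s \<omega> - ?J s \<omega>\<bar> \<le> r)) \<and>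
          (\<forall>s\<in>{0..t}. \<bar>X s \<omega>\<bar> \<le> real K2) \<and> (\<forall>s\<in>{0..t}. \<bar>Y s \<omega>\<bar> \<le> real K3)" and s: "s \<in> {0..t}" and ws: "\<omega> \<in> space P"
        have Xn: "\<bar>X u \<omega>\<bar> \<le> real n" and Yn: "\<bar>Y u \<omega>\<bar> \<le> real n" if "u \<in> {0..t}" for u
          using w that elim(2,3) by (meson of_nat_le_iff order_trans)+
        have GXI: "simple_integral (?GX n) V s \<omega> = ?rs n X V s \<omega>" for V
          by (rule grid_approx_integral[where X = X and t = t, OF dyadic_simps(1,2) _ s]) (rule Xn)
        have GYI: "simple_integral (?GY n) Z u \<omega> = ?rs n Y Z u \<omega>" if "u \<in> {0..t}" for u
          by (rule grid_approx_integral[where X = Y and t = t, OF dyadic_simps(1,2) _ that]) (rule Yn)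
        let ?W = "\<lambda>s \<omega>. simple_integral (?GY m) Z s \<omega> - ?J s \<omega>"
        have "simple_integral (?GX n) (simple_integral (?GY n) Z) s \<omega> = ?rs n X (?rs n Y Z) s \<omega>"
          unfolding GXI by (rule riemann_sum_cong[where t = t, OF _ dyadic_simps(3) s]) (rule GYI)
        then have e1: "simple_integral (?GX n) (simple_integral (?GY n) Z) s \<omega> = ?rs n ?XY Z s \<omega>"
          by (simp add: riemann_sum_assoc dyadic_simps(2))
        \<comment> \<open>Exact associativity for simple integrands splits the product integrand
          into the sums for m and for n.\<close>
        have e2: "simple_integral ?H Z s \<omega> =
          simple_integral (?GX n) (simple_integral (?GY m) Z) s \<omega> - simple_integral (?GX n) (simple_integral (?GY n) Z) s \<omega>"
        proof -
          have "simple_integral ?D Z = (\<lambda>s \<omega>. simple_integral (?GY m) Z s \<omega> - simple_integral (?GY n) Z s \<omega>)"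
            by (intro ext D(3))
          then show ?thesis unfolding H(3) by (simp add: simple_integral_diff)
        qed
        have e3: "simple_integral (?GX n) ?W s \<omega> = simple_integral (?GX n) (simple_integral (?GY m) Z) s \<omega> - ?rs n X ?J s \<omega>"
          by (simp add: simple_integral_diff GXI)
        have "\<bar>simple_integral (?GX n) ?W s \<omega>\<bar> \<le> (\<Sum>i<(4::nat)^n. real n * (2 * r))"
          unfolding simple_integral_def[of "?GX n" ?W] grid_approx_sel
        proof (rule order_trans[OF sum_abs sum_mono])
          fix i
          let ?a = "\<lambda>i. min (dyadic n i) s"
          have a: "?a i \<in> {0..t}" for i using s dyadic_simps(3)[of n i] by auto
          have "\<bar>?W (?a (Suc i)) \<omega>\<bar> \<le> r" "\<bar>?W (?a i) \<omega>\<bar> \<le> r" using w a by blast+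
          then have "\<bar>?W (?a (Suc i)) \<omega> - ?W (?a i) \<omega>\<bar> \<le> 2 * r" by linarith
          then show "\<bar>clip (real n) (X (dyadic n i) \<omega>) * (?W (?a (Suc i)) \<omega> - ?W (?a i) \<omega>)\<bar> \<le> real n * (2 * r)"
            unfolding abs_mult using abs_clip_le[of "real n"] by (intro mult_mono) auto
        qed
        also have "\<dots> = 4 ^ n * (real n * (2 * r))" by simp
        finally have bW: "\<bar>simple_integral (?GX n) ?W s \<omega>\<bar> \<le> e/4" using r(3) by linarith
        have bH: "\<bar>simple_integral ?H Z s \<omega>\<bar> \<le> e/4" using w s by blast
        show "\<bar>?rs n X ?J s \<omega> - ?rs n ?XY Z s \<omega> - 0\<bar> \<le> e"
          using bW bH te unfolding e3 e2 e1 by linarith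
      qed
    qed
  qed
  from ucp_diff[OF riemann_sum_ucp_ito[OF X JS dyadic_grids] this]
  have "ucp (\<lambda>n. ?rs n ?XY Z) (ito X ?J)" by (rule ucp_cong) auto
  from ucp_unique[OF this riemann_sum_ucp_ito[OF AC_mult[OF X Y] Z dyadic_grids]] show ?thesis .
qed

text \<open>All terms of the discrete product formula have known limits except the sum whose
  integrand is itself a Riemann sum; \<open>riemann_sum_vanishing\<close> replaces that integrand by
  its limit.\<close>

lemma ito_product:
  assumes X: "X \<in> AC" and Y: "Y \<in> SM" and Z: "Z \<in> SM" and YZ: "(\<lambda>t \<omega>. Y t \<omega> * Z t \<omega>) \<in> SM"
  shows "AE \<omega> in P. \<forall>t\<ge>0. ito X Y t \<omega> * Z t \<omega> = ito (ito X Y) Z t \<omega> +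
    ito X (\<lambda>t \<omega>. Y t \<omega> * Z t \<omega>) t \<omega> - ito (\<lambda>t \<omega>. X t \<omega> * Y t \<omega>) Z t \<omega>"
proof -
  let ?I = "ito X Y" and ?YZ = "\<lambda>t \<omega>. Y t \<omega> * Z t \<omega>" and ?XY = "\<lambda>t \<omega>. X t \<omega> * Y t \<omega>"
  let ?rs = "\<lambda>n. riemann_sum (4 ^ n) (dyadic n)"
  have IA: "?I \<in> AC" by (rule ito_AC[OF X Y])
  have RA: "?rs n X Y \<in> AC" for n by (rule riemann_sum_AC[OF X SM_AC[OF Y] dyadic_simps(1,2)])
  have uI: "ucp (\<lambda>n. ?rs n X Y) ?I" by (rule riemann_sum_ucp_ito[OF X Y dyadic_grids])
  have u0: "ucp (\<lambda>n s \<omega>. ?rs n X Y s \<omega> - ?I s \<omega>) (\<lambda>t \<omega>. 0)" using ucp_diff[OF uI ucp_const[of ?I]] by simp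
  have "ucp (\<lambda>n. ?rs n (\<lambda>s \<omega>. ?rs n X Y s \<omega> - ?I s \<omega>) Z) (\<lambda>t \<omega>. 0)"
    by (rule riemann_sum_vanishing[OF AC_diff[OF RA IA] u0 SM_good[OF Z]])
  from ucp_add[OF riemann_sum_ucp_ito[OF IA Z dyadic_grids] this]
  have u1: "ucp (\<lambda>n. ?rs n (?rs n X Y) Z) (ito ?I Z)"
  proof (rule ucp_cong)
    fix n t \<omega>
    show "?rs n ?I Z t \<omega> + ?rs n (\<lambda>s \<omega>. ?rs n X Y s \<omega> - ?I s \<omega>) Z t \<omega> = ?rs n (?rs n X Y) Z t \<omega>"
      unfolding riemann_sum_def[of _ _ _ Z] sum.distrib[symmetric] by (intro sum.cong) (auto simp: algebra_simps)
  qed simp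
  have u2: "ucp (\<lambda>n t \<omega>. ?rs n (?rs n X Y) Z t \<omega> + ?rs n X ?YZ t \<omega> - ?rs n ?XY Z t \<omega>)
    (\<lambda>t \<omega>. ito ?I Z t \<omega> + ito X ?YZ t \<omega> - ito ?XY Z t \<omega>)"
    by (intro ucp_diff ucp_add u1 riemann_sum_ucp_ito dyadic_grids X YZ Z AC_mult SM_AC[OF Y])
  have u3: "ucp (\<lambda>n t \<omega>. ?rs n (?rs n X Y) Z t \<omega> + ?rs n X ?YZ t \<omega> - ?rs n ?XY Z t \<omega>) (\<lambda>t \<omega>. ?I t \<omega> * Z t \<omega>)"
    using ucp_min_time[OF ucp_mult_right[OF uI SM_AC[OF Z]] dyadic_grids]
  proof (rule ucp_cong)
    fix n \<omega> and t :: real assume "0 \<le> t"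
    from riemann_sum_product[OF dyadic_simps(1,2) this, where X = X and Y = Y and Z = Z]
    show "?rs n X Y (min (dyadic n (4 ^ n)) t) \<omega> * Z (min (dyadic n (4 ^ n)) t) \<omega> =
      ?rs n (?rs n X Y) Z t \<omega> + ?rs n X ?YZ t \<omega> - ?rs n ?XY Z t \<omega>" .
  qed simp
  show ?thesis by (rule ucp_unique[OF u3 u2])
qed

section \<open>The dendriform structure\<close>

abbreviation indist (infix "\<doteq>" 50) where "X \<doteq> Y \<equiv> indistinguishable P X Y"

lemma indist_AE: "X \<doteq> Y \<longleftrightarrow> (AE \<omega> in P. \<forall>t\<ge>0. X t \<omega> = Y t \<omega>)"
  by (simp add: indistinguishable_def)

lemma indist_refl [simp, intro]: "X \<doteq> X"
  by (simp add: indist_AE)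

lemma indist_sym: "X \<doteq> Y \<Longrightarrow> Y \<doteq> X"
  unfolding indist_AE by (elim AE_mp) auto

lemma indist_trans [trans]:
  assumes "X \<doteq> Y" "Y \<doteq> Z"
  shows "X \<doteq> Z"
  using assms unfolding indist_AE by eventually_elim auto

lemma ito_cong:
  assumes X: "X \<in> AC" "X' \<in> AC" "X \<doteq> X'" and Y: "Y \<in> SM" "Y' \<in> SM" "Y \<doteq> Y'"
  shows "ito X Y \<doteq> ito X' Y'"
proof -
  have "AE \<omega> in P. \<forall>t\<ge>0. riemann_sum (4 ^ n) (dyadic n) X Y t \<omega> = riemann_sum (4 ^ n) (dyadic n) X' Y' t \<omega>" for n
    using X(3)[unfolded indist_AE] Y(3)[unfolded indist_AE]
    by eventually_elim (simp add: riemann_sum_def dyadic_simps)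
  from ucp_cong_AE[OF riemann_sum_ucp_ito[OF X(1) Y(1) dyadic_grids] this]
  have "ucp (\<lambda>n. riemann_sum (4 ^ n) (dyadic n) X' Y') (ito X Y)" by simp
  from ucp_unique[OF this riemann_sum_ucp_ito[OF X(2) Y(2) dyadic_grids]] show ?thesis by (simp add: indist_AE)
qed

abbreviation "S0 \<equiv> semimartingales0 P F"

lemma S0_SM: "X \<in> S0 \<Longrightarrow> X \<in> SM" and S0_0: "X \<in> S0 \<Longrightarrow> AE \<omega> in P. X 0 \<omega> = 0"
  by (simp_all add: semimartingales0_def)

lemma S0_AC: "X \<in> S0 \<Longrightarrow> X \<in> AC"
  by (simp add: S0_SM SM_AC)

lemma S0_I: "\<lbrakk>X \<in> SM; AE \<omega> in P. X 0 \<omega> = 0\<rbrakk> \<Longrightarrow> X \<in> S0"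
  by (simp add: semimartingales0_def)

lemma S0_lin:
  assumes X: "X \<in> S0" and Y: "Y \<in> S0"
  shows "(\<lambda>t \<omega>. a * X t \<omega> + b * Y t \<omega>) \<in> S0"
  by (rule S0_I[OF SM_lin[OF S0_SM[OF X] S0_SM[OF Y]]])
    (use S0_0[OF X] S0_0[OF Y] in eventually_elim, simp)

lemma ito_S0: "\<lbrakk>X \<in> AC; Y \<in> SM\<rbrakk> \<Longrightarrow> ito X Y \<in> S0"
  by (rule S0_I[OF ito_SM ito_0])

lemma qc_S0:
  assumes X: "X \<in> SM" and Y: "Y \<in> SM"
  shows "qc X Y \<in> S0"
proof (rule S0_I[OF qc_SM[OF X Y]])
  show "AE \<omega> in P. qc X Y 0 \<omega> = 0"
    using qc_spec(3)[OF X Y] ito_0[OF SM_AC[OF X] Y] ito_0[OF SM_AC[OF Y] X] by eventually_elim auto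
qed

lemma qc_by_parts:
  assumes X: "X \<in> S0" and Y: "Y \<in> S0"
  shows "AE \<omega> in P. \<forall>t\<ge>0. qc X Y t \<omega> = X t \<omega> * Y t \<omega> - ito X Y t \<omega> - ito Y X t \<omega>"
  using qc_spec(3)[OF S0_SM[OF X] S0_SM[OF Y]] S0_0[OF X] by eventually_elim simp

text \<open>Integration by parts exhibits the product as a semimartingale, which is what allows YZ
  to be an integrator in \<open>ito_product\<close>.\<close>

lemma mult_SM:
  assumes X: "X \<in> S0" and Y: "Y \<in> S0"
  shows "(\<lambda>t \<omega>. X t \<omega> * Y t \<omega>) \<in> SM"
proof (rule SM_cong_AE)
  show "(\<lambda>t \<omega>. 1 * (1 * ito X Y t \<omega> + 1 * ito Y X t \<omega>) + 1 * qc X Y t \<omega>) \<in> SM"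
    by (intro SM_lin ito_SM qc_SM S0_SM X Y S0_AC)
  show "(\<lambda>t \<omega>. X t \<omega> * Y t \<omega>) \<in> AC" by (intro AC_mult S0_AC X Y)
  show "AE \<omega> in P. \<forall>t\<ge>0. 1 * (1 * ito X Y t \<omega> + 1 * ito Y X t \<omega>) + 1 * qc X Y t \<omega> = X t \<omega> * Y t \<omega>"
    using qc_by_parts[OF X Y] by eventually_elim simp
qed

lemma qc_cong:
  assumes X: "X \<in> S0" "X' \<in> S0" "X \<doteq> X'" and Y: "Y \<in> S0" "Y' \<in> S0" "Y \<doteq> Y'"
  shows "qc X Y \<doteq> qc X' Y'"
  unfolding indist_AE
  using qc_by_parts[OF X(1) Y(1)] qc_by_parts[OF X(2) Y(2)] X(3)[unfolded indist_AE] Y(3)[unfolded indist_AE]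
    ito_cong[OF S0_AC[OF X(1)] S0_AC[OF X(2)] X(3) S0_SM[OF Y(1)] S0_SM[OF Y(2)] Y(3), unfolded indist_AE]
    ito_cong[OF S0_AC[OF Y(1)] S0_AC[OF Y(2)] Y(3) S0_SM[OF X(1)] S0_SM[OF X(2)] X(3), unfolded indist_AE]
  by eventually_elim simp

lemma qc_commute:
  assumes X: "X \<in> S0" and Y: "Y \<in> S0"
  shows "qc X Y \<doteq> qc Y X"
  unfolding indist_AE using qc_by_parts[OF X Y] qc_by_parts[OF Y X] by eventually_elim simp

lemma qc_lin_left:
  assumes X: "X \<in> S0" and Y: "Y \<in> S0" and Z: "Z \<in> S0"
  shows "AE \<omega> in P. \<forall>t\<ge>0. qc (\<lambda>t \<omega>. a * X t \<omega> + b * Y t \<omega>) Z t \<omega> = a * qc X Z t \<omega> + b * qc Y Z t \<omega>"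
  using qc_by_parts[OF S0_lin[OF X Y] Z, of a b] qc_by_parts[OF X Z] qc_by_parts[OF Y Z]
    ito_lin_left[OF S0_AC[OF X] S0_AC[OF Y] S0_SM[OF Z], of a b]
    ito_lin_right[OF S0_AC[OF Z] S0_SM[OF X] S0_SM[OF Y], of a b]
  by eventually_elim (simp add: ring_distribs mult.assoc)

text \<open>Integration by parts and the product formula give [X \<bullet> Y, Z] = X \<bullet> (YZ)
  - (XY) \<bullet> Z - (XZ) \<bullet> Y. By associativity the right side is X \<bullet> (YZ - Y
  \<bullet> Z - Z \<bullet> Y), which is X \<bullet> [Y,Z].\<close>

lemma qc_ito:
  assumes X: "X \<in> S0" and Y: "Y \<in> S0" and Z: "Z \<in> S0"
  shows "qc (ito X Y) Z \<doteq> ito X (qc Y Z)"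
proof -
  let ?YZ = "\<lambda>t \<omega>. Y t \<omega> * Z t \<omega>" and ?XY = "\<lambda>t \<omega>. X t \<omega> * Y t \<omega>" and ?XZ = "\<lambda>t \<omega>. X t \<omega> * Z t \<omega>"
  note xa = S0_AC[OF X] and ya = S0_AC[OF Y] and za = S0_AC[OF Z]
  note ys = S0_SM[OF Y] and zs = S0_SM[OF Z]
  have I: "ito X Y \<in> S0" by (rule ito_S0[OF xa ys])
  let ?L = "\<lambda>t \<omega>. 1 * ito Y Z t \<omega> + 1 * ito Z Y t \<omega>"
  have L: "?L \<in> SM" by (intro SM_lin ito_SM ya za ys zs)
  have YZ: "?YZ \<in> SM" by (rule mult_SM[OF Y Z])
  have c: "ito X (qc Y Z) \<doteq> ito X (\<lambda>t \<omega>. 1 * ?YZ t \<omega> + (- 1) * ?L t \<omega>)"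
  proof (rule ito_cong[OF xa xa indist_refl qc_SM[OF ys zs] SM_lin[OF YZ L]])
    show "qc Y Z \<doteq> (\<lambda>t \<omega>. 1 * ?YZ t \<omega> + (- 1) * ?L t \<omega>)"
      unfolding indist_AE using qc_by_parts[OF Y Z] by eventually_elim simp
  qed
  have zx: "(\<lambda>t \<omega>. Z t \<omega> * X t \<omega>) = ?XZ" by (simp add: mult.commute)
  show ?thesis unfolding indist_AE
    using qc_by_parts[OF I Z] ito_product[OF xa ys zs YZ] ito_assoc[OF za xa ys, unfolded zx] c[unfolded indist_AE]
      ito_lin_right[OF xa YZ L, of 1 "- 1"] ito_lin_right[OF xa ito_SM[OF ya zs] ito_SM[OF za ys], of 1 1]
      ito_assoc[OF xa ya zs] ito_assoc[OF xa za ys]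
    by eventually_elim simp
qed

section \<open>Normal forms of iterated products\<close>

abbreviation "R h \<equiv> right_op P F h"

text \<open>The factor 1 gives the operation the shape of the linearity lemmas.\<close>

lemma R_eq: "R a X Y = (\<lambda>t \<omega>. 1 * ito X Y t \<omega> + a * qc X Y t \<omega>)"
  by (simp add: right_op_def process_add_def process_scale_def)

lemma R_S0: "\<lbrakk>X \<in> S0; Y \<in> S0\<rbrakk> \<Longrightarrow> R a X Y \<in> S0"
  unfolding R_eq by (intro S0_lin ito_S0 qc_S0 S0_AC S0_SM)

lemma left_op_R:
  assumes "X \<in> S0" "Y \<in> S0"
  shows "left_op P F h X Y \<doteq> R (1 - h) Y X"
  unfolding indist_AE R_eq left_op_def process_add_def process_scale_def
  using qc_commute[OF assms, unfolded indist_AE] by eventually_elim simp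

lemma left_op_S0: "\<lbrakk>X \<in> S0; Y \<in> S0\<rbrakk> \<Longrightarrow> left_op P F h X Y \<in> S0"
  using S0_lin[OF ito_S0[OF S0_AC S0_SM] qc_S0[OF S0_SM S0_SM], of Y X X Y 1 "1 - h"]
  by (simp add: left_op_def process_add_def process_scale_def)

lemma R_cong:
  assumes "X \<in> S0" "X' \<in> S0" "X \<doteq> X'" "Y \<in> S0" "Y' \<in> S0" "Y \<doteq> Y'"
  shows "R a X Y \<doteq> R a X' Y'"
  using qc_cong[OF assms] ito_cong[OF S0_AC[OF assms(1)] S0_AC[OF assms(2)] assms(3) S0_SM[OF assms(4)] S0_SM[OF assms(5)] assms(6)]
  unfolding indist_AE R_eq by eventually_elim simp

lemma R_lin_left:
  assumes X: "X \<in> S0" and Y: "Y \<in> S0" and Z: "Z \<in> S0"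
  shows "R h (\<lambda>t \<omega>. a * X t \<omega> + b * Y t \<omega>) Z \<doteq> (\<lambda>t \<omega>. a * R h X Z t \<omega> + b * R h Y Z t \<omega>)"
  unfolding indist_AE R_eq
  using qc_lin_left[OF X Y Z, of a b] ito_lin_left[OF S0_AC[OF X] S0_AC[OF Y] S0_SM[OF Z], of a b]
  by eventually_elim (simp add: algebra_simps)

lemma R_lin_right:
  assumes X: "X \<in> S0" and Y: "Y \<in> S0" and Z: "Z \<in> S0"
  shows "R h Z (\<lambda>t \<omega>. a * X t \<omega> + b * Y t \<omega>) \<doteq> (\<lambda>t \<omega>. a * R h Z X t \<omega> + b * R h Z Y t \<omega>)"
  unfolding indist_AE R_eq
  using qc_lin_left[OF X Y Z, of a b] ito_lin_right[OF S0_AC[OF Z] S0_SM[OF X] S0_SM[OF Y], of a b]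
    qc_commute[OF S0_lin[OF X Y] Z, of a b, unfolded indist_AE] qc_commute[OF X Z, unfolded indist_AE]
    qc_commute[OF Y Z, unfolded indist_AE]
  by eventually_elim (simp add: algebra_simps)

text \<open>Here [W, X \<bullet> Y] = X \<bullet> [W,Y] and [W,[X,Y]] = 0, so no product a * b
  survives.\<close>

lemma R_R_right:
  assumes W: "W \<in> S0" and X: "X \<in> S0" and Y: "Y \<in> S0"
  shows "R b W (R a X Y) \<doteq> (\<lambda>t \<omega>. ito (\<lambda>t \<omega>. W t \<omega> * X t \<omega>) Y t \<omega> + a * ito W (qc X Y) t \<omega> + b * ito X (qc W Y) t \<omega>)"
proof -
  note wa = S0_AC[OF W] and xa = S0_AC[OF X] and ys = S0_SM[OF Y] and xs = S0_SM[OF X] and wsm = S0_SM[OF W]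
  have I: "ito X Y \<in> S0" and Q: "qc X Y \<in> S0" by (rule ito_S0[OF xa ys], rule qc_S0[OF xs ys])
  have c: "ito X (qc Y W) \<doteq> ito X (qc W Y)"
    by (rule ito_cong[OF xa xa indist_refl qc_SM[OF ys wsm] qc_SM[OF wsm ys] qc_commute[OF Y W]])
  show ?thesis unfolding R_eq indist_AE
    using ito_lin_right[OF wa S0_SM[OF I] S0_SM[OF Q], of 1 a] ito_assoc[OF wa xa ys]
      qc_commute[OF W S0_lin[OF I Q], of 1 a, unfolded indist_AE] qc_lin_left[OF I Q W, of 1 a]
      qc_ito[OF X Y W, unfolded indist_AE] c[unfolded indist_AE] qc_qc_zero[OF xs ys wsm]
    by eventually_elim simp
qed

lemma R_R_left:
  assumes X: "X \<in> S0" and Y: "Y \<in> S0" and Z: "Z \<in> S0"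
  shows "R b (R a X Y) Z \<doteq> (\<lambda>t \<omega>. ito (ito X Y) Z t \<omega> + a * ito (qc X Y) Z t \<omega> + b * ito X (qc Y Z) t \<omega>)"
proof -
  have I: "ito X Y \<in> S0" and Q: "qc X Y \<in> S0"
    by (rule ito_S0[OF S0_AC[OF X] S0_SM[OF Y]], rule qc_S0[OF S0_SM[OF X] S0_SM[OF Y]])
  show ?thesis unfolding R_eq indist_AE
    using ito_lin_left[OF S0_AC[OF I] S0_AC[OF Q] S0_SM[OF Z], of 1 a] qc_lin_left[OF I Q Z, of 1 a]
      qc_ito[OF X Y Z, unfolded indist_AE] qc_qc_zero[OF S0_SM[OF X] S0_SM[OF Y] S0_SM[OF Z]]
    by eventually_elim simp
qed

text \<open>Integration by parts inside the integrand; it links the normal form of products nested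
  on the right with that of products nested on the left.\<close>

lemma ito_mult_left:
  assumes X: "X \<in> S0" and Y: "Y \<in> S0" and Z: "Z \<in> S0"
  shows "ito (\<lambda>t \<omega>. X t \<omega> * Y t \<omega>) Z \<doteq> (\<lambda>t \<omega>. ito (ito X Y) Z t \<omega> + ito (ito Y X) Z t \<omega> + ito (qc X Y) Z t \<omega>)"
proof -
  have I: "ito X Y \<in> AC" "ito Y X \<in> AC" and Q: "qc X Y \<in> AC"
    by (intro ito_AC S0_AC S0_SM X Y qc_spec(1))+
  let ?L = "\<lambda>t \<omega>. 1 * ito X Y t \<omega> + 1 * ito Y X t \<omega>"
  have L: "?L \<in> AC" by (intro AC_add AC_scale I)
  have c: "ito (\<lambda>t \<omega>. X t \<omega> * Y t \<omega>) Z \<doteq> ito (\<lambda>t \<omega>. 1 * ?L t \<omega> + 1 * qc X Y t \<omega>) Z"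
  proof (rule ito_cong[OF _ _ _ S0_SM[OF Z] S0_SM[OF Z] indist_refl])
    show "(\<lambda>t \<omega>. X t \<omega> * Y t \<omega>) \<in> AC" by (intro AC_mult S0_AC X Y)
    show "(\<lambda>t \<omega>. 1 * ?L t \<omega> + 1 * qc X Y t \<omega>) \<in> AC" by (intro AC_add AC_scale L I Q)
    show "(\<lambda>t \<omega>. X t \<omega> * Y t \<omega>) \<doteq> (\<lambda>t \<omega>. 1 * ?L t \<omega> + 1 * qc X Y t \<omega>)"
      unfolding indist_AE using qc_by_parts[OF X Y] by eventually_elim simp
  qed
  show ?thesis unfolding indist_AE
    using c[unfolded indist_AE] ito_lin_left[OF L Q S0_SM[OF Z], of 1 1] ito_lin_left[OF I S0_SM[OF Z], of 1 1]
    by eventually_elim simp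
qed

section \<open>Verification of the axioms\<close>

lemma S0_vector_space: "real_vector_space_upto S0 (indistinguishable P) process_add process_zero process_scale"
proof
  show "equivp (indistinguishable P)"
    by (rule equivpI) (auto simp: reflp_def symp_def transp_def intro: indist_sym indist_trans)
  show "process_add X Y \<in> S0" if "X \<in> S0" "Y \<in> S0" for X Y
    using S0_lin[OF that, of 1 1] by (simp add: process_add_def)
  show "process_zero \<in> S0"
    using BV_SM[OF BV_const[of 0]] by (intro S0_I) (simp_all add: process_zero_def)
  show "process_scale a X \<in> S0" if "X \<in> S0" for X a
    using S0_lin[OF that that, of a 0] by (simp add: process_scale_def)
  show "process_add X Y \<doteq> process_add X' Y'" if "X \<doteq> X'" "Y \<doteq> Y'" for X X' Y Y'
    using that unfolding indist_AE process_add_def by eventually_elim simp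
  show "process_scale a X \<doteq> process_scale a X'" if "X \<doteq> X'" for X X' a
    using that unfolding indist_AE process_scale_def by eventually_elim simp
qed (simp_all add: indist_AE process_add_def process_scale_def process_zero_def algebra_simps)

lemma R_bilinear:
  "bilinear_operation_upto S0 (indistinguishable P) process_add process_zero process_scale (R h)"
proof (intro bilinear_operation_upto.intro S0_vector_space bilinear_operation_upto_axioms.intro)
  show "R h (process_add X Y) Z \<doteq> process_add (R h X Z) (R h Y Z)" if "X \<in> S0" "Y \<in> S0" "Z \<in> S0" for X Y Z
    using R_lin_left[OF that, of h 1 1] by (simp add: process_add_def)
  show "R h X (process_add Y Z) \<doteq> process_add (R h X Y) (R h X Z)" if "X \<in> S0" "Y \<in> S0" "Z \<in> S0" for X Y Z
    using R_lin_right[OF that(2,3,1), of h 1 1] by (simp add: process_add_def)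
  show "R h (process_scale a X) Y \<doteq> process_scale a (R h X Y)" if "X \<in> S0" "Y \<in> S0" for X Y a
    using R_lin_left[OF that(1,1,2), of h a 0] by (simp add: process_scale_def)
  show "R h X (process_scale a Y) \<doteq> process_scale a (R h X Y)" if "X \<in> S0" "Y \<in> S0" for X Y a
    using R_lin_right[OF that(2,2,1), of h a 0] by (simp add: process_scale_def)
  show "R h X Y \<doteq> R h X' Y'"
    if "X \<in> S0" "X' \<in> S0" "Y \<in> S0" "Y' \<in> S0" "X \<doteq> X'" "Y \<doteq> Y'" for X X' Y Y'
    by (rule R_cong) (use that in auto)
qed (fact R_S0)

lemma left_op_bilinear:
  "bilinear_operation_upto S0 (indistinguishable P) process_add process_zero process_scale (left_op P F h)"
proof -
  interpret r: bilinear_operation_upto S0 "indistinguishable P" process_add process_zero process_scale "R (1 - h)"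
    by (rule R_bilinear)
  note lr = left_op_R[where h = h] and rl = left_op_R[where h = h, THEN indist_sym]
  show ?thesis
  proof (intro bilinear_operation_upto.intro S0_vector_space bilinear_operation_upto_axioms.intro)
    show "left_op P F h X Y \<doteq> left_op P F h X' Y'"
      if "X \<in> S0" "X' \<in> S0" "Y \<in> S0" "Y' \<in> S0" "X \<doteq> X'" "Y \<doteq> Y'" for X X' Y Y'
      by (rule indist_trans[OF lr indist_trans[OF r.mult_cong rl]]) (use that in auto)
    show "left_op P F h (process_add X Y) Z \<doteq> process_add (left_op P F h X Z) (left_op P F h Y Z)"
      if "X \<in> S0" "Y \<in> S0" "Z \<in> S0" for X Y Z
      by (rule indist_trans[OF lr indist_trans[OF r.mult_add_right r.add_cong]])
        (use that in \<open>auto intro: r.add_closed r.mult_closed left_op_S0 rl\<close>)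
    show "left_op P F h X (process_add Y Z) \<doteq> process_add (left_op P F h X Y) (left_op P F h X Z)"
      if "X \<in> S0" "Y \<in> S0" "Z \<in> S0" for X Y Z
      by (rule indist_trans[OF lr indist_trans[OF r.mult_add_left r.add_cong]])
        (use that in \<open>auto intro: r.add_closed r.mult_closed left_op_S0 rl\<close>)
    show "left_op P F h (process_scale a X) Y \<doteq> process_scale a (left_op P F h X Y)"
      if "X \<in> S0" "Y \<in> S0" for X Y a
      by (rule indist_trans[OF lr indist_trans[OF r.mult_scale_right r.scale_cong]])
        (use that in \<open>auto intro: r.scale_closed r.mult_closed left_op_S0 rl\<close>)
    show "left_op P F h X (process_scale a Y) \<doteq> process_scale a (left_op P F h X Y)"
      if "X \<in> S0" "Y \<in> S0" for X Y a
      by (rule indist_trans[OF lr indist_trans[OF r.mult_scale_left r.scale_cong]])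
        (use that in \<open>auto intro: r.scale_closed r.mult_closed left_op_S0 rl\<close>)
  qed (fact left_op_S0)
qed

lemma S0_dendriform:
  "dendriform_algebra S0 (indistinguishable P) process_add process_zero process_scale (left_op P F h) (R h)"
proof (intro dendriform_algebra.intro left_op_bilinear R_bilinear dendriform_algebra_axioms.intro)
  fix X Y Z assume S: "X \<in> S0" "Y \<in> S0" "Z \<in> S0"
  let ?L = "left_op P F h" and ?c = "1 - h"
  note [simp, intro] = R_S0 left_op_S0
  \<comment> \<open>Everything is expressed by right products with parameters h and 1 - h, to which
    the normal forms apply.\<close>
  have LL: "?L X (?L Y Z) \<doteq> R ?c (R ?c Z Y) X" "?L (?L X Y) Z \<doteq> R ?c Z (R ?c Y X)"
    "?L X (R h Y Z) \<doteq> R ?c (R h Y Z) X" "?L (R h X Y) Z \<doteq> R ?c Z (R h X Y)"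
    "R h X (?L Y Z) \<doteq> R h X (R ?c Z Y)" "R h (?L X Y) Z \<doteq> R h (R ?c Y X) Z"
    by (auto intro!: left_op_R R_cong indist_trans[OF left_op_R R_cong] S)
  have qc: "ito W (qc Y' X') \<doteq> ito W (qc X' Y')" "ito (qc Y' X') W \<doteq> ito (qc X' Y') W"
    if "X' \<in> S0" "Y' \<in> S0" "W \<in> S0" for X' Y' W
    using that by (auto intro!: ito_cong qc_commute S0_AC S0_SM qc_S0)
  have mult_commute: "(\<lambda>t \<omega>. A t \<omega> * B t \<omega>) = (\<lambda>t \<omega>. B t \<omega> * A t \<omega> :: real)" for A B :: "'a process"
    by (simp add: mult.commute)
  \<comment> \<open>On the right side [Z,Y] \<bullet> X occurs with coefficients 1 - h and h. Their
    sum 1 is what \<open>ito_mult_left\<close> produces from (ZY) \<bullet> X.\<close>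
  show "?L (?L X Y) Z \<doteq> process_add (?L X (?L Y Z)) (?L X (R h Y Z))"
    unfolding indist_AE process_add_def
    using LL(1-3)[unfolded indist_AE] R_R_right[OF S(3,2,1), of ?c ?c, unfolded indist_AE]
      R_R_left[OF S(3,2,1), of ?c ?c, unfolded indist_AE] R_R_left[OF S(2,3,1), of ?c h, unfolded indist_AE]
      ito_mult_left[OF S(3,2,1), unfolded indist_AE] qc(2)[OF S(2,3,1), unfolded indist_AE]
    by eventually_elim (simp add: ring_distribs)
  \<comment> \<open>Both sides have the same normal form, (XZ) \<bullet> Y + h Z \<bullet> [X,Y] +
    (1 - h) X \<bullet> [Z,Y].\<close>
  show "?L (R h X Y) Z \<doteq> R h X (?L Y Z)"
    unfolding indist_AE
    using LL(4,5)[unfolded indist_AE] R_R_right[OF S(3,1,2), of ?c h, unfolded indist_AE]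
      R_R_right[OF S(1,3,2), of h ?c, unfolded indist_AE mult_commute[of X Z]]
    by eventually_elim (simp add: ring_distribs)
  \<comment> \<open>Again the coefficients 1 - h and h of [X,Y] \<bullet> Z add up to 1.\<close>
  show "process_add (R h (?L X Y) Z) (R h (R h X Y) Z) \<doteq> R h X (R h Y Z)"
    unfolding indist_AE process_add_def
    using LL(6)[unfolded indist_AE] R_R_left[OF S(2,1,3), of h ?c, unfolded indist_AE]
      R_R_left[OF S, of h h, unfolded indist_AE] R_R_right[OF S, of h h, unfolded indist_AE]
      ito_mult_left[OF S, unfolded indist_AE] qc(2)[OF S, unfolded indist_AE]
    by eventually_elim (simp add: ring_distribs)
qed

text \<open>The value 1/2 is the fixed point of h \<mapsto> 1 - h, the parameter change that swaps
  the two operations.\<close>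

lemma S0_commutative_dendriform:
  "commutative_dendriform_algebra S0 (indistinguishable P) process_add process_zero process_scale
    (left_op P F (1/2)) (R (1/2))"
  using left_op_R[where h = "1/2"]
  by (intro commutative_dendriform_algebra.intro S0_dendriform commutative_dendriform_algebra_axioms.intro) simp

end

section \<open>Zinbiel relations in an abstract commutative dendriform algebra\<close>

lemma (in commutative_dendriform_algebra) left_zinbiel:
  "left_zinbiel_algebra V eq add zero scale left"
proof (intro left_zinbiel_algebra.intro left.bilinear_operation_upto_axioms left_zinbiel_algebra_axioms.intro)
  fix x y z assume V: "x \<in> V" "y \<in> V" "z \<in> V"
  have tr: "transp (\<simeq>)" and sy: "symp (\<simeq>)" and re: "reflp (\<simeq>)"
    using left.equiv by (auto elim: equivpE)
  have "x \<stileturn> (y \<turnstile> z) \<simeq> x \<stileturn> (z \<stileturn> y)"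
    using V left_right_commute[of z y] sympD[OF sy] reflpD[OF re]
    by (intro left.mult_cong) (auto intro: left.mult_closed right.mult_closed)
  then have "x \<stileturn> (y \<stileturn> z) \<oplus> x \<stileturn> (y \<turnstile> z) \<simeq> x \<stileturn> (y \<stileturn> z) \<oplus> x \<stileturn> (z \<stileturn> y)"
    using V reflpD[OF re] by (intro left.add_cong) (auto intro: left.mult_closed right.mult_closed)
  with left_left[OF V] show "(x \<stileturn> y) \<stileturn> z \<simeq> x \<stileturn> (y \<stileturn> z) \<oplus> x \<stileturn> (z \<stileturn> y)"
    by (rule transpD[OF tr])
qed

lemma (in commutative_dendriform_algebra) right_zinbiel:
  "right_zinbiel_algebra V eq add zero scale right"
proof (intro right_zinbiel_algebra.intro right.bilinear_operation_upto_axioms right_zinbiel_algebra_axioms.intro)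
  fix x y z assume V: "x \<in> V" "y \<in> V" "z \<in> V"
  have tr: "transp (\<simeq>)" and sy: "symp (\<simeq>)" and re: "reflp (\<simeq>)"
    using left.equiv by (auto elim: equivpE)
  have "(y \<turnstile> x) \<turnstile> z \<simeq> (x \<stileturn> y) \<turnstile> z"
    using V left_right_commute[of x y] sympD[OF sy] reflpD[OF re]
    by (intro right.mult_cong) (auto intro: left.mult_closed right.mult_closed)
  then have "(y \<turnstile> x) \<turnstile> z \<oplus> (x \<turnstile> y) \<turnstile> z \<simeq> (x \<stileturn> y) \<turnstile> z \<oplus> (x \<turnstile> y) \<turnstile> z"
    using V reflpD[OF re] by (intro left.add_cong) (auto intro: left.mult_closed right.mult_closed)
  then show "(y \<turnstile> x) \<turnstile> z \<oplus> (x \<turnstile> y) \<turnstile> z \<simeq> x \<turnstile> (y \<turnstile> z)"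
    using right_right[OF V] by (rule transpD[OF tr])
qed

theorem theorem4p2:
  fixes P :: "'a measure" and F :: "real \<Rightarrow> 'a measure"
  assumes "complete_filtered_prob_space P F"
  shows "(\<forall>h\<in>{0..1}.
            dendriform_algebra (semimartingales0 P F) (indistinguishable P)
              process_add process_zero process_scale (left_op P F h) (right_op P F h)) \<and>
         commutative_dendriform_algebra (semimartingales0 P F) (indistinguishable P)
              process_add process_zero process_scale (left_op P F (1/2)) (right_op P F (1/2)) \<and>
         left_zinbiel_algebra (semimartingales0 P F) (indistinguishable P)
              process_add process_zero process_scale (left_op P F (1/2)) \<and>
         right_zinbiel_algebra (semimartingales0 P F) (indistinguishable P)
              process_add process_zero process_scale (right_op P F (1/2))"
proof -
  interpret complete_filtered_prob_space P F by (rule assms)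
  note comm = S0_commutative_dendriform
  show ?thesis
    using S0_dendriform comm commutative_dendriform_algebra.left_zinbiel[OF comm]
      commutative_dendriform_algebra.right_zinbiel[OF comm] by blast
qed

end
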